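(* Let $X_1,\dots,X_n$ be i.i.d. $N(0,\Sigma)$ random variables in a separable Banach space $E$. (i) Suppose $f:L(E^{\ast},E)\to\mathbb{R}$ satisfies the Hölder condition with exponent $\rho\in(0,1]$ (that is, $\|f\|_{\mathrm{Lip}_\rho}<\infty$). Then, for all $p\ge 1$, $$\bigl\|f(\hat\Sigma_n)-f(\Sigma)\bigr\|_{L_p(\mathbb{P}_\Sigma)}\lesssim \|f\|_{\mathrm{Lip}_\rho}\|\Sigma\|^{\rho}\Bigl[\Bigl(\sqrt{\tfrac{\mathbf{r}(\Sigma)}{n}}\vee\tfrac{\mathbf{r}(\Sigma)}{n}\Bigr)^{\rho}+\Bigl(\sqrt{\tfrac{\mathbf{r}(\Sigma)}{n}}\vee 1\Bigr)^{\rho}\Bigl(\sqrt{\tfrac{p}{n}}\Bigr)^{\rho}+\Bigl(\tfrac{p}{n}\Bigr)^{\rho}\Bigr].$$ (ii) Suppose $f:L(E^{\ast},E)\to\mathbb{R}$ is Lipschitz and, moreover, it is Fréchet continuously differentiable with derivative $f'$ satisfying the Hölder condition with exponent $\rho\in(0,1]$. Then, for all $p\ge1$, $$\bigl\|f(\hat\Sigma_n)-f(\Sigma)\bigr\|_{L_p(\mathbb{P}_\Sigma)}\lesssim \|f\|_{\mathrm{Lip}}\|\Sigma\|\Bigl(\sqrt{\tfrac pn}\Bigl(\sqrt{\tfrac{\mathbf{r}(\Sigma)}{n}}\vee 1\Bigr)+\tfrac pn\Bigr)+\|f'\|_{\mathrm{Lip}_\rho}\|\Sigma\|^{1+\rh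o}\Bigl(\sqrt{\tfrac{\mathbf{r}(\Sigma)}{n}}\vee\tfrac{\mathbf{r}(\Sigma)}{n}\Bigr)^{1+\rho}.$$
   Context: $E$ is a separable Banach space with dual $E^\ast$; $\langle x,u\rangle$ is the value of $u\in E^\ast$ at $x\in E$. $L(E^\ast,E)$ is the space of bounded linear operators $A:E^\ast\to E$ with the operator norm $\|A\|=\sup_{\|u\|\le1}\|Au\|$. $X$ is a centered Gaussian random variable in $E$ with covariance operator $\Sigma:E^\ast\to E$, $\Sigma u=\mathbb{E}\langle X,u\rangle X$ (we write $X\sim N(0,\Sigma)$). The sample covariance operator of i.i.d. copies $X_1,\dots,X_n$ of $X$ is $\hat\Sigma_n u=n^{-1}\sum_{j=1}^n\langle X_j,u\rangle X_j$, $u\in E^\ast$. The effective rank is $\mathbf{r}(\Sigma)=\mathbb{E}\|X\|^2/\|\Sigma\|$ (for $\Sigma\ne0$). $\|\eta\|_{L_p(\mathbb{P}_\Sigma)}=(\mathbb{E}_\Sigma|\eta|^p)^{1/p}$. For a map $g$ between Banach spaces, $\|g\|_{\mathrm{Lip}_\rho}=\sup_{x\ne y}\|g(x)-g(y)\|/\|x-y\|^\rho$ and $\|g\|_{\mathrm{Lip}}=\|g\|_{\mathrm{Lip}_1}$; for $f'$ these are taken with the norm of the dual space of $L(E^\ast,E)$. $A\lesssim B$ means $A\le CB$ with a numerical constant $C>0$. $a\vee b=\max(a,b)$. *)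

theory Defs
  imports "HOL-Probability.Probability"
begin

text \<open>
  A separable Banach space \<open>E\<close> is a type of sort \<open>{banach, second_countable_topology}\<close> (a metric
  space is separable iff it is second countable). Bounded operators are \<open>\<Rightarrow>\<^sub>L\<close> with the operator norm.
\<close>

type_synonym 'a dual = "'a \<Rightarrow>\<^sub>L real"

type_synonym 'a opr = "'a dual \<Rightarrow>\<^sub>L 'a"

text \<open>The point mass at \<open>0\<close> counts as a (degenerate) centered normal law.\<close>

definition centered_normal :: "real measure \<Rightarrow> bool" where
  "centered_normal \<nu> \<longleftrightarrow>
     \<nu> = return borel 0 \<or> (\<exists>\<sigma>>0. \<nu> = density lborel (\<lambda>x. ennreal (normal_density 0 \<sigma> x)))"

text \<open>
  \<open>gaussian_law \<mu> \<Sigma>\<close>: the Borel measure \<open>\<mu>\<close> is the law \<open>N(0,\<Sigma>)\<close>. A Gaussian law is one all of whose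
  images under continuous linear functionals are normal. The covariance \<open>\<Sigma> u = E \<langle>X,u\<rangle> X\<close> is a
  Bochner integral; its existence is automatic for Gaussian laws (Fernique's theorem).
\<close>

definition gaussian_law ::
    "'a::{banach, second_countable_topology} measure \<Rightarrow> 'a opr \<Rightarrow> bool" where
  "gaussian_law \<mu> \<Sigma> \<longleftrightarrow>
     prob_space \<mu> \<and> sets \<mu> = sets borel \<and>
     (\<forall>u :: 'a dual. centered_normal (distr \<mu> borel (blinfun_apply u))) \<and>
     (\<forall>u :: 'a dual. has_bochner_integral \<mu> (\<lambda>x. blinfun_apply u x *\<^sub>R x) (blinfun_apply \<Sigma> u))"

text \<open>
  The effective rank \<open>E \<parallel>X\<parallel>\<^sup>2 / \<parallel>\<Sigma>\<parallel>\<close>, where \<open>\<mu> = N(0,\<Sigma>)\<close> is the law of \<open>X\<close>; the second moment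
  is finite by Fernique's theorem. For \<open>\<Sigma> = 0\<close> the value is \<open>0\<close> by the convention \<open>x / 0 = 0\<close>.
\<close>

definition effective_rank ::
    "'a::{banach, second_countable_topology} measure \<Rightarrow> 'a opr \<Rightarrow> real" where
  "effective_rank \<mu> \<Sigma> = (\<integral>x. (norm x)\<^sup>2 \<partial>\<mu>) / norm \<Sigma>"

lift_definition sample_cov :: "nat \<Rightarrow> (nat \<Rightarrow> 'a::real_normed_vector) \<Rightarrow> 'a opr"
  is "\<lambda>n x u. (1 / real n) *\<^sub>R (\<Sum>j=1..n. blinfun_apply u (x j) *\<^sub>R x j)"
  by (intro bounded_linear_scaleR_right[THEN bounded_linear_compose] bounded_linear_sum
        bounded_linear_scaleR_left[THEN bounded_linear_compose] blinfun.bounded_linear_left)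

text \<open>
  The \<open>L\<^sub>p\<close>-norm and the Hoelder seminorm take values in \<open>[0,\<infinity>]\<close>: the Bochner integral of a
  non-integrable function and the supremum of an unbounded set of reals carry no information.
\<close>

definition Lp_norm :: "'w measure \<Rightarrow> real \<Rightarrow> ('w \<Rightarrow> real) \<Rightarrow> ennreal" where
  "Lp_norm M p \<eta> =
     (if integrable M (\<lambda>\<omega>. \<bar>\<eta> \<omega>\<bar> powr p)
      then ennreal ((\<integral>\<omega>. \<bar>\<eta> \<omega>\<bar> powr p \<partial>M) powr (1 / p)) else \<infinity>)"

definition Lip_seminorm ::
    "real \<Rightarrow> ('b::real_normed_vector \<Rightarrow> 'c::real_normed_vector) \<Rightarrow> ennreal" where
  "Lip_seminorm \<rho> g =
     (SUP (x, y)\<in>{(x, y). x \<noteq> y}. ennreal (norm (g x - g y) / norm (x - y) powr \<rho>))"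

text \<open>
  The numerical constant in \<open>\<lesssim>\<close> must not depend on the space \<open>E\<close> or on the underlying probability
  space. Types cannot be quantified inside a formula, so a bare \<open>\<exists>C\<close> would allow such a dependence;
  this deliberately generous bound, the same for all types, excludes it.
\<close>

definition numerical_bound :: real where
  "numerical_bound = 10 ^ 100"

end

theory Submission
  imports Defs
begin

text \<open>
  A norming sequence of functionals turns every norm into a countable supremum, so that it suffices
  to understand suprema of linear spaces of centered Gaussian variables, whose joint laws are
  determined by their covariances. Such a supremum concentrates around its mean at the scale of the
  weak standard deviation, and means of suprema are compared by Sudakov--Fernique.

  If \<open>X'\<close> is an independent copy of the sample, rotating \<open>(X, X')\<close> by \<open>\<pi>/4\<close> turns the difference of
  the two sample covariances into a multiple of the symmetrised \<open>\<Sum> X\<^sub>j \<otimes> X'\<^sub>j\<close>. Given \<open>X\<close>, this is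
  Gaussian: Chevet's inequality bounds the mean of its norm and concentration bounds its moments, both
  in terms of the norm of the sample covariance of \<open>X\<close>. Since the latter is at most \<open>\<parallel>\<Sigma>\<parallel>\<close> plus the
  deviation, the \<open>p\<close>-th moment of the deviation satisfies a self-bounding quadratic inequality, which
  yields the estimate for \<open>f\<close> Hoelder. For a smooth \<open>f\<close> one linearises at \<open>\<Sigma>\<close>: the same rotation
  makes the linear term conditionally a real Gaussian variable, and the remainder is bounded by the
  Hoelder condition on \<open>f'\<close> where the deviation has its typical size and by the Lipschitz condition on
  \<open>f\<close> elsewhere.
\<close>

section \<open>Norming functionals\<close>

text \<open>The obstacle is that the operators from the dual to \<open>E\<close> form a space that
  need not be separable, so the sample covariance is not handled as a random vector of its own. Its
  functions are measurable because they are continuous in the sample vectors, its mean enters only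
  through scalar functionals, and its norm is a countable supremum over pairs of norming
  functionals.

  The self-bounding inequality can be solved only for a moment known to be finite; a crude bound by
  squared norms of the sample vectors provides this. The standard Gaussian weights in Chevet's
  inequality come from the sample itself, as one functional of positive variance applied to each
  vector, which is why \<Sigma> = 0 is set apart.

  In the smooth case the threshold between typical and large deviations must leave an excess whose
  moments contain no effective rank. The moment whose order is the effective rank achieves this,
  since at that order the two kinds of terms coincide.\<close>

definition sublinear :: "('a::real_vector \<Rightarrow> real) \<Rightarrow> bool" where
  "sublinear q \<longleftrightarrow> (\<forall>x y. q (x + y) \<le> q x + q y) \<and> (\<forall>c>0. \<forall>x. q (c *\<^sub>R x) \<le> c * q x)"

lemma sublinearD:
  assumes "sublinear q"
  shows "q (x + y) \<le> q x + q y" "c > 0 \<Longrightarrow> q (c *\<^sub>R x) = c * q x" "q 0 = 0" "- q (- x) \<le> q x"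
proof -
  show 1: "q (x + y) \<le> q x + q y" for x y using assms by (auto simp: sublinear_def)
  have le: "q (c *\<^sub>R x) \<le> c * q x" if "c > 0" for c x using assms that by (auto simp: sublinear_def)
  show 2: "q (c *\<^sub>R x) = c * q x" if "c > 0" for c x
    using le[OF that, of x] le[of "1/c" "c *\<^sub>R x"] that by (simp add: field_simps)
  show 0: "q 0 = 0" using 2[of 2 0] by simp
  show "- q (- x) \<le> q x" using 1[of x "-x"] 0 by simp
qed

text \<open>The tilt lowers \<open>q\<close> along \<open>y\<close>: at x = -y and t = 1 the last
  bound reads r (-y) <= - q y. Since also r <= q, every linear functional below \<open>r\<close>
  takes the value q y at \<open>y\<close>.\<close>

lemma sublinear_tilt:
  fixes q :: "'a::real_vector \<Rightarrow> real" and y :: 'a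
  assumes q: "sublinear q"
  defines "r \<equiv> \<lambda>x. INF t\<in>{0..}. q (x + t *\<^sub>R y) - t * q y"
  shows "sublinear r" "r x \<le> q x" "t \<ge> 0 \<Longrightarrow> r x \<le> q (x + t *\<^sub>R y) - t * q y"
proof -
  have scale: "q (t *\<^sub>R y) = t * q y" if "t \<ge> 0" for t
    using that sublinearD(2,3)[OF q] by (cases "t = 0") auto
  have "- q (- x) \<le> q (x + t *\<^sub>R y) - t * q y" if "t \<ge> 0" for x t
    using sublinearD(1)[OF q, of "x + t *\<^sub>R y" "-x"] scale[OF that] by simp
  then have bdd: "bdd_below ((\<lambda>t. q (x + t *\<^sub>R y) - t * q y) ` {0..})" for x
    by (intro bdd_belowI[where m = "- q (- x)"]) auto
  show le: "r x \<le> q (x + t *\<^sub>R y) - t * q y" if "t \<ge> 0" for x t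
    unfolding r_def using that by (intro cINF_lower bdd) auto
  show "r x \<le> q x" using le[of 0 x] by simp
  have ge: "m \<le> r x" if "\<And>t. t \<ge> 0 \<Longrightarrow> m \<le> q (x + t *\<^sub>R y) - t * q y" for m x
    unfolding r_def using that by (intro cINF_greatest) auto
  have add: "r (x1 + x2) \<le> r x1 + r x2" for x1 x2
  proof -
    have "r (x1 + x2) - r x2 \<le> r x1"
    proof (rule ge)
      fix s :: real assume s: "s \<ge> 0"
      have "r (x1 + x2) - (q (x1 + s *\<^sub>R y) - s * q y) \<le> r x2"
      proof (rule ge)
        fix t :: real assume t: "t \<ge> 0"
        have "r (x1 + x2) \<le> q (x1 + x2 + (s + t) *\<^sub>R y) - (s + t) * q y" using s t by (intro le) auto
        also have "x1 + x2 + (s + t) *\<^sub>R y = (x1 + s *\<^sub>R y) + (x2 + t *\<^sub>R y)" by (simp add: algebra_simps)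
        also have "q \<dots> \<le> q (x1 + s *\<^sub>R y) + q (x2 + t *\<^sub>R y)" by (rule sublinearD(1)[OF q])
        finally show "r (x1 + x2) - (q (x1 + s *\<^sub>R y) - s * q y) \<le> q (x2 + t *\<^sub>R y) - t * q y"
          by (simp add: algebra_simps)
      qed
      then show "r (x1 + x2) - r x2 \<le> q (x1 + s *\<^sub>R y) - s * q y" by simp
    qed
    then show ?thesis by simp
  qed
  have hom: "r (c *\<^sub>R x) \<le> c * r x" if c: "c > 0" for c x
  proof -
    have "r (c *\<^sub>R x) / c \<le> r x"
    proof (rule ge)
      fix t :: real assume t: "t \<ge> 0"
      have "r (c *\<^sub>R x) \<le> q (c *\<^sub>R x + (c * t) *\<^sub>R y) - (c * t) * q y" using c t by (intro le) auto
      also have "c *\<^sub>R x + (c * t) *\<^sub>R y = c *\<^sub>R (x + t *\<^sub>R y)" by (simp add: algebra_simps)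
      also have "q \<dots> = c * q (x + t *\<^sub>R y)" using c by (rule sublinearD(2)[OF q])
      finally show "r (c *\<^sub>R x) / c \<le> q (x + t *\<^sub>R y) - t * q y" using c by (simp add: field_simps)
    qed
    then show ?thesis using c by (simp add: field_simps)
  qed
  show "sublinear r" unfolding sublinear_def using add hom by blast
qed

text \<open>A minimal sublinear functional is linear, since it coincides with all its tilts.\<close>

lemma linear_below_sublinear:
  fixes q0 :: "'a::real_vector \<Rightarrow> real"
  assumes q0: "sublinear q0"
  shows "\<exists>f. linear f \<and> (\<forall>x. f x \<le> q0 x)"
proof -
  define A where "A = {q. sublinear q \<and> (\<forall>x. q x \<le> q0 x)}"
  \<comment> \<open>The order is reversed, so that the maximal element given by Zorn's lemma is a
    minimal sublinear functional.\<close>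
  define P where "P = (\<lambda>(q::'a \<Rightarrow> real) q'. \<forall>x. q' x \<le> q x)"
  have "\<exists>m\<in>A. \<forall>a\<in>A. P m a \<longrightarrow> a = m"
  proof (rule predicate_Zorn)
    show "partial_order_on A (relation_of P A)"
      by (rule partial_order_on_relation_ofI) (auto simp: P_def intro: order_trans intro!: ext antisym)
    fix C assume C: "C \<in> Chains (relation_of P A)"
    show "\<exists>u\<in>A. \<forall>a\<in>C. P a u"
    proof (cases "C = {}")
      case True then show ?thesis using q0 by (auto simp: A_def)
    next
      case False
      have CA: "C \<subseteq> A" using C by (rule Chains_relation_of)
      define u where "u = (\<lambda>x. INF q\<in>C. q x)"
      have "- q0 (- x) \<le> q x" if "q \<in> C" for q x
      proof -
        have "sublinear q" "q (- x) \<le> q0 (- x)" using that CA by (auto simp: A_def)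
        then show ?thesis using sublinearD(4)[of q x] by linarith
      qed
      then have bdd: "bdd_below ((\<lambda>q. q x) ` C)" for x by (intro bdd_belowI[where m = "- q0 (-x)"]) auto
      have le: "u x \<le> q x" if "q \<in> C" for q x unfolding u_def using that by (intro cINF_lower bdd) auto
      have ge: "m \<le> u x" if "\<And>q. q \<in> C \<Longrightarrow> m \<le> q x" for m x
        unfolding u_def using that False by (intro cINF_greatest) auto
      have "u (x + y) \<le> u x + u y" for x y
      proof -
        have "u (x + y) - u y \<le> u x"
        proof (rule ge)
          fix q1 assume q1: "q1 \<in> C"
          have "u (x + y) - q1 x \<le> u y"
          proof (rule ge)
            fix q2 assume q2: "q2 \<in> C"
            \<comment> \<open>Members of a chain are comparable, so one of the two lies below the
              other; subadditivity of that single functional yields subadditivity of the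
              infimum.\<close>
            obtain q where q: "q \<in> C" "\<And>x. q x \<le> q1 x" "\<And>x. q x \<le> q2 x"
            proof -
              from C q1 q2 have "P q1 q2 \<or> P q2 q1" by (auto simp: Chains_def relation_of_def)
              then show ?thesis using that[of q1] that[of q2] q1 q2 by (auto simp: P_def)
            qed
            have "u (x + y) \<le> q (x + y)" by (rule le[OF q(1)])
            also have "\<dots> \<le> q x + q y" using q(1) CA by (intro sublinearD) (auto simp: A_def)
            also have "\<dots> \<le> q1 x + q2 y" by (intro add_mono q)
            finally show "u (x + y) - q1 x \<le> q2 y" by simp
          qed
          then show "u (x + y) - u y \<le> q1 x" by simp
        qed
        then show ?thesis by simp
      qed
      moreover have "u (c *\<^sub>R x) \<le> c * u x" if c: "c > 0" for c x
      proof -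
        have "u (c *\<^sub>R x) / c \<le> u x"
        proof (rule ge)
          fix q assume q: "q \<in> C"
          have "u (c *\<^sub>R x) \<le> q (c *\<^sub>R x)" by (rule le[OF q])
          also have "\<dots> = c * q x" using q CA c by (intro sublinearD) (auto simp: A_def)
          finally show "u (c *\<^sub>R x) / c \<le> q x" using c by (simp add: field_simps)
        qed
        then show ?thesis using c by (simp add: field_simps)
      qed
      moreover have "u x \<le> q0 x" for x
      proof -
        obtain q where "q \<in> C" using False by blast
        then show ?thesis using le[of q x] CA by (auto simp: A_def intro: order_trans)
      qed
      ultimately have "u \<in> A" by (auto simp: A_def sublinear_def)
      then show ?thesis using le by (auto simp: P_def)
    qed
  qed
  then obtain m where m: "sublinear m" "\<And>x. m x \<le> q0 x"
    and min: "\<And>r. r \<in> A \<Longrightarrow> P m r \<Longrightarrow> r = m" by (auto simp: A_def)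
  have add: "m (x + y) = m x + m y" for x y
  proof -
    define r where "r = (\<lambda>x. INF t\<in>{0..}. m (x + t *\<^sub>R y) - t * m y)"
    have tilt: "sublinear r" "r x \<le> m x" "t \<ge> 0 \<Longrightarrow> r x \<le> m (x + t *\<^sub>R y) - t * m y" for x t
      unfolding r_def by (fact sublinear_tilt[OF m(1), where y = y])+
    have "r = m" using tilt(1,2) m(2) by (intro min) (auto simp: A_def P_def intro: order_trans)
    \<comment> \<open>The tilt at t = 1 is the superadditivity that makes a minimal sublinear
      functional additive.\<close>
    then have "m x \<le> m (x + y) - m y" using tilt(3)[of 1 x] by simp
    then show ?thesis using sublinearD(1)[OF m(1), of x y] by simp
  qed
  have neg: "m (- x) = - m x" for x using add[of x "- x"] sublinearD(3)[OF m(1)] by simp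
  have "m (c *\<^sub>R x) = c * m x" for c x
    using sublinearD(2)[OF m(1), of c x] sublinearD(2)[OF m(1), of "-c" x] sublinearD(3)[OF m(1)] neg[of "c *\<^sub>R x"]
    by (cases c "0::real" rule: linorder_cases) auto
  with add have "linear m" by (intro linearI) auto
  with m(2) show ?thesis by blast
qed

text \<open>The linear functional is chosen below the tilt of the norm along \<open>x0\<close>, not
  merely below the norm: the tilt forces it to attain the norm at \<open>x0\<close>, while lying
  below the norm bounds it by 1.\<close>

theorem norming_functional:
  fixes x0 :: "'a::real_normed_vector"
  shows "\<exists>u :: 'a dual. norm u \<le> 1 \<and> blinfun_apply u x0 = norm x0"
proof -
  have n: "sublinear (norm :: 'a \<Rightarrow> real)" by (auto simp: sublinear_def norm_triangle_ineq)
  define r where "r = (\<lambda>x. INF t\<in>{0..}. norm (x + t *\<^sub>R x0) - t * norm x0)"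
  have tilt: "sublinear r" "r x \<le> norm x" "t \<ge> 0 \<Longrightarrow> r x \<le> norm (x + t *\<^sub>R x0) - t * norm x0" for x t
    unfolding r_def by (fact sublinear_tilt[OF n, where y = x0])+
  obtain f where f: "linear f" "\<And>x. f x \<le> r x" using linear_below_sublinear[OF tilt(1)] by blast
  have le: "f x \<le> norm x" for x using f(2) tilt(2) by (rule order_trans)
  have abs: "\<bar>f x\<bar> \<le> norm x" for x using le[of x] le[of "-x"] linear_neg[OF f(1), of x] by simp
  have bl: "bounded_linear f" using f(1) abs by (intro bounded_linear_intro[where K = 1]) (auto simp: linear_add linear_scale)
  have "- f x0 \<le> - norm x0" using f(2)[of "- x0"] tilt(3)[of 1 "- x0"] linear_neg[OF f(1), of x0] by simp
  then have eq: "f x0 = norm x0" using le[of x0] by simp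
  show ?thesis
    using abs eq by (intro exI[of _ "Blinfun f"]) (auto simp: bounded_linear_Blinfun_apply[OF bl] intro!: norm_blinfun_bound)
qed

text \<open>Norming functionals of a countable dense set suffice: passing from \<open>x\<close> to a
  point at distance less than e/2 costs less than e/2 in the norm and less than e/2 in the
  functional.\<close>

lemma norming_sequence:
  "\<exists>u :: nat \<Rightarrow> 'a::{real_normed_vector, second_countable_topology} dual.
     (\<forall>i. norm (u i) \<le> 1) \<and> (\<forall>x e. e > 0 \<longrightarrow> (\<exists>i. norm x - e < blinfun_apply (u i) x))"
proof -
  obtain D :: "'a set" where D: "countable D" "\<And>X. open X \<Longrightarrow> X \<noteq> {} \<Longrightarrow> \<exists>d\<in>D. d \<in> X"
    using countable_dense_setE by blast
  obtain v :: "'a \<Rightarrow> 'a dual" where v: "\<And>x. norm (v x) \<le> 1" "\<And>x. v x x = norm x"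
    using norming_functional by metis
  define u where "u = (\<lambda>i. v (from_nat_into D i))"
  show ?thesis
  proof (intro exI[of _ u] conjI allI impI)
    show "norm (u i) \<le> 1" for i using v by (simp add: u_def)
    fix x :: 'a and e :: real assume e: "e > 0"
    obtain d where d: "d \<in> D" "d \<in> ball x (e / 2)" using D(2)[of "ball x (e/2)"] e by auto
    obtain i where i: "from_nat_into D i = d" using from_nat_into_surj[OF D(1) d(1)] by blast
    have "v d (d - x) \<le> norm (v d) * norm (d - x)" using norm_blinfun[of "v d" "d - x"] by simp
    also have "\<dots> \<le> 1 * norm (d - x)" by (intro mult_right_mono v) auto
    finally have "v d x \<ge> norm d - norm (d - x)" using v(2)[of d] by (simp add: blinfun.diff_right)
    moreover have "norm x \<le> norm d + norm (d - x)" using norm_triangle_ineq4[of d "d - x"] by simp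
    moreover have "norm (d - x) < e / 2" using d(2) by (simp add: dist_norm norm_minus_commute)
    ultimately show "\<exists>i. norm x - e < u i x" using i by (intro exI[of _ i]) (auto simp: u_def)
  qed
qed

text \<open>The norm is approached without absolute values, so it is a supremum of expressions
  linear in the vector; evaluated at a Gaussian vector it is the supremum of a Gaussian
  process.\<close>

definition norming :: "nat \<Rightarrow> 'a::{real_normed_vector, second_countable_topology} dual" where
  "norming = (SOME u. (\<forall>i. norm (u i) \<le> 1) \<and> (\<forall>x e. e > 0 \<longrightarrow> (\<exists>i. norm x - e < blinfun_apply (u i) x)))"

lemma norm_norming: "norm (norming i :: 'a::{real_normed_vector, second_countable_topology} dual) \<le> 1"
  and norming_approx: "e > 0 \<Longrightarrow> \<exists>i. norm x - e < blinfun_apply (norming i) (x::'a)"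
  using someI_ex[OF norming_sequence[where 'a = 'a], folded norming_def] by auto

lemma norming_le: "blinfun_apply (norming i) x \<le> norm x"
proof -
  have "norming i x \<le> norm (norming i :: 'a dual) * norm x" using norm_blinfun[of "norming i" x] by simp
  also have "\<dots> \<le> norm x" by (intro mult_left_le_one_le norm_norming) auto
  finally show ?thesis .
qed

lemma norm_le_norming:
  assumes "\<And>i. blinfun_apply (norming i) x \<le> B"
  shows "norm x \<le> B"
proof (rule field_le_epsilon)
  fix e :: real assume "e > 0"
  from norming_approx[OF this, of x] obtain i where "norm x - e < norming i x" by auto
  with assms[of i] show "norm x \<le> B + e" by simp
qed

lemma norm_eq_SUP_norming: "norm x = (SUP i. blinfun_apply (norming i) x)"
proof (rule antisym)
  have "bdd_above (range (\<lambda>i. norming i x))" using norming_le by (intro bdd_aboveI[where M = "norm x"]) auto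
  then show "norm x \<le> (SUP i. norming i x)" by (intro norm_le_norming cSUP_upper) auto
  show "(SUP i. norming i x) \<le> norm x" by (intro cSUP_least norming_le) auto
qed

text \<open>An open set is a countable union of balls, and the distance to a centre is a countable
  supremum of functionals. Hence the norming sequence already generates the Borel sets.\<close>

lemma borel_measurable_norming:
  fixes f :: "'w \<Rightarrow> 'a::{real_normed_vector, second_countable_topology}"
  assumes "\<And>i. (\<lambda>w. blinfun_apply (norming i) (f w)) \<in> borel_measurable M"
  shows "f \<in> borel_measurable M"
proof (rule borel_measurableI)
  fix U :: "'a set" assume "open U"
  obtain D :: "'a set" where D: "countable D" "\<And>X. open X \<Longrightarrow> X \<noteq> {} \<Longrightarrow> \<exists>d\<in>D. d \<in> X"
    using countable_dense_setE by blast
  define S where "S = {(d, q). d \<in> D \<and> q \<in> \<rat> \<and> ball d q \<subseteq> U}"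
  have "S \<subseteq> D \<times> \<rat>" by (auto simp: S_def)
  then have S: "countable S" using D(1) countable_rat by (meson countable_SIGMA countable_subset)
  have "x \<in> (\<Union>(d, q)\<in>S. ball d q)" if x: "x \<in> U" for x
  proof -
    obtain e where e: "e > 0" "ball x e \<subseteq> U" using \<open>open U\<close> x by (meson open_contains_ball)
    obtain q where q: "q \<in> \<rat>" "e / 4 < q" "q < e / 2" using Rats_dense_in_real[of "e/4" "e/2"] e by auto
    obtain d where d: "d \<in> D" "d \<in> ball x q" using D(2)[of "ball x q"] q e by auto
    have "ball d q \<subseteq> ball x e"
    proof
      fix z assume z: "z \<in> ball d q"
      have "dist x z \<le> dist x d + dist d z" by (rule dist_triangle)
      then show "z \<in> ball x e" using d(2) z q(3) by simp
    qed
    then have "(d, q) \<in> S" using d q e by (auto simp: S_def)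
    moreover have "x \<in> ball d q" using d by (simp add: dist_commute)
    ultimately show ?thesis by (intro UN_I[of "(d, q)"]) auto
  qed
  then have U: "U = (\<Union>(d, q)\<in>S. ball d q)" by (auto simp: S_def)
  have *: "(\<lambda>w. norm (f w - d)) \<in> borel_measurable M" for d
  proof -
    have "(\<lambda>w. norming i (f w - d)) \<in> borel_measurable M" for i
      using assms[of i] by (simp add: blinfun.diff_right)
    moreover have "bdd_above (range (\<lambda>i. norming i (f w - d)))" for w
      using norming_le by (intro bdd_aboveI[where M = "norm (f w - d)"]) auto
    ultimately show ?thesis unfolding norm_eq_SUP_norming by (intro borel_measurable_cSUP) auto
  qed
  have "f -` U \<inter> space M = (\<Union>(d, q)\<in>S. {w \<in> space M. norm (f w - d) < q})"
    unfolding arg_cong[OF U, of "vimage f"] vimage_UN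
    by (auto simp: dist_norm norm_minus_commute intro!: bexI[where x = "(_, _)"])
  also have "\<dots> \<in> sets M" using * S by (intro sets.countable_UN') auto
  finally show "f -` U \<inter> space M \<in> sets M" .
qed

section \<open>Uniqueness of joint laws\<close>

text \<open>The sine is written as a cosine with a phase, so that the single family cos (t x + s)
  carries the whole characteristic function.\<close>

lemma cos_sin_char:
  assumes "real_distribution \<nu>"
  shows "char \<nu> t = Complex (\<integral>x. cos (t * x) \<partial>\<nu>) (\<integral>x. cos (t * x - pi / 2) \<partial>\<nu>)"
proof -
  interpret real_distribution \<nu> by fact
  have i: "integrable \<nu> (\<lambda>x. iexp (t * x))" by (rule integrable_iexp) auto
  have "Re (char \<nu> t) = (\<integral>x. Re (iexp (t * x)) \<partial>\<nu>)" unfolding char_def using i by (rule integral_Re[symmetric])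
  moreover have "Im (char \<nu> t) = (\<integral>x. Im (iexp (t * x)) \<partial>\<nu>)" unfolding char_def using i by (rule integral_Im[symmetric])
  ultimately show ?thesis
    by (intro complex_eqI) (auto simp: Re_exp Im_exp cos_diff)
qed

lemma finite_measure_char_unique:
  fixes \<nu> \<nu>' :: "real measure"
  assumes "finite_measure \<nu>" "finite_measure \<nu>'" and [measurable_cong, simp]: "sets \<nu> = sets borel" "sets \<nu>' = sets borel"
    and eq: "\<And>t s. (\<integral>x. cos (t * x + s) \<partial>\<nu>) = (\<integral>x. cos (t * x + s) \<partial>\<nu>')"
  shows "\<nu> = \<nu>'"
proof -
  interpret a: finite_measure \<nu> by fact
  interpret b: finite_measure \<nu>' by fact
  have sp[simp]: "space \<nu> = UNIV" "space \<nu>' = UNIV" using sets_eq_imp_space_eq[of \<nu> borel] sets_eq_imp_space_eq[of \<nu>' borel] by auto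
  define c where "c = measure \<nu> UNIV"
  have c': "c = measure \<nu>' UNIV" using eq[of 0 0] by (simp add: c_def)
  show ?thesis
  proof (cases "c = 0")
    case True
    have "emeasure \<nu> A = 0" "emeasure \<nu>' A = 0" for A
      using a.bounded_measure[of A] b.bounded_measure[of A] True c_def c'
      by (auto simp: a.emeasure_eq_measure b.emeasure_eq_measure measure_le_0_iff)
    then show ?thesis by (intro measure_eqI) auto
  next
    case False
    then have c: "c > 0" by (simp add: c_def less_le)
    let ?d = "\<lambda>\<nu>. density \<nu> (\<lambda>_. ennreal (1 / c))"
    have rd: "real_distribution (?d \<nu>)" "real_distribution (?d \<nu>')"
      using c c_def c' by (auto simp: real_distribution_def real_distribution_axioms_def emeasure_density_const
          a.emeasure_eq_measure b.emeasure_eq_measure ennreal_mult[symmetric] intro!: prob_spaceI)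
    have i: "(\<integral>x. cos (t * x + s) \<partial>?d \<nu>) = (\<integral>x. cos (t * x + s) \<partial>?d \<nu>')" for t s
      using c eq[of t s] by (simp add: integral_density)
    have "char (?d \<nu>) = char (?d \<nu>')"
      using i[of _ 0] i[of _ "- (pi / 2)"] by (intro ext) (simp add: cos_sin_char rd)
    then have E: "?d \<nu> = ?d \<nu>'" using Levy_uniqueness rd by blast
    show ?thesis
    proof (rule measure_eqI)
      fix A assume "A \<in> sets \<nu>"
      then have A: "A \<in> sets borel" by simp
      have "ennreal c * emeasure (?d \<nu>) A = ennreal c * emeasure (?d \<nu>') A" using E by simp
      then show "emeasure \<nu> A = emeasure \<nu>' A"
        using A c by (simp add: emeasure_density_const mult.assoc[symmetric] ennreal_mult[symmetric])
    qed auto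
  qed
qed

lemma integrable_bounded_measurable:
  fixes f :: "'w \<Rightarrow> real"
  assumes "finite_measure M" "f \<in> borel_measurable M" "\<And>w. \<bar>f w\<bar> \<le> B"
  shows "integrable M f"
  using finite_measure.integrable_const_bound[OF assms(1), of f B] assms(2,3) by auto

text \<open>
  Restricting both measures to a one-dimensional cylinder preserves the hypothesis on the
  trigonometric integrals: apply one-dimensional uniqueness to the positive densities
  \<open>1 + cos (a + s)\<close>. Induction over the number of coordinates then identifies all cylinders.
\<close>

lemma cramer_wold_aux:
  fixes g :: "'i \<Rightarrow> 'w \<Rightarrow> real" and h :: "'i \<Rightarrow> 'v \<Rightarrow> real"
  assumes M: "finite_measure M" and N: "finite_measure N"
    and [measurable]: "\<And>i. g i \<in> borel_measurable M" "\<And>i. h i \<in> borel_measurable N"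
    and mP: "\<And>a b. (a, b) \<in> P \<Longrightarrow> a \<in> borel_measurable M" "\<And>a b. (a, b) \<in> P \<Longrightarrow> b \<in> borel_measurable N"
    and zero: "((\<lambda>_. 0), (\<lambda>_. 0)) \<in> P"
    and step: "\<And>a b t i. (a, b) \<in> P \<Longrightarrow> ((\<lambda>w. t * g i w + a w), (\<lambda>w. t * h i w + b w)) \<in> P"
    and neg: "\<And>a b. (a, b) \<in> P \<Longrightarrow> ((\<lambda>w. - a w), (\<lambda>w. - b w)) \<in> P"
    and eq: "\<And>a b s. (a, b) \<in> P \<Longrightarrow> (\<integral>w. cos (a w + s) \<partial>M) = (\<integral>w. cos (b w + s) \<partial>N)"
    and K: "finite K" and A: "\<And>k. k \<in> K \<Longrightarrow> A k \<in> sets borel"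
  shows "(a, b) \<in> P \<Longrightarrow> (\<integral>w. cos (a w + s) * (\<Prod>k\<in>K. indicator (A k) (g k w)) \<partial>M)
      = (\<integral>w. cos (b w + s) * (\<Prod>k\<in>K. indicator (A k) (h k w)) \<partial>N)"
  using K A
proof (induction K arbitrary: a b s rule: finite_induct)
  case empty then show ?case using eq by simp
next
  case (insert k K)
  interpret M: finite_measure M by fact
  interpret N: finite_measure N by fact
  have [measurable]: "A i \<in> sets borel" if "i \<in> insert k K" for i using insert that by auto
  have [measurable]: "A k \<in> sets borel" using insert by auto
  define I where "I = (\<lambda>w. \<Prod>i\<in>K. indicator (A i) (g i w) :: real)"
  define J where "J = (\<lambda>w. \<Prod>i\<in>K. indicator (A i) (h i w) :: real)"
  have [measurable]: "I \<in> borel_measurable M" "J \<in> borel_measurable N"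
    unfolding I_def J_def by (auto intro!: borel_measurable_prod)
  have I01: "0 \<le> I w" "I w \<le> 1" and J01: "0 \<le> J v" "J v \<le> 1" for w v
    unfolding I_def J_def by (auto intro!: prod_nonneg prod_le_1 simp: indicator_def)
  have IH: "(\<integral>w. cos (a w + s) * I w \<partial>M) = (\<integral>w. cos (b w + s) * J w \<partial>N)" if "(a, b) \<in> P" for a b s
    using insert that by (auto simp: I_def J_def)
  have key: "(\<integral>w. (1 + cos (a w + s)) * I w * indicator (A k) (g k w) \<partial>M) = (\<integral>w. (1 + cos (b w + s)) * J w * indicator (A k) (h k w) \<partial>N)"
    if ab: "(a, b) \<in> P" for a b s
  proof -
    have [measurable]: "a \<in> borel_measurable M" "b \<in> borel_measurable N" using mP[OF ab] by auto
    define wM where "wM = (\<lambda>w. (1 + cos (a w + s)) * I w)"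
    define wN where "wN = (\<lambda>w. (1 + cos (b w + s)) * J w)"
    have [measurable]: "wM \<in> borel_measurable M" "wN \<in> borel_measurable N" unfolding wM_def wN_def by measurable
    have c0: "0 \<le> 1 + cos x" for x :: real using cos_ge_minus_one[of x] by linarith
    have c2: "(1 + cos x) * y \<le> 2" if "0 \<le> y" "y \<le> 1" for x y :: real
      using mult_mono[of "1 + cos x" 2 y 1] that cos_le_one[of x] by simp
    have w0: "0 \<le> wM w" "wM w \<le> 2" "0 \<le> wN v" "wN v \<le> 2" for w v
      unfolding wM_def wN_def using I01[of w] J01[of v]
      by (auto intro!: mult_nonneg_nonneg c0 c2)
    have iw: "integrable M wM" "integrable N wN"
      using w0 by (auto intro!: integrable_bounded_measurable[where B = 2] M N)
    define \<nu> where "\<nu> = distr (density M wM) borel (g k)"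
    define \<nu>' where "\<nu>' = distr (density N wN) borel (h k)"
    have int\<nu>: "(\<integral>x. f x \<partial>\<nu>) = (\<integral>w. wM w * f (g k w) \<partial>M)" "(\<integral>x. f x \<partial>\<nu>') = (\<integral>w. wN w * f (h k w) \<partial>N)"
      if [measurable]: "f \<in> borel_measurable borel" for f :: "real \<Rightarrow> real"
      using w0 by (auto simp: \<nu>_def \<nu>'_def integral_distr integral_density)
    have fin: "finite_measure (density M wM)" "finite_measure (density N wN)"
      using iw w0 by (auto intro!: finite_measureI simp: emeasure_density nn_integral_eq_integral cong: nn_integral_cong_simp)
    have "\<nu> = \<nu>'"
    proof (rule finite_measure_char_unique)
      show "finite_measure \<nu>" "finite_measure \<nu>'"
        unfolding \<nu>_def \<nu>'_def by (auto intro!: finite_measure.finite_measure_distr fin)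
      show "sets \<nu> = sets borel" "sets \<nu>' = sets borel" by (auto simp: \<nu>_def \<nu>'_def)
      fix t r
      have 1: "((\<lambda>w. t * g k w), (\<lambda>w. t * h k w)) \<in> P" using step[OF zero, of t k] by simp
      have 2: "((\<lambda>w. t * g k w + a w), (\<lambda>w. t * h k w + b w)) \<in> P" using step[OF ab] .
      have 3: "((\<lambda>w. t * g k w + - a w), (\<lambda>w. t * h k w + - b w)) \<in> P" using step[OF neg[OF ab]] .
      \<comment> \<open>Product-to-sum: the trigonometric integral against the weight splits into
        integrals with arguments t g, t g + a and t g - a, each covered by the induction hypothesis.
        Here the closure properties \<open>step\<close> and \<open>neg\<close> of \<open>P\<close>
        enter.\<close>
      have e: "(1 + cos (y + s)) * X * cos (t * x + r) = cos (t * x + r) * X + (cos ((t * x + y) + (s + r)) * X + cos ((t * x + - y) + (r - s)) * X) / 2"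
        for x y X :: real
      proof -
        have "cos (t * x + r) * cos (y + s) = (cos ((t * x + r) - (y + s)) + cos ((t * x + r) + (y + s))) / 2" by (rule cos_times_cos)
        moreover have "(t * x + r) - (y + s) = (t * x + - y) + (r - s)" "(t * x + r) + (y + s) = (t * x + y) + (s + r)" by auto
        ultimately show ?thesis by (simp add: algebra_simps add_divide_distrib)
      qed
      have ab1: "\<bar>cos x * y\<bar> \<le> 1" if "0 \<le> y" "y \<le> 1" for x y :: real
        using that by (auto simp: abs_mult intro!: mult_le_one)
      have iM: "integrable M (\<lambda>w. cos (f w) * I w)" if [measurable]: "f \<in> borel_measurable M" for f
        using I01 by (intro integrable_bounded_measurable[where B = 1] M ab1) auto
      have iN: "integrable N (\<lambda>w. cos (f w) * J w)" if [measurable]: "f \<in> borel_measurable N" for f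
        using J01 by (intro integrable_bounded_measurable[where B = 1] N ab1) auto
      have "(\<integral>x. cos (t * x + r) \<partial>\<nu>) = (\<integral>w. cos (t * g k w + r) * I w \<partial>M)
          + ((\<integral>w. cos ((t * g k w + a w) + (s + r)) * I w \<partial>M) + (\<integral>w. cos ((t * g k w + - a w) + (r - s)) * I w \<partial>M)) / 2"
        by (subst int\<nu>, simp, unfold wM_def e) (simp add: iM)
      also have "\<dots> = (\<integral>w. cos (t * h k w + r) * J w \<partial>N)
          + ((\<integral>w. cos ((t * h k w + b w) + (s + r)) * J w \<partial>N) + (\<integral>w. cos ((t * h k w + - b w) + (r - s)) * J w \<partial>N)) / 2"
        by (simp only: IH[OF 1] IH[OF 2] IH[OF 3])
      also have "\<dots> = (\<integral>x. cos (t * x + r) \<partial>\<nu>')"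
        by (subst int\<nu>, simp, unfold wN_def e) (simp add: iN)
      finally show "(\<integral>x. cos (t * x + r) \<partial>\<nu>) = (\<integral>x. cos (t * x + r) \<partial>\<nu>')" .
    qed
    then have "(\<integral>x. indicator (A k) x \<partial>\<nu>) = (\<integral>x. indicator (A k) x \<partial>\<nu>' :: real)" by simp
    then show ?thesis by (subst (asm) int\<nu>, simp, subst (asm) int\<nu>, simp) (simp add: wM_def wN_def)
  qed
  have [measurable]: "a \<in> borel_measurable M" "b \<in> borel_measurable N" using mP insert by auto
  have split: "(1 + c) * x * y = x * y + c * (x * y)" for c x y :: real by (simp add: algebra_simps)
  have ii: "integrable M (\<lambda>w. I w * indicator (A k) (g k w))" "integrable N (\<lambda>w. J w * indicator (A k) (h k w))"
     "integrable M (\<lambda>w. cos (a w + s) * (I w * indicator (A k) (g k w)))" "integrable N (\<lambda>w. cos (b w + s) * (J w * indicator (A k) (h k w)))"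
    using I01 J01 by (auto intro!: integrable_bounded_measurable[where B = 1] M N simp: abs_mult mult_le_one indicator_def)
  \<comment> \<open>For the zero combination and zero phase the weight is the constant factor 2,
    which gives the identity without a cosine; removing it from the general one isolates the cosine
    term.\<close>
  have "(\<integral>w. (1 + cos (0 + 0)) * I w * indicator (A k) (g k w) \<partial>M) = (\<integral>w. (1 + cos (0 + 0)) * J w * indicator (A k) (h k w) \<partial>N)"
    by (rule key[OF zero])
  then have 1: "(\<integral>w. I w * indicator (A k) (g k w) \<partial>M) = (\<integral>w. J w * indicator (A k) (h k w) \<partial>N)"
    by (simp add: mult.assoc)
  from key[OF insert.prems(1), of s] have 2: "(\<integral>w. cos (a w + s) * (I w * indicator (A k) (g k w)) \<partial>M) = (\<integral>w. cos (b w + s) * (J w * indicator (A k) (h k w)) \<partial>N)"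
    unfolding split by (simp add: ii 1)
  show ?case using 2 insert.hyps by (simp add: I_def J_def mult.commute)
qed

text \<open>The factor cos (0 + 0) = 1 gives the probability of a cylinder the exact shape of the
  integrals compared in \<open>cramer_wold_aux\<close>.\<close>

lemma emeasure_cylinder:
  fixes R :: "'z measure" and f :: "'i \<Rightarrow> 'z \<Rightarrow> real"
  assumes R: "prob_space R" and f[measurable]: "\<And>i. f i \<in> borel_measurable R"
    and K: "finite K" and A: "\<And>i. i \<in> K \<Longrightarrow> A i \<in> sets borel"
  shows "emeasure (distr R (PiM UNIV (\<lambda>_. borel)) (\<lambda>w i. f i w)) (prod_emb UNIV (\<lambda>_. borel) K (Pi\<^sub>E K A))
      = ennreal (\<integral>w. cos (0 + 0) * (\<Prod>k\<in>K. indicator (A k) (f k w)) \<partial>R)"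
proof -
  interpret R: prob_space R by fact
  have mf: "(\<lambda>w i. f i w) \<in> R \<rightarrow>\<^sub>M PiM UNIV (\<lambda>_. borel)" by (auto intro!: measurable_PiM_single')
  have S: "{w\<in>space R. \<forall>k\<in>K. f k w \<in> A k} \<in> sets R" using K A by (auto intro!: sets.sets_Collect_finite_All)
  have "emeasure (distr R (PiM UNIV (\<lambda>_. borel)) (\<lambda>w i. f i w)) (prod_emb UNIV (\<lambda>_. borel) K (Pi\<^sub>E K A))
     = emeasure R {w\<in>space R. \<forall>k\<in>K. f k w \<in> A k}"
  proof -
    have "prod_emb UNIV (\<lambda>_. borel) K (Pi\<^sub>E K A) \<in> sets (PiM UNIV (\<lambda>_. borel))" using K A by (auto intro!: sets_PiM_I)
    moreover have "(\<lambda>w i. f i w) -` prod_emb UNIV (\<lambda>_. borel) K (Pi\<^sub>E K A) \<inter> space R = {w\<in>space R. \<forall>k\<in>K. f k w \<in> A k}"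
      by (auto simp: prod_emb_def)
    ultimately show ?thesis by (simp add: emeasure_distr mf)
  qed
  also have "\<dots> = ennreal (\<integral>w. indicator {w\<in>space R. \<forall>k\<in>K. f k w \<in> A k} w \<partial>R)"
    using S by (simp add: R.emeasure_eq_measure)
  also have "(\<integral>w. indicator {w\<in>space R. \<forall>k\<in>K. f k w \<in> A k} w \<partial>R :: real) = (\<integral>w. cos (0 + 0) * (\<Prod>k\<in>K. indicator (A k) (f k w)) \<partial>R)"
  proof (rule Bochner_Integration.integral_cong)
    fix w assume w: "w \<in> space R"
    show "indicator {w\<in>space R. \<forall>k\<in>K. f k w \<in> A k} w = cos (0 + 0) * (\<Prod>k\<in>K. indicator (A k) (f k w) :: real)"
    proof (cases "\<forall>k\<in>K. f k w \<in> A k")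
      case True then show ?thesis using w by simp
    next
      case False then show ?thesis using K by (auto simp: prod_zero_iff indicator_def)
    qed
  qed simp
  finally show ?thesis .
qed

text \<open>\<open>P\<close> stands for pairs of matching linear combinations. It is left abstract
  so that an inductively generated set can be inserted, on which the cosine condition is verified by
  induction.\<close>

theorem cramer_wold:
  fixes g :: "'i \<Rightarrow> 'w \<Rightarrow> real" and h :: "'i \<Rightarrow> 'v \<Rightarrow> real"
  assumes M: "prob_space M" and N: "prob_space N"
    and [measurable]: "\<And>i. g i \<in> borel_measurable M" "\<And>i. h i \<in> borel_measurable N"
    and mP: "\<And>a b. (a, b) \<in> P \<Longrightarrow> a \<in> borel_measurable M" "\<And>a b. (a, b) \<in> P \<Longrightarrow> b \<in> borel_measurable N"
    and zero: "((\<lambda>_. 0), (\<lambda>_. 0)) \<in> P"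
    and step: "\<And>a b t i. (a, b) \<in> P \<Longrightarrow> ((\<lambda>w. t * g i w + a w), (\<lambda>w. t * h i w + b w)) \<in> P"
    and neg: "\<And>a b. (a, b) \<in> P \<Longrightarrow> ((\<lambda>w. - a w), (\<lambda>w. - b w)) \<in> P"
    and eq: "\<And>a b s. (a, b) \<in> P \<Longrightarrow> (\<integral>w. cos (a w + s) \<partial>M) = (\<integral>w. cos (b w + s) \<partial>N)"
  shows "distr M (PiM UNIV (\<lambda>_. borel)) (\<lambda>w i. g i w) = distr N (PiM UNIV (\<lambda>_. borel)) (\<lambda>w i. h i w)"
proof (rule measure_eqI_PiM_infinite)
  interpret M: prob_space M by fact
  interpret N: prob_space N by fact
  have mg[measurable]: "(\<lambda>w i. g i w) \<in> M \<rightarrow>\<^sub>M PiM UNIV (\<lambda>_. borel)" and mh[measurable]: "(\<lambda>w i. h i w) \<in> N \<rightarrow>\<^sub>M PiM UNIV (\<lambda>_. borel)"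
    by (auto intro!: measurable_PiM_single')
  show "finite_measure (distr M (PiM UNIV (\<lambda>_. borel)) (\<lambda>w i. g i w))" by (intro M.finite_measure_distr mg)
  fix A :: "'i \<Rightarrow> real set" and K :: "'i set" assume K: "finite K" and A: "\<And>i. i \<in> K \<Longrightarrow> A i \<in> sets borel"
  show "emeasure (distr M (PiM UNIV (\<lambda>_. borel)) (\<lambda>w i. g i w)) (prod_emb UNIV (\<lambda>_. borel) K (Pi\<^sub>E K A)) =
      emeasure (distr N (PiM UNIV (\<lambda>_. borel)) (\<lambda>w i. h i w)) (prod_emb UNIV (\<lambda>_. borel) K (Pi\<^sub>E K A))"
  proof -
    have "(\<integral>w. cos (0 + 0) * (\<Prod>k\<in>K. indicator (A k) (g k w)) \<partial>M) = (\<integral>w. cos (0 + 0) * (\<Prod>k\<in>K. indicator (A k) (h k w)) \<partial>N :: real)"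
      by (rule cramer_wold_aux[where M = M and N = N and g = g and h = h and A = A and K = K and P = P and a = "\<lambda>_. 0" and b = "\<lambda>_. 0" and s = 0])
        (use assms K A M.finite_measure_axioms N.finite_measure_axioms in auto)
    then show ?thesis
      using emeasure_cylinder[where f = g and R = M and K = K and A = A] emeasure_cylinder[where f = h and R = N and K = K and A = A] M N K A by simp
  qed
qed auto

section \<open>Spaces of centered Gaussian variables\<close>

text \<open>The point mass is the case s = 0 of a scaled standard normal variable; the common form
  spares later arguments the case distinction.\<close>

lemma centered_normal_iff:
  "centered_normal \<nu> \<longleftrightarrow> (\<exists>s\<ge>0. \<nu> = distr std_normal_distribution borel (\<lambda>x. s * x))"
proof -
  interpret std: real_distribution std_normal_distribution by (rule real_dist_normal_dist)
  have 0: "distr std_normal_distribution borel (\<lambda>x. 0 * x) = return borel 0"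
    by (intro measure_eqI) (auto simp: emeasure_distr indicator_def std.emeasure_space_1[simplified])
  have 1: "distr std_normal_distribution borel (\<lambda>x. s * x) = density lborel (\<lambda>x. ennreal (normal_density 0 s x))" if "s > 0" for s
  proof -
    have "distributed std_normal_distribution lborel (\<lambda>x. x) std_normal_density"
      by (auto simp: distributed_def intro!: measure_eqI)
        (auto simp: emeasure_distr)
    from std.normal_density_affine[OF this, of s 0] that
    have "distributed std_normal_distribution lborel (\<lambda>x. s * x) (normal_density 0 s)" by simp
    then have "distr std_normal_distribution lborel (\<lambda>x. s * x) = density lborel (normal_density 0 s)" by (simp add: distributed_def)
    moreover have "distr std_normal_distribution lborel (\<lambda>x. s * x) = distr std_normal_distribution borel (\<lambda>x. s * x)"
      by (intro distr_cong) auto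
    ultimately show ?thesis by simp
  qed
  show ?thesis
  proof
    assume "centered_normal \<nu>"
    then show "\<exists>s\<ge>0. \<nu> = distr std_normal_distribution borel (\<lambda>x. s * x)"
      unfolding centered_normal_def
    proof (elim disjE exE conjE)
      show ?thesis if "\<nu> = return borel 0" using that 0 by (intro exI[of _ 0]) simp
      show ?thesis if "0 < s" "\<nu> = density lborel (\<lambda>x. ennreal (normal_density 0 s x))" for s
        using that 1[of s] by (intro exI[of _ s]) simp
    qed
  next
    assume "\<exists>s\<ge>0. \<nu> = distr std_normal_distribution borel (\<lambda>x. s * x)"
    then obtain s where "s \<ge> 0" "\<nu> = distr std_normal_distribution borel (\<lambda>x. s * x)" by auto
    then consider "\<nu> = return borel 0" | "s > 0" "\<nu> = density lborel (\<lambda>x. ennreal (normal_density 0 s x))"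
      using 0 1[of s] by (cases "s = 0") (auto simp: less_le)
    then show "centered_normal \<nu>" unfolding centered_normal_def by cases blast+
  qed
qed

section \<open>Transforms and moments of centered normal variables\<close>

lemma std_normal_cos: "(\<integral>x. cos (t * x + s) \<partial>std_normal_distribution) = cos s * exp (- t\<^sup>2 / 2)"
proof -
  interpret std: real_distribution std_normal_distribution by (rule real_dist_normal_dist)
  have c: "Complex (\<integral>x. cos (t * x) \<partial>std_normal_distribution) (\<integral>x. cos (t * x - pi / 2) \<partial>std_normal_distribution) = complex_of_real (exp (- t\<^sup>2 / 2))"
    using cos_sin_char[OF real_dist_normal_dist, of t] by (simp add: char_std_normal_distribution)
  then have 1: "(\<integral>x. cos (t * x) \<partial>std_normal_distribution) = exp (- t\<^sup>2 / 2)" "(\<integral>x. sin (t * x) \<partial>std_normal_distribution) = 0"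
    by (auto simp: complex_eq_iff cos_diff)
  have "integrable std_normal_distribution (\<lambda>x. cos (t * x))" "integrable std_normal_distribution (\<lambda>x. sin (t * x))"
    by (auto intro!: integrable_bounded_measurable[where B = 1] std.finite_measure_axioms)
  then have "(\<integral>x. cos (t * x + s) \<partial>std_normal_distribution) = (\<integral>x. cos (t * x) \<partial>std_normal_distribution) * cos s - (\<integral>x. sin (t * x) \<partial>std_normal_distribution) * sin s"
    unfolding cos_add by (subst Bochner_Integration.integral_diff) auto
  then show ?thesis using 1 by simp
qed

lemma std_normal_mgf: "(\<integral>\<^sup>+x. ennreal (exp (a * x)) \<partial>std_normal_distribution) = ennreal (exp (a\<^sup>2 / 2))"
proof -
  have e: "std_normal_density x * exp (a * x) = exp (a\<^sup>2 / 2) * normal_density a 1 x" for x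
  proof -
    have "- (x\<^sup>2 / 2) + a * x = a\<^sup>2 / 2 - (x - a)\<^sup>2 / 2" by (simp add: power2_eq_square field_simps)
    then have "exp (- (x\<^sup>2 / 2)) * exp (a * x) = exp (a\<^sup>2 / 2) * exp (- (x - a)\<^sup>2 / 2)" unfolding exp_add[symmetric] by simp
    then show ?thesis by (simp add: normal_density_def)
  qed
  have "(\<integral>\<^sup>+x. ennreal (exp (a * x)) \<partial>std_normal_distribution) = (\<integral>\<^sup>+x. ennreal (std_normal_density x * exp (a * x)) \<partial>lborel)"
    by (subst nn_integral_density) (auto simp: ennreal_mult)
  also have "\<dots> = ennreal (exp (a\<^sup>2 / 2)) * (\<integral>\<^sup>+x. ennreal (normal_density a 1 x) \<partial>lborel)"
    unfolding e by (subst nn_integral_cmult[symmetric]) (auto simp: ennreal_mult)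
  also have "(\<integral>\<^sup>+x. ennreal (normal_density a 1 x) \<partial>lborel) = 1"
    by (subst nn_integral_eq_integral) auto
  finally show ?thesis by simp
qed

definition gaussian_rv :: "'w measure \<Rightarrow> ('w \<Rightarrow> real) \<Rightarrow> bool" where
  "gaussian_rv M g \<longleftrightarrow> g \<in> borel_measurable M \<and> centered_normal (distr M borel g)"

lemma gaussian_rv_measurable: "gaussian_rv M g \<Longrightarrow> g \<in> borel_measurable M"
  by (simp add: gaussian_rv_def)

lemma gaussian_rv_std:
  assumes "gaussian_rv M g"
  obtains s where "s \<ge> 0" "s\<^sup>2 = (\<integral>w. (g w)\<^sup>2 \<partial>M)"
    "\<And>f::real\<Rightarrow>real. f \<in> borel_measurable borel \<Longrightarrow> integrable M (\<lambda>w. f (g w)) \<longleftrightarrow> integrable std_normal_distribution (\<lambda>x. f (s * x))"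
    "\<And>f::real\<Rightarrow>real. f \<in> borel_measurable borel \<Longrightarrow> (\<integral>w. f (g w) \<partial>M) = (\<integral>x. f (s * x) \<partial>std_normal_distribution)"
    "\<And>f::real\<Rightarrow>ennreal. f \<in> borel_measurable borel \<Longrightarrow> (\<integral>\<^sup>+w. f (g w) \<partial>M) = (\<integral>\<^sup>+x. f (s * x) \<partial>std_normal_distribution)"
proof -
  from assms obtain s where s: "s \<ge> 0" and d: "distr M borel g = distr std_normal_distribution borel (\<lambda>x. s * x)"
    and [measurable]: "g \<in> borel_measurable M"
    by (auto simp: gaussian_rv_def centered_normal_iff)
  have i: "integrable M (\<lambda>w. f (g w)) \<longleftrightarrow> integrable std_normal_distribution (\<lambda>x. f (s * x))"
     "(\<integral>w. f (g w) \<partial>M) = (\<integral>x. f (s * x) \<partial>std_normal_distribution)" if [measurable]: "f \<in> borel_measurable borel" for f :: "real \<Rightarrow> real"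
    using arg_cong[OF d, of "\<lambda>m. integrable m f"] arg_cong[OF d, of "\<lambda>m. integral\<^sup>L m f"]
    by (simp_all add: integrable_distr_eq integral_distr)
  have n: "(\<integral>\<^sup>+w. f (g w) \<partial>M) = (\<integral>\<^sup>+x. f (s * x) \<partial>std_normal_distribution)" if [measurable]: "f \<in> borel_measurable borel" for f :: "real \<Rightarrow> ennreal"
    using arg_cong[OF d, of "\<lambda>m. integral\<^sup>N m f"] by (simp add: nn_integral_distr)
  have "(\<integral>x. x\<^sup>2 \<partial>std_normal_distribution) = 1"
    using std_normal_distribution_even_moments[of 1] by simp
  then have "(\<integral>w. (g w)\<^sup>2 \<partial>M) = s\<^sup>2" using i(2)[of "\<lambda>x. x\<^sup>2"] by (simp add: power_mult_distrib)
  then have 2: "s\<^sup>2 = (\<integral>w. (g w)\<^sup>2 \<partial>M)" ..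
  show ?thesis by (rule that[of s]) (fact s 2 | rule i n, assumption)+
qed

lemma gaussian_rv_power:
  assumes "gaussian_rv M g"
  shows "integrable M (\<lambda>w. (g w)^k)"
proof (rule gaussian_rv_std[OF assms])
  fix s assume "\<And>f::real\<Rightarrow>real. f \<in> borel_measurable borel \<Longrightarrow> integrable M (\<lambda>w. f (g w)) \<longleftrightarrow> integrable std_normal_distribution (\<lambda>x. f (s * x))"
  from this[of "\<lambda>x. x ^ k"] show ?thesis by (simp add: power_mult_distrib integrable_std_normal_distribution_moment)
qed

lemma gaussian_rv_abs_power: "gaussian_rv M g \<Longrightarrow> integrable M (\<lambda>w. \<bar>g w\<bar>^k)"
  using integrable_abs[OF gaussian_rv_power[of M g k]] by (simp add: power_abs)

lemma gaussian_rv_integrable: "gaussian_rv M g \<Longrightarrow> integrable M g"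
  using gaussian_rv_power[of M g 1] by simp

lemma gaussian_rv_mean:
  assumes "gaussian_rv M g"
  shows "(\<integral>w. g w \<partial>M) = 0"
proof (rule gaussian_rv_std[OF assms])
  fix s assume "\<And>f::real\<Rightarrow>real. f \<in> borel_measurable borel \<Longrightarrow> (\<integral>w. f (g w) \<partial>M) = (\<integral>x. f (s * x) \<partial>std_normal_distribution)"
  from this[of "\<lambda>x. x"] show ?thesis using integral_std_normal_distribution_moment_odd[of 1] by simp
qed

lemma gaussian_rv_cos:
  assumes "gaussian_rv M g"
  shows "(\<integral>w. cos (g w + s) \<partial>M) = cos s * exp (- (\<integral>w. (g w)\<^sup>2 \<partial>M) / 2)"
proof (rule gaussian_rv_std[OF assms])
  fix r assume r: "r\<^sup>2 = (\<integral>w. (g w)\<^sup>2 \<partial>M)"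
    and *: "\<And>f::real\<Rightarrow>real. f \<in> borel_measurable borel \<Longrightarrow> (\<integral>w. f (g w) \<partial>M) = (\<integral>x. f (r * x) \<partial>std_normal_distribution)"
  show ?thesis using *[of "\<lambda>x. cos (x + s)"] std_normal_cos[of r s] r by simp
qed

lemma gaussian_rv_mgf:
  assumes "gaussian_rv M g"
  shows "(\<integral>\<^sup>+w. ennreal (exp (a * g w)) \<partial>M) = ennreal (exp (a\<^sup>2 * (\<integral>w. (g w)\<^sup>2 \<partial>M) / 2))"
proof (rule gaussian_rv_std[OF assms])
  fix s assume s: "s\<^sup>2 = (\<integral>w. (g w)\<^sup>2 \<partial>M)"
    and *: "\<And>f::real\<Rightarrow>ennreal. f \<in> borel_measurable borel \<Longrightarrow> (\<integral>\<^sup>+w. f (g w) \<partial>M) = (\<integral>\<^sup>+x. f (s * x) \<partial>std_normal_distribution)"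
  show ?thesis using *[of "\<lambda>x. ennreal (exp (a * x))"] std_normal_mgf[of "a * s"] s
    by (simp add: mult.assoc power_mult_distrib)
qed

lemma gaussian_rvI:
  assumes "prob_space M" and [measurable]: "g \<in> borel_measurable M" and v: "v \<ge> 0"
    and eq: "\<And>t s. (\<integral>w. cos (t * g w + s) \<partial>M) = cos s * exp (- t\<^sup>2 * v / 2)"
  shows "gaussian_rv M g"
proof -
  interpret prob_space M by fact
  interpret std: real_distribution std_normal_distribution by (rule real_dist_normal_dist)
  have "distr M borel g = distr std_normal_distribution borel (\<lambda>x. sqrt v * x)"
  proof (rule finite_measure_char_unique)
    show "finite_measure (distr M borel g)" by (intro finite_measure_distr) simp
    show "finite_measure (distr std_normal_distribution borel (\<lambda>x. sqrt v * x))" by (intro std.finite_measure_distr) simp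
    fix t s show "(\<integral>x. cos (t * x + s) \<partial>distr M borel g) = (\<integral>x. cos (t * x + s) \<partial>distr std_normal_distribution borel (\<lambda>x. sqrt v * x))"
      using eq[of t s] v std_normal_cos[of "t * sqrt v" s] by (simp add: integral_distr power_mult_distrib mult.assoc)
  qed auto
  then show ?thesis unfolding gaussian_rv_def centered_normal_iff using v by (auto intro!: exI[of _ "sqrt v"])
qed

text \<open>A Gaussian space in the usual sense, without completeness: joint Gaussianity of a family
  is encoded by membership in one linear space of centered Gaussian variables.\<close>

definition gaussian_space :: "'w measure \<Rightarrow> ('w \<Rightarrow> real) set \<Rightarrow> bool" where
  "gaussian_space M G \<longleftrightarrow> prob_space M \<and> G \<noteq> {} \<and> (\<forall>g\<in>G. gaussian_rv M g) \<and>
     (\<forall>g\<in>G. \<forall>h\<in>G. \<forall>a b. (\<lambda>w. a * g w + b * h w) \<in> G)"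

lemma gaussian_spaceD:
  assumes "gaussian_space M G"
  shows "prob_space M" "g \<in> G \<Longrightarrow> gaussian_rv M g" "g \<in> G \<Longrightarrow> h \<in> G \<Longrightarrow> (\<lambda>w. a * g w + b * h w) \<in> G"
    "g \<in> G \<Longrightarrow> g \<in> borel_measurable M" "(\<lambda>w. 0) \<in> G" "g \<in> G \<Longrightarrow> (\<lambda>w. a * g w) \<in> G"
    "g \<in> G \<Longrightarrow> h \<in> G \<Longrightarrow> (\<lambda>w. g w + h w) \<in> G" "g \<in> G \<Longrightarrow> h \<in> G \<Longrightarrow> (\<lambda>w. g w - h w) \<in> G"
    "g \<in> G \<Longrightarrow> (\<lambda>w. - g w) \<in> G"
proof -
  have comb: "(\<lambda>w. a * g w + b * h w) \<in> G" if "g \<in> G" "h \<in> G" for g h a b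
    using assms that by (auto simp: gaussian_space_def)
  show "prob_space M" "g \<in> G \<Longrightarrow> gaussian_rv M g" "g \<in> G \<Longrightarrow> h \<in> G \<Longrightarrow> (\<lambda>w. a * g w + b * h w) \<in> G"
    "g \<in> G \<Longrightarrow> g \<in> borel_measurable M"
    using assms by (auto simp: gaussian_space_def gaussian_rv_def)
  obtain k where "k \<in> G" using assms by (auto simp: gaussian_space_def)
  from comb[OF this this, of 0 0] show "(\<lambda>w. 0) \<in> G" by simp
  show "g \<in> G \<Longrightarrow> (\<lambda>w. a * g w) \<in> G" using comb[of g g a 0] by simp
  show "g \<in> G \<Longrightarrow> h \<in> G \<Longrightarrow> (\<lambda>w. g w + h w) \<in> G" using comb[of g h 1 1] by simp
  show "g \<in> G \<Longrightarrow> h \<in> G \<Longrightarrow> (\<lambda>w. g w - h w) \<in> G" using comb[of g h 1 "-1"] by simp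
  show "g \<in> G \<Longrightarrow> (\<lambda>w. - g w) \<in> G" using comb[of g g "-1" 0] by simp
qed

lemma gaussian_space_sum:
  assumes "gaussian_space M G" "\<And>i. i \<in> I \<Longrightarrow> g i \<in> G"
  shows "(\<lambda>w. \<Sum>i\<in>I. c i * g i w) \<in> G"
  using assms(2)
proof (induction I rule: infinite_finite_induct)
  case (insert i I)
  then show ?case using gaussian_spaceD(3)[OF assms(1), of "g i" "\<lambda>w. \<Sum>i\<in>I. c i * g i w" "c i" 1] by simp
qed (use gaussian_spaceD(5)[OF assms(1)] in auto)

lemma gaussian_space_integrable_mult:
  assumes "gaussian_space M G" "g \<in> G" "h \<in> G"
  shows "integrable M (\<lambda>w. g w * h w)"
proof -
  have "(\<lambda>w. g w + h w) \<in> G" "(\<lambda>w. g w - h w) \<in> G" using gaussian_spaceD[OF assms(1)] assms(2,3) by auto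
  then have "integrable M (\<lambda>w. ((g w + h w)\<^sup>2 - (g w - h w)\<^sup>2) / 4)"
    using gaussian_spaceD(2)[OF assms(1)] gaussian_rv_power[of M _ 2] by (intro integrable_divide Bochner_Integration.integrable_diff) blast+
  then show ?thesis by (simp add: power2_eq_square algebra_simps)
qed

lemma gaussian_space_second_moment:
  assumes "gaussian_space M G" "g \<in> G" "h \<in> G"
  shows "(\<integral>w. (a * g w + b * h w)\<^sup>2 \<partial>M) = a\<^sup>2 * (\<integral>w. (g w)\<^sup>2 \<partial>M) + 2 * a * b * (\<integral>w. g w * h w \<partial>M) + b\<^sup>2 * (\<integral>w. (h w)\<^sup>2 \<partial>M)"
proof -
  note i = gaussian_space_integrable_mult[OF assms(1)]
  have "(\<integral>w. (a * g w + b * h w)\<^sup>2 \<partial>M) = (\<integral>w. a\<^sup>2 * (g w * g w) + 2 * a * b * (g w * h w) + b\<^sup>2 * (h w * h w) \<partial>M)"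
    by (intro Bochner_Integration.integral_cong) (auto simp: power2_eq_square algebra_simps)
  also have "\<dots> = a\<^sup>2 * (\<integral>w. g w * g w \<partial>M) + 2 * a * b * (\<integral>w. g w * h w \<partial>M) + b\<^sup>2 * (\<integral>w. h w * h w \<partial>M)"
    using assms(2,3) i by simp
  finally show ?thesis by (simp add: power2_eq_square)
qed

section \<open>Independent copies on a product space\<close>

lemma integral_prod_fst:
  fixes f :: "'a \<Rightarrow> 'c::{banach, second_countable_topology}"
  assumes "prob_space M" "prob_space N" and [measurable]: "f \<in> borel_measurable M"
  shows "(\<integral>x. f (fst x) \<partial>(M \<Otimes>\<^sub>M N)) = (\<integral>x. f x \<partial>M)"
    "integrable (M \<Otimes>\<^sub>M N) (\<lambda>x. f (fst x)) \<longleftrightarrow> integrable M f"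
proof -
  interpret N: prob_space N by fact
  have d: "distr (M \<Otimes>\<^sub>M N) M fst = M" by (rule N.distr_pair_fst)
  show "(\<integral>x. f (fst x) \<partial>(M \<Otimes>\<^sub>M N)) = (\<integral>x. f x \<partial>M)"
    using integral_distr[of fst "M \<Otimes>\<^sub>M N" M f] by (simp add: d)
  show "integrable (M \<Otimes>\<^sub>M N) (\<lambda>x. f (fst x)) \<longleftrightarrow> integrable M f"
    using integrable_distr_eq[of fst "M \<Otimes>\<^sub>M N" M f] by (simp add: d)
qed

lemma distr_pair_snd:
  assumes "prob_space M" "prob_space N"
  shows "distr (M \<Otimes>\<^sub>M N) N snd = N"
proof -
  interpret M: prob_space M by fact
  interpret N: prob_space N by fact
  interpret pair_prob_space M N ..
  show ?thesis
  proof (rule measure_eqI)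
    fix A assume "A \<in> sets (distr (M \<Otimes>\<^sub>M N) N snd)"
    then have A: "A \<in> sets N" by simp
    then have "snd -` A \<inter> space (M \<Otimes>\<^sub>M N) = space M \<times> A" using sets.sets_into_space by (auto simp: space_pair_measure)
    then show "emeasure (distr (M \<Otimes>\<^sub>M N) N snd) A = emeasure N A"
      using A by (simp add: emeasure_distr N.emeasure_pair_measure_Times M.emeasure_space_1)
  qed simp
qed

lemma integral_prod_snd:
  fixes f :: "'b \<Rightarrow> 'c::{banach, second_countable_topology}"
  assumes "prob_space M" "prob_space N" and [measurable]: "f \<in> borel_measurable N"
  shows "(\<integral>x. f (snd x) \<partial>(M \<Otimes>\<^sub>M N)) = (\<integral>x. f x \<partial>N)"
    "integrable (M \<Otimes>\<^sub>M N) (\<lambda>x. f (snd x)) \<longleftrightarrow> integrable N f"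
proof -
  have d: "distr (M \<Otimes>\<^sub>M N) N snd = N" by (rule distr_pair_snd[OF assms(1,2)])
  show "(\<integral>x. f (snd x) \<partial>(M \<Otimes>\<^sub>M N)) = (\<integral>x. f x \<partial>N)"
    using integral_distr[of snd "M \<Otimes>\<^sub>M N" N f] by (simp add: d)
  show "integrable (M \<Otimes>\<^sub>M N) (\<lambda>x. f (snd x)) \<longleftrightarrow> integrable N f"
    using integrable_distr_eq[of snd "M \<Otimes>\<^sub>M N" N f] by (simp add: d)
qed

definition sum_space :: "('w \<Rightarrow> real) set \<Rightarrow> ('v \<Rightarrow> real) set \<Rightarrow> ('w \<times> 'v \<Rightarrow> real) set" where
  "sum_space G H = {\<lambda>x. g (fst x) + h (snd x) |g h. g \<in> G \<and> h \<in> H}"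

text \<open>The free phase in the cosine formula makes Fubini immediate: with one coordinate fixed,
  its contribution is a phase for the other, and the two Gaussian factors multiply.\<close>

lemma gaussian_space_sum_space:
  assumes G: "gaussian_space M G" and H: "gaussian_space N H"
  shows "gaussian_space (M \<Otimes>\<^sub>M N) (sum_space G H)"
proof -
  interpret M: prob_space M by (rule gaussian_spaceD[OF G])
  interpret N: prob_space N by (rule gaussian_spaceD[OF H])
  interpret P: pair_prob_space M N ..
  have 1: "gaussian_rv (M \<Otimes>\<^sub>M N) (\<lambda>x. g (fst x) + h (snd x))" if g: "g \<in> G" and h: "h \<in> H" for g h
  proof (rule gaussian_rvI)
    have [measurable]: "g \<in> borel_measurable M" "h \<in> borel_measurable N" using gaussian_spaceD(4)[OF G g] gaussian_spaceD(4)[OF H h] by auto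
    show "prob_space (M \<Otimes>\<^sub>M N)" by unfold_locales
    show "(\<lambda>x. g (fst x) + h (snd x)) \<in> borel_measurable (M \<Otimes>\<^sub>M N)" by measurable
    define v v' where "v = (\<integral>w. (g w)\<^sup>2 \<partial>M)" and "v' = (\<integral>w. (h w)\<^sup>2 \<partial>N)"
    show "0 \<le> v + v'" by (auto simp: v_def v'_def)
    fix t s
    have tg: "(\<lambda>w. t * g w) \<in> G" "(\<lambda>w. t * h w) \<in> H" using gaussian_spaceD(6)[OF G g] gaussian_spaceD(6)[OF H h] by auto
    have cg: "(\<integral>w. cos (t * g w + r) \<partial>M) = cos r * exp (- t\<^sup>2 * v / 2)" for r
      using gaussian_rv_cos[OF gaussian_spaceD(2)[OF G tg(1)]] by (simp add: v_def power_mult_distrib)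
    have ch: "(\<integral>w. cos (t * h w + r) \<partial>N) = cos r * exp (- t\<^sup>2 * v' / 2)" for r
      using gaussian_rv_cos[OF gaussian_spaceD(2)[OF H tg(2)]] by (simp add: v'_def power_mult_distrib)
    have "integrable (M \<Otimes>\<^sub>M N) (\<lambda>x. cos (t * (g (fst x) + h (snd x)) + s))"
      by (intro integrable_bounded_measurable[where B = 1] P.finite_measure_axioms) auto
    from P.integral_fst'[OF this]
    have "(\<integral>x. cos (t * (g (fst x) + h (snd x)) + s) \<partial>(M \<Otimes>\<^sub>M N)) = (\<integral>x. (\<integral>y. cos (t * h y + (t * g x + s)) \<partial>N) \<partial>M)"
      by (simp add: algebra_simps)
    also have "\<dots> = cos s * exp (- t\<^sup>2 * v / 2) * exp (- t\<^sup>2 * v' / 2)" unfolding ch by (simp add: cg)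
    also have "\<dots> = cos s * exp (- t\<^sup>2 * (v + v') / 2)" by (simp add: exp_add[symmetric] mult.assoc algebra_simps add_divide_distrib)
    finally show "(\<integral>x. cos (t * (g (fst x) + h (snd x)) + s) \<partial>(M \<Otimes>\<^sub>M N)) = cos s * exp (- t\<^sup>2 * (v + v') / 2)" .
  qed
  have "(\<lambda>w. a * f w + b * k w) \<in> sum_space G H" if fk: "f \<in> sum_space G H" "k \<in> sum_space G H" for f k a b
  proof -
    obtain g h g' h' where f: "f = (\<lambda>x. g (fst x) + h (snd x))" "k = (\<lambda>x. g' (fst x) + h' (snd x))" and m: "g \<in> G" "g' \<in> G" "h \<in> H" "h' \<in> H"
      using fk by (auto simp: sum_space_def)
    have "(\<lambda>w. a * f w + b * k w) = (\<lambda>x. (\<lambda>w. a * g w + b * g' w) (fst x) + (\<lambda>w. a * h w + b * h' w) (snd x))"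
      by (auto simp: f algebra_simps)
    moreover have "(\<lambda>w. a * g w + b * g' w) \<in> G" "(\<lambda>w. a * h w + b * h' w) \<in> H" using gaussian_spaceD(3)[OF G m(1,2)] gaussian_spaceD(3)[OF H m(3,4)] by auto
    ultimately show ?thesis unfolding sum_space_def mem_Collect_eq
      by (intro exI[of _ "\<lambda>w. a * g w + b * g' w"] exI[of _ "\<lambda>w. a * h w + b * h' w"]) simp
  qed
  moreover have "sum_space G H \<noteq> {}" using G H by (auto simp: gaussian_space_def sum_space_def)
  moreover have "prob_space (M \<Otimes>\<^sub>M N)" by unfold_locales
  moreover have "gaussian_rv (M \<Otimes>\<^sub>M N) f" if "f \<in> sum_space G H" for f
    using that 1 by (auto simp: sum_space_def)
  ultimately show ?thesis unfolding gaussian_space_def by blast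
qed

lemma sum_spaceI:
  assumes "gaussian_space M G" "gaussian_space N H"
  shows "g \<in> G \<Longrightarrow> h \<in> H \<Longrightarrow> (\<lambda>x. g (fst x) + h (snd x)) \<in> sum_space G H"
    "g \<in> G \<Longrightarrow> (\<lambda>x. g (fst x)) \<in> sum_space G H" "h \<in> H \<Longrightarrow> (\<lambda>x. h (snd x)) \<in> sum_space G H"
proof -
  show *: "g \<in> G \<Longrightarrow> h \<in> H \<Longrightarrow> (\<lambda>x. g (fst x) + h (snd x)) \<in> sum_space G H" for g h by (auto simp: sum_space_def)
  show "g \<in> G \<Longrightarrow> (\<lambda>x. g (fst x)) \<in> sum_space G H" "h \<in> H \<Longrightarrow> (\<lambda>x. h (snd x)) \<in> sum_space G H"
    using *[of g "\<lambda>_. 0"] *[of "\<lambda>_. 0" h] gaussian_spaceD(5)[OF assms(1)] gaussian_spaceD(5)[OF assms(2)] by auto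
qed

lemma cov_sum_space:
  assumes G: "gaussian_space M G" and H: "gaussian_space N H" and m: "g \<in> G" "g' \<in> G" "h \<in> H" "h' \<in> H"
  shows "(\<integral>x. (g (fst x) + h (snd x)) * (g' (fst x) + h' (snd x)) \<partial>(M \<Otimes>\<^sub>M N)) = (\<integral>w. g w * g' w \<partial>M) + (\<integral>w. h w * h' w \<partial>N)"
proof -
  interpret M: prob_space M by (rule gaussian_spaceD[OF G])
  interpret N: prob_space N by (rule gaussian_spaceD[OF H])
  interpret P: pair_prob_space M N ..
  have [measurable]: "g \<in> borel_measurable M" "g' \<in> borel_measurable M" "h \<in> borel_measurable N" "h' \<in> borel_measurable N"
    using m gaussian_spaceD(4)[OF G] gaussian_spaceD(4)[OF H] by auto
  note i = gaussian_space_integrable_mult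
  have x: "integrable (M \<Otimes>\<^sub>M N) (\<lambda>x. a (fst x) * b (snd x)) \<and> (\<integral>x. a (fst x) * b (snd x) \<partial>(M \<Otimes>\<^sub>M N)) = 0"
    if "a \<in> G" "b \<in> H" for a b
  proof -
    have r: "gaussian_rv M a" "gaussian_rv N b" using that gaussian_spaceD(2)[OF G] gaussian_spaceD(2)[OF H] by auto
    note ii = gaussian_rv_integrable[OF r(1)] gaussian_rv_integrable[OF r(2)]
    have I: "integrable (M \<Otimes>\<^sub>M N) (\<lambda>x. a (fst x) * b (snd x))"
      using gaussian_space_integrable_mult[OF gaussian_space_sum_space[OF G H] sum_spaceI(2)[OF G H that(1)] sum_spaceI(3)[OF G H that(2)]] .
    from P.integral_fst'[OF this] show ?thesis using I gaussian_rv_mean[OF r(2)] by simp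
  qed
  have "(\<integral>x. (g (fst x) + h (snd x)) * (g' (fst x) + h' (snd x)) \<partial>(M \<Otimes>\<^sub>M N))
    = (\<integral>x. (\<lambda>w. g w * g' w) (fst x) + (g (fst x) * h' (snd x) + g' (fst x) * h (snd x)) + (\<lambda>w. h w * h' w) (snd x) \<partial>(M \<Otimes>\<^sub>M N))"
    by (intro Bochner_Integration.integral_cong) (auto simp: algebra_simps)
  also have "\<dots> = (\<integral>x. (\<lambda>w. g w * g' w) (fst x) \<partial>(M \<Otimes>\<^sub>M N)) + ((\<integral>x. g (fst x) * h' (snd x) \<partial>(M \<Otimes>\<^sub>M N)) + (\<integral>x. g' (fst x) * h (snd x) \<partial>(M \<Otimes>\<^sub>M N))) + (\<integral>x. (\<lambda>w. h w * h' w) (snd x) \<partial>(M \<Otimes>\<^sub>M N))"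
    using x m i[OF G] i[OF H] integral_prod_fst(2)[OF M.prob_space_axioms N.prob_space_axioms, of "\<lambda>w. g w * g' w"] integral_prod_snd(2)[OF M.prob_space_axioms N.prob_space_axioms, of "\<lambda>w. h w * h' w"]
    by simp
  also have "\<dots> = (\<integral>w. g w * g' w \<partial>M) + (\<integral>w. h w * h' w \<partial>N)"
    using x m integral_prod_fst(1)[OF M.prob_space_axioms N.prob_space_axioms, of "\<lambda>w. g w * g' w"] integral_prod_snd(1)[OF M.prob_space_axioms N.prob_space_axioms, of "\<lambda>w. h w * h' w"]
    by simp
  finally show ?thesis .
qed

text \<open>Pairs of linear combinations built with the same coefficients from both families; a set
  of the kind that \<open>cramer_wold\<close> asks for, closed under negation because the
  coefficients are arbitrary.\<close>

inductive_set comb for g :: "'i \<Rightarrow> 'w \<Rightarrow> real" and h :: "'i \<Rightarrow> 'v \<Rightarrow> real" where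
  comb_zero: "((\<lambda>_. 0), (\<lambda>_. 0)) \<in> comb g h"
| comb_step: "(a, b) \<in> comb g h \<Longrightarrow> ((\<lambda>w. t * g i w + a w), (\<lambda>w. t * h i w + b w)) \<in> comb g h"

lemma comb_neg: "(a, b) \<in> comb g h \<Longrightarrow> ((\<lambda>w. - a w), (\<lambda>w. - b w)) \<in> comb g h"
proof (induction rule: comb.induct)
  case (comb_step a b t i)
  from comb.comb_step[OF comb_step.IH, of "-t" i] show ?case by simp
qed (simp add: comb.comb_zero)

text \<open>A centered Gaussian variable is determined by its variance, and equal covariances give
  equal variances to matching combinations.\<close>

theorem gaussian_law_unique:
  fixes g :: "'i \<Rightarrow> 'w \<Rightarrow> real" and h :: "'i \<Rightarrow> 'v \<Rightarrow> real"
  assumes G: "gaussian_space M G" and H: "gaussian_space N H" and g: "\<And>i. g i \<in> G" and h: "\<And>i. h i \<in> H"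
    and cov: "\<And>i j. (\<integral>w. g i w * g j w \<partial>M) = (\<integral>w. h i w * h j w \<partial>N)"
  shows "distr M (PiM UNIV (\<lambda>_. borel)) (\<lambda>w i. g i w) = distr N (PiM UNIV (\<lambda>_. borel)) (\<lambda>w i. h i w)"
proof -
  \<comment> \<open>Covariances with every member of the family are carried along in the induction,
    since the variance of t g i + a contains the mixed term.\<close>
  have P: "a \<in> G \<and> b \<in> H \<and> (\<forall>j. (\<integral>w. g j w * a w \<partial>M) = (\<integral>w. h j w * b w \<partial>N)) \<and> (\<integral>w. (a w)\<^sup>2 \<partial>M) = (\<integral>w. (b w)\<^sup>2 \<partial>N)"
    if "(a, b) \<in> comb g h" for a b
    using that
  proof (induction rule: comb.induct)
    case comb_zero then show ?case using gaussian_spaceD(5)[OF G] gaussian_spaceD(5)[OF H] by auto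
  next
    case (comb_step a b t i)
    have "(\<lambda>w. t * g i w + a w) \<in> G" "(\<lambda>w. t * h i w + b w) \<in> H"
      using gaussian_spaceD(3)[OF G, of "g i" a t 1] gaussian_spaceD(3)[OF H, of "h i" b t 1] comb_step g h by auto
    moreover have "(\<integral>w. g j w * (t * g i w + a w) \<partial>M) = (\<integral>w. h j w * (t * h i w + b w) \<partial>N)" for j
    proof -
      have "(\<integral>w. g j w * (t * g i w + a w) \<partial>M) = (\<integral>w. t * (g j w * g i w) + g j w * a w \<partial>M)"
        by (simp add: algebra_simps)
      also have "\<dots> = t * (\<integral>w. g j w * g i w \<partial>M) + (\<integral>w. g j w * a w \<partial>M)"
        using gaussian_space_integrable_mult[OF G] g comb_step by simp
      also have "\<dots> = t * (\<integral>w. h j w * h i w \<partial>N) + (\<integral>w. h j w * b w \<partial>N)" using cov comb_step by simp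
      also have "\<dots> = (\<integral>w. t * (h j w * h i w) + h j w * b w \<partial>N)"
        using gaussian_space_integrable_mult[OF H] h comb_step by simp
      also have "\<dots> = (\<integral>w. h j w * (t * h i w + b w) \<partial>N)" by (simp add: algebra_simps)
      finally show ?thesis .
    qed
    moreover have "(\<integral>w. (t * g i w + a w)\<^sup>2 \<partial>M) = (\<integral>w. (t * h i w + b w)\<^sup>2 \<partial>N)"
      using gaussian_space_second_moment[OF G, of "g i" a t 1] gaussian_space_second_moment[OF H, of "h i" b t 1] comb_step g h cov[of i i]
      by (simp add: power2_eq_square)
    ultimately show ?case by blast
  qed
  show ?thesis
  proof (rule cramer_wold[where P = "comb g h"])
    show "prob_space M" "prob_space N" using gaussian_spaceD(1)[OF G] gaussian_spaceD(1)[OF H] by auto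
    show "g i \<in> borel_measurable M" "h i \<in> borel_measurable N" for i using gaussian_spaceD(4)[OF G g] gaussian_spaceD(4)[OF H h] by auto
    show "a \<in> borel_measurable M" "b \<in> borel_measurable N" if "(a, b) \<in> comb g h" for a b using P[OF that] gaussian_spaceD(4)[OF G] gaussian_spaceD(4)[OF H] by auto
    show "((\<lambda>_. 0), (\<lambda>_. 0)) \<in> comb g h" by (rule comb_zero)
    show "((\<lambda>w. t * g i w + a w), (\<lambda>w. t * h i w + b w)) \<in> comb g h" if "(a, b) \<in> comb g h" for a b t i using that by (rule comb_step)
    show "((\<lambda>w. - a w), (\<lambda>w. - b w)) \<in> comb g h" if "(a, b) \<in> comb g h" for a b using that by (rule comb_neg)
    show "(\<integral>w. cos (a w + s) \<partial>M) = (\<integral>w. cos (b w + s) \<partial>N)" if "(a, b) \<in> comb g h" for a b s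
      using P[OF that] gaussian_rv_cos[OF gaussian_spaceD(2)[OF G]] gaussian_rv_cos[OF gaussian_spaceD(2)[OF H]] by simp
  qed
qed

lemma gaussian_law_transfer:
  fixes g :: "'i \<Rightarrow> 'w \<Rightarrow> real" and h :: "'i \<Rightarrow> 'v \<Rightarrow> real"
  assumes G: "gaussian_space M G" and H: "gaussian_space N H" and g: "\<And>i. g i \<in> G" and h: "\<And>i. h i \<in> H"
    and cov: "\<And>i j. (\<integral>w. g i w * g j w \<partial>M) = (\<integral>w. h i w * h j w \<partial>N)"
  shows "\<And>f::('i \<Rightarrow> real) \<Rightarrow> real. f \<in> borel_measurable (PiM UNIV (\<lambda>_. borel)) \<Longrightarrow> (\<integral>w. f (\<lambda>i. g i w) \<partial>M) = (\<integral>w. f (\<lambda>i. h i w) \<partial>N)"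
    "\<And>f::('i \<Rightarrow> real) \<Rightarrow> ennreal. f \<in> borel_measurable (PiM UNIV (\<lambda>_. borel)) \<Longrightarrow> (\<integral>\<^sup>+w. f (\<lambda>i. g i w) \<partial>M) = (\<integral>\<^sup>+w. f (\<lambda>i. h i w) \<partial>N)"
proof -
  have d: "distr M (PiM UNIV (\<lambda>_. borel)) (\<lambda>w i. g i w) = distr N (PiM UNIV (\<lambda>_. borel)) (\<lambda>w i. h i w)"
    by (rule gaussian_law_unique[where G = G and H = H]) (use assms in auto)
  have [measurable]: "g i \<in> borel_measurable M" "h i \<in> borel_measurable N" for i
    using gaussian_spaceD(4)[OF G g] gaussian_spaceD(4)[OF H h] by auto
  have m: "(\<lambda>w i. g i w) \<in> M \<rightarrow>\<^sub>M PiM UNIV (\<lambda>_. borel)" "(\<lambda>w i. h i w) \<in> N \<rightarrow>\<^sub>M PiM UNIV (\<lambda>_. borel)"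
    by (auto intro!: measurable_PiM_single')
  show "(\<integral>w. f (\<lambda>i. g i w) \<partial>M) = (\<integral>w. f (\<lambda>i. h i w) \<partial>N)" if "f \<in> borel_measurable (PiM UNIV (\<lambda>_. borel))" for f :: "('i \<Rightarrow> real) \<Rightarrow> real"
    using arg_cong[OF d, of "\<lambda>m. integral\<^sup>L m f"] m that by (simp add: integral_distr)
  show "(\<integral>\<^sup>+w. f (\<lambda>i. g i w) \<partial>M) = (\<integral>\<^sup>+w. f (\<lambda>i. h i w) \<partial>N)" if "f \<in> borel_measurable (PiM UNIV (\<lambda>_. borel))" for f :: "('i \<Rightarrow> real) \<Rightarrow> ennreal"
    using arg_cong[OF d, of "\<lambda>m. integral\<^sup>N m f"] m that by (simp add: nn_integral_distr)
qed

section \<open>Comparison of Gaussian maxima\<close>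

definition softmax :: "'i set \<Rightarrow> ('i \<Rightarrow> real) \<Rightarrow> real" where
  "softmax I x = ln (\<Sum>i\<in>I. exp (x i))"

text \<open>The gradient of \<open>softmax\<close>, a probability vector on
  \<open>I\<close>.\<close>

definition softmax_weight :: "'i set \<Rightarrow> ('i \<Rightarrow> real) \<Rightarrow> 'i \<Rightarrow> real" where
  "softmax_weight I x i = exp (x i) / (\<Sum>j\<in>I. exp (x j))"

lemma softmax_weight_sum:
  assumes "finite I" "I \<noteq> {}"
  shows "(\<Sum>i\<in>I. softmax_weight I x i) = 1" "0 \<le> softmax_weight I x i"
proof -
  have "(\<Sum>j\<in>I. exp (x j)) > 0" using assms by (intro sum_pos) auto
  then show "(\<Sum>i\<in>I. softmax_weight I x i) = 1" "0 \<le> softmax_weight I x i"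
    by (auto simp: softmax_weight_def sum_divide_distrib[symmetric])
qed

lemma softmax_bounds:
  assumes "finite I" "I \<noteq> {}"
  shows "Max (x ` I) \<le> softmax I x" "softmax I x \<le> Max (x ` I) + ln (card I)"
proof -
  have "Max (x ` I) \<in> x ` I" using assms by (intro Max_in) auto
  then obtain i where i: "i \<in> I" "Max (x ` I) = x i" by auto
  have c: "card I > 0" using assms by (simp add: card_gt_0_iff)
  have "exp (x i) \<le> (\<Sum>i\<in>I. exp (x i))" using assms i by (intro member_le_sum) auto
  then have "ln (exp (x i)) \<le> softmax I x" unfolding softmax_def by (intro ln_mono) (auto intro: less_le_trans[OF exp_gt_zero])
  then show "Max (x ` I) \<le> softmax I x" using i by simp
  have "(\<Sum>i\<in>I. exp (x i)) \<le> (\<Sum>j\<in>I. exp (Max (x ` I)))" using assms by (intro sum_mono) auto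
  then have "softmax I x \<le> ln (card I * exp (Max (x ` I)))" unfolding softmax_def
    using assms by (intro ln_mono) (auto intro: sum_pos)
  also have "\<dots> = Max (x ` I) + ln (card I)" using c by (simp add: ln_mult)
  finally show "softmax I x \<le> Max (x ` I) + ln (card I)" .
qed

lemma abs_Max_le_sum:
  fixes x :: "'i \<Rightarrow> real"
  assumes "finite I" "I \<noteq> {}"
  shows "\<bar>Max (x ` I)\<bar> \<le> (\<Sum>i\<in>I. \<bar>x i\<bar>)"
proof -
  have "Max (x ` I) \<in> x ` I" using assms by (intro Max_in) auto
  then obtain i where "i \<in> I" "Max (x ` I) = x i" by auto
  then show ?thesis using assms member_le_sum[of i I "\<lambda>i. \<bar>x i\<bar>"] by auto
qed

text \<open>Along the segment from w to w + k the function is, up to a constant, a cumulant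
  generating function: its derivatives are cumulants of k under the tilted weights. The third is at
  most 6 max |k|^3, from the coefficients 1, 3 and 2, and division by 3! leaves the constant
  1.\<close>

lemma softmax_taylor:
  fixes w k :: "'i \<Rightarrow> real"
  assumes I: "finite I" "I \<noteq> {}"
  defines "p \<equiv> softmax_weight I w"
  shows "\<bar>softmax I (\<lambda>i. w i + k i) - softmax I w
     - ((\<Sum>i\<in>I. p i * k i) + ((\<Sum>i\<in>I. p i * (k i)\<^sup>2) - (\<Sum>i\<in>I. p i * k i)\<^sup>2) / 2)\<bar> \<le> (\<Sum>i\<in>I. \<bar>k i\<bar> ^ 3)"
proof -
  define A where "A = (\<lambda>r s. \<Sum>i\<in>I. k i ^ r * exp (w i + s * k i))"
  have pos: "A 0 s > 0" for s unfolding A_def using I by (auto intro!: sum_pos)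
  have dA: "((A r) has_real_derivative A (Suc r) s) (at s)" for r s
    unfolding A_def by (auto intro!: derivative_eq_intros sum.cong simp: algebra_simps)
  define d where "d = (\<lambda>(m::nat) (s::real). if m = 0 then ln (A 0 s) else if m = 1 then A 1 s / A 0 s else
     if m = 2 then A 2 s / A 0 s - (A 1 s / A 0 s)^2 else A 3 s / A 0 s - 3 * A 1 s * A 2 s / (A 0 s)^2 + 2 * (A 1 s / A 0 s)^3)"
  have Maxin: "Max ((\<lambda>i. \<bar>k i\<bar>) ` I) \<in> (\<lambda>i. \<bar>k i\<bar>) ` I" using I by (intro Max_in) auto
  then obtain m where m: "m \<in> I" "Max ((\<lambda>i. \<bar>k i\<bar>) ` I) = \<bar>k m\<bar>" by auto
  have kle: "\<bar>k i\<bar> \<le> \<bar>k m\<bar>" if "i \<in> I" for i unfolding m(2)[symmetric] using I that by (intro Max_ge) auto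
  have Ar: "\<bar>A r s / A 0 s\<bar> \<le> \<bar>k m\<bar> ^ r" for r s
  proof -
    have "\<bar>A r s\<bar> \<le> (\<Sum>i\<in>I. \<bar>k i ^ r * exp (w i + s * k i)\<bar>)" unfolding A_def by (rule sum_abs)
    also have "\<dots> \<le> (\<Sum>i\<in>I. \<bar>k m\<bar> ^ r * exp (w i + s * k i))"
      using kle by (intro sum_mono) (auto simp: abs_mult power_abs intro!: mult_right_mono power_mono)
    also have "\<dots> = \<bar>k m\<bar> ^ r * A 0 s" by (simp add: A_def sum_distrib_left)
    finally show ?thesis using pos[of s] by (simp add: field_simps)
  qed
  have d3: "\<bar>d 3 s\<bar> \<le> 6 * \<bar>k m\<bar> ^ 3" for s
  proof -
    define a1 a2 a3 where "a1 = A 1 s / A 0 s" and "a2 = A 2 s / A 0 s" and "a3 = A 3 s / A 0 s"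
    have a: "\<bar>a1\<bar> \<le> \<bar>k m\<bar>" "\<bar>a2\<bar> \<le> \<bar>k m\<bar> ^ 2" "\<bar>a3\<bar> \<le> \<bar>k m\<bar> ^ 3"
      using Ar[of 1 s] Ar[of 2 s] Ar[of 3 s] by (auto simp: a1_def a2_def a3_def)
    have "d 3 s = a3 - 3 * (a1 * a2) + 2 * a1 ^ 3" using pos[of s]
      by (simp add: d_def a1_def a2_def a3_def power2_eq_square field_simps)
    moreover have "\<bar>a1 * a2\<bar> \<le> \<bar>k m\<bar> * \<bar>k m\<bar>^2" unfolding abs_mult using a by (intro mult_mono) auto
    moreover have "\<bar>a1 ^ 3\<bar> \<le> \<bar>k m\<bar> ^ 3" unfolding power_abs using a by (intro power_mono) auto
    moreover have "\<bar>k m\<bar> * \<bar>k m\<bar>^2 = \<bar>k m\<bar>^3" by (simp add: power2_eq_square power3_eq_cube)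
    ultimately show ?thesis using a(3) by linarith
  qed
  have "\<exists>t. 0 < t \<and> t < 1 \<and> ln (A 0 1) = (\<Sum>m<3. d m 0 / fact m * 1 ^ m) + d 3 t / fact 3 * 1 ^ 3"
  proof (rule Maclaurin)
    show "d 0 = (\<lambda>s. ln (A 0 s))" by (simp add: d_def)
    show "\<forall>m t. m < 3 \<and> 0 \<le> t \<and> t \<le> 1 \<longrightarrow> (d m has_real_derivative d (Suc m) t) (at t)"
    proof (intro allI impI)
      fix m t assume mt: "m < (3::nat) \<and> (0::real) \<le> t \<and> t \<le> 1"
      have nz: "A 0 t \<noteq> 0" using pos[of t] by simp
      consider "m = 0" | "m = 1" | "m = 2" using mt by linarith
      then show "(d m has_real_derivative d (Suc m) t) (at t)"
      proof cases
        case 1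
        then show ?thesis unfolding d_def using pos[of t] by (auto intro!: derivative_eq_intros dA)
      next
        case 2
        then show ?thesis unfolding d_def using nz
          by (auto intro!: derivative_eq_intros dA simp: power2_eq_square field_simps numeral_2_eq_2)
      next
        case 3
        then show ?thesis unfolding d_def using nz
          by (auto intro!: derivative_eq_intros dA simp: power2_eq_square power3_eq_cube field_simps numeral_2_eq_2 numeral_3_eq_3)
      qed
    qed
  qed auto
  then obtain t where t: "ln (A 0 1) = (\<Sum>m<3. d m 0 / fact m) + d 3 t / fact 3" by auto
  have sm: "(\<Sum>m<3. d m 0 / fact m) = d 0 0 + d 1 0 + d 2 0 / 2" by (simp add: numeral_3_eq_3 numeral_2_eq_2)
  have Ap: "A r 0 / A 0 0 = (\<Sum>i\<in>I. p i * k i ^ r)" for r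
    by (simp add: A_def p_def softmax_weight_def sum_divide_distrib mult.commute)
  have "softmax I (\<lambda>i. w i + k i) = ln (A 0 1)" "softmax I w = d 0 0" by (simp_all add: softmax_def A_def d_def)
  moreover have "d 1 0 = (\<Sum>i\<in>I. p i * k i)" using Ap[of 1] by (simp add: d_def)
  moreover have "d 2 0 = (\<Sum>i\<in>I. p i * (k i)\<^sup>2) - (\<Sum>i\<in>I. p i * k i)\<^sup>2" using Ap[of 1] Ap[of 2] by (simp add: d_def)
  moreover have r3: "\<bar>d 3 t / fact 3\<bar> \<le> \<bar>k m\<bar> ^ 3" using d3[of t] by (simp add: fact_numeral)
  moreover have k3: "\<bar>k m\<bar> ^ 3 \<le> (\<Sum>i\<in>I. \<bar>k i\<bar> ^ 3)" using I m by (intro member_le_sum) auto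
  ultimately have "softmax I (\<lambda>i. w i + k i) - softmax I w - ((\<Sum>i\<in>I. p i * k i) + ((\<Sum>i\<in>I. p i * (k i)\<^sup>2) - (\<Sum>i\<in>I. p i * k i)\<^sup>2) / 2)
      = d 3 t / fact 3"
    unfolding t sm by simp
  then show ?thesis using r3 k3 by linarith
qed

lemma softmax_measurable:
  assumes [measurable]: "\<And>i. i \<in> I \<Longrightarrow> (\<lambda>w. x w i) \<in> borel_measurable M"
  shows "(\<lambda>w. softmax I (x w)) \<in> borel_measurable M"
  unfolding softmax_def by measurable

lemma softmax_abs_le:
  assumes "finite I" "I \<noteq> {}"
  shows "\<bar>softmax I x\<bar> \<le> (\<Sum>i\<in>I. \<bar>x i\<bar>) + ln (card I)"
proof -
  have "card I \<ge> 1" using assms by (simp add: Suc_leI card_gt_0_iff)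
  then have "ln (card I) \<ge> 0" by simp
  then show ?thesis using softmax_bounds[OF assms, of x] abs_Max_le_sum[OF assms, of x] by linarith
qed

lemma softmax_integrable:
  assumes "prob_space M" and I: "finite I" "I \<noteq> {}" and "\<And>i. i \<in> I \<Longrightarrow> integrable M (\<lambda>w. x w i)"
  shows "integrable M (\<lambda>w. softmax I (x w))"
proof (rule Bochner_Integration.integrable_bound)
  interpret prob_space M by fact
  show "integrable M (\<lambda>w. (\<Sum>i\<in>I. \<bar>x w i\<bar>) + ln (card I))" using assms by auto
  show "(\<lambda>w. softmax I (x w)) \<in> borel_measurable M" using assms by (intro softmax_measurable) auto
  show "AE w in M. norm (softmax I (x w)) \<le> norm ((\<Sum>i\<in>I. \<bar>x w i\<bar>) + ln (card I))"
    unfolding real_norm_def by (intro AE_I2 order_trans[OF softmax_abs_le[OF I] abs_ge_self])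
qed

text \<open>The variance as half the mean squared difference of two independent draws. In this form
  the second order term of the soft maximum involves only increments, the quantities compared by
  Sudakov-Fernique.\<close>

lemma weighted_variance:
  fixes p k :: "'i \<Rightarrow> real"
  assumes "(\<Sum>i\<in>I. p i) = 1"
  shows "(\<Sum>i\<in>I. p i * (k i)\<^sup>2) - (\<Sum>i\<in>I. p i * k i)\<^sup>2 = (\<Sum>i\<in>I. \<Sum>j\<in>I. p i * p j * (k i - k j)\<^sup>2) / 2"
proof -
  have "(\<Sum>i\<in>I. \<Sum>j\<in>I. p i * p j * (k i - k j)\<^sup>2)
      = (\<Sum>i\<in>I. \<Sum>j\<in>I. (p i * (k i)\<^sup>2) * p j + p i * (p j * (k j)\<^sup>2) - 2 * ((p i * k i) * (p j * k j)))"
    by (intro sum.cong refl) (simp add: power2_eq_square algebra_simps)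
  also have "\<dots> = (\<Sum>i\<in>I. p i * (k i)\<^sup>2) * (\<Sum>j\<in>I. p j) + (\<Sum>i\<in>I. p i) * (\<Sum>j\<in>I. p j * (k j)\<^sup>2) - 2 * ((\<Sum>i\<in>I. p i * k i) * (\<Sum>j\<in>I. p j * k j))"
  proof -
    have "(\<Sum>i\<in>I. \<Sum>j\<in>I. a i * b j) = (\<Sum>i\<in>I. a i) * (\<Sum>j\<in>I. b j)" for a b :: "'i \<Rightarrow> real"
      by (simp add: sum_product)
    then show ?thesis unfolding sum_subtractf sum.distrib sum_distrib_left[symmetric] by simp
  qed
  finally show ?thesis using assms by (simp add: power2_eq_square)
qed

text \<open>The linear term has mean zero and the quadratic one sees only variances of increments.
  The error is cubic in c, so for c = sqrt e it is of smaller order than e.\<close>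

lemma softmax_gaussian_increment:
  fixes w :: "'i \<Rightarrow> real"
  assumes G: "gaussian_space M G" and I: "finite I" "I \<noteq> {}" and g: "\<And>i. i \<in> I \<Longrightarrow> g i \<in> G" and c: "c \<ge> 0"
  defines "p \<equiv> softmax_weight I w"
  shows "\<bar>(\<integral>x. softmax I (\<lambda>i. w i + c * g i x) \<partial>M) - softmax I w - c\<^sup>2 / 4 * (\<Sum>i\<in>I. \<Sum>j\<in>I. p i * p j * (\<integral>x. (g i x - g j x)\<^sup>2 \<partial>M))\<bar>
    \<le> c ^ 3 * (\<Sum>i\<in>I. \<integral>x. \<bar>g i x\<bar> ^ 3 \<partial>M)"
proof -
  interpret prob_space M by (rule gaussian_spaceD(1)[OF G])
  note p1 = softmax_weight_sum[OF I, of w, folded p_def]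
  have rv: "gaussian_rv M (g i)" if "i \<in> I" for i using gaussian_spaceD(2)[OF G g[OF that]] .
  have rvd: "gaussian_rv M (\<lambda>x. g i x - g j x)" if "i \<in> I" "j \<in> I" for i j
    using gaussian_spaceD(2)[OF G gaussian_spaceD(8)[OF G g g]] that by auto
  have i1: "integrable M (g i)" if "i \<in> I" for i using gaussian_rv_integrable[OF rv[OF that]] .
  have i2: "integrable M (\<lambda>x. (g i x - g j x)\<^sup>2)" if "i \<in> I" "j \<in> I" for i j using gaussian_rv_power[OF rvd[OF that], of 2] .
  have i3: "integrable M (\<lambda>x. \<bar>g i x\<bar> ^ 3)" if "i \<in> I" for i using gaussian_rv_abs_power[OF rv[OF that]] .
  define S where "S = (\<lambda>x. softmax I (\<lambda>i. w i + c * g i x))"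
  define T where "T = (\<lambda>x. c * (\<Sum>i\<in>I. p i * g i x) + c\<^sup>2 / 4 * (\<Sum>i\<in>I. \<Sum>j\<in>I. p i * p j * (g i x - g j x)\<^sup>2))"
  have iS: "integrable M S" unfolding S_def using i1 by (intro softmax_integrable I prob_space_axioms) auto
  have iT: "integrable M T" unfolding T_def using i1 i2
    by (intro Bochner_Integration.integrable_add integrable_mult_right Bochner_Integration.integrable_sum) auto
  have T: "(\<integral>x. T x \<partial>M) = c\<^sup>2 / 4 * (\<Sum>i\<in>I. \<Sum>j\<in>I. p i * p j * (\<integral>x. (g i x - g j x)\<^sup>2 \<partial>M))"
    unfolding T_def using i1 i2 gaussian_rv_mean[OF rv] by (simp add: Bochner_Integration.integral_sum)
  have pt: "\<bar>S x - softmax I w - T x\<bar> \<le> c ^ 3 * (\<Sum>i\<in>I. \<bar>g i x\<bar> ^ 3)" for x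
  proof -
    have "(\<Sum>i\<in>I. p i * (c * g i x)) + ((\<Sum>i\<in>I. p i * (c * g i x)\<^sup>2) - (\<Sum>i\<in>I. p i * (c * g i x))\<^sup>2) / 2 = T x"
      unfolding weighted_variance[OF p1(1)] T_def
      by (simp add: sum_distrib_left power_mult_distrib right_diff_distrib[symmetric] mult.left_commute mult.assoc sum_divide_distrib)
    moreover have "(\<Sum>i\<in>I. \<bar>c * g i x\<bar> ^ 3) = c ^ 3 * (\<Sum>i\<in>I. \<bar>g i x\<bar> ^ 3)"
      using c by (simp add: abs_mult power_mult_distrib sum_distrib_left)
    ultimately show ?thesis using softmax_taylor[OF I, of w "\<lambda>i. c * g i x"] by (simp add: S_def p_def)
  qed
  have "\<bar>\<integral>x. S x - softmax I w - T x \<partial>M\<bar> \<le> (\<integral>x. \<bar>S x - softmax I w - T x\<bar> \<partial>M)" by (rule integral_abs_bound)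
  also have "\<dots> \<le> (\<integral>x. c ^ 3 * (\<Sum>i\<in>I. \<bar>g i x\<bar> ^ 3) \<partial>M)"
    using iS iT i3 pt by (intro integral_mono) auto
  also have "\<dots> = c ^ 3 * (\<Sum>i\<in>I. \<integral>x. \<bar>g i x\<bar> ^ 3 \<partial>M)" using i3 by simp
  finally show ?thesis using iS iT by (simp add: S_def T prob_space)
qed

lemma gaussian_space_cov:
  assumes G: "gaussian_space M G" and f: "f1 \<in> G" "f2 \<in> G" "g1 \<in> G" "g2 \<in> G"
  shows "(\<integral>w. (a1 * f1 w + a2 * f2 w) * (b1 * g1 w + b2 * g2 w) \<partial>M)
    = a1 * b1 * (\<integral>w. f1 w * g1 w \<partial>M) + a1 * b2 * (\<integral>w. f1 w * g2 w \<partial>M) + a2 * b1 * (\<integral>w. f2 w * g1 w \<partial>M) + a2 * b2 * (\<integral>w. f2 w * g2 w \<partial>M)"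
proof -
  note i = gaussian_space_integrable_mult[OF G]
  have "(\<integral>w. (a1 * f1 w + a2 * f2 w) * (b1 * g1 w + b2 * g2 w) \<partial>M) =
    (\<integral>w. a1 * b1 * (f1 w * g1 w) + a1 * b2 * (f1 w * g2 w) + a2 * b1 * (f2 w * g1 w) + a2 * b2 * (f2 w * g2 w) \<partial>M)"
    by (intro Bochner_Integration.integral_cong) (auto simp: algebra_simps)
  then show ?thesis using f i by simp
qed

text \<open>\<open>U\<close> has the covariances, hence the law, of V + c k with k taken from an
  independent copy; this copy can be integrated with V fixed.\<close>

lemma softmax_gaussian_split:
  fixes U V k :: "'i \<Rightarrow> 'w \<Rightarrow> real"
  assumes G: "gaussian_space M G" and I: "finite I" "I \<noteq> {}"
    and m: "\<And>i. U i \<in> G" "\<And>i. V i \<in> G" "\<And>i. k i \<in> G"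
    and cov: "\<And>i j. (\<integral>w. U i w * U j w \<partial>M) = (\<integral>w. V i w * V j w \<partial>M) + c\<^sup>2 * (\<integral>w. k i w * k j w \<partial>M)"
  shows "(\<integral>w. softmax I (\<lambda>i. U i w) \<partial>M) = (\<integral>a. (\<integral>b. softmax I (\<lambda>i. V i a + c * k i b) \<partial>M) \<partial>M)"
    "integrable M (\<lambda>a. \<integral>b. softmax I (\<lambda>i. V i a + c * k i b) \<partial>M)"
proof -
  interpret M: prob_space M by (rule gaussian_spaceD(1)[OF G])
  interpret P: pair_prob_space M M ..
  have ck: "(\<lambda>w. c * k i w) \<in> G" for i using gaussian_spaceD(6)[OF G m(3)] .
  note GG = gaussian_space_sum_space[OF G G]
  have mem: "(\<lambda>x. V i (fst x) + c * k i (snd x)) \<in> sum_space G G" for i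
    using sum_spaceI(1)[OF G G m(2) ck] .
  have int: "integrable (M \<Otimes>\<^sub>M M) (\<lambda>x. softmax I (\<lambda>i. V i (fst x) + c * k i (snd x)))"
    using gaussian_rv_integrable[OF gaussian_spaceD(2)[OF GG mem]]
    by (intro softmax_integrable I P.prob_space_axioms) auto
  have "(\<integral>w. softmax I (\<lambda>i. U i w) \<partial>M) = (\<integral>x. softmax I (\<lambda>i. V i (fst x) + c * k i (snd x)) \<partial>(M \<Otimes>\<^sub>M M))"
  proof (rule gaussian_law_transfer(1)[where f = "softmax I" and g = U and h = "\<lambda>i x. V i (fst x) + c * k i (snd x)", OF G GG m(1) mem])
    show "(\<integral>w. U i w * U j w \<partial>M) = (\<integral>x. (V i (fst x) + c * k i (snd x)) * (V j (fst x) + c * k j (snd x)) \<partial>(M \<Otimes>\<^sub>M M))" for i j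
      using cov_sum_space[OF G G m(2)[of i] m(2)[of j] ck[of i] ck[of j]] cov[of i j] gaussian_space_integrable_mult[OF G m(3) m(3), of i j]
      by (simp add: mult.assoc mult.left_commute power2_eq_square)
    show "softmax I \<in> borel_measurable (Pi\<^sub>M UNIV (\<lambda>_. borel))" by (intro softmax_measurable) auto
  qed
  also have "\<dots> = (\<integral>a. (\<integral>b. softmax I (\<lambda>i. V i a + c * k i b) \<partial>M) \<partial>M)"
    using P.integral_fst'[OF int] by simp
  finally show "(\<integral>w. softmax I (\<lambda>i. U i w) \<partial>M) = (\<integral>a. (\<integral>b. softmax I (\<lambda>i. V i a + c * k i b) \<partial>M) \<partial>M)" .
  show "integrable M (\<lambda>a. \<integral>b. softmax I (\<lambda>i. V i a + c * k i b) \<partial>M)"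
    using P.integrable_fst'[OF int] by simp
qed

text \<open>The interpolation from g to h is run in finite steps: a step of length e exchanges an
  independent increment sqrt e * g for sqrt e * h on top of a common part. Each exchange loses at
  most a multiple of e^(3/2), so the total loss over m steps of length 1/m tends to 0.\<close>

lemma softmax_comparison_uncorrelated:
  fixes g h :: "'i \<Rightarrow> 'w \<Rightarrow> real"
  assumes G: "gaussian_space M G" and I: "finite I" "I \<noteq> {}"
    and g: "\<And>i. g i \<in> G" and h: "\<And>i. h i \<in> G"
    and cross: "\<And>i j. (\<integral>w. g i w * h j w \<partial>M) = 0"
    and inc: "\<And>i j. i \<in> I \<Longrightarrow> j \<in> I \<Longrightarrow> (\<integral>w. (g i w - g j w)\<^sup>2 \<partial>M) \<le> (\<integral>w. (h i w - h j w)\<^sup>2 \<partial>M)"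
  shows "(\<integral>w. softmax I (\<lambda>i. g i w) \<partial>M) \<le> (\<integral>w. softmax I (\<lambda>i. h i w) \<partial>M)"
proof -
  interpret M: prob_space M by (rule gaussian_spaceD(1)[OF G])
  define U where "U = (\<lambda>t i w. sqrt (1 - t) * g i w + sqrt t * h i w)"
  define \<phi> where "\<phi> = (\<lambda>t. \<integral>w. softmax I (\<lambda>i. U t i w) \<partial>M)"
  define C where "C = (\<Sum>i\<in>I. \<integral>x. \<bar>g i x\<bar> ^ 3 \<partial>M) + (\<Sum>i\<in>I. \<integral>x. \<bar>h i x\<bar> ^ 3 \<partial>M)"
  have cross': "(\<integral>w. h i w * g j w \<partial>M) = 0" for i j using cross[of j i] by (simp add: mult.commute)
  have step: "\<phi> t \<le> \<phi> (t + e) + sqrt e ^ 3 * C" if t: "0 \<le> t" "0 \<le> e" "t + e \<le> 1" for t e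
  proof -
    \<comment> \<open>The common part of the positions t and t + e: adding an independent sqrt e * g
      gives the law at t, adding an independent sqrt e * h the law at t + e.\<close>
    define V where "V = (\<lambda>i w. sqrt (1 - t - e) * g i w + sqrt t * h i w)"
    have mU: "U s i \<in> G" for s i unfolding U_def by (rule gaussian_spaceD(3)[OF G g h])
    have mV: "V i \<in> G" for i unfolding V_def by (rule gaussian_spaceD(3)[OF G g h])
    note cv = gaussian_space_cov[OF G g h g h]
    have "(\<integral>w. U t i w * U t j w \<partial>M) = (\<integral>w. V i w * V j w \<partial>M) + (sqrt e)\<^sup>2 * (\<integral>w. g i w * g j w \<partial>M)" for i j
      unfolding U_def V_def cv cross cross' using t by (simp add: algebra_simps)
    note s1 = softmax_gaussian_split[OF G I mU mV g this]
    have "(\<integral>w. U (t + e) i w * U (t + e) j w \<partial>M) = (\<integral>w. V i w * V j w \<partial>M) + (sqrt e)\<^sup>2 * (\<integral>w. h i w * h j w \<partial>M)" for i j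
      unfolding U_def V_def cv cross cross' using t by (simp add: algebra_simps)
    note s2 = softmax_gaussian_split[OF G I mU mV h this]
    have pt: "(\<integral>b. softmax I (\<lambda>i. V i a + sqrt e * g i b) \<partial>M) \<le> (\<integral>b. softmax I (\<lambda>i. V i a + sqrt e * h i b) \<partial>M) + sqrt e ^ 3 * C" for a
    proof -
      let ?p = "softmax_weight I (\<lambda>i. V i a)"
      let ?D = "\<lambda>k. (sqrt e)\<^sup>2 / 4 * (\<Sum>i\<in>I. \<Sum>j\<in>I. ?p i * ?p j * (\<integral>x. (k i x - k j x)\<^sup>2 \<partial>M))"
      have "?D g \<le> ?D h"
        using softmax_weight_sum[OF I] by (intro mult_left_mono sum_mono inc mult_nonneg_nonneg) auto
      moreover have B: "\<bar>(\<integral>x. softmax I (\<lambda>i. V i a + sqrt e * k i x) \<partial>M) - softmax I (\<lambda>i. V i a) - ?D k\<bar> \<le> sqrt e ^ 3 * (\<Sum>i\<in>I. \<integral>x. \<bar>k i x\<bar> ^ 3 \<partial>M)"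
        if "\<forall>i. k i \<in> G" for k
        using softmax_gaussian_increment[where g = k and w = "\<lambda>i. V i a" and c = "sqrt e", OF G I] that t by simp
      have
        "(\<integral>x. softmax I (\<lambda>i. V i a + sqrt e * g i x) \<partial>M) - softmax I (\<lambda>i. V i a) - ?D g \<le> sqrt e ^ 3 * (\<Sum>i\<in>I. \<integral>x. \<bar>g i x\<bar> ^ 3 \<partial>M)"
        "softmax I (\<lambda>i. V i a) + ?D h - (\<integral>x. softmax I (\<lambda>i. V i a + sqrt e * h i x) \<partial>M) \<le> sqrt e ^ 3 * (\<Sum>i\<in>I. \<integral>x. \<bar>h i x\<bar> ^ 3 \<partial>M)"
        using B[of g] B[of h] g h unfolding abs_le_iff by auto
      ultimately show ?thesis unfolding C_def distrib_left by linarith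
    qed
    have "\<phi> t = (\<integral>a. (\<integral>b. softmax I (\<lambda>i. V i a + sqrt e * g i b) \<partial>M) \<partial>M)" unfolding \<phi>_def by (rule s1(1))
    also have "\<dots> \<le> (\<integral>a. (\<integral>b. softmax I (\<lambda>i. V i a + sqrt e * h i b) \<partial>M) + sqrt e ^ 3 * C \<partial>M)"
      using s1(2) s2(2) pt by (intro integral_mono) auto
    also have "\<dots> = \<phi> (t + e) + sqrt e ^ 3 * C" using s2 by (simp add: \<phi>_def M.prob_space)
    finally show ?thesis .
  qed
  have tele: "\<phi> 0 \<le> \<phi> (real k / real (Suc m)) + real k * (sqrt (1 / real (Suc m)) ^ 3 * C)" if "k \<le> Suc m" for k m
    using that
  proof (induction k)
    case (Suc k)
    have "real k / real (Suc m) + 1 / real (Suc m) = real (Suc k) / real (Suc m)" by (simp add: add_divide_distrib)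
    moreover have "real (Suc k) / real (Suc m) \<le> 1" using Suc.prems by simp
    ultimately show ?case using Suc step[of "real k / real (Suc m)" "1 / real (Suc m)"] by (simp add: algebra_simps)
  qed simp
  have "\<phi> 0 \<le> \<phi> 1 + inverse (sqrt (real (Suc m))) * C" for m
  proof -
    have "real (Suc m) * sqrt (1 / real (Suc m)) ^ 3 = inverse (sqrt (real (Suc m)))"
    proof -
      define s where "s = sqrt (real (Suc m))"
      have s: "s > 0" "real (Suc m) = s\<^sup>2" by (simp_all add: s_def)
      have "sqrt (1 / real (Suc m)) = 1 / s" by (simp add: s_def real_sqrt_divide)
      then show ?thesis using s by (simp add: s_def[symmetric] power2_eq_square power3_eq_cube field_simps)
    qed
    then have "real (Suc m) * (sqrt (1 / real (Suc m)) ^ 3 * C) = inverse (sqrt (real (Suc m))) * C"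
      by (simp only: mult.assoc[symmetric])
    moreover have "real (Suc m) / real (Suc m) = 1" by simp
    ultimately show ?thesis using tele[of "Suc m" m] by (simp only: order_refl)
  qed
  moreover have "(\<lambda>m. \<phi> 1 + inverse (sqrt (real (Suc m))) * C) \<longlonglongrightarrow> \<phi> 1 + 0 * C"
    by (intro tendsto_intros LIMSEQ_Suc) real_asymp
  ultimately have "\<phi> 0 \<le> \<phi> 1 + 0 * C" by (intro LIMSEQ_le_const) auto
  then show ?thesis by (simp add: \<phi>_def U_def)
qed

text \<open>Only the two separate laws matter, so the families are put on a product space, where
  they are uncorrelated.\<close>

lemma softmax_comparison:
  fixes g :: "'i \<Rightarrow> 'w \<Rightarrow> real" and h :: "'i \<Rightarrow> 'v \<Rightarrow> real"
  assumes G: "gaussian_space M G" and H: "gaussian_space N H" and I: "finite I" "I \<noteq> {}"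
    and g: "\<And>i. g i \<in> G" and h: "\<And>i. h i \<in> H"
    and inc: "\<And>i j. i \<in> I \<Longrightarrow> j \<in> I \<Longrightarrow> (\<integral>w. (g i w - g j w)\<^sup>2 \<partial>M) \<le> (\<integral>w. (h i w - h j w)\<^sup>2 \<partial>N)"
  shows "(\<integral>w. softmax I (\<lambda>i. g i w) \<partial>M) \<le> (\<integral>w. softmax I (\<lambda>i. h i w) \<partial>N)"
proof -
  have pM: "prob_space M" and pN: "prob_space N" using gaussian_spaceD(1)[OF G] gaussian_spaceD(1)[OF H] by auto
  have [measurable]: "g i \<in> borel_measurable M" "h i \<in> borel_measurable N" for i
    using gaussian_spaceD(4)[OF G g] gaussian_spaceD(4)[OF H h] by auto
  have "(\<integral>x. softmax I (\<lambda>i. g i (fst x)) \<partial>(M \<Otimes>\<^sub>M N)) \<le> (\<integral>x. softmax I (\<lambda>i. h i (snd x)) \<partial>(M \<Otimes>\<^sub>M N))"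
  proof (rule softmax_comparison_uncorrelated[OF gaussian_space_sum_space[OF G H] I])
    show "(\<lambda>x. g i (fst x)) \<in> sum_space G H" "(\<lambda>x. h i (snd x)) \<in> sum_space G H" for i
      using sum_spaceI(2)[OF G H g] sum_spaceI(3)[OF G H h] by auto
    show "(\<integral>x. g i (fst x) * h j (snd x) \<partial>(M \<Otimes>\<^sub>M N)) = 0" for i j
      using cov_sum_space[OF G H g gaussian_spaceD(5)[OF G] gaussian_spaceD(5)[OF H] h, of i j] by simp
    show "(\<integral>x. (g i (fst x) - g j (fst x))\<^sup>2 \<partial>(M \<Otimes>\<^sub>M N)) \<le> (\<integral>x. (h i (snd x) - h j (snd x))\<^sup>2 \<partial>(M \<Otimes>\<^sub>M N))" if "i \<in> I" "j \<in> I" for i j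
      using inc[OF that] integral_prod_fst(1)[OF pM pN, of "\<lambda>w. (g i w - g j w)\<^sup>2"] integral_prod_snd(1)[OF pM pN, of "\<lambda>w. (h i w - h j w)\<^sup>2"] by simp
  qed
  moreover have "(\<lambda>w. softmax I (\<lambda>i. g i w)) \<in> borel_measurable M" "(\<lambda>w. softmax I (\<lambda>i. h i w)) \<in> borel_measurable N"
    by (auto intro!: softmax_measurable)
  ultimately show ?thesis
    using integral_prod_fst(1)[OF pM pN, of "\<lambda>w. softmax I (\<lambda>i. g i w)"] integral_prod_snd(1)[OF pM pN, of "\<lambda>w. softmax I (\<lambda>i. h i w)"] by simp
qed

section \<open>From the smooth maximum to the maximum\<close>

lemma integrable_Max:
  fixes x :: "'w \<Rightarrow> 'i \<Rightarrow> real"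
  assumes "finite I" "I \<noteq> {}" and int: "\<And>i. i \<in> I \<Longrightarrow> integrable M (\<lambda>w. x w i)"
  shows "integrable M (\<lambda>w. Max (x w ` I))"
proof (rule Bochner_Integration.integrable_bound)
  show "integrable M (\<lambda>w. \<Sum>i\<in>I. \<bar>x w i\<bar>)" using int by auto
  show "(\<lambda>w. Max (x w ` I)) \<in> borel_measurable M"
    using assms borel_measurable_Max[of I "\<lambda>i w. x w i" M] by auto
  show "AE w in M. norm (Max (x w ` I)) \<le> norm (\<Sum>i\<in>I. \<bar>x w i\<bar>)"
    unfolding real_norm_def by (intro AE_I2 order_trans[OF abs_Max_le_sum[OF assms(1,2)] abs_ge_self])
qed

text \<open>After scaling by c the soft maximum exceeds c times the maximum by at most ln (card I);
  dividing by c and letting c grow removes the difference.\<close>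

theorem sudakov_fernique:
  fixes g :: "'i \<Rightarrow> 'w \<Rightarrow> real" and h :: "'i \<Rightarrow> 'v \<Rightarrow> real"
  assumes G: "gaussian_space M G" and H: "gaussian_space N H" and I: "finite I" "I \<noteq> {}"
    and g: "\<And>i. i \<in> I \<Longrightarrow> g i \<in> G" and h: "\<And>i. i \<in> I \<Longrightarrow> h i \<in> H"
    and inc: "\<And>i j. i \<in> I \<Longrightarrow> j \<in> I \<Longrightarrow> (\<integral>w. (g i w - g j w)\<^sup>2 \<partial>M) \<le> (\<integral>w. (h i w - h j w)\<^sup>2 \<partial>N)"
  shows "(\<integral>w. Max ((\<lambda>i. g i w) ` I) \<partial>M) \<le> (\<integral>w. Max ((\<lambda>i. h i w) ` I) \<partial>N)"
proof -
  interpret M: prob_space M by (rule gaussian_spaceD(1)[OF G])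
  interpret N: prob_space N by (rule gaussian_spaceD(1)[OF H])
  let ?A = "\<integral>w. Max ((\<lambda>i. g i w) ` I) \<partial>M" and ?B = "\<integral>w. Max ((\<lambda>i. h i w) ` I) \<partial>N"
  have ig: "integrable M (g i)" and ih: "integrable N (h i)" if "i \<in> I" for i
    using that gaussian_rv_integrable[OF gaussian_spaceD(2)[OF G g]] gaussian_rv_integrable[OF gaussian_spaceD(2)[OF H h]] by auto
  have Max_scale: "Max ((\<lambda>i. c * x i) ` I) = c * Max (x ` I)" if "c > 0" for c and x :: "'i \<Rightarrow> real"
    using that I mono_Max_commute[of "\<lambda>y. c * y" "x ` I"] by (simp add: image_image mono_def)
  have le: "?A \<le> ?B + ln (card I) / c" if c: "c > 0" for c
  proof -
    \<comment> \<open>Off \<open>I\<close> both families are replaced by zero, because the soft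
      comparison asks for members of the spaces at every index.\<close>
    define g' where "g' = (\<lambda>i. if i \<in> I then (\<lambda>w. c * g i w) else (\<lambda>w. 0))"
    define h' where "h' = (\<lambda>i. if i \<in> I then (\<lambda>w. c * h i w) else (\<lambda>w. 0))"
    have eqI: "(\<lambda>i. g' i w) ` I = (\<lambda>i. c * g i w) ` I" "(\<lambda>i. h' i v) ` I = (\<lambda>i. c * h i v) ` I" for w v
      by (auto simp: g'_def h'_def)
    have mem: "g' i \<in> G" "h' i \<in> H" for i
      using g h gaussian_spaceD(5,6)[OF G] gaussian_spaceD(5,6)[OF H] by (auto simp: g'_def h'_def)
    have ig': "integrable M (g' i)" and ih': "integrable N (h' i)" for i
      using gaussian_rv_integrable[OF gaussian_spaceD(2)[OF G mem(1)]] gaussian_rv_integrable[OF gaussian_spaceD(2)[OF H mem(2)]] by auto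
    have iMg: "integrable M (\<lambda>w. Max ((\<lambda>i. g i w) ` I))" and iMh: "integrable N (\<lambda>w. Max ((\<lambda>i. h i w) ` I))"
      using ig ih by (auto intro!: integrable_Max I)
    have "c * ?A = (\<integral>w. Max ((\<lambda>i. g' i w) ` I) \<partial>M)" by (simp add: eqI Max_scale c)
    also have "\<dots> \<le> (\<integral>w. softmax I (\<lambda>i. g' i w) \<partial>M)"
      by (intro integral_mono softmax_bounds I integrable_Max softmax_integrable M.prob_space_axioms ig')
    also have "\<dots> \<le> (\<integral>w. softmax I (\<lambda>i. h' i w) \<partial>N)"
    proof (rule softmax_comparison[OF G H I mem])
      fix i j assume ij: "i \<in> I" "j \<in> I"
      have "(g' i w - g' j w)\<^sup>2 = c\<^sup>2 * (g i w - g j w)\<^sup>2" "(h' i v - h' j v)\<^sup>2 = c\<^sup>2 * (h i v - h j v)\<^sup>2" for w v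
        using ij by (auto simp: g'_def h'_def power_mult_distrib[symmetric] algebra_simps)
      then show "(\<integral>w. (g' i w - g' j w)\<^sup>2 \<partial>M) \<le> (\<integral>w. (h' i w - h' j w)\<^sup>2 \<partial>N)"
        using inc[OF ij] by (simp add: mult_left_mono)
    qed
    also have "\<dots> \<le> (\<integral>w. Max ((\<lambda>i. h' i w) ` I) + ln (card I) \<partial>N)"
      by (intro integral_mono softmax_bounds I Bochner_Integration.integrable_add integrable_Max softmax_integrable N.prob_space_axioms ih') auto
    also have "\<dots> = c * ?B + ln (card I)"
      unfolding eqI using iMh by (simp add: Max_scale c N.prob_space)
    finally show ?thesis using c by (simp add: field_simps)
  qed
  have "?A \<le> ?B + ln (card I) / real (Suc m)" for m by (rule le) simp
  moreover have "(\<lambda>m. ?B + ln (card I) / real (Suc m)) \<longlonglongrightarrow> ?B + 0"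
    by (intro tendsto_intros LIMSEQ_Suc lim_const_over_n)
  ultimately have "?A \<le> ?B + 0" by (intro LIMSEQ_le_const) auto
  then show ?thesis by simp
qed

section \<open>Concentration of Gaussian suprema\<close>

lemma exp_mean_le:
  fixes y :: "'i \<Rightarrow> real"
  assumes "finite K" "K \<noteq> {}"
  shows "exp ((\<Sum>k\<in>K. y k) / card K) \<le> (\<Sum>k\<in>K. exp (y k)) / card K"
proof -
  define a where "a = (\<Sum>k\<in>K. y k) / card K"
  have c: "real (card K) > 0" using assms by (simp add: card_gt_0_iff)
  have "exp a * (1 + y k - a) \<le> exp (y k)" for k
  proof -
    have "exp a * (1 + (y k - a)) \<le> exp a * exp (y k - a)" by (intro mult_left_mono exp_ge_add_one_self) auto
    then show ?thesis by (simp add: exp_add[symmetric] add_diff_eq)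
  qed
  then have "(\<Sum>k\<in>K. exp a * (1 + y k - a)) \<le> (\<Sum>k\<in>K. exp (y k))" by (rule sum_mono)
  also have "(\<Sum>k\<in>K. exp a * (1 + y k - a)) = exp a * (card K + (\<Sum>k\<in>K. y k) - card K * a)"
    by (simp add: sum_distrib_left[symmetric] sum.distrib sum_subtractf)
  also have "\<dots> = exp a * card K" using c by (simp add: a_def)
  finally show ?thesis using c by (simp add: a_def[symmetric] field_simps)
qed

text \<open>Bernoulli's inequality. It shows that an exponential moment with exponent x / m is 1 +
  O(1/m) once the one with exponent x is finite.\<close>

lemma exp_divide_le:
  fixes x :: real
  assumes "m > 0"
  shows "exp (x / real m) \<le> 1 + (exp x - 1) / real m"
proof -
  have "1 + real m * (exp (x / m) - 1) \<le> (1 + (exp (x / m) - 1)) ^ m"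
    by (rule Bernoulli_inequality) auto
  also have "\<dots> = exp x" using assms by (simp add: exp_of_nat_mult[symmetric])
  finally show ?thesis using assms by (simp add: field_simps)
qed

text \<open>The least maximising index: a measurable choice, and the coordinate it selects is a
  subgradient of the maximum.\<close>

definition argmax :: "nat set \<Rightarrow> (nat \<Rightarrow> real) \<Rightarrow> nat" where
  "argmax I x = (LEAST i. i \<in> I \<and> (\<forall>j\<in>I. x j \<le> x i))"

lemma argmax:
  assumes I: "finite I" "I \<noteq> {}"
  shows "argmax I x \<in> I" "x (argmax I x) = Max (x ` I)"
proof -
  have "Max (x ` I) \<in> x ` I" using I by (intro Max_in) auto
  then obtain i where i: "i \<in> I" "Max (x ` I) = x i" by auto
  then have "\<exists>i. i \<in> I \<and> (\<forall>j\<in>I. x j \<le> x i)" using I by (metis Max_ge finite_imageI imageI)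
  from LeastI_ex[OF this] have *: "argmax I x \<in> I" "\<forall>j\<in>I. x j \<le> x (argmax I x)" by (simp_all add: argmax_def)
  then show "argmax I x \<in> I" by simp
  show "x (argmax I x) = Max (x ` I)" using * I i by (intro antisym[OF Max_ge]) auto
qed

lemma argmax_measurable:
  assumes "finite I" and [measurable]: "\<And>i. (\<lambda>w. x w i) \<in> borel_measurable M"
  shows "(\<lambda>w. argmax I (x w)) \<in> M \<rightarrow>\<^sub>M count_space UNIV"
  unfolding argmax_def using assms(1) by measurable

lemma Max_increment_le:
  assumes I: "finite I" "I \<noteq> {}"
  shows "Max (x ` I) - Max (y ` I) \<le> x (argmax I x) - y (argmax I x)"
  using argmax[OF I, of x] I by (simp add: Max_ge)

lemma cos_ge_quadratic: "1 - cos x \<le> x\<^sup>2 / 2" for x :: real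
proof -
  have "cos x = 1 - 2 * (sin (x / 2))\<^sup>2" using cos_double_sin[of "x / 2"] by simp
  moreover have "(sin (x / 2))\<^sup>2 \<le> (x / 2)\<^sup>2" by (rule abs_le_square_iff[THEN iffD1, OF abs_sin_x_le_abs_x])
  ultimately show ?thesis by (simp add: power_divide)
qed

text \<open>
  The path \<open>cos \<theta> g(a) + sin \<theta> g(b)\<close> from \<open>g(a)\<close> to \<open>g(b)\<close> is cut into \<open>m\<close> pieces; convexity of the
  maximum bounds each increment by a linear functional of the velocity, which is independent of the
  position for every \<open>\<theta>\<close> by rotation invariance.
\<close>

lemma concentration_Max_aux:
  fixes g :: "nat \<Rightarrow> 'w \<Rightarrow> real"
  assumes G: "gaussian_space M G" and I: "finite I" "I \<noteq> {}" and g: "\<And>i. g i \<in> G"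
    and s2: "\<And>i. i \<in> I \<Longrightarrow> (\<integral>w. (g i w)\<^sup>2 \<partial>M) \<le> s2" and l: "l \<ge> 0" and m: "m > 0"
  shows "(\<integral>\<^sup>+x. ennreal (exp (l * (Max ((\<lambda>i. g i (snd x)) ` I) - Max ((\<lambda>i. g i (fst x)) ` I)))) \<partial>(M \<Otimes>\<^sub>M M))
    \<le> ennreal (exp (2 * l\<^sup>2 * s2)) * (\<integral>\<^sup>+w. ennreal (exp (2 * l / real m * \<bar>Max ((\<lambda>i. g i w) ` I)\<bar>)) \<partial>M)"
proof -
  interpret M: prob_space M by (rule gaussian_spaceD(1)[OF G])
  interpret P: pair_prob_space M M ..
  have [measurable]: "g i \<in> borel_measurable M" for i by (rule gaussian_spaceD(4)[OF G g])
  define F :: "(nat \<Rightarrow> real) \<Rightarrow> real" where "F = (\<lambda>x. Max (x ` I))"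
  have Fm[measurable]: "(\<lambda>w. F (x w)) \<in> borel_measurable N" if "\<And>i. (\<lambda>w. x w i) \<in> borel_measurable N" for x and N :: "'z measure"
    using that I borel_measurable_Max[of I "\<lambda>i w. x w i" N] by (simp add: F_def)
  define d where "d = pi / (2 * real m)"
  have d: "0 \<le> d" "d \<le> pi / 2" "real m * d = pi / 2" using m by (auto simp: d_def field_simps)
  \<comment> \<open>\<open>B\<close> is the weight of the velocity, m l sin d <= l pi / 2 <= 2 l.
    \<open>A\<close> bounds the second order error, m l (1 - cos d) <= l pi^2 / (8 m) <= 2 l / m,
    which vanishes as m grows.\<close>
  define A B where "A = 2 * l / real m" and "B = real m * l * sin d"
  have B0: "0 \<le> B" using l d unfolding B_def by (intro mult_nonneg_nonneg sin_ge_zero) auto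
  have B1: "B\<^sup>2 / 2 \<le> 2 * l\<^sup>2"
  proof -
    have "B \<le> real m * l * d" unfolding B_def using d l by (intro mult_left_mono sin_x_le_x) auto
    also have "\<dots> = l * (pi / 2)" using d(3) by simp
    also have "\<dots> \<le> l * 2" using l pi_less_4 by (intro mult_left_mono) auto
    finally have "B\<^sup>2 \<le> (l * 2)\<^sup>2" using B0 by (intro power_mono) auto
    then show ?thesis by (simp add: power_mult_distrib)
  qed
  have A1: "real m * l * (1 - cos d) \<le> A"
  proof -
    have "real m * l * (1 - cos d) \<le> real m * l * (d\<^sup>2 / 2)" using l by (intro mult_left_mono cos_ge_quadratic) auto
    also have "\<dots> = l * pi\<^sup>2 / (8 * real m)" using m by (simp add: d_def power2_eq_square field_simps)
    also have "\<dots> \<le> l * 4\<^sup>2 / (8 * real m)" using l pi_less_4 by (intro divide_right_mono mult_left_mono power_mono) auto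
    finally show ?thesis by (simp add: A_def)
  qed
  \<comment> \<open>The flag separates position (\<open>False\<close>) from velocity
    (\<open>True\<close>) on the circle. At every angle the rotated family has the covariances of
    the original one, so integrals of the rotated pair reduce to integrals of the original
    pair.\<close>
  define base :: "nat \<times> bool \<Rightarrow> 'w \<times> 'w \<Rightarrow> real" where "base = (\<lambda>(i, v) x. if v then g i (snd x) else g i (fst x))"
  define rot :: "real \<Rightarrow> nat \<times> bool \<Rightarrow> 'w \<times> 'w \<Rightarrow> real" where
    "rot = (\<lambda>\<theta> (i, v) x. if v then - sin \<theta> * g i (fst x) + cos \<theta> * g i (snd x) else cos \<theta> * g i (fst x) + sin \<theta> * g i (snd x))"
  define \<Phi> :: "(nat \<times> bool \<Rightarrow> real) \<Rightarrow> ennreal" where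
    "\<Phi> = (\<lambda>z. ennreal (exp (A * \<bar>F (\<lambda>i. z (i, False))\<bar> + B * z (argmax I (\<lambda>i. z (i, False)), True))))"
  have \<Phi>m[measurable]: "\<Phi> \<in> borel_measurable (PiM UNIV (\<lambda>_. borel))"
  proof -
    have [measurable]: "(\<lambda>z. argmax I (\<lambda>i. z (i, False))) \<in> PiM UNIV (\<lambda>_. borel) \<rightarrow>\<^sub>M count_space UNIV"
      by (intro argmax_measurable I) auto
    have "(\<lambda>z. F (\<lambda>i. z (i, False))) \<in> borel_measurable (PiM UNIV (\<lambda>_::nat\<times>bool. borel))"
      using I borel_measurable_Max[of I "\<lambda>i z. z (i, False)" "PiM UNIV (\<lambda>_::nat\<times>bool. borel)"] by (simp add: F_def)
    moreover have "(\<lambda>z. z (argmax I (\<lambda>i. z (i, False)), True)) \<in> borel_measurable (PiM UNIV (\<lambda>_::nat\<times>bool. borel))"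
      by (rule measurable_compose_countable[where f = "\<lambda>i z. z (i, True)"]) auto
    ultimately show ?thesis unfolding \<Phi>_def by simp
  qed
  have mem: "g' \<in> sum_space G G" if "g' = (\<lambda>x. a * g i (fst x) + b * g i (snd x))" for g' a b i
    unfolding that by (rule sum_spaceI(1)[OF G G gaussian_spaceD(6)[OF G g] gaussian_spaceD(6)[OF G g]])
  have rotmem: "rot \<theta> iv \<in> sum_space G G" for \<theta> iv
  proof (cases iv)
    case (Pair i v)
    then show ?thesis using mem[of _ "- sin \<theta>" i "cos \<theta>"] mem[of _ "cos \<theta>" i "sin \<theta>"] by (cases v) (simp_all add: rot_def)
  qed
  have basemem: "base iv \<in> sum_space G G" for iv
  proof (cases iv)
    case (Pair i v)
    then show ?thesis using mem[of _ 0 i 1] mem[of _ 1 i 0] by (cases v) (auto simp: base_def)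
  qed
  have cvp: "(\<integral>x. (a * g i (fst x) + b * g i (snd x)) * (a' * g j (fst x) + b' * g j (snd x)) \<partial>(M \<Otimes>\<^sub>M M))
     = (a * a' + b * b') * (\<integral>w. g i w * g j w \<partial>M)" for a b a' b' i j
  proof -
    have "(\<integral>w. a * g i w * (a' * g j w) \<partial>M) = a * a' * (\<integral>w. g i w * g j w \<partial>M)" for a a'
      by (subst integral_mult_right_zero[symmetric]) (simp add: ac_simps)
    then show ?thesis
      using cov_sum_space[OF G G gaussian_spaceD(6)[OF G g[of i], of a] gaussian_spaceD(6)[OF G g[of j], of a']
        gaussian_spaceD(6)[OF G g[of i], of b] gaussian_spaceD(6)[OF G g[of j], of b']] by (simp add: algebra_simps)
  qed
  have cov: "(\<integral>x. rot \<theta> iv x * rot \<theta> jv x \<partial>(M \<Otimes>\<^sub>M M)) = (\<integral>x. base iv x * base jv x \<partial>(M \<Otimes>\<^sub>M M))" for \<theta> iv jv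
  proof -
    have sc: "cos \<theta> * cos \<theta> + sin \<theta> * sin \<theta> = 1" "sin \<theta> * sin \<theta> + cos \<theta> * cos \<theta> = 1"
      by (simp_all add: power2_eq_square[symmetric])
    obtain i v j u where ij: "iv = (i, v)" "jv = (j, u)" by (cases iv, cases jv) auto
    show ?thesis
      using cvp[of "- sin \<theta>" i "cos \<theta>" "- sin \<theta>" j "cos \<theta>"] cvp[of "- sin \<theta>" i "cos \<theta>" "cos \<theta>" j "sin \<theta>"]
       cvp[of "cos \<theta>" i "sin \<theta>" "cos \<theta>" j "sin \<theta>"] cvp[of "cos \<theta>" i "sin \<theta>" "- sin \<theta>" j "cos \<theta>"]
       cvp[of 1 i 0 1 j 0] cvp[of 1 i 0 0 j 1] cvp[of 0 i 1 1 j 0] cvp[of 0 i 1 0 j 1] sc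
      unfolding ij by (cases v; cases u) (simp_all add: rot_def base_def)
  qed
  have rotint: "(\<integral>\<^sup>+x. \<Phi> (\<lambda>iv. rot \<theta> iv x) \<partial>(M \<Otimes>\<^sub>M M)) = (\<integral>\<^sup>+x. \<Phi> (\<lambda>iv. base iv x) \<partial>(M \<Otimes>\<^sub>M M))" for \<theta>
    by (rule gaussian_law_transfer(2)[where g = "rot \<theta>" and h = base, OF gaussian_space_sum_space[OF G G] gaussian_space_sum_space[OF G G]])
      (use rotmem basemem cov in auto)
  have baseint: "(\<integral>\<^sup>+x. \<Phi> (\<lambda>iv. base iv x) \<partial>(M \<Otimes>\<^sub>M M)) \<le> ennreal (exp (2 * l\<^sup>2 * s2)) * (\<integral>\<^sup>+w. ennreal (exp (A * \<bar>F (\<lambda>i. g i w)\<bar>)) \<partial>M)"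
  proof -
    have basem: "(\<lambda>x iv. base iv x) \<in> M \<Otimes>\<^sub>M M \<rightarrow>\<^sub>M PiM UNIV (\<lambda>_. borel)"
      using gaussian_spaceD(4)[OF gaussian_space_sum_space[OF G G] basemem] by (intro measurable_PiM_single') auto
    have "(\<integral>\<^sup>+x. \<Phi> (\<lambda>iv. base iv x) \<partial>(M \<Otimes>\<^sub>M M)) = (\<integral>\<^sup>+a. (\<integral>\<^sup>+b. \<Phi> (\<lambda>iv. base iv (a, b)) \<partial>M) \<partial>M)"
      using M.nn_integral_fst[OF measurable_compose[OF basem \<Phi>m], symmetric] by simp
    also have "\<dots> \<le> (\<integral>\<^sup>+a. ennreal (exp (2 * l\<^sup>2 * s2)) * ennreal (exp (A * \<bar>F (\<lambda>i. g i a)\<bar>)) \<partial>M)"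
    proof (rule nn_integral_mono)
      fix a
      \<comment> \<open>The maximiser depends on the first coordinate only; given that coordinate,
        the velocity is one fixed Gaussian variable with an explicit exponential moment.\<close>
      define j where "j = argmax I (\<lambda>i. g i a)"
      have j: "j \<in> I" unfolding j_def by (rule argmax[OF I])
      have "(\<integral>\<^sup>+b. \<Phi> (\<lambda>iv. base iv (a, b)) \<partial>M) = (\<integral>\<^sup>+b. ennreal (exp (A * \<bar>F (\<lambda>i. g i a)\<bar>)) * ennreal (exp (B * g j b)) \<partial>M)"
        by (simp add: \<Phi>_def base_def j_def ennreal_mult[symmetric] exp_add)
      also have "\<dots> = ennreal (exp (A * \<bar>F (\<lambda>i. g i a)\<bar>)) * ennreal (exp (B\<^sup>2 * (\<integral>w. (g j w)\<^sup>2 \<partial>M) / 2))"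
        by (subst nn_integral_cmult) (auto simp: gaussian_rv_mgf[OF gaussian_spaceD(2)[OF G g]])
      also have "\<dots> \<le> ennreal (exp (A * \<bar>F (\<lambda>i. g i a)\<bar>)) * ennreal (exp (2 * l\<^sup>2 * s2))"
      proof -
        have "0 \<le> (\<integral>w. (g j w)\<^sup>2 \<partial>M)" by simp
        then have "B\<^sup>2 / 2 * (\<integral>w. (g j w)\<^sup>2 \<partial>M) \<le> 2 * l\<^sup>2 * s2" using B1 s2[OF j] by (intro mult_mono) auto
        then show ?thesis by (intro mult_left_mono) auto
      qed
      finally show "(\<integral>\<^sup>+b. \<Phi> (\<lambda>iv. base iv (a, b)) \<partial>M) \<le> ennreal (exp (2 * l\<^sup>2 * s2)) * ennreal (exp (A * \<bar>F (\<lambda>i. g i a)\<bar>))"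
        by (simp add: mult.commute)
    qed
    also have "\<dots> = ennreal (exp (2 * l\<^sup>2 * s2)) * (\<integral>\<^sup>+w. ennreal (exp (A * \<bar>F (\<lambda>i. g i w)\<bar>)) \<partial>M)"
      by (rule nn_integral_cmult) auto
    finally show ?thesis .
  qed
  have pt: "ennreal (exp (l * (F (\<lambda>i. g i (snd x)) - F (\<lambda>i. g i (fst x)))))
     \<le> (\<Sum>k<m. ennreal (1 / real m) * \<Phi> (\<lambda>iv. rot (real (Suc k) * d) iv x))" for x
  proof -
    define X where "X = (\<lambda>\<theta> i. rot \<theta> (i, False) x)"
    define X' where "X' = (\<lambda>\<theta> i. rot \<theta> (i, True) x)"
    have inc: "F (X (real (Suc k) * d)) - F (X (real k * d))
       \<le> (1 - cos d) * \<bar>F (X (real (Suc k) * d))\<bar> + sin d * X' (real (Suc k) * d) (argmax I (X (real (Suc k) * d)))" for k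
    proof -
      define \<theta> where "\<theta> = real (Suc k) * d"
      define j where "j = argmax I (X \<theta>)"
      have k: "real k * d = \<theta> - d" by (simp add: \<theta>_def algebra_simps)
      have "F (X \<theta>) - F (X (\<theta> - d)) \<le> X \<theta> j - X (\<theta> - d) j" unfolding F_def j_def by (rule Max_increment_le[OF I])
      \<comment> \<open>Rotating back by d expresses the earlier position through the present
        position and velocity at the same index.\<close>
      also have "X (\<theta> - d) j = cos d * X \<theta> j - sin d * X' \<theta> j"
        by (simp add: X_def X'_def rot_def cos_diff sin_diff algebra_simps)
      also have "X \<theta> j - (cos d * X \<theta> j - sin d * X' \<theta> j) = (1 - cos d) * F (X \<theta>) + sin d * X' \<theta> j"
        using argmax(2)[OF I, of "X \<theta>"] by (simp add: F_def j_def algebra_simps)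
      also have "\<dots> \<le> (1 - cos d) * \<bar>F (X \<theta>)\<bar> + sin d * X' \<theta> j" by (intro add_right_mono mult_left_mono) auto
      finally show ?thesis unfolding k \<theta>_def[symmetric] j_def .
    qed
    have e: "F (\<lambda>i. g i (snd x)) = F (X (real m * d))" "F (\<lambda>i. g i (fst x)) = F (X (real 0 * d))"
      unfolding d(3) by (simp_all add: X_def rot_def)
    define y where "y = (\<lambda>k. A * \<bar>F (X (real (Suc k) * d))\<bar> + B * X' (real (Suc k) * d) (argmax I (X (real (Suc k) * d))))"
    have "l * (F (\<lambda>i. g i (snd x)) - F (\<lambda>i. g i (fst x))) = l * (\<Sum>k<m. F (X (real (Suc k) * d)) - F (X (real k * d)))"
      unfolding e sum_lessThan_telescope[of "\<lambda>k. F (X (real k * d))"] ..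
    also have "\<dots> = (\<Sum>k<m. real m * l * (F (X (real (Suc k) * d)) - F (X (real k * d)))) / card {..<m}"
      using m by (simp add: sum_distrib_left[symmetric])
    also have "\<dots> \<le> (\<Sum>k<m. y k) / card {..<m}"
    proof (intro divide_right_mono sum_mono)
      fix k
      have "real m * l * (F (X (real (Suc k) * d)) - F (X (real k * d)))
        \<le> real m * l * ((1 - cos d) * \<bar>F (X (real (Suc k) * d))\<bar> + sin d * X' (real (Suc k) * d) (argmax I (X (real (Suc k) * d))))"
        using l inc[of k] by (intro mult_left_mono) auto
      also have "\<dots> = (real m * l * (1 - cos d)) * \<bar>F (X (real (Suc k) * d))\<bar> + B * X' (real (Suc k) * d) (argmax I (X (real (Suc k) * d)))"
        by (simp add: B_def algebra_simps)
      also have "\<dots> \<le> y k" unfolding y_def by (intro add_right_mono mult_right_mono A1) auto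
      finally show "real m * l * (F (X (real (Suc k) * d)) - F (X (real k * d))) \<le> y k" .
    qed auto
    finally have "exp (l * (F (\<lambda>i. g i (snd x)) - F (\<lambda>i. g i (fst x)))) \<le> exp ((\<Sum>k<m. y k) / card {..<m})" by simp
    also have "\<dots> \<le> (\<Sum>k<m. exp (y k)) / card {..<m}" using m by (intro exp_mean_le) auto
    also have "\<dots> = (\<Sum>k<m. 1 / real m * exp (y k))" by (simp add: sum_divide_distrib)
    finally have "ennreal (exp (l * (F (\<lambda>i. g i (snd x)) - F (\<lambda>i. g i (fst x))))) \<le> ennreal (\<Sum>k<m. 1 / real m * exp (y k))"
      by (rule ennreal_leI)
    also have "\<dots> = (\<Sum>k<m. ennreal (1 / real m) * ennreal (exp (y k)))"
      by (subst sum_ennreal[symmetric]) (auto simp: ennreal_mult[symmetric])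
    finally show ?thesis unfolding \<Phi>_def y_def X_def X'_def .
  qed
  have rotm: "(\<lambda>x. \<Phi> (\<lambda>iv. rot \<theta> iv x)) \<in> borel_measurable (M \<Otimes>\<^sub>M M)" for \<theta>
    using gaussian_spaceD(4)[OF gaussian_space_sum_space[OF G G] rotmem]
    by (intro measurable_compose[OF _ \<Phi>m] measurable_PiM_single') auto
  have "(\<integral>\<^sup>+x. ennreal (exp (l * (F (\<lambda>i. g i (snd x)) - F (\<lambda>i. g i (fst x))))) \<partial>(M \<Otimes>\<^sub>M M))
    \<le> (\<integral>\<^sup>+x. (\<Sum>k<m. ennreal (1 / real m) * \<Phi> (\<lambda>iv. rot (real (Suc k) * d) iv x)) \<partial>(M \<Otimes>\<^sub>M M))"
    by (intro nn_integral_mono pt)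
  also have "\<dots> = (\<Sum>k<m. ennreal (1 / real m) * (\<integral>\<^sup>+x. \<Phi> (\<lambda>iv. rot (real (Suc k) * d) iv x) \<partial>(M \<Otimes>\<^sub>M M)))"
    using rotm by (subst nn_integral_sum) (auto simp: nn_integral_cmult)
  also have "\<dots> = (\<integral>\<^sup>+x. \<Phi> (\<lambda>iv. base iv x) \<partial>(M \<Otimes>\<^sub>M M))"
    unfolding rotint using m by (simp add: mult.assoc[symmetric] ennreal_of_nat_eq_real_of_nat ennreal_mult[symmetric])
  also note baseint
  finally show ?thesis unfolding F_def A_def .
qed

text \<open>For a maximum over a finite set the exponential moment \<open>L\<close> is finite, so
  the factor left over by the discretisation is at most 1 + L / m and disappears as m tends to
  infinity.\<close>

lemma concentration_Max:
  fixes g :: "nat \<Rightarrow> 'w \<Rightarrow> real"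
  assumes G: "gaussian_space M G" and I: "finite I" "I \<noteq> {}" and g: "\<And>i. g i \<in> G"
    and s2: "\<And>i. i \<in> I \<Longrightarrow> (\<integral>w. (g i w)\<^sup>2 \<partial>M) \<le> s2" and l: "l \<ge> 0"
  shows "(\<integral>\<^sup>+x. ennreal (exp (l * (Max ((\<lambda>i. g i (snd x)) ` I) - Max ((\<lambda>i. g i (fst x)) ` I)))) \<partial>(M \<Otimes>\<^sub>M M))
    \<le> ennreal (exp (2 * l\<^sup>2 * s2))"
proof -
  interpret M: prob_space M by (rule gaussian_spaceD(1)[OF G])
  have [measurable]: "g i \<in> borel_measurable M" for i by (rule gaussian_spaceD(4)[OF G g])
  define F where "F = (\<lambda>w. Max ((\<lambda>i. g i w) ` I))"
  have [measurable]: "F \<in> borel_measurable M" using I borel_measurable_Max[of I g M] by (simp add: F_def)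
  define L where "L = (\<integral>\<^sup>+w. ennreal (exp (2 * l * \<bar>F w\<bar>)) \<partial>M)"
  have "L \<le> (\<integral>\<^sup>+w. (\<Sum>i\<in>I. ennreal (exp (2 * l * g i w)) + ennreal (exp (- 2 * l * g i w))) \<partial>M)"
    unfolding L_def
  proof (rule nn_integral_mono)
    fix w
    define j where "j = argmax I (\<lambda>i. g i w)"
    have j: "j \<in> I" "F w = g j w" using argmax[OF I, of "\<lambda>i. g i w"] by (auto simp: j_def F_def)
    have "ennreal (exp (2 * l * \<bar>F w\<bar>)) \<le> ennreal (exp (2 * l * g j w)) + ennreal (exp (- 2 * l * g j w))"
      unfolding j(2) by (cases "g j w \<ge> 0") (auto simp: add_increasing add_increasing2)
    also have "\<dots> \<le> (\<Sum>i\<in>I. ennreal (exp (2 * l * g i w)) + ennreal (exp (- 2 * l * g i w)))"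
      using I(1) j(1) by (intro member_le_sum[where f = "\<lambda>i. ennreal (exp (2 * l * g i w)) + ennreal (exp (- 2 * l * g i w))"]) auto
    finally show "ennreal (exp (2 * l * \<bar>F w\<bar>)) \<le> (\<Sum>i\<in>I. ennreal (exp (2 * l * g i w)) + ennreal (exp (- 2 * l * g i w)))" .
  qed
  also have "\<dots> = (\<Sum>i\<in>I. ennreal (exp ((2 * l)\<^sup>2 * (\<integral>w. (g i w)\<^sup>2 \<partial>M) / 2)) + ennreal (exp ((- 2 * l)\<^sup>2 * (\<integral>w. (g i w)\<^sup>2 \<partial>M) / 2)))"
    by (simp only: gaussian_rv_mgf[OF gaussian_spaceD(2)[OF G g], symmetric])
      (simp add: nn_integral_sum nn_integral_add)
  also have "\<dots> < \<infinity>" by (simp add: ennreal_plus[symmetric] del: ennreal_plus)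
  finally have Lfin: "L < \<infinity>" .
  then obtain L' where L': "L = ennreal L'" "L' \<ge> 0" by (cases L) auto
  let ?X = "(\<integral>\<^sup>+x. ennreal (exp (l * (Max ((\<lambda>i. g i (snd x)) ` I) - Max ((\<lambda>i. g i (fst x)) ` I)))) \<partial>(M \<Otimes>\<^sub>M M))"
  have le: "?X \<le> ennreal (exp (2 * l\<^sup>2 * s2) * (1 + L' / real (Suc m)))" for m
  proof -
    have "(\<integral>\<^sup>+w. ennreal (exp (2 * l / real (Suc m) * \<bar>F w\<bar>)) \<partial>M) \<le> (\<integral>\<^sup>+w. ennreal 1 + ennreal (1 / real (Suc m)) * ennreal (exp (2 * l * \<bar>F w\<bar>)) \<partial>M)"
    proof (rule nn_integral_mono)
      fix w
      have "exp (2 * l / real (Suc m) * \<bar>F w\<bar>) = exp ((2 * l * \<bar>F w\<bar>) / real (Suc m))" by simp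
      also have "\<dots> \<le> 1 + (exp (2 * l * \<bar>F w\<bar>) - 1) / real (Suc m)" by (rule exp_divide_le) simp
      also have "\<dots> \<le> 1 + 1 / real (Suc m) * exp (2 * l * \<bar>F w\<bar>)" by (simp add: divide_right_mono)
      finally have "ennreal (exp (2 * l / real (Suc m) * \<bar>F w\<bar>)) \<le> ennreal (1 + 1 / real (Suc m) * exp (2 * l * \<bar>F w\<bar>))" by (rule ennreal_leI)
      then show "ennreal (exp (2 * l / real (Suc m) * \<bar>F w\<bar>)) \<le> ennreal 1 + ennreal (1 / real (Suc m)) * ennreal (exp (2 * l * \<bar>F w\<bar>))"
        by (subst ennreal_mult[symmetric], simp, simp, subst ennreal_plus[symmetric]) auto
    qed
    also have "\<dots> = ennreal (1 + L' / real (Suc m))"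
      using L' ennreal_plus[of 1 "L' / real (Suc m)"] by (subst nn_integral_add, simp, simp, subst nn_integral_cmult)
        (auto simp: L_def[symmetric] M.emeasure_space_1 ennreal_mult[symmetric])
    finally have "ennreal (exp (2 * l\<^sup>2 * s2)) * (\<integral>\<^sup>+w. ennreal (exp (2 * l / real (Suc m) * \<bar>F w\<bar>)) \<partial>M)
        \<le> ennreal (exp (2 * l\<^sup>2 * s2)) * ennreal (1 + L' / real (Suc m))" by (rule mult_left_mono) simp
    also have "\<dots> = ennreal (exp (2 * l\<^sup>2 * s2) * (1 + L' / real (Suc m)))" using L' by (simp add: ennreal_mult)
    finally have "ennreal (exp (2 * l\<^sup>2 * s2)) * (\<integral>\<^sup>+w. ennreal (exp (2 * l / real (Suc m) * \<bar>F w\<bar>)) \<partial>M) \<le> \<dots>" .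
    moreover have "?X \<le> ennreal (exp (2 * l\<^sup>2 * s2)) * (\<integral>\<^sup>+w. ennreal (exp (2 * l / real (Suc m) * \<bar>F w\<bar>)) \<partial>M)"
      unfolding F_def by (rule concentration_Max_aux[where g = g, OF G I]) (use g s2 l in auto)
    ultimately show ?thesis by (rule order_trans[rotated])
  qed
  have "(\<lambda>m. exp (2 * l\<^sup>2 * s2) * (1 + L' / real (Suc m))) \<longlonglongrightarrow> exp (2 * l\<^sup>2 * s2) * (1 + 0)"
    by (intro tendsto_intros LIMSEQ_Suc lim_const_over_n)
  then have "(\<lambda>m. ennreal (exp (2 * l\<^sup>2 * s2) * (1 + L' / real (Suc m)))) \<longlonglongrightarrow> ennreal (exp (2 * l\<^sup>2 * s2) * (1 + 0))"
    by (rule tendsto_ennrealI)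
  then have "?X \<le> ennreal (exp (2 * l\<^sup>2 * s2) * (1 + 0))" using le by (intro LIMSEQ_le_const) auto
  then show ?thesis by simp
qed

lemma Max_initial_tendsto_SUP:
  fixes x :: "nat \<Rightarrow> real"
  assumes bdd: "bdd_above (range x)"
  shows "(\<lambda>N. Max (x ` {..N})) \<longlonglongrightarrow> (SUP i. x i)"
proof -
  have le: "Max (x ` {..N}) \<le> (SUP i. x i)" for N
    using bdd by (auto simp: Max_le_iff intro: cSUP_upper)
  then have b: "bdd_above (range (\<lambda>N. Max (x ` {..N})))" by (intro bdd_aboveI[where M = "SUP i. x i"]) auto
  have "(SUP N. Max (x ` {..N})) = (SUP i. x i)"
  proof (rule antisym)
    show "(SUP N. Max (x ` {..N})) \<le> (SUP i. x i)" by (intro cSUP_least le) auto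
    show "(SUP i. x i) \<le> (SUP N. Max (x ` {..N}))"
    proof (rule cSUP_least)
      fix i
      have "x i \<le> Max (x ` {..i})" by (intro Max_ge) auto
      also have "\<dots> \<le> (SUP N. Max (x ` {..N}))" by (intro cSUP_upper b) auto
      finally show "x i \<le> (SUP N. Max (x ` {..N}))" .
    qed auto
  qed
  moreover have "incseq (\<lambda>N. Max (x ` {..N}))" by (intro monoI Max_mono) auto
  ultimately show ?thesis using LIMSEQ_incseq_SUP[OF b] by simp
qed

text \<open>The bound for two independent copies factorises as E exp (- l T) E exp (l T). The first
  factor is positive, so the second is finite: integrability of the supremum is a result, not an
  assumption. Jensen's inequality then replaces the first factor by exp (- l E T).\<close>

theorem concentration_SUP:
  fixes g :: "nat \<Rightarrow> 'w \<Rightarrow> real"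
  assumes G: "gaussian_space M G" and g: "\<And>i. g i \<in> G" and s2: "\<And>i. (\<integral>w. (g i w)\<^sup>2 \<partial>M) \<le> s2"
    and bdd: "\<And>w. bdd_above (range (\<lambda>i. g i w))" and T: "\<And>w. T w = (SUP i. g i w)" and T0: "\<And>w. 0 \<le> T w"
  shows "integrable M T"
    "l \<ge> 0 \<Longrightarrow> (\<integral>\<^sup>+w. ennreal (exp (l * T w)) \<partial>M) \<le> ennreal (exp (l * (\<integral>w. T w \<partial>M) + 2 * l\<^sup>2 * s2))"
proof -
  interpret M: prob_space M by (rule gaussian_spaceD(1)[OF G])
  interpret P: pair_prob_space M M ..
  have [measurable]: "g i \<in> borel_measurable M" for i by (rule gaussian_spaceD(4)[OF G g])
  have Tm[measurable]: "T \<in> borel_measurable M" unfolding T by (intro borel_measurable_cSUP bdd) auto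
  have two: "(\<integral>\<^sup>+a. ennreal (exp (- l * T a)) \<partial>M) * (\<integral>\<^sup>+b. ennreal (exp (l * T b)) \<partial>M) \<le> ennreal (exp (2 * l\<^sup>2 * s2))" if l: "l \<ge> 0" for l
  proof -
    define F where "F = (\<lambda>N w. Max ((\<lambda>i. g i w) ` {..N}))"
    have Fm[measurable]: "F N \<in> borel_measurable M" for N using borel_measurable_Max[of "{..N}" g M] by (simp add: F_def)
    have lim: "(\<lambda>N. F N w) \<longlonglongrightarrow> T w" for w unfolding F_def T by (rule Max_initial_tendsto_SUP[OF bdd])
    have "(\<integral>\<^sup>+a. ennreal (exp (- l * T a)) \<partial>M) * (\<integral>\<^sup>+b. ennreal (exp (l * T b)) \<partial>M)
      = (\<integral>\<^sup>+a. (\<integral>\<^sup>+b. ennreal (exp (l * (T b - T a))) \<partial>M) \<partial>M)"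
    proof -
      have "(\<integral>\<^sup>+b. ennreal (exp (l * (T b - T a))) \<partial>M) = ennreal (exp (- l * T a)) * (\<integral>\<^sup>+b. ennreal (exp (l * T b)) \<partial>M)" for a
        by (subst nn_integral_cmult[symmetric]) (auto simp: ennreal_mult[symmetric] exp_add[symmetric] algebra_simps)
      then show ?thesis by (simp add: nn_integral_multc)
    qed
    also have "\<dots> = (\<integral>\<^sup>+x. ennreal (exp (l * (T (snd x) - T (fst x)))) \<partial>(M \<Otimes>\<^sub>M M))"
      using M.nn_integral_fst[of "\<lambda>x. ennreal (exp (l * (T (snd x) - T (fst x))))" M] by simp
    \<comment> \<open>Fatou's lemma carries the estimate from finite maxima to the supremum.\<close>
    also have "\<dots> = (\<integral>\<^sup>+x. liminf (\<lambda>N. ennreal (exp (l * (F N (snd x) - F N (fst x))))) \<partial>(M \<Otimes>\<^sub>M M))"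
    proof (rule nn_integral_cong)
      fix x
      have "(\<lambda>N. ennreal (exp (l * (F N (snd x) - F N (fst x))))) \<longlonglongrightarrow> ennreal (exp (l * (T (snd x) - T (fst x))))"
        by (intro tendsto_ennrealI tendsto_intros lim)
      from lim_imp_Liminf[OF _ this] show "ennreal (exp (l * (T (snd x) - T (fst x)))) = liminf (\<lambda>N. ennreal (exp (l * (F N (snd x) - F N (fst x)))))"
        by simp
    qed
    also have "\<dots> \<le> liminf (\<lambda>N. \<integral>\<^sup>+x. ennreal (exp (l * (F N (snd x) - F N (fst x)))) \<partial>(M \<Otimes>\<^sub>M M))"
      by (rule nn_integral_liminf) measurable
    also have "\<dots> \<le> ennreal (exp (2 * l\<^sup>2 * s2))"
    proof (rule order_trans[OF Liminf_mono])
      show "\<forall>\<^sub>F N in sequentially. (\<integral>\<^sup>+x. ennreal (exp (l * (F N (snd x) - F N (fst x)))) \<partial>(M \<Otimes>\<^sub>M M)) \<le> ennreal (exp (2 * l\<^sup>2 * s2))"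
        unfolding F_def by (intro always_eventually allI concentration_Max[where g = g, OF G _ _ g s2 l]) auto
      show "liminf (\<lambda>N. ennreal (exp (2 * l\<^sup>2 * s2))) \<le> ennreal (exp (2 * l\<^sup>2 * s2))" by (simp add: Liminf_const)
    qed
    finally show ?thesis .
  qed
  have pos: "(\<integral>\<^sup>+a. ennreal (exp (- l * T a)) \<partial>M) \<noteq> 0" for l
  proof
    assume "(\<integral>\<^sup>+a. ennreal (exp (- l * T a)) \<partial>M) = 0"
    then have "AE a in M. ennreal (exp (- l * T a)) = 0" by (subst (asm) nn_integral_0_iff_AE) auto
    then show False using M.AE_False by (simp add: ennreal_eq_0_iff)
  qed
  have "(\<integral>\<^sup>+b. ennreal (exp (1 * T b)) \<partial>M) \<noteq> \<infinity>"
    using two[of 1] pos[of 1] by (auto simp: ennreal_mult_top ennreal_top_mult top_unique)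
  then have fin: "integrable M (\<lambda>b. exp (T b))" by (intro integrableI_nonneg) (auto simp: top.not_eq_extremum)
  show int: "integrable M T"
  proof (rule Bochner_Integration.integrable_bound[OF fin])
    show "AE x in M. norm (T x) \<le> norm (exp (T x))"
    proof (rule AE_I2)
      fix x show "norm (T x) \<le> norm (exp (T x))" using exp_ge_add_one_self[of "T x"] T0[of x] unfolding real_norm_def abs_exp_cancel by linarith
    qed
  qed simp
  show "(\<integral>\<^sup>+w. ennreal (exp (l * T w)) \<partial>M) \<le> ennreal (exp (l * (\<integral>w. T w \<partial>M) + 2 * l\<^sup>2 * s2))" if l: "l \<ge> 0"
  proof -
    define m where "m = (\<integral>w. T w \<partial>M)"
    \<comment> \<open>The tangent line of the exponential at - l m, integrated: Jensen's
      inequality.\<close>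
    have "ennreal (exp (- l * m)) = ennreal (\<integral>a. exp (- l * m) * (1 + (- l * T a - (- l * m))) \<partial>M)"
      using int by (simp add: M.prob_space m_def)
    also have "\<dots> \<le> ennreal (\<integral>a. exp (- l * T a) \<partial>M)"
    proof (intro ennreal_leI integral_mono)
      show "integrable M (\<lambda>a. exp (- l * m) * (1 + (- l * T a - (- l * m))))" using int by simp
      show "integrable M (\<lambda>a. exp (- l * T a))"
        using l T0 by (intro M.integrable_const_bound[where B = 1]) (auto simp: mult_nonneg_nonneg)
      fix a
      have "exp (- l * m) * (1 + (- l * T a - (- l * m))) \<le> exp (- l * m) * exp (- l * T a - (- l * m))"
        by (intro mult_left_mono exp_ge_add_one_self) auto
      then show "exp (- l * m) * (1 + (- l * T a - (- l * m))) \<le> exp (- l * T a)" by (simp add: exp_add[symmetric])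
    qed
    also have "\<dots> = (\<integral>\<^sup>+a. ennreal (exp (- l * T a)) \<partial>M)"
      using l T0 by (intro nn_integral_eq_integral[symmetric] M.integrable_const_bound[where B = 1]) (auto simp: mult_nonneg_nonneg)
    finally have "ennreal (exp (- l * m)) * (\<integral>\<^sup>+b. ennreal (exp (l * T b)) \<partial>M) \<le> ennreal (exp (2 * l\<^sup>2 * s2))"
      by (intro order_trans[OF mult_right_mono two[OF l]]) auto
    then have "ennreal (exp (l * m)) * (ennreal (exp (- l * m)) * (\<integral>\<^sup>+b. ennreal (exp (l * T b)) \<partial>M)) \<le> ennreal (exp (l * m)) * ennreal (exp (2 * l\<^sup>2 * s2))"
      by (rule mult_left_mono) simp
    then show ?thesis by (simp add: mult.assoc[symmetric] ennreal_mult[symmetric] exp_add[symmetric] m_def)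
  qed
qed

section \<open>Moment bounds\<close>

text \<open>The L_p norm of a nonnegative function is at most \<open>B\<close>. The extended
  integral makes finiteness of the moment part of the assertion and lets iterated integrals be
  exchanged without integrability conditions.\<close>

definition Lpb :: "'w measure \<Rightarrow> real \<Rightarrow> ('w \<Rightarrow> real) \<Rightarrow> real \<Rightarrow> bool" where
  "Lpb M p F B \<longleftrightarrow> F \<in> borel_measurable M \<and> (\<forall>w. 0 \<le> F w) \<and> 0 \<le> B \<and>
     (\<integral>\<^sup>+w. ennreal (F w powr p) \<partial>M) \<le> ennreal (B powr p)"

lemma LpbD:
  assumes "Lpb M p F B"
  shows "F \<in> borel_measurable M" "0 \<le> F w" "0 \<le> B" "(\<integral>\<^sup>+w. ennreal (F w powr p) \<partial>M) \<le> ennreal (B powr p)"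
  using assms by (auto simp: Lpb_def)

lemma Lpb_mono:
  assumes "Lpb M p F B" "p > 0" "F' \<in> borel_measurable M" "\<And>w. 0 \<le> F' w" "\<And>w. F' w \<le> F w" "B \<le> B'"
  shows "Lpb M p F' B'"
proof -
  have "(\<integral>\<^sup>+w. ennreal (F' w powr p) \<partial>M) \<le> (\<integral>\<^sup>+w. ennreal (F w powr p) \<partial>M)"
    using assms by (intro nn_integral_mono ennreal_leI powr_mono2) auto
  also have "\<dots> \<le> ennreal (B powr p)" using assms by (auto simp: Lpb_def)
  also have "\<dots> \<le> ennreal (B' powr p)" using assms by (intro ennreal_leI powr_mono2) (auto simp: Lpb_def)
  finally show ?thesis using assms by (auto simp: Lpb_def)
qed

lemma Lpb_cmult:
  assumes "Lpb M p F B" "c \<ge> 0"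
  shows "Lpb M p (\<lambda>w. c * F w) (c * B)"
proof -
  have [measurable]: "F \<in> borel_measurable M" using LpbD[OF assms(1)] by auto
  have "(\<integral>\<^sup>+w. ennreal ((c * F w) powr p) \<partial>M) = (\<integral>\<^sup>+w. ennreal (c powr p) * ennreal (F w powr p) \<partial>M)"
    using assms LpbD(2)[OF assms(1)] by (intro nn_integral_cong) (auto simp: powr_mult ennreal_mult)
  also have "\<dots> = ennreal (c powr p) * (\<integral>\<^sup>+w. ennreal (F w powr p) \<partial>M)" by (rule nn_integral_cmult) simp
  also have "\<dots> \<le> ennreal (c powr p) * ennreal (B powr p)" using LpbD[OF assms(1)] by (intro mult_left_mono) auto
  also have "\<dots> = ennreal ((c * B) powr p)" using assms LpbD[OF assms(1)] by (simp add: powr_mult ennreal_mult)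
  finally show ?thesis using assms LpbD[OF assms(1)] by (auto simp: Lpb_def)
qed

section \<open>Calculus of moment bounds\<close>

lemma powr_add_le:
  fixes a b p :: real
  assumes "a \<ge> 0" "b \<ge> 0" "p > 0"
  shows "(a + b) powr p \<le> 2 powr p * (a powr p + b powr p)"
proof -
  have "(a + b) powr p \<le> (2 * max a b) powr p" using assms by (intro powr_mono2) auto
  also have "\<dots> = 2 powr p * (max a b) powr p" using assms by (simp add: powr_mult)
  also have "(max a b) powr p \<le> a powr p + b powr p" by (auto simp: max_def)
  finally show ?thesis by (simp add: mult_left_mono)
qed

lemma powr_superadditive:
  fixes a b p :: real
  assumes "a \<ge> 0" "b \<ge> 0" "p \<ge> 1"
  shows "a powr p + b powr p \<le> (a + b) powr p"
proof (cases "a + b = 0")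
  case False
  define s where "s = a + b"
  have s: "s > 0" using False assms by (simp add: s_def)
  have *: "x powr p \<le> x / s * s powr p" if "0 \<le> x" "x \<le> s" for x
  proof -
    have "x powr p = (x / s) powr p * s powr p" using that s by (simp add: powr_mult[symmetric])
    also have "(x / s) powr p \<le> (x / s) powr 1"
      using that s assms by (intro powr_mono') auto
    finally show ?thesis using that s by (simp add: mult_right_mono)
  qed
  have "a powr p + b powr p \<le> a / s * s powr p + b / s * s powr p" using assms by (intro add_mono *) (auto simp: s_def)
  also have "\<dots> = (a + b) / s * s powr p" by (simp add: add_divide_distrib algebra_simps)
  also have "\<dots> = s powr p" using s by (simp add: s_def)
  finally show ?thesis by (simp add: s_def)
next
  case True
  then have "a = 0" "b = 0" using assms by auto
  then show ?thesis by simp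
qed

text \<open>The factor 2, independent of p, comes from using (x + y)^p <= 2^p (x^p + y^p) and
  superadditivity of powers in place of Minkowski's inequality.\<close>

lemma Lpb_add:
  assumes F: "Lpb M p F B" and H: "Lpb M p H C" and p: "p \<ge> 1"
  shows "Lpb M p (\<lambda>w. F w + H w) (2 * (B + C))"
proof -
  note f = LpbD[OF F] and h = LpbD[OF H]
  have [measurable]: "F \<in> borel_measurable M" "H \<in> borel_measurable M" using f h by auto
  have "(\<integral>\<^sup>+w. ennreal ((F w + H w) powr p) \<partial>M) \<le> (\<integral>\<^sup>+w. ennreal (2 powr p) * (ennreal (F w powr p) + ennreal (H w powr p)) \<partial>M)"
    using f h p powr_add_le[of "F _" "H _" p]
    by (intro nn_integral_mono) (auto simp: ennreal_mult[symmetric] ennreal_plus[symmetric] simp del: ennreal_plus intro!: ennreal_leI)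
  also have "\<dots> = ennreal (2 powr p) * ((\<integral>\<^sup>+w. ennreal (F w powr p) \<partial>M) + (\<integral>\<^sup>+w. ennreal (H w powr p) \<partial>M))"
    by (subst nn_integral_cmult, simp, subst nn_integral_add) auto
  also have "\<dots> \<le> ennreal (2 powr p) * (ennreal (B powr p) + ennreal (C powr p))"
    using f h by (intro mult_left_mono add_mono) auto
  also have "\<dots> = ennreal (2 powr p * (B powr p + C powr p))" by (simp add: ennreal_mult ennreal_plus)
  also have "\<dots> \<le> ennreal (2 powr p * (B + C) powr p)"
    using f h p by (intro ennreal_leI mult_left_mono powr_superadditive) auto
  also have "\<dots> = ennreal ((2 * (B + C)) powr p)" using f h by (subst powr_mult) auto
  finally show ?thesis using f h by (auto simp: Lpb_def)
qed

lemma Lpb_const: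
  assumes "prob_space M" "c \<ge> 0"
  shows "Lpb M p (\<lambda>_. c) c"
  using assms by (simp add: Lpb_def prob_space.emeasure_space_1)

lemma Lpb_powr:
  assumes "Lpb M p F B" "s > 0"
  shows "Lpb M (p / s) (\<lambda>w. F w powr s) (B powr s)"
  using assms by (auto simp: Lpb_def powr_powr)

text \<open>The elementary inequality \<open>x\<^sup>q \<le> 1 + q (x - 1)\<close> for \<open>q \<le> 1\<close> replaces Jensen's inequality.\<close>

lemma powr_le_affine:
  fixes x q :: real
  assumes "x \<ge> 0" "0 < q" "q \<le> 1"
  shows "x powr q \<le> 1 + q * (x - 1)"
proof (cases "x = 0")
  case False
  then have x: "x > 0" using assms by simp
  have "x powr q * 1 powr (1 - q) \<le> q * x + (1 - q) * 1"
    using x assms by (intro Youngs_inequality_0) auto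
  then show ?thesis by (simp add: algebra_simps)
qed (use assms in auto)

text \<open>On a probability space moment bounds pass to lower orders: the affine bound for powers
  is applied to (F / B)^p with the exponent q / p.\<close>

lemma Lpb_lower:
  assumes "prob_space M" and F: "Lpb M p F B" and q: "0 < q" "q \<le> p"
  shows "Lpb M q F B"
proof (cases "B = 0")
  case True
  note f = LpbD[OF F]
  have [measurable]: "F \<in> borel_measurable M" using f by auto
  have "(\<integral>\<^sup>+w. ennreal (F w powr p) \<partial>M) = 0" using f(4) True q by simp
  then have "AE w in M. F w = 0" using f by (subst (asm) nn_integral_0_iff_AE) (auto simp: ennreal_eq_0_iff)
  then have "(\<integral>\<^sup>+w. ennreal (F w powr q) \<partial>M) = 0" by (subst nn_integral_0_iff_AE) (auto simp: ennreal_eq_0_iff)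
  then show ?thesis using f True by (simp add: Lpb_def)
next
  case False
  interpret prob_space M by fact
  note f = LpbD[OF F]
  have [measurable]: "F \<in> borel_measurable M" using f by auto
  have B: "B > 0" using False f by simp
  define r where "r = q / p"
  have r: "0 < r" "r \<le> 1" "q = p * r" using q by (auto simp: r_def)
  have pt: "F w powr q \<le> B powr q * (1 - r) + B powr q * r / B powr p * F w powr p" for w
  proof -
    have "(F w / B) powr q = ((F w / B) powr p) powr r" by (simp add: powr_powr r(3))
    also have "\<dots> \<le> 1 + r * ((F w / B) powr p - 1)" using r by (intro powr_le_affine) auto
    finally have "B powr q * (F w / B) powr q \<le> B powr q * (1 + r * ((F w / B) powr p - 1))" by (intro mult_left_mono) auto
    moreover have "B powr q * (F w / B) powr q = F w powr q" "(F w / B) powr p = F w powr p / B powr p" using B f by (auto simp: powr_divide)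
    ultimately show ?thesis by (simp add: algebra_simps)
  qed
  have "(\<integral>\<^sup>+w. ennreal (F w powr q) \<partial>M) \<le> (\<integral>\<^sup>+w. ennreal (B powr q * (1 - r)) + ennreal (B powr q * r / B powr p) * ennreal (F w powr p) \<partial>M)"
    using pt r by (intro nn_integral_mono) (auto simp: ennreal_mult[symmetric] ennreal_plus[symmetric] simp del: ennreal_plus intro!: ennreal_leI)
  also have "\<dots> = ennreal (B powr q * (1 - r)) + ennreal (B powr q * r / B powr p) * (\<integral>\<^sup>+w. ennreal (F w powr p) \<partial>M)"
    by (subst nn_integral_add) (auto simp: nn_integral_cmult emeasure_space_1)
  also have "\<dots> \<le> ennreal (B powr q * (1 - r)) + ennreal (B powr q * r / B powr p) * ennreal (B powr p)"
    using f by (intro add_left_mono mult_left_mono) auto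
  also have "\<dots> = ennreal (B powr q * (1 - r) + B powr q * r)"
    using r B by (subst ennreal_mult[symmetric]) (auto simp: ennreal_plus[symmetric] simp del: ennreal_plus)
  also have "B powr q * (1 - r) + B powr q * r = B powr q" by (simp add: algebra_simps)
  finally show ?thesis using f by (simp add: Lpb_def)
qed

lemma Lpb_integral:
  assumes "prob_space M" and F: "Lpb M p F B" and p: "p \<ge> 1"
  shows "integrable M F" "(\<integral>w. F w \<partial>M) \<le> B"
proof -
  have 1: "Lpb M 1 F B" using p by (intro Lpb_lower[OF assms(1,2)]) auto
  note f = LpbD[OF 1]
  have le: "(\<integral>\<^sup>+w. ennreal (F w) \<partial>M) \<le> ennreal B" using f by simp
  then have "(\<integral>\<^sup>+w. ennreal (F w) \<partial>M) < \<infinity>" by (auto intro: le_less_trans)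
  then show i: "integrable M F" using f by (intro integrableI_nonneg) auto
  have "ennreal (\<integral>w. F w \<partial>M) \<le> ennreal B" using le nn_integral_eq_integral[OF i] f by simp
  then show "(\<integral>w. F w \<partial>M) \<le> B" using f by (simp add: ennreal_le_iff)
qed

text \<open>Jensen's inequality for powers, with an infinite right-hand side allowed; it turns a
  mean over an independent copy into a moment over that copy.\<close>

lemma integral_powr_le:
  assumes M: "prob_space M" and F: "F \<in> borel_measurable M" "\<And>w. 0 \<le> F w" and p: "p \<ge> 1"
  shows "ennreal ((\<integral>w. F w \<partial>M) powr p) \<le> (\<integral>\<^sup>+w. ennreal (F w powr p) \<partial>M)"
proof (cases "\<integral>\<^sup>+w. ennreal (F w powr p) \<partial>M")
  case (real r)
  then have "Lpb M p F (r powr (1 / p))" using F p by (auto simp: Lpb_def powr_powr)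
  from Lpb_integral(2)[OF M this p] have "(\<integral>w. F w \<partial>M) powr p \<le> (r powr (1 / p)) powr p"
    using F p by (intro powr_mono2) (auto intro: integral_nonneg)
  then show ?thesis using real p by (simp add: powr_powr ennreal_leI)
qed simp

text \<open>From x <= e^(x - 1) one gets T^p <= (D / e)^p exp (l T) with l = p / D. The hypothesis
  on \<open>D\<close> gives l m <= p and 2 l^2 v <= p, so the exponent - p + l m + 2 l^2 v is at
  most p.\<close>

lemma Lpb_of_mgf:
  assumes T: "T \<in> borel_measurable M" "\<And>w. 0 \<le> T w" and p: "p > 0" and v: "v \<ge> 0"
    and D: "D \<ge> m + sqrt (2 * p * v)" "m \<ge> 0"
    and mgf: "\<And>l. l \<ge> 0 \<Longrightarrow> (\<integral>\<^sup>+w. ennreal (exp (l * T w)) \<partial>M) \<le> ennreal (exp (l * m + 2 * l\<^sup>2 * v))"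
  shows "Lpb M p T (exp 1 * D)"
proof -
  have main: "(\<integral>\<^sup>+w. ennreal (T w powr p) \<partial>M) \<le> ennreal ((exp 1 * D) powr p)" if D0: "D > 0" and D: "D \<ge> m + sqrt (2 * p * v)" for D
  proof -
    define l where "l = p / D"
    have l: "l > 0" using p D0 by (simp add: l_def)
    have pt: "T w powr p \<le> D powr p * exp (- p) * exp (l * T w)" for w
    proof -
      have "T w / D \<le> exp (T w / D - 1)" using exp_ge_add_one_self[of "T w / D - 1"] by simp
      then have "(T w / D) powr p \<le> exp (T w / D - 1) powr p" using T D0 p by (intro powr_mono2) auto
      also have "\<dots> = exp (l * T w - p)" by (simp add: powr_def l_def algebra_simps)
      finally have "D powr p * (T w / D) powr p \<le> D powr p * exp (l * T w - p)" by (intro mult_left_mono) auto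
      moreover have "D powr p * (T w / D) powr p = T w powr p" using D0 T by (simp add: powr_divide)
      ultimately show ?thesis by (simp add: exp_diff exp_minus field_simps)
    qed
    have "(\<integral>\<^sup>+w. ennreal (T w powr p) \<partial>M) \<le> (\<integral>\<^sup>+w. ennreal (D powr p * exp (- p)) * ennreal (exp (l * T w)) \<partial>M)"
      using pt by (intro nn_integral_mono) (auto simp: ennreal_mult[symmetric] intro!: ennreal_leI)
    also have "\<dots> = ennreal (D powr p * exp (- p)) * (\<integral>\<^sup>+w. ennreal (exp (l * T w)) \<partial>M)"
      using T by (intro nn_integral_cmult) auto
    also have "\<dots> \<le> ennreal (D powr p * exp (- p)) * ennreal (exp (l * m + 2 * l\<^sup>2 * v))"
      using l by (intro mult_left_mono mgf) auto
    also have "\<dots> = ennreal (D powr p * exp (- p + l * m + 2 * l\<^sup>2 * v))" by (simp add: ennreal_mult[symmetric] exp_add[symmetric] mult.assoc)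
    also have "\<dots> \<le> ennreal (D powr p * exp p)"
    proof (intro ennreal_leI mult_left_mono)
      have sq: "sqrt (2 * p * v) \<ge> 0" using p v by simp
      have "m \<le> D" using D sq by linarith
      then have "l * m \<le> p" using p D0 unfolding l_def by (simp add: field_simps)
      moreover have "2 * p * v \<le> D\<^sup>2"
      proof -
        have "(sqrt (2 * p * v))\<^sup>2 \<le> D\<^sup>2" using D sq assms(6) by (intro power_mono) auto
        then show ?thesis using p v by simp
      qed
      then have "2 * l\<^sup>2 * v \<le> p" using p D0 by (simp add: l_def power_divide power2_eq_square field_simps)
      ultimately show "exp (- p + l * m + 2 * l\<^sup>2 * v) \<le> exp p" by simp
    qed auto
    also have "D powr p * exp p = (exp 1 * D) powr p" using D0 by (simp add: powr_def exp_add[symmetric] ln_mult algebra_simps)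
    finally show ?thesis .
  qed
  have D0: "D \<ge> 0" using D p v by (auto intro: order_trans[rotated])
  have "(\<integral>\<^sup>+w. ennreal (T w powr p) \<partial>M) \<le> ennreal ((exp 1 * D) powr p)"
  proof (cases "D = 0")
    case True
    \<comment> \<open>For D = 0 every positive number is an admissible bound in place of
      \<open>D\<close>; letting it decrease to 0 makes the moment vanish.\<close>
    have "(\<integral>\<^sup>+w. ennreal (T w powr p) \<partial>M) \<le> ennreal e" if e: "e > 0" for e
    proof -
      have "D \<le> e powr (1 / p) / exp 1" using True by simp
      then have "(\<integral>\<^sup>+w. ennreal (T w powr p) \<partial>M) \<le> ennreal ((exp 1 * (e powr (1 / p) / exp 1)) powr p)"
        using D e by (intro main) (auto intro: order_trans)
      then show ?thesis using e p by (simp add: powr_powr)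
    qed
    then have "(\<integral>\<^sup>+w. ennreal (T w powr p) \<partial>M) \<le> 0" by (rule ennreal_le_epsilon[of 0, unfolded add_0])
    then show ?thesis by simp
  next
    case False
    then show ?thesis using main D D0 by auto
  qed
  then show ?thesis using T D0 by (simp add: Lpb_def)
qed

lemma Lpb_SUP:
  fixes g :: "nat \<Rightarrow> 'w \<Rightarrow> real"
  assumes G: "gaussian_space M G" and g: "\<And>i. g i \<in> G" and s2: "\<And>i. (\<integral>w. (g i w)\<^sup>2 \<partial>M) \<le> s2"
    and bdd: "\<And>w. bdd_above (range (\<lambda>i. g i w))" and T: "\<And>w. T w = (SUP i. g i w)" and T0: "\<And>w. 0 \<le> T w"
    and p: "p > 0" and D: "D \<ge> (\<integral>w. T w \<partial>M) + sqrt (2 * p * s2)"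
  shows "Lpb M p T (exp 1 * D)"
proof (rule Lpb_of_mgf[where m = "\<integral>w. T w \<partial>M" and v = s2])
  show "T \<in> borel_measurable M" using concentration_SUP(1)[where g = g, OF G g s2 bdd T T0] by auto
  have "0 \<le> (\<integral>w. (g 0 w)\<^sup>2 \<partial>M)" by simp
  then show "0 \<le> s2" using s2[of 0] by linarith
  show "0 \<le> (\<integral>w. T w \<partial>M)" using T0 by simp
qed (use T0 p D concentration_SUP(2)[where g = g, OF G g s2 bdd T T0] in auto)

section \<open>Gaussian vectors and sums of tensors\<close>

lemma borel_measurable_blinfun_apply:
  fixes u :: "'a::{real_normed_vector, second_countable_topology} \<Rightarrow>\<^sub>L 'b::real_normed_vector"
  assumes "f \<in> borel_measurable M"
  shows "(\<lambda>w. u (f w)) \<in> borel_measurable M"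
  using assms by (rule borel_measurable_continuous_on[OF linear_continuous_on[OF blinfun.bounded_linear_right]])

text \<open>The norming coordinates of all members of the family generate the product of the Borel
  sets, so uniqueness for the real coordinates is uniqueness for the vectors.\<close>

theorem gaussian_vector_law_unique:
  fixes X :: "'i \<Rightarrow> 'w \<Rightarrow> 'a::{real_normed_vector, second_countable_topology}" and Y :: "'i \<Rightarrow> 'v \<Rightarrow> 'a"
  assumes G: "gaussian_space M G" and H: "gaussian_space N H"
    and X: "\<And>i. X i \<in> borel_measurable M" and Y: "\<And>i. Y i \<in> borel_measurable N"
    and g: "\<And>i (u :: 'a dual). (\<lambda>w. u (X i w)) \<in> G" and h: "\<And>i (u :: 'a dual). (\<lambda>w. u (Y i w)) \<in> H"
    and cov: "\<And>i j (u :: 'a dual) (v :: 'a dual). (\<integral>w. u (X i w) * v (X j w) \<partial>M) = (\<integral>w. u (Y i w) * v (Y j w) \<partial>N)"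
  shows "distr M (PiM UNIV (\<lambda>_. borel)) (\<lambda>w i. X i w) = distr N (PiM UNIV (\<lambda>_. borel)) (\<lambda>w i. Y i w)"
proof -
  let ?P = "PiM UNIV (\<lambda>_::'i. borel :: 'a measure)" and ?R = "PiM UNIV (\<lambda>_::'i \<times> nat. borel :: real measure)"
  define J :: "('i \<Rightarrow> 'a) \<Rightarrow> 'i \<times> nat \<Rightarrow> real" where "J = (\<lambda>x (i, k). norming k (x i))"
  have law: "distr M ?R (\<lambda>w ik. J (\<lambda>i. X i w) ik) = distr N ?R (\<lambda>w ik. J (\<lambda>i. Y i w) ik)"
  proof (rule gaussian_law_unique[where g = "\<lambda>ik w. J (\<lambda>i. X i w) ik" and h = "\<lambda>ik w. J (\<lambda>i. Y i w) ik", OF G H])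
    show "(\<lambda>w. J (\<lambda>i. X i w) ik) \<in> G" "(\<lambda>w. J (\<lambda>i. Y i w) ik) \<in> H" for ik
      using g h by (cases ik; simp add: J_def)+
    show "(\<integral>w. J (\<lambda>i. X i w) ik * J (\<lambda>i. X i w) jl \<partial>M) = (\<integral>w. J (\<lambda>i. Y i w) ik * J (\<lambda>i. Y i w) jl \<partial>N)" for ik jl
      using cov by (cases ik; cases jl; simp add: J_def)
  qed
  have mX: "(\<lambda>w i. X i w) \<in> M \<rightarrow>\<^sub>M ?P" and mY: "(\<lambda>w i. Y i w) \<in> N \<rightarrow>\<^sub>M ?P" using X Y by (auto intro!: measurable_PiM_single')
  have mJ: "J \<in> ?P \<rightarrow>\<^sub>M ?R"
  proof (rule measurable_PiM_single')
    fix ik :: "'i \<times> nat"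
    show "(\<lambda>x. J x ik) \<in> borel_measurable ?P" by (cases ik) (auto simp: J_def intro!: borel_measurable_blinfun_apply)
  qed auto
  \<comment> \<open>Measurability of the identity says that every set of the product sigma-algebra
    is a preimage under the coordinate map \<open>J\<close>.\<close>
  have id: "(\<lambda>x. x) \<in> vimage_algebra UNIV J ?R \<rightarrow>\<^sub>M ?P"
  proof (rule measurable_PiM_single')
    fix i :: 'i
    show "(\<lambda>x. x i) \<in> borel_measurable (vimage_algebra UNIV J ?R)"
    proof (rule borel_measurable_norming)
      fix k
      have "J \<in> vimage_algebra UNIV J ?R \<rightarrow>\<^sub>M ?R" by (rule measurable_vimage_algebra1) (auto simp: space_PiM)
      then have "(\<lambda>x. J x (i, k)) \<in> borel_measurable (vimage_algebra UNIV J ?R)"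
        by (rule measurable_compose) simp
      then show "(\<lambda>x. norming k (x i)) \<in> borel_measurable (vimage_algebra UNIV J ?R)" by (simp add: J_def)
    qed
  qed auto
  show ?thesis
  proof (rule measure_eqI)
    fix A assume "A \<in> sets (distr M ?P (\<lambda>w i. X i w))"
    then have A: "A \<in> sets ?P" by simp
    have "A \<in> sets (vimage_algebra UNIV J ?R)" using measurable_sets[OF id A] by simp
    then obtain C where C: "C \<in> sets ?R" "A = J -` C" by (auto simp: sets_vimage_algebra2[of J UNIV ?R] space_PiM)
    have "emeasure (distr M ?P (\<lambda>w i. X i w)) A = emeasure (distr M ?R (\<lambda>w. J (\<lambda>i. X i w))) C"
      using A C mX measurable_compose[OF mX mJ] by (simp add: emeasure_distr vimage_def)
    also have "\<dots> = emeasure (distr N ?R (\<lambda>w. J (\<lambda>i. Y i w))) C" using law by simp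
    also have "\<dots> = emeasure (distr N ?P (\<lambda>w i. Y i w)) A"
      using A C mY measurable_compose[OF mY mJ] by (simp add: emeasure_distr vimage_def)
    finally show "emeasure (distr M ?P (\<lambda>w i. X i w)) A = emeasure (distr N ?P (\<lambda>w i. Y i w)) A" .
  qed simp
qed

section \<open>Rank-one operators and norms of their sums\<close>

lift_definition tens :: "'a::real_normed_vector \<Rightarrow> 'a \<Rightarrow> 'a opr"
  is "\<lambda>x y u. blinfun_apply u x *\<^sub>R y"
  by (intro bounded_linear_scaleR_left[THEN bounded_linear_compose] blinfun.bounded_linear_left)

lemma norm_tens_le: "norm (tens x y) \<le> norm x * norm y"
proof (rule norm_blinfun_bound)
  fix u :: "'a dual"
  have "norm (tens x y u) = \<bar>u x\<bar> * norm y" by (simp add: tens.rep_eq)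
  also have "\<dots> \<le> (norm u * norm x) * norm y" using norm_blinfun[of u x] by (intro mult_right_mono) auto
  finally show "norm (tens x y u) \<le> norm x * norm y * norm u" by (simp add: ac_simps)
qed simp

lemma bounded_bilinear_tens: "bounded_bilinear tens"
proof
  show "\<exists>K. \<forall>a b. norm (tens a b) \<le> norm a * norm b * K" using norm_tens_le by (intro exI[of _ 1]) auto
qed (auto intro!: blinfun_eqI simp: tens.rep_eq plus_blinfun.rep_eq scaleR_blinfun.rep_eq blinfun.add_right blinfun.scaleR_right algebra_simps)

definition tsum :: "nat \<Rightarrow> (nat \<Rightarrow> 'a::real_normed_vector) \<Rightarrow> (nat \<Rightarrow> 'a) \<Rightarrow> 'a opr" where
  "tsum n x y = (\<Sum>j=1..n. tens (x j) (y j))"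

lemma tsum_apply: "tsum n x y u = (\<Sum>j=1..n. u (x j) *\<^sub>R y j)"
proof -
  have "blinfun_apply (\<Sum>j\<in>J. tens (x j) (y j)) u = (\<Sum>j\<in>J. u (x j) *\<^sub>R y j)" if "finite J" for J
    using that by (induction J rule: finite_induct) (auto simp: plus_blinfun.rep_eq tens.rep_eq)
  then show ?thesis by (simp add: tsum_def)
qed

lemma sample_cov_eq_tsum: "sample_cov n x = (1 / real n) *\<^sub>R tsum n x x"
  by (rule blinfun_eqI) (simp add: sample_cov.rep_eq scaleR_blinfun.rep_eq tsum_apply)

lemma tsum_pair_le: "(\<Sum>j=1..n. u (x j) * v (y j)) \<le> norm u * norm v * norm (tsum n x y)"
  for u v :: "'a::real_normed_vector dual"
proof -
  have "(\<Sum>j=1..n. u (x j) * v (y j)) = v (tsum n x y u)"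
    by (simp add: tsum_apply blinfun.sum_right blinfun.scaleR_right)
  also have "\<dots> \<le> norm v * norm (tsum n x y u)" using norm_blinfun[of v "tsum n x y u"] by simp
  also have "\<dots> \<le> norm v * (norm (tsum n x y) * norm u)" by (intro mult_left_mono norm_blinfun) auto
  finally show ?thesis by (simp add: ac_simps)
qed

text \<open>Transposition: \<open>norming l\<close> applied to T v equals v applied to a vector z of
  the space, whose norm is tested by the norming sequence again. Thus countably many pairs control
  all v, even when the dual is not separable.\<close>

lemma norm_tsum_le:
  fixes x y :: "nat \<Rightarrow> 'a::{real_normed_vector, second_countable_topology}"
  assumes le: "\<And>i l. (\<Sum>j=1..n. blinfun_apply (norming i) (x j) * blinfun_apply (norming l) (y j)) \<le> B" and B: "0 \<le> B"
  shows "norm (tsum n x y) \<le> B"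
proof (rule norm_blinfun_bound[OF B])
  fix v :: "'a dual"
  show "norm (tsum n x y v) \<le> B * norm v"
  proof (rule norm_le_norming)
    fix l
    define z where "z = (\<Sum>j=1..n. blinfun_apply (norming l) (y j) *\<^sub>R x j)"
    have "norm z \<le> B"
      using le by (intro norm_le_norming) (simp add: z_def blinfun.sum_right blinfun.scaleR_right mult.commute)
    have "norming l (tsum n x y v) = v z"
      by (simp add: tsum_apply z_def blinfun.sum_right blinfun.scaleR_right mult.commute)
    also have "\<dots> \<le> norm v * norm z" using norm_blinfun[of v z] by simp
    also have "\<dots> \<le> norm v * B" using \<open>norm z \<le> B\<close> by (intro mult_left_mono) auto
    finally show "norming l (tsum n x y v) \<le> B * norm v" by (simp add: mult.commute)
  qed
qed

lemma norming_pair_le: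
  "(\<Sum>j=1..n. blinfun_apply (norming i) (x j) * blinfun_apply (norming l) (y j)) \<le> norm (tsum n x y)"
proof -
  have "norm (norming i :: 'a dual) * norm (norming l :: 'a dual) * norm (tsum n x y) \<le> 1 * 1 * norm (tsum n x y)"
    by (intro mult_mono norm_norming) auto
  then show ?thesis using tsum_pair_le[where u = "norming i" and v = "norming l" and x = x and y = y and n = n] by simp
qed

text \<open>The norm depends only on the bilinear form on pairs of functionals, and swapping the
  families transposes that form.\<close>

lemma norm_tsum_commute: "norm (tsum n x y) = norm (tsum n y x)"
  for x y :: "nat \<Rightarrow> 'a::{real_normed_vector, second_countable_topology}"
proof -
  have "norm (tsum n x y) \<le> norm (tsum n y x)" for x y :: "nat \<Rightarrow> 'a"
  proof (rule norm_tsum_le)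
    fix i l
    show "(\<Sum>j=1..n. blinfun_apply (norming i) (x j) * blinfun_apply (norming l) (y j)) \<le> norm (tsum n y x)"
      using norming_pair_le[where i = l and l = i and x = y and y = x and n = n] by (simp add: mult.commute)
  qed simp
  then show ?thesis by (intro antisym)
qed

text \<open>Pairs of indices are encoded by one natural number, so that the norm is a supremum along
  a sequence, the form in which concentration is stated.\<close>

lemma norm_tsum_SUP:
  fixes x y :: "nat \<Rightarrow> 'a::{real_normed_vector, second_countable_topology}" and n :: nat
  defines "f \<equiv> \<lambda>k. \<Sum>j=1..n. blinfun_apply (norming (fst (prod_decode k))) (x j) * blinfun_apply (norming (snd (prod_decode k))) (y j)"
  shows "bdd_above (range f)" "norm (tsum n x y) = (SUP k. f k)"
proof -
  have le: "f k \<le> norm (tsum n x y)" for k unfolding f_def by (rule norming_pair_le)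
  then show bdd: "bdd_above (range f)" by (intro bdd_aboveI[where M = "norm (tsum n x y)"]) auto
  show "norm (tsum n x y) = (SUP k. f k)"
  proof (rule antisym)
    show "(SUP k. f k) \<le> norm (tsum n x y)" by (intro cSUP_least le) auto
    have 1: "(\<Sum>j=1..n. blinfun_apply (norming i) (x j) * blinfun_apply (norming l) (y j)) \<le> (SUP k. f k)" for i l
      using cSUP_upper[OF UNIV_I bdd, of "prod_encode (i, l)"] by (simp add: f_def)
    \<comment> \<open>\<open>norm_tsum_le\<close> asks for a nonnegative bound. Some norming
      functional comes arbitrarily close to the norm of a vector from below, so its value there
      exceeds any given negative number.\<close>
    have "0 \<le> (SUP k. f k)"
    proof (rule ccontr)
      assume neg: "\<not> 0 \<le> (SUP k. f k)"
      define e where "e = - (SUP k. f k)"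
      have e: "e > 0" using neg by (simp add: e_def)
      define z where "z = (\<Sum>j=1..n. blinfun_apply (norming 0) (y j) *\<^sub>R x j)"
      obtain i where "norm z - e < norming i z" using norming_approx[OF e, of z] by blast
      then have "- e < norming i z" using norm_ge_zero[of z] by linarith
      moreover have "norming i z = (\<Sum>j=1..n. blinfun_apply (norming i) (x j) * blinfun_apply (norming 0) (y j))"
        by (simp add: z_def blinfun.sum_right blinfun.scaleR_right mult.commute)
      ultimately show False using 1[of i 0] by (simp add: e_def)
    qed
    then show "norm (tsum n x y) \<le> (SUP k. f k)" by (intro norm_tsum_le 1)
  qed
qed

lemma continuous_on_tsum:
  fixes f g :: "'s::topological_space \<Rightarrow> nat \<Rightarrow> 'a::real_normed_vector"
  assumes "\<And>j. continuous_on UNIV (\<lambda>z. f z j)" "\<And>j. continuous_on UNIV (\<lambda>z. g z j)"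
  shows "continuous_on UNIV (\<lambda>z. tsum n (f z) (g z))"
  unfolding tsum_def using assms by (intro continuous_on_sum bounded_bilinear.continuous_on[OF bounded_bilinear_tens])

text \<open>For a countable family in a second countable space the product sigma-algebra is the
  Borel one. Functions continuous in the sample vectors are therefore measurable, without
  separability of the space of operators.\<close>

lemma borel_measurable_continuous_family:
  fixes F :: "('i::countable \<Rightarrow> 'a::second_countable_topology) \<Rightarrow> 'b::topological_space"
  assumes F: "continuous_on UNIV F" and X: "\<And>i. X i \<in> borel_measurable M"
  shows "(\<lambda>w. F (\<lambda>i. X i w)) \<in> borel_measurable M"
proof -
  have "F \<in> borel_measurable borel" by (rule borel_measurable_continuous_onI[OF F])
  then have "F \<in> borel_measurable (PiM UNIV (\<lambda>_. borel))" using measurable_cong_sets[OF sets_PiM_equal_borel refl] by blast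
  moreover have "(\<lambda>w i. X i w) \<in> M \<rightarrow>\<^sub>M PiM UNIV (\<lambda>_. borel)" using X by (auto intro!: measurable_PiM_single')
  ultimately show ?thesis by (rule measurable_compose[rotated])
qed

text \<open>Independence is encoded as vanishing covariance inside a Gaussian space. Vectors with an
  index outside {1..n} have covariance 0, so the family is defined on all natural numbers while only
  the sample contributes.\<close>

locale gaussian_sample =
  fixes M :: "'w measure" and G :: "('w \<Rightarrow> real) set" and S :: "'a::{banach, second_countable_topology} opr"
    and Y :: "nat \<Rightarrow> 'w \<Rightarrow> 'a" and n :: nat
  assumes G: "gaussian_space M G"
    and Y_measurable: "\<And>j. Y j \<in> borel_measurable M"
    and Y_mem: "\<And>j (u :: 'a dual). (\<lambda>w. blinfun_apply u (Y j w)) \<in> G"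
    and Y_cov: "\<And>i j (u :: 'a dual) (v :: 'a dual). (\<integral>w. blinfun_apply u (Y i w) * blinfun_apply v (Y j w) \<partial>M) = (if i = j \<and> i \<in> {1..n} then blinfun_apply v (blinfun_apply S u) else 0)"
    and n: "1 \<le> n"
begin

sublocale prob_space M by (rule gaussian_spaceD(1)[OF G])

text \<open>\<open>sg\<close> bounds the standard deviation of u (Y 1) over unit functionals u, the
  weak scale; \<open>xi\<close> is the mean norm, the strong scale.\<close>

definition sg :: real where "sg = sqrt (norm S)"
definition xi :: real where "xi = (\<integral>w. norm (Y 1 w) \<partial>M)"

lemma sg_nonneg: "0 \<le> sg" and sg_square: "sg\<^sup>2 = norm S" and xi_nonneg: "0 \<le> xi"
  by (auto simp: sg_def xi_def)

lemma cov_le: "blinfun_apply v (blinfun_apply S u) \<le> norm u * norm v * sg\<^sup>2"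
proof -
  have "v (S u) \<le> norm v * norm (S u)" using norm_blinfun[of v "S u"] by simp
  also have "\<dots> \<le> norm v * (norm S * norm u)" by (intro mult_left_mono norm_blinfun) auto
  finally show ?thesis by (simp add: sg_square ac_simps)
qed

lemma var_nonneg: "0 \<le> blinfun_apply u (blinfun_apply S u)"
proof -
  have "(\<integral>w. u (Y 1 w) * u (Y 1 w) \<partial>M) \<ge> 0" by simp
  then show ?thesis using n by (simp add: Y_cov)
qed

lemma lin_mem: "(\<lambda>w. \<Sum>j=1..n. blinfun_apply (u j) (Y j w)) \<in> G"
  using gaussian_space_sum[OF G, of "{1..n}" "\<lambda>j w. u j (Y j w)" "\<lambda>_. 1"] Y_mem by simp

lemma lin_cov: "(\<integral>w. (\<Sum>j=1..n. blinfun_apply (u j) (Y j w)) * (\<Sum>j=1..n. blinfun_apply (v j) (Y j w)) \<partial>M) = (\<Sum>j=1..n. blinfun_apply (v j) (blinfun_apply S (u j)))"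
proof -
  have "(\<integral>w. (\<Sum>j=1..n. u j (Y j w)) * (\<Sum>j=1..n. v j (Y j w)) \<partial>M) = (\<Sum>i=1..n. \<Sum>j=1..n. \<integral>w. u i (Y i w) * v j (Y j w) \<partial>M)"
    using gaussian_space_integrable_mult[OF G Y_mem Y_mem] by (simp add: sum_product Bochner_Integration.integral_sum)
  also have "\<dots> = (\<Sum>i=1..n. \<Sum>j=1..n. if i = j then blinfun_apply (v j) (blinfun_apply S (u i)) else 0)" by (intro sum.cong refl) (auto simp: Y_cov)
  finally show ?thesis by simp
qed

lemma lin_var: "(\<integral>w. (\<Sum>j=1..n. blinfun_apply (u j) (Y j w))\<^sup>2 \<partial>M) = (\<Sum>j=1..n. blinfun_apply (u j) (blinfun_apply S (u j)))"
  using lin_cov[of u u] by (simp add: power2_eq_square)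

lemma Lpb_norm_lin:
  assumes p: "p > 0"
  shows "integrable M (\<lambda>w. norm (\<Sum>j=1..n. a j *\<^sub>R Y j w))"
    "Lpb M p (\<lambda>w. norm (\<Sum>j=1..n. a j *\<^sub>R Y j w)) (exp 1 * ((\<integral>w. norm (\<Sum>j=1..n. a j *\<^sub>R Y j w) \<partial>M) + sqrt (2 * p * (sg\<^sup>2 * (\<Sum>j=1..n. (a j)\<^sup>2)))))"
proof -
  define g where "g = (\<lambda>i w. \<Sum>j=1..n. blinfun_apply (a j *\<^sub>R norming i) (Y j w))"
  have eq: "g i w = norming i (\<Sum>j=1..n. a j *\<^sub>R Y j w)" for i w
    by (simp add: g_def blinfun.sum_right blinfun.scaleR_right scaleR_blinfun.rep_eq)
  have g: "g i \<in> G" for i unfolding g_def by (rule lin_mem)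
  have var: "(\<integral>w. (g i w)\<^sup>2 \<partial>M) \<le> sg\<^sup>2 * (\<Sum>j=1..n. (a j)\<^sup>2)" for i
  proof -
    have "(\<integral>w. (g i w)\<^sup>2 \<partial>M) = (\<Sum>j=1..n. (a j)\<^sup>2 * norming i (S (norming i)))"
      unfolding g_def lin_var by (simp add: scaleR_blinfun.rep_eq blinfun.scaleR_right power2_eq_square ac_simps)
    also have "\<dots> \<le> (\<Sum>j=1..n. (a j)\<^sup>2 * sg\<^sup>2)"
    proof (intro sum_mono mult_left_mono)
      have "norming i (S (norming i)) \<le> norm (norming i :: 'a dual) * norm (norming i :: 'a dual) * sg\<^sup>2" by (rule cov_le)
      also have "\<dots> \<le> 1 * 1 * sg\<^sup>2" by (intro mult_mono norm_norming) auto
      finally show "norming i (S (norming i)) \<le> sg\<^sup>2" by simp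
    qed auto
    finally show ?thesis by (simp add: sum_distrib_left mult.commute)
  qed
  have bdd: "bdd_above (range (\<lambda>i. g i w))" for w
    unfolding eq using norming_le by (intro bdd_aboveI[where M = "norm (\<Sum>j=1..n. a j *\<^sub>R Y j w)"]) auto
  have T: "norm (\<Sum>j=1..n. a j *\<^sub>R Y j w) = (SUP i. g i w)" for w unfolding eq by (rule norm_eq_SUP_norming)
  show "integrable M (\<lambda>w. norm (\<Sum>j=1..n. a j *\<^sub>R Y j w))"
    by (rule concentration_SUP(1)[where g = g, OF G g var bdd T]) simp
  show "Lpb M p (\<lambda>w. norm (\<Sum>j=1..n. a j *\<^sub>R Y j w)) (exp 1 * ((\<integral>w. norm (\<Sum>j=1..n. a j *\<^sub>R Y j w) \<partial>M) + sqrt (2 * p * (sg\<^sup>2 * (\<Sum>j=1..n. (a j)\<^sup>2)))))"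
    by (rule Lpb_SUP[where g = g, OF G g var bdd T _ p]) auto
qed

end

section \<open>Chevet's inequality\<close>

text \<open>The \<gamma> j are the standard Gaussian weights of Chevet's inequality, taken from the
  same Gaussian space as the sample. Their independence makes the exponential moments of their sum
  of squares factorise.\<close>

locale gaussian_sample_frame = gaussian_sample M G S Y n
  for M :: "'w measure" and G and S :: "'a::{banach, second_countable_topology} opr" and Y and n +
  fixes \<gamma> :: "nat \<Rightarrow> 'w \<Rightarrow> real"
  assumes \<gamma>_mem: "\<And>j. \<gamma> j \<in> G"
    and \<gamma>_var: "\<And>j. j \<in> {1..n} \<Longrightarrow> (\<integral>w. (\<gamma> j w)\<^sup>2 \<partial>M) = 1"
    and \<gamma>_cov: "\<And>i j. i \<in> {1..n} \<Longrightarrow> j \<in> {1..n} \<Longrightarrow> i \<noteq> j \<Longrightarrow> (\<integral>w. \<gamma> i w * \<gamma> j w \<partial>M) = 0"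
    and \<gamma>_indep: "prob_space.indep_vars M (\<lambda>_. borel) \<gamma> {1..n}"
begin

definition Vmean :: "(nat \<Rightarrow> 'a) \<Rightarrow> real" where "Vmean y = (\<integral>w. norm (\<Sum>j=1..n. \<gamma> j w *\<^sub>R y j) \<partial>M)"
text \<open>The weak l_2 norm of y: the supremum over unit functionals u of the square root of the
  sum of the u (y j)^2.\<close>

definition bnorm :: "(nat \<Rightarrow> 'a) \<Rightarrow> real" where "bnorm y = sqrt (norm (tsum n y y))"

lemma \<gamma>_lin_var: "(\<integral>w. (\<Sum>j=1..n. c j * \<gamma> j w)\<^sup>2 \<partial>M) = (\<Sum>j=1..n. (c j)\<^sup>2)"
proof -
  have "(\<integral>w. (\<Sum>j=1..n. c j * \<gamma> j w)\<^sup>2 \<partial>M) = (\<integral>w. (\<Sum>i=1..n. \<Sum>j=1..n. c i * c j * (\<gamma> i w * \<gamma> j w)) \<partial>M)"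
    by (simp add: power2_eq_square sum_product ac_simps)
  also have "\<dots> = (\<Sum>i=1..n. \<Sum>j=1..n. c i * c j * (\<integral>w. \<gamma> i w * \<gamma> j w \<partial>M))"
    using gaussian_space_integrable_mult[OF G \<gamma>_mem \<gamma>_mem] by (simp add: Bochner_Integration.integral_sum)
  also have "\<dots> = (\<Sum>i=1..n. \<Sum>j=1..n. if i = j then (c j)\<^sup>2 else 0)"
    using \<gamma>_cov \<gamma>_var by (intro sum.cong refl) (auto simp: power2_eq_square)
  finally show ?thesis by simp
qed

lemma integrable_\<gamma>_norm:
  fixes y :: "nat \<Rightarrow> 'a"
  shows "integrable M (\<lambda>w. norm (\<Sum>j=1..n. \<gamma> j w *\<^sub>R y j))"
proof (rule Bochner_Integration.integrable_bound)
  show "integrable M (\<lambda>w. \<Sum>j=1..n. \<bar>\<gamma> j w\<bar> * norm (y j))"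
    using gaussian_rv_integrable[OF gaussian_spaceD(2)[OF G \<gamma>_mem]] by auto
  have [measurable]: "\<gamma> j \<in> borel_measurable M" for j by (rule gaussian_spaceD(4)[OF G \<gamma>_mem])
  show "(\<lambda>w. norm (\<Sum>j=1..n. \<gamma> j w *\<^sub>R y j)) \<in> borel_measurable M"
    by measurable
  show "AE w in M. norm (norm (\<Sum>j=1..n. \<gamma> j w *\<^sub>R y j)) \<le> norm (\<Sum>j=1..n. \<bar>\<gamma> j w\<bar> * norm (y j))"
    by (intro AE_I2) (auto intro!: order_trans[OF norm_sum] order_trans[OF _ abs_ge_self])
qed

lemma integrable_norm_Y: "integrable M (\<lambda>w. norm (Y 1 w))"
proof -
  have "norm (Y 1 w) = norm (\<Sum>j=1..n. (if j = 1 then 1 else 0) *\<^sub>R Y j w)" for w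
  proof -
    have "(\<Sum>j=1..n. (if j = 1 then 1 else 0) *\<^sub>R Y j w) = (\<Sum>j=1..n. if j = 1 then Y j w else 0)"
      by (intro sum.cong) auto
    then show ?thesis using n by simp
  qed
  then show ?thesis using Lpb_norm_lin(1)[of 1 "\<lambda>j. if j = 1 then 1 else 0"] by simp
qed

text \<open>
  For a deterministic \<open>y\<close>, the operator norm of \<open>\<Sum> y\<^sub>j \<otimes> Y\<^sub>j\<close> is the supremum of a Gaussian process
  whose increments are dominated by those of the sum of two independent one-sided processes
  (Chevet's inequality, here with the constant 2).
\<close>

lemma chevet:
  fixes y :: "nat \<Rightarrow> 'a"
  shows "(\<integral>w. norm (tsum n y (\<lambda>j. Y j w)) \<partial>M) \<le> 2 * (sg * Vmean y + bnorm y * xi)"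
    "p > 0 \<Longrightarrow> Lpb M p (\<lambda>w. norm (tsum n y (\<lambda>j. Y j w))) (exp 1 * (2 * (sg * Vmean y + bnorm y * xi) + sqrt (2 * p) * sg * bnorm y))"
proof -
  let ?P = "M \<Otimes>\<^sub>M M"
  interpret P: pair_prob_space M M ..
  define b where "b = bnorm y"
  have b0: "0 \<le> b" and b2: "b\<^sup>2 = norm (tsum n y y)" by (simp_all add: b_def bnorm_def)
  define q :: "'a dual \<Rightarrow> real" where "q = (\<lambda>u. blinfun_apply u (blinfun_apply S u))"
  have q0: "0 \<le> q u" for u unfolding q_def by (rule var_nonneg)
  have q_scale: "q (c *\<^sub>R u) = c\<^sup>2 * q u" for c u
    by (simp add: q_def scaleR_blinfun.rep_eq blinfun.scaleR_right power2_eq_square)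
  \<comment> \<open>Parallelogram identity for the nonnegative quadratic form
    \<open>q\<close>.\<close>
  have q_add: "q (u + v) \<le> 2 * q u + 2 * q v" for u v
  proof -
    have "q (u + v) + q (u - v) = 2 * q u + 2 * q v"
      by (simp add: q_def plus_blinfun.rep_eq minus_blinfun.rep_eq blinfun.add_right blinfun.diff_right)
    then show ?thesis using q0[of "u - v"] by linarith
  qed
  have q1: "q (norming l) \<le> sg\<^sup>2" for l
  proof -
    have "q (norming l) \<le> norm (norming l :: 'a dual) * norm (norming l :: 'a dual) * sg\<^sup>2" unfolding q_def by (rule cov_le)
    also have "\<dots> \<le> 1 * 1 * sg\<^sup>2" by (intro mult_mono norm_norming) auto
    finally show ?thesis by simp
  qed
  define I where "I = (\<lambda>k. fst (prod_decode k))"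
  define L where "L = (\<lambda>k. snd (prod_decode k))"
  define a where "a = (\<lambda>k j. blinfun_apply (norming (I k)) (y j))"
  have a2: "(\<Sum>j=1..n. (a k j)\<^sup>2) \<le> b\<^sup>2" for k
    unfolding b2 a_def power2_eq_square[of "blinfun_apply _ _"] by (rule norming_pair_le)
  define g where "g = (\<lambda>k w. \<Sum>j=1..n. blinfun_apply (a k j *\<^sub>R norming (L k)) (Y j w))"
  have g_eq: "g k w = (\<Sum>j=1..n. blinfun_apply (norming (I k)) (y j) * blinfun_apply (norming (L k)) (Y j w))" for k w
    by (simp add: g_def a_def scaleR_blinfun.rep_eq)
  have g: "g k \<in> G" for k unfolding g_def by (rule lin_mem)
  define W where "W = (\<lambda>w. norm (tsum n y (\<lambda>j. Y j w)))"
  have bdd: "bdd_above (range (\<lambda>k. g k w))" and W_SUP: "W w = (SUP k. g k w)" for w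
    unfolding g_eq W_def I_def L_def by (rule norm_tsum_SUP)+
  have gvar: "(\<integral>w. (g k w)\<^sup>2 \<partial>M) \<le> sg\<^sup>2 * b\<^sup>2" for k
  proof -
    have "(\<integral>w. (g k w)\<^sup>2 \<partial>M) = (\<Sum>j=1..n. (a k j)\<^sup>2) * q (norming (L k))"
      unfolding g_def lin_var by (simp add: q_def sum_distrib_left scaleR_blinfun.rep_eq blinfun.scaleR_right power2_eq_square ac_simps)
    also have "\<dots> \<le> b\<^sup>2 * sg\<^sup>2" using q0 by (intro mult_mono a2 q1) auto
    finally show ?thesis by (simp add: mult.commute)
  qed
  have W0: "0 \<le> W w" for w by (simp add: W_def)
  have Wint: "integrable M W" by (rule concentration_SUP(1)[where g = g, OF G g gvar bdd W_SUP W0])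
  \<comment> \<open>The one-sided processes: \<open>A\<close> depends only on the first index of the
    pair and \<open>B\<close> only on the second. Their factors sqrt 2 match the constant 2 in
    \<open>q_add\<close>.\<close>
  define A where "A = (\<lambda>k w. sqrt 2 * sg * (\<Sum>j=1..n. a k j * \<gamma> j w))"
  define B where "B = (\<lambda>k w. sqrt 2 * b * blinfun_apply (norming (L k)) (Y 1 w))"
  have Amem: "A k \<in> G" for k unfolding A_def by (intro gaussian_spaceD(6)[OF G] gaussian_space_sum[OF G] \<gamma>_mem)
  have Bmem: "B k \<in> G" for k unfolding B_def by (rule gaussian_spaceD(6)[OF G Y_mem])
  note GG = gaussian_space_sum_space[OF G G]
  have inc: "(\<integral>w. (g k w - g k' w)\<^sup>2 \<partial>M) \<le> (\<integral>x. ((A k (fst x) + B k (snd x)) - (A k' (fst x) + B k' (snd x)))\<^sup>2 \<partial>?P)" for k k'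
  proof -
    let ?u = "norming (L k) :: 'a dual" and ?v = "norming (L k') :: 'a dual"
    have "(\<integral>w. (g k w - g k' w)\<^sup>2 \<partial>M) = (\<integral>w. (\<Sum>j=1..n. blinfun_apply (a k j *\<^sub>R ?u - a k' j *\<^sub>R ?v) (Y j w))\<^sup>2 \<partial>M)"
      by (simp add: g_def minus_blinfun.rep_eq sum_subtractf)
    also have "\<dots> = (\<Sum>j=1..n. q (a k j *\<^sub>R ?u - a k' j *\<^sub>R ?v))" unfolding lin_var q_def ..
    also have "\<dots> \<le> (\<Sum>j=1..n. 2 * sg\<^sup>2 * (a k j - a k' j)\<^sup>2 + 2 * (a k' j)\<^sup>2 * q (?u - ?v))"
    proof (rule sum_mono)
      fix j
      \<comment> \<open>A difference of products: the first summand varies the coefficient and costs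
        the weak variance, the second varies the functional and, after summation, costs the squared
        weak norm of y.\<close>
      have "a k j *\<^sub>R ?u - a k' j *\<^sub>R ?v = (a k j - a k' j) *\<^sub>R ?u + a k' j *\<^sub>R (?u - ?v)" by (simp add: algebra_simps)
      then have "q (a k j *\<^sub>R ?u - a k' j *\<^sub>R ?v) \<le> 2 * ((a k j - a k' j)\<^sup>2 * q ?u) + 2 * ((a k' j)\<^sup>2 * q (?u - ?v))"
        using q_add[of "(a k j - a k' j) *\<^sub>R ?u" "a k' j *\<^sub>R (?u - ?v)"] by (simp only: q_scale)
      also have "(a k j - a k' j)\<^sup>2 * q ?u \<le> (a k j - a k' j)\<^sup>2 * sg\<^sup>2" by (intro mult_left_mono q1) auto
      finally show "q (a k j *\<^sub>R ?u - a k' j *\<^sub>R ?v) \<le> 2 * sg\<^sup>2 * (a k j - a k' j)\<^sup>2 + 2 * (a k' j)\<^sup>2 * q (?u - ?v)" by (simp add: ac_simps)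
    qed
    also have "\<dots> = 2 * sg\<^sup>2 * (\<Sum>j=1..n. (a k j - a k' j)\<^sup>2) + 2 * q (?u - ?v) * (\<Sum>j=1..n. (a k' j)\<^sup>2)"
      by (simp add: sum.distrib sum_distrib_left ac_simps)
    also have "\<dots> \<le> 2 * sg\<^sup>2 * (\<Sum>j=1..n. (a k j - a k' j)\<^sup>2) + 2 * q (?u - ?v) * b\<^sup>2"
      using q0 by (intro add_left_mono mult_left_mono a2) auto
    also have "\<dots> = (\<integral>w. (A k w - A k' w) * (A k w - A k' w) \<partial>M) + (\<integral>w. (B k w - B k' w) * (B k w - B k' w) \<partial>M)"
    proof -
      have "A k w - A k' w = sqrt 2 * sg * (\<Sum>j=1..n. (a k j - a k' j) * \<gamma> j w)" for w
        by (simp add: A_def algebra_simps sum_subtractf)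
      then have "(A k w - A k' w) * (A k w - A k' w) = 2 * sg\<^sup>2 * (\<Sum>j=1..n. (a k j - a k' j) * \<gamma> j w)\<^sup>2" for w
        by (simp add: power2_eq_square ac_simps)
      then have 1: "(\<integral>w. (A k w - A k' w) * (A k w - A k' w) \<partial>M) = 2 * sg\<^sup>2 * (\<Sum>j=1..n. (a k j - a k' j)\<^sup>2)"
        by (simp only: integral_mult_right_zero \<gamma>_lin_var)
      have "B k w - B k' w = sqrt 2 * b * blinfun_apply (?u - ?v) (Y 1 w)" for w
        by (simp add: B_def algebra_simps minus_blinfun.rep_eq)
      then have "(B k w - B k' w) * (B k w - B k' w) = 2 * b\<^sup>2 * (blinfun_apply (?u - ?v) (Y 1 w) * blinfun_apply (?u - ?v) (Y 1 w))" for w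
        by (simp add: power2_eq_square ac_simps)
      then have 2: "(\<integral>w. (B k w - B k' w) * (B k w - B k' w) \<partial>M) = 2 * b\<^sup>2 * q (?u - ?v)"
        using n by (simp add: Y_cov q_def)
      show ?thesis unfolding 1 2 by simp
    qed
    also have "\<dots> = (\<integral>x. ((A k (fst x) - A k' (fst x)) + (B k (snd x) - B k' (snd x))) * ((A k (fst x) - A k' (fst x)) + (B k (snd x) - B k' (snd x))) \<partial>?P)"
      using cov_sum_space[OF G G gaussian_spaceD(8)[OF G Amem[of k] Amem[of k']] gaussian_spaceD(8)[OF G Amem[of k] Amem[of k']]
        gaussian_spaceD(8)[OF G Bmem[of k] Bmem[of k']] gaussian_spaceD(8)[OF G Bmem[of k] Bmem[of k']]] by simp
    also have "\<dots> = (\<integral>x. ((A k (fst x) + B k (snd x)) - (A k' (fst x) + B k' (snd x)))\<^sup>2 \<partial>?P)"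
      by (simp add: power2_eq_square algebra_simps)
    finally show ?thesis .
  qed
  have Emax: "(\<integral>w. Max ((\<lambda>k. g k w) ` {..N}) \<partial>M) \<le> 2 * (sg * Vmean y + b * xi)" for N
  proof -
    define V where "V = (\<lambda>w. norm (\<Sum>j=1..n. \<gamma> j w *\<^sub>R y j))"
    have iV: "integrable M V" unfolding V_def by (rule integrable_\<gamma>_norm)
    have iVP: "integrable ?P (\<lambda>x. V (fst x))" "(\<integral>x. V (fst x) \<partial>?P) = Vmean y"
      using iV integral_prod_fst[of M M V] by (auto simp: prob_space_axioms Vmean_def V_def)
    have iYP: "integrable ?P (\<lambda>x. norm (Y 1 (snd x)))" "(\<integral>x. norm (Y 1 (snd x)) \<partial>?P) = xi"
      using integrable_norm_Y integral_prod_snd[of M M "\<lambda>w. norm (Y 1 w)"] by (auto simp: prob_space_axioms xi_def)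
    have hmem: "(\<lambda>x. A k (fst x) + B k (snd x)) \<in> sum_space G G" for k by (rule sum_spaceI(1)[OF G G Amem Bmem])
    have "(\<integral>w. Max ((\<lambda>k. g k w) ` {..N}) \<partial>M) \<le> (\<integral>x. Max ((\<lambda>k. A k (fst x) + B k (snd x)) ` {..N}) \<partial>?P)"
      by (rule sudakov_fernique[where g = g and h = "\<lambda>k x. A k (fst x) + B k (snd x)", OF G GG]) (use g hmem inc in auto)
    also have "\<dots> \<le> (\<integral>x. sqrt 2 * sg * V (fst x) + sqrt 2 * b * norm (Y 1 (snd x)) \<partial>?P)"
    proof (rule integral_mono)
      show "integrable ?P (\<lambda>x. Max ((\<lambda>k. A k (fst x) + B k (snd x)) ` {..N}))"
        by (intro integrable_Max gaussian_rv_integrable[OF gaussian_spaceD(2)[OF GG hmem]]) auto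
      show "integrable ?P (\<lambda>x. sqrt 2 * sg * V (fst x) + sqrt 2 * b * norm (Y 1 (snd x)))" using iVP iYP by simp
      fix x
      have "A k (fst x) + B k (snd x) \<le> sqrt 2 * sg * V (fst x) + sqrt 2 * b * norm (Y 1 (snd x))" for k
      proof (rule add_mono)
        have "(\<Sum>j=1..n. a k j * \<gamma> j (fst x)) = blinfun_apply (norming (I k)) (\<Sum>j=1..n. \<gamma> j (fst x) *\<^sub>R y j)"
          by (simp add: a_def blinfun.sum_right blinfun.scaleR_right mult.commute)
        also have "\<dots> \<le> V (fst x)" unfolding V_def by (rule norming_le)
        finally show "A k (fst x) \<le> sqrt 2 * sg * V (fst x)" unfolding A_def using sg_nonneg by (intro mult_left_mono) auto
        show "B k (snd x) \<le> sqrt 2 * b * norm (Y 1 (snd x))" unfolding B_def using b0 by (intro mult_left_mono norming_le) auto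
      qed
      then show "Max ((\<lambda>k. A k (fst x) + B k (snd x)) ` {..N}) \<le> sqrt 2 * sg * V (fst x) + sqrt 2 * b * norm (Y 1 (snd x))" by auto
    qed
    also have "\<dots> = sqrt 2 * (sg * Vmean y + b * xi)" using iVP iYP by (simp add: algebra_simps)
    also have "\<dots> \<le> 2 * (sg * Vmean y + b * xi)"
    proof (rule mult_right_mono)
      show "sqrt 2 \<le> 2" by (rule real_le_lsqrt) auto
      have "0 \<le> Vmean y" by (simp add: Vmean_def)
      then show "0 \<le> sg * Vmean y + b * xi" using sg_nonneg b0 xi_nonneg by simp
    qed
    finally show ?thesis .
  qed
  \<comment> \<open>The finite maxima lie between \<open>g 0\<close> and the supremum, which
    supplies the dominating function.\<close>
  have "(\<lambda>N. \<integral>w. Max ((\<lambda>k. g k w) ` {..N}) \<partial>M) \<longlonglongrightarrow> (\<integral>w. W w \<partial>M)"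
  proof (rule integral_dominated_convergence)
    have gi: "integrable M (g k)" for k by (rule gaussian_rv_integrable[OF gaussian_spaceD(2)[OF G g]])
    show "integrable M (\<lambda>w. \<bar>g 0 w\<bar> + W w)" using gi Wint by simp
    show "W \<in> borel_measurable M" using Wint by simp
    show "(\<lambda>w. Max ((\<lambda>k. g k w) ` {..N})) \<in> borel_measurable M" for N
      using integrable_Max[of "{..N}" M "\<lambda>w k. g k w"] gi by auto
    show "AE w in M. (\<lambda>N. Max ((\<lambda>k. g k w) ` {..N})) \<longlonglongrightarrow> W w"
      unfolding W_SUP by (intro AE_I2 Max_initial_tendsto_SUP bdd)
    show "AE w in M. norm (Max ((\<lambda>k. g k w) ` {..N})) \<le> \<bar>g 0 w\<bar> + W w" for N
    proof (rule AE_I2)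
      fix w
      have "g 0 w \<le> Max ((\<lambda>k. g k w) ` {..N})" by (intro Max_ge) auto
      moreover have "Max ((\<lambda>k. g k w) ` {..N}) \<le> W w" unfolding W_SUP using bdd[of w] by (auto intro: cSUP_upper)
      ultimately show "norm (Max ((\<lambda>k. g k w) ` {..N})) \<le> \<bar>g 0 w\<bar> + W w" using W0[of w] unfolding real_norm_def by linarith
    qed
  qed
  then show E: "(\<integral>w. norm (tsum n y (\<lambda>j. Y j w)) \<partial>M) \<le> 2 * (sg * Vmean y + bnorm y * xi)"
    using Emax by (intro LIMSEQ_le_const2) (auto simp: W_def b_def)
  show "Lpb M p (\<lambda>w. norm (tsum n y (\<lambda>j. Y j w))) (exp 1 * (2 * (sg * Vmean y + bnorm y * xi) + sqrt (2 * p) * sg * bnorm y))" if p: "p > 0"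
    unfolding W_def[symmetric]
  proof (rule Lpb_SUP[where g = g, OF G g gvar bdd W_SUP W0 p])
    have "sqrt (2 * p * (sg\<^sup>2 * b\<^sup>2)) = sqrt (2 * p) * sg * b" using sg_nonneg b0 by (simp add: real_sqrt_mult)
    then show "(\<integral>w. W w \<partial>M) + sqrt (2 * p * (sg\<^sup>2 * b\<^sup>2)) \<le> 2 * (sg * Vmean y + bnorm y * xi) + sqrt (2 * p) * sg * bnorm y"
      using E by (simp add: W_def b_def)
  qed
qed

end

section \<open>Decoupling by rotation\<close>

lemma std_normal_exp_square:
  assumes s: "0 \<le> s" "s < 1 / 2"
  shows "(\<integral>\<^sup>+x. ennreal (exp (s * x\<^sup>2)) \<partial>std_normal_distribution) = ennreal (1 / sqrt (1 - 2 * s))"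
proof -
  define r where "r = 1 / sqrt (1 - 2 * s)"
  have r: "r > 0" "r\<^sup>2 = 1 / (1 - 2 * s)" using s by (simp_all add: r_def power_divide)
  have e: "std_normal_density x * exp (s * x\<^sup>2) = r * normal_density 0 r x" for x
  proof -
    have "- x\<^sup>2 / 2 + s * x\<^sup>2 = - x\<^sup>2 / (2 * r\<^sup>2)" using s by (simp add: r(2) field_simps)
    then have "exp (- x\<^sup>2 / 2) * exp (s * x\<^sup>2) = exp (- x\<^sup>2 / (2 * r\<^sup>2))" unfolding exp_add[symmetric] by simp
    moreover have "sqrt (2 * pi * r\<^sup>2) = sqrt (2 * pi) * r" using r(1) by (simp add: real_sqrt_mult)
    ultimately show ?thesis using r(1) by (simp add: normal_density_def)
  qed
  have "(\<integral>\<^sup>+x. ennreal (exp (s * x\<^sup>2)) \<partial>std_normal_distribution) = (\<integral>\<^sup>+x. ennreal (std_normal_density x * exp (s * x\<^sup>2)) \<partial>lborel)"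
    by (subst nn_integral_density) (auto simp: ennreal_mult)
  also have "\<dots> = ennreal r * (\<integral>\<^sup>+x. ennreal (normal_density 0 r x) \<partial>lborel)"
    unfolding e using r by (subst nn_integral_cmult[symmetric]) (auto simp: ennreal_mult)
  also have "(\<integral>\<^sup>+x. ennreal (normal_density 0 r x) \<partial>lborel) = 1"
    using r by (subst nn_integral_eq_integral) auto
  finally show ?thesis by (simp add: r_def)
qed

lemma integral_square_ge:
  fixes f :: "'w \<Rightarrow> real"
  assumes "prob_space M" "integrable M f" "integrable M (\<lambda>w. (f w)\<^sup>2)"
  shows "(\<integral>w. f w \<partial>M)\<^sup>2 \<le> (\<integral>w. (f w)\<^sup>2 \<partial>M)"
proof -
  interpret prob_space M by fact
  have "0 \<le> variance f" by simp
  then show ?thesis using variance_eq[OF assms(2,3)] by simp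
qed

context gaussian_sample
begin

lemma measurable_sample:
  fixes F :: "(nat \<Rightarrow> 'a) \<Rightarrow> 'b::topological_space"
  assumes "continuous_on UNIV F"
  shows "(\<lambda>w. F (\<lambda>j. Y j w)) \<in> borel_measurable M"
  by (rule borel_measurable_continuous_family[OF assms Y_measurable])

section \<open>Two independent copies of the sample and their rotation\<close>

definition pairY :: "bool \<times> nat \<Rightarrow> 'w \<times> 'w \<Rightarrow> 'a" where
  "pairY = (\<lambda>(v, j) x. if v then Y j (snd x) else Y j (fst x))"

lemma pairY_measurable: "pairY i \<in> borel_measurable (M \<Otimes>\<^sub>M M)"
proof (cases i)
  case (Pair v j)
  have [measurable]: "Y j \<in> borel_measurable M" by (rule Y_measurable)
  show ?thesis unfolding Pair pairY_def by (cases v) simp_all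
qed

lemma measurable_sample_pair:
  fixes F :: "(nat \<Rightarrow> 'a) \<Rightarrow> (nat \<Rightarrow> 'a) \<Rightarrow> 'b::topological_space"
  assumes "continuous_on UNIV (\<lambda>z :: bool \<times> nat \<Rightarrow> 'a. F (\<lambda>j. z (False, j)) (\<lambda>j. z (True, j)))"
  shows "(\<lambda>x. F (\<lambda>j. Y j (fst x)) (\<lambda>j. Y j (snd x))) \<in> borel_measurable (M \<Otimes>\<^sub>M M)"
  using borel_measurable_continuous_family[where X = pairY, OF assms pairY_measurable] by (simp add: pairY_def)

lemma continuous_on_coordinate: "continuous_on UNIV (\<lambda>z :: 'i \<Rightarrow> 'b::topological_space. z i)"
  by (rule continuous_on_product_coordinates)

text \<open>Rotating two independent copies by \<open>\<pi>/4\<close> decouples the difference of the quadratic forms.\<close>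

lemma rotation_decoupling:
  fixes \<psi> :: "'a opr \<Rightarrow> real"
  assumes \<psi>: "continuous_on UNIV \<psi>"
  defines "T \<equiv> \<lambda>w w'. tsum n (\<lambda>j. Y j w) (\<lambda>j. Y j w')"
  shows "(\<integral>\<^sup>+x. ennreal (\<psi> (T (fst x) (fst x) - T (snd x) (snd x))) \<partial>(M \<Otimes>\<^sub>M M))
    = (\<integral>\<^sup>+x. ennreal (\<psi> (T (fst x) (snd x) + T (snd x) (fst x))) \<partial>(M \<Otimes>\<^sub>M M))"
proof -
  note GG = gaussian_space_sum_space[OF G G]
  define rotY :: "bool \<times> nat \<Rightarrow> 'w \<times> 'w \<Rightarrow> 'a" where
    "rotY = (\<lambda>(v, j) x. (1 / sqrt 2) *\<^sub>R (if v then Y j (fst x) - Y j (snd x) else Y j (fst x) + Y j (snd x)))"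
  define F :: "(bool \<times> nat \<Rightarrow> 'a) \<Rightarrow> real" where
    "F = (\<lambda>z. \<psi> (tsum n (\<lambda>j. z (False, j)) (\<lambda>j. z (False, j)) - tsum n (\<lambda>j. z (True, j)) (\<lambda>j. z (True, j))))"
  have F: "continuous_on UNIV F" unfolding F_def
    by (intro continuous_on_compose2[OF \<psi>] continuous_on_diff continuous_on_tsum continuous_on_coordinate) auto
  have rotm: "rotY i \<in> borel_measurable (M \<Otimes>\<^sub>M M)" for i
  proof (cases i)
    case (Pair v j)
    have [measurable]: "Y j \<in> borel_measurable M" by (rule Y_measurable)
    show ?thesis unfolding Pair rotY_def by (cases v) simp_all
  qed
  \<comment> \<open>Coefficients of the two copies in the original and in the rotated family; the
    covariances agree because the two coefficient matrices have the same Gram matrix.\<close>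
  define ca cb da db where "ca = (\<lambda>v. if v then 0 else 1 :: real)" and "cb = (\<lambda>v. if v then 1 else 0 :: real)"
    and "da = (\<lambda>v::bool. 1 / sqrt 2 :: real)" and "db = (\<lambda>v. if v then - 1 / sqrt 2 else 1 / sqrt 2 :: real)"
  have pe: "blinfun_apply u (pairY (v, j) x) = ca v * blinfun_apply u (Y j (fst x)) + cb v * blinfun_apply u (Y j (snd x))" for u v j x
    by (simp add: pairY_def ca_def cb_def)
  have re: "blinfun_apply u (rotY (v, j) x) = da v * blinfun_apply u (Y j (fst x)) + db v * blinfun_apply u (Y j (snd x))" for u v j x
    by (simp add: rotY_def da_def db_def blinfun.scaleR_right blinfun.add_right blinfun.diff_right algebra_simps add_divide_distrib diff_divide_distrib)
  have mem: "(\<lambda>x. a * blinfun_apply u (Y j (fst x)) + b * blinfun_apply u (Y j (snd x))) \<in> sum_space G G" for a b :: real and u :: "'a dual" and j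
    by (rule sum_spaceI(1)[OF G G gaussian_spaceD(6)[OF G Y_mem] gaussian_spaceD(6)[OF G Y_mem]])
  have cov: "(\<integral>x. (a * blinfun_apply u (Y i (fst x)) + b * blinfun_apply u (Y i (snd x))) * (a' * blinfun_apply u' (Y j (fst x)) + b' * blinfun_apply u' (Y j (snd x))) \<partial>(M \<Otimes>\<^sub>M M))
     = (a * a' + b * b') * (\<integral>w. blinfun_apply u (Y i w) * blinfun_apply u' (Y j w) \<partial>M)" for a b a' b' :: real and i j and u u' :: "'a dual"
  proof -
    have "(\<integral>w. a * blinfun_apply u (Y i w) * (a' * blinfun_apply u' (Y j w)) \<partial>M) = a * a' * (\<integral>w. blinfun_apply u (Y i w) * blinfun_apply u' (Y j w) \<partial>M)" for a a'
      by (subst integral_mult_right_zero[symmetric]) (simp add: ac_simps)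
    then show ?thesis
      using cov_sum_space[OF G G gaussian_spaceD(6)[OF G Y_mem[of u i], of a] gaussian_spaceD(6)[OF G Y_mem[of u' j], of a']
        gaussian_spaceD(6)[OF G Y_mem[of u i], of b] gaussian_spaceD(6)[OF G Y_mem[of u' j], of b']] by (simp add: algebra_simps)
  qed
  have law: "distr (M \<Otimes>\<^sub>M M) (PiM UNIV (\<lambda>_. borel)) (\<lambda>x i. pairY i x) = distr (M \<Otimes>\<^sub>M M) (PiM UNIV (\<lambda>_. borel)) (\<lambda>x i. rotY i x)"
  proof (rule gaussian_vector_law_unique[OF GG GG pairY_measurable rotm])
    show "(\<lambda>x. blinfun_apply u (pairY i x)) \<in> sum_space G G" "(\<lambda>x. blinfun_apply u (rotY i x)) \<in> sum_space G G" for i and u :: "'a dual"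
      by (cases i; simp only: pe re mem)+
    show "(\<integral>x. blinfun_apply u (pairY i x) * blinfun_apply u' (pairY j x) \<partial>(M \<Otimes>\<^sub>M M)) = (\<integral>x. blinfun_apply u (rotY i x) * blinfun_apply u' (rotY j x) \<partial>(M \<Otimes>\<^sub>M M))" for i j and u u' :: "'a dual"
    proof -
      obtain v k w l where ij: "i = (v, k)" "j = (w, l)" by (cases i, cases j) auto
      have "ca v * ca w + cb v * cb w = da v * da w + db v * db w" by (simp add: ca_def cb_def da_def db_def)
      then show ?thesis unfolding ij pe re cov by simp
    qed
  qed
  have Fm: "F \<in> borel_measurable (PiM UNIV (\<lambda>_. borel))"
    using borel_measurable_continuous_onI[OF F] measurable_cong_sets[OF sets_PiM_equal_borel refl] by blast
  have mp: "(\<lambda>x i. pairY i x) \<in> M \<Otimes>\<^sub>M M \<rightarrow>\<^sub>M PiM UNIV (\<lambda>_. borel)" "(\<lambda>x i. rotY i x) \<in> M \<Otimes>\<^sub>M M \<rightarrow>\<^sub>M PiM UNIV (\<lambda>_. borel)"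
    using pairY_measurable rotm by (auto intro!: measurable_PiM_single')
  have "(\<integral>\<^sup>+x. ennreal (F (\<lambda>i. pairY i x)) \<partial>(M \<Otimes>\<^sub>M M)) = (\<integral>\<^sup>+x. ennreal (F (\<lambda>i. rotY i x)) \<partial>(M \<Otimes>\<^sub>M M))"
    using arg_cong[OF law, of "\<lambda>m. \<integral>\<^sup>+z. ennreal (F z) \<partial>m"] Fm mp by (simp add: nn_integral_distr)
  moreover have "F (\<lambda>i. pairY i x) = \<psi> (T (fst x) (fst x) - T (snd x) (snd x))" for x by (simp add: F_def pairY_def T_def)
  moreover have "F (\<lambda>i. rotY i x) = \<psi> (T (fst x) (snd x) + T (snd x) (fst x))" for x
  proof -
    \<comment> \<open>Polarisation: the two squares differ by twice the symmetrised product, and the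
      scalings by 1 / sqrt 2 contribute 1 / 2.\<close>
    have "tens ((1 / sqrt 2) *\<^sub>R (a + b)) ((1 / sqrt 2) *\<^sub>R (a + b)) - tens ((1 / sqrt 2) *\<^sub>R (a - b)) ((1 / sqrt 2) *\<^sub>R (a - b)) = tens a b + tens b a" for a b :: 'a
    proof -
      interpret tens: bounded_bilinear "tens :: 'a \<Rightarrow> 'a \<Rightarrow> 'a opr" by (rule bounded_bilinear_tens)
      have "tens (a + b) (a + b) - tens (a - b) (a - b) = 2 *\<^sub>R (tens a b + tens b a)"
        by (simp add: tens.add_left tens.add_right tens.diff_left tens.diff_right scaleR_2)
      moreover have "tens ((1 / sqrt 2) *\<^sub>R z) ((1 / sqrt 2) *\<^sub>R z) = (1 / 2) *\<^sub>R tens z z" for z :: 'a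
        by (simp add: tens.scaleR_left tens.scaleR_right)
      ultimately show ?thesis by (simp only: scaleR_right_diff_distrib[symmetric] scaleR_scaleR) simp
    qed
    then show ?thesis unfolding F_def rotY_def T_def tsum_def by (simp add: sum_subtractf[symmetric] sum.distrib[symmetric])
  qed
  ultimately show ?thesis by simp
qed

lemma Lpb_norm_Y: "p > 0 \<Longrightarrow> Lpb M p (\<lambda>w. norm (Y 1 w)) (exp 1 * (xi + sqrt (2 * p) * sg))"
proof -
  assume p: "p > 0"
  define a where "a = (\<lambda>j::nat. if j = 1 then 1 else 0 :: real)"
  have "(\<Sum>j=1..n. a j *\<^sub>R Y j w) = Y 1 w" for w
  proof -
    have "(\<Sum>j=1..n. a j *\<^sub>R Y j w) = (\<Sum>j=1..n. if j = 1 then Y j w else 0)" by (intro sum.cong) (auto simp: a_def)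
    then show ?thesis using n by simp
  qed
  moreover have "(\<Sum>j=1..n. (a j)\<^sup>2) = 1"
  proof -
    have "(\<Sum>j=1..n. (a j)\<^sup>2) = (\<Sum>j=1..n. if j = 1 then 1 else 0)" by (intro sum.cong) (auto simp: a_def)
    then show ?thesis using n by simp
  qed
  moreover have "sqrt (2 * p * (sg\<^sup>2 * 1)) = sqrt (2 * p) * sg" using sg_nonneg by (simp add: real_sqrt_mult)
  ultimately show ?thesis using Lpb_norm_lin(2)[OF p, of a] by (simp add: xi_def)
qed

text \<open>By comparison of covariances the combination has the law of |a| Y 1 with |a| the
  Euclidean length of the coefficients. The bound thus involves \<open>xi\<close> in place of the
  mean norm of the combination itself.\<close>

lemma Lpb_lin:
  assumes p: "p > 0"
  shows "Lpb M p (\<lambda>w. norm (\<Sum>j=1..n. a j *\<^sub>R Y j w)) (sqrt (\<Sum>j=1..n. (a j)\<^sup>2) * (exp 1 * (xi + sqrt (2 * p) * sg)))"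
proof -
  define c where "c = sqrt (\<Sum>j=1..n. (a j)\<^sup>2)"
  have c: "c \<ge> 0" "c * c = (\<Sum>j=1..n. (a j)\<^sup>2)" by (auto simp: c_def sum_nonneg)
  define Z where "Z = (\<lambda>_::unit. \<lambda>w. \<Sum>j=1..n. a j *\<^sub>R Y j w)"
  define Z' where "Z' = (\<lambda>_::unit. \<lambda>w. c *\<^sub>R Y 1 w)"
  have [measurable]: "Y j \<in> borel_measurable M" for j by (rule Y_measurable)
  have Zm[measurable]: "Z i \<in> borel_measurable M" "Z' i \<in> borel_measurable M" for i by (simp_all add: Z_def Z'_def)
  have Ze: "blinfun_apply u (Z i w) = (\<Sum>j=1..n. blinfun_apply (a j *\<^sub>R u) (Y j w))" for u :: "'a dual" and i w
    by (simp add: Z_def blinfun.sum_right blinfun.scaleR_right scaleR_blinfun.rep_eq)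
  have law: "distr M (PiM UNIV (\<lambda>_. borel)) (\<lambda>w i. Z i w) = distr M (PiM UNIV (\<lambda>_. borel)) (\<lambda>w i. Z' i w)"
  proof (rule gaussian_vector_law_unique[OF G G Zm])
    show "(\<lambda>w. blinfun_apply u (Z i w)) \<in> G" for i u unfolding Ze by (rule lin_mem)
    show "(\<lambda>w. blinfun_apply u (Z' i w)) \<in> G" for i u
      unfolding Z'_def blinfun.scaleR_right using gaussian_spaceD(6)[OF G Y_mem] by simp
    show "(\<integral>w. blinfun_apply u (Z i w) * blinfun_apply v (Z j w) \<partial>M) = (\<integral>w. blinfun_apply u (Z' i w) * blinfun_apply v (Z' j w) \<partial>M)" for i j and u v :: "'a dual"
    proof -
      have "(\<integral>w. blinfun_apply u (Z i w) * blinfun_apply v (Z j w) \<partial>M) = (\<Sum>j=1..n. a j * a j) * blinfun_apply v (blinfun_apply S u)"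
        unfolding Ze lin_cov by (simp add: scaleR_blinfun.rep_eq blinfun.scaleR_right sum_distrib_left ac_simps)
      also have "\<dots> = c * c * (\<integral>w. blinfun_apply u (Y 1 w) * blinfun_apply v (Y 1 w) \<partial>M)"
        using n c by (simp add: Y_cov power2_eq_square)
      also have "\<dots> = (\<integral>w. c * c * (blinfun_apply u (Y 1 w) * blinfun_apply v (Y 1 w)) \<partial>M)" by simp
      also have "\<dots> = (\<integral>w. blinfun_apply u (Z' i w) * blinfun_apply v (Z' j w) \<partial>M)"
        by (simp add: Z'_def blinfun.scaleR_right ac_simps)
      finally show ?thesis .
    qed
  qed
  have mp: "(\<lambda>w i. Z i w) \<in> M \<rightarrow>\<^sub>M PiM UNIV (\<lambda>_. borel)" "(\<lambda>w i. Z' i w) \<in> M \<rightarrow>\<^sub>M PiM UNIV (\<lambda>_. borel)"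
    by (auto intro!: measurable_PiM_single')
  have "(\<integral>\<^sup>+w. ennreal (norm (Z () w) powr p) \<partial>M) = (\<integral>\<^sup>+w. ennreal (norm (Z' () w) powr p) \<partial>M)"
    using arg_cong[OF law, of "\<lambda>m. \<integral>\<^sup>+z. ennreal (norm (z ()) powr p) \<partial>m"] mp by (simp add: nn_integral_distr)
  moreover have "Lpb M p (\<lambda>w. norm (Z' () w)) (c * (exp 1 * (xi + sqrt (2 * p) * sg)))"
    using Lpb_cmult[OF Lpb_norm_Y[OF p] c(1)] c by (simp add: Z'_def)
  ultimately have "Lpb M p (\<lambda>w. norm (Z () w)) (c * (exp 1 * (xi + sqrt (2 * p) * sg)))"
    by (simp add: Lpb_def)
  then show ?thesis by (simp add: Z_def c_def)
qed

end

context gaussian_sample_frame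
begin

text \<open>Moments of a chi variable through E exp (s Z) with s = p / (4 (p + n)): s <= 1/4 keeps
  each factor below exp (2 s), and 2 s n <= p / 2. The bound B = 2 (p + n) for the square solves s B
  = p / 2.\<close>

lemma Lpb_\<gamma>:
  assumes p: "p > 0"
  shows "Lpb M p (\<lambda>w. sqrt (\<Sum>j=1..n. (\<gamma> j w)\<^sup>2)) (sqrt (2 * (p + real n)))"
proof -
  have [measurable]: "\<gamma> j \<in> borel_measurable M" for j by (rule gaussian_spaceD(4)[OF G \<gamma>_mem])
  define s where "s = p / (4 * (p + real n))"
  have s: "0 < s" "s \<le> 1 / 4" using p by (auto simp: s_def field_simps)
  have one: "(\<integral>\<^sup>+w. ennreal (exp (s * (\<gamma> j w)\<^sup>2)) \<partial>M) \<le> ennreal (exp (2 * s))" if j: "j \<in> {1..n}" for j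
  proof (rule gaussian_rv_std[OF gaussian_spaceD(2)[OF G \<gamma>_mem[of j]]])
    fix r assume r: "r \<ge> 0" "r\<^sup>2 = (\<integral>w. (\<gamma> j w)\<^sup>2 \<partial>M)"
      and *: "\<And>f::real\<Rightarrow>ennreal. f \<in> borel_measurable borel \<Longrightarrow> (\<integral>\<^sup>+w. f (\<gamma> j w) \<partial>M) = (\<integral>\<^sup>+x. f (r * x) \<partial>std_normal_distribution)"
    have "r\<^sup>2 = 1" using r(2) \<gamma>_var[OF j] by simp
    then have "r = 1" using r(1) by (simp add: power2_eq_1_iff)
    then have "(\<integral>\<^sup>+w. ennreal (exp (s * (\<gamma> j w)\<^sup>2)) \<partial>M) = ennreal (1 / sqrt (1 - 2 * s))"
      using *[of "\<lambda>x. ennreal (exp (s * x\<^sup>2))"] std_normal_exp_square[of s] s by simp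
    also have "\<dots> \<le> ennreal (exp (2 * s))"
    proof (rule ennreal_leI)
      have "1 \<le> (1 - 2 * s) * (1 + 4 * s)"
      proof -
        have "0 \<le> 2 * s * (1 - 4 * s)" using s by (intro mult_nonneg_nonneg) auto
        then show ?thesis by (simp add: algebra_simps)
      qed
      also have "\<dots> \<le> (1 - 2 * s) * exp (4 * s)" using s by (intro mult_left_mono exp_ge_add_one_self) auto
      finally have "sqrt 1 \<le> sqrt ((1 - 2 * s) * exp (4 * s))" by (rule real_sqrt_le_mono)
      moreover have "sqrt (exp (4 * s)) = exp (2 * s)"
        by (rule real_sqrt_unique) (auto simp: power2_eq_square exp_add[symmetric])
      ultimately have "1 \<le> sqrt (1 - 2 * s) * exp (2 * s)" by (simp add: real_sqrt_mult)
      then show "1 / sqrt (1 - 2 * s) \<le> exp (2 * s)" using s by (simp add: field_simps)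
    qed
    finally show ?thesis .
  qed
  have "(\<integral>\<^sup>+w. ennreal (exp (s * (\<Sum>j=1..n. (\<gamma> j w)\<^sup>2))) \<partial>M) = (\<integral>\<^sup>+w. (\<Prod>j=1..n. ennreal (exp (s * (\<gamma> j w)\<^sup>2))) \<partial>M)"
    by (simp add: sum_distrib_left exp_sum prod_ennreal)
  also have "\<dots> = (\<Prod>j=1..n. \<integral>\<^sup>+w. ennreal (exp (s * (\<gamma> j w)\<^sup>2)) \<partial>M)"
  proof (rule indep_vars_nn_integral)
    show "indep_vars (\<lambda>_. borel) (\<lambda>j w. ennreal (exp (s * (\<gamma> j w)\<^sup>2))) {1..n}"
      by (rule indep_vars_compose2[OF \<gamma>_indep]) simp
  qed auto
  also have "\<dots> \<le> (\<Prod>j=1..n. ennreal (exp (2 * s)))" by (intro prod_mono_ennreal one)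
  also have "\<dots> = ennreal (exp (2 * s * real n))" by (simp add: ennreal_power exp_of_nat_mult[symmetric] mult.commute)
  also have "\<dots> \<le> ennreal (exp (p / 2))"
  proof (rule ennreal_leI)
    have "2 * s * real n = p / 2 * (real n / (p + real n))" using p by (simp add: s_def field_simps)
    also have "\<dots> \<le> p / 2 * 1" using p by (intro mult_left_mono) auto
    finally show "exp (2 * s * real n) \<le> exp (p / 2)" by simp
  qed
  finally have mgf: "(\<integral>\<^sup>+w. ennreal (exp (s * (\<Sum>j=1..n. (\<gamma> j w)\<^sup>2))) \<partial>M) \<le> ennreal (exp (p / 2))" .
  define B where "B = 2 * (p + real n)"
  have B: "B > 0" "s * B = p / 2" using p by (auto simp: B_def s_def field_simps)
  have pt: "sqrt t powr p \<le> B powr (p / 2) * exp (- p / 2) * exp (s * t)" if t: "t \<ge> 0" for t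
  proof -
    have "t / B \<le> exp (t / B - 1)" using exp_ge_add_one_self[of "t / B - 1"] by simp
    then have "(t / B) powr (p / 2) \<le> exp (t / B - 1) powr (p / 2)" using t B p by (intro powr_mono2) auto
    also have "\<dots> = exp (s * t - p / 2)"
    proof -
      have "s = p / (2 * B)" using B by (simp add: field_simps)
      then show ?thesis by (simp add: powr_def algebra_simps diff_divide_distrib)
    qed
    finally have "B powr (p / 2) * (t / B) powr (p / 2) \<le> B powr (p / 2) * exp (s * t - p / 2)" by (intro mult_left_mono) auto
    moreover have "B powr (p / 2) * (t / B) powr (p / 2) = t powr (p / 2)" using B t by (simp add: powr_divide)
    moreover have "sqrt t powr p = t powr (p / 2)" using t by (simp add: powr_half_sqrt[symmetric] powr_powr)
    moreover have "B powr (p / 2) * exp (- p / 2) * exp (s * t) = B powr (p / 2) * exp (s * t - p / 2)"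
      by (simp add: mult.assoc exp_add[symmetric])
    ultimately show ?thesis by (simp only:)
  qed
  have "(\<integral>\<^sup>+w. ennreal (sqrt (\<Sum>j=1..n. (\<gamma> j w)\<^sup>2) powr p) \<partial>M)
     \<le> (\<integral>\<^sup>+w. ennreal (B powr (p / 2) * exp (- p / 2)) * ennreal (exp (s * (\<Sum>j=1..n. (\<gamma> j w)\<^sup>2))) \<partial>M)"
  proof (rule nn_integral_mono)
    fix w
    have "0 \<le> (\<Sum>j=1..n. (\<gamma> j w)\<^sup>2)" by (intro sum_nonneg) auto
    from ennreal_leI[OF pt[OF this]]
    show "ennreal (sqrt (\<Sum>j=1..n. (\<gamma> j w)\<^sup>2) powr p) \<le> ennreal (B powr (p / 2) * exp (- p / 2)) * ennreal (exp (s * (\<Sum>j=1..n. (\<gamma> j w)\<^sup>2)))"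
      by (simp only: ennreal_mult'' exp_ge_zero)
  qed
  also have "\<dots> = ennreal (B powr (p / 2) * exp (- p / 2)) * (\<integral>\<^sup>+w. ennreal (exp (s * (\<Sum>j=1..n. (\<gamma> j w)\<^sup>2))) \<partial>M)"
    by (rule nn_integral_cmult) simp
  also have "\<dots> \<le> ennreal (B powr (p / 2) * exp (- p / 2)) * ennreal (exp (p / 2))" by (intro mult_left_mono mgf) auto
  also have "\<dots> = ennreal (sqrt B powr p)" using B
    by (simp add: ennreal_mult[symmetric] mult.assoc exp_add[symmetric] powr_half_sqrt[symmetric] powr_powr)
  finally show ?thesis using p by (simp add: Lpb_def B_def sum_nonneg)
qed

end

section \<open>Moments of the deviation\<close>

lemma Lpb_sum:
  assumes "finite J" "prob_space M" "p \<ge> 1" "\<And>j. j \<in> J \<Longrightarrow> \<exists>B. Lpb M p (F j) B"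
  shows "\<exists>B. Lpb M p (\<lambda>w. \<Sum>j\<in>J. F j w) B"
  using assms(1,4)
proof (induction J rule: finite_induct)
  case empty
  show ?case using Lpb_const[OF assms(2), of 0 p] by auto
next
  case (insert j J)
  then show ?case using Lpb_add[OF _ _ assms(3)] by fastforce
qed

text \<open>The exact moment, as the least admissible bound; the self-bounding inequality is an
  inequality for this number.\<close>

lemma Lpb_least:
  assumes F: "Lpb M p F B" and p: "p > 0"
  obtains z where "Lpb M p F z" "\<And>B. Lpb M p F B \<Longrightarrow> z \<le> B"
proof -
  define r where "r = enn2real (\<integral>\<^sup>+w. ennreal (F w powr p) \<partial>M)"
  have fin: "(\<integral>\<^sup>+w. ennreal (F w powr p) \<partial>M) < \<infinity>"
    using LpbD(4)[OF F] by (auto intro: le_less_trans)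
  then have r: "(\<integral>\<^sup>+w. ennreal (F w powr p) \<partial>M) = ennreal r" "r \<ge> 0" by (simp_all add: r_def)
  have "Lpb M p F (r powr (1 / p))" using F r p by (simp add: Lpb_def powr_powr)
  moreover have "r powr (1 / p) \<le> B" if "Lpb M p F B" for B
  proof -
    have B: "0 \<le> B" "ennreal r \<le> ennreal (B powr p)" using LpbD[OF that] r by auto
    then have "r powr (1 / p) \<le> (B powr p) powr (1 / p)" using r p by (intro powr_mono2) auto
    then show ?thesis using B p by (simp add: powr_powr)
  qed
  ultimately show ?thesis by (rule that)
qed

text \<open>With x = s / sqrt n the hypothesis becomes z <= 108 x^2 + 144 g x + 36 x sqrt z, where
  sqrt p * g <= s takes care of the term mixing p and g. Then 36 x sqrt z <= 648 x^2 + z / 2, and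
  half of z moves to the left.\<close>

lemma sqrt_fixpoint_bound:
  fixes g s p N z :: real
  assumes g: "0 \<le> g" and s: "0 \<le> s" and p: "0 \<le> p" and pg: "sqrt p * g \<le> s" and n: "0 < n" and z: "0 \<le> z"
    and le: "z \<le> 2 / n * (exp 1 * (2 * (2 * g * (sqrt (2 * (p + n)) * (exp 1 * s)) + 2 * s * sqrt (2 * (n * (g\<^sup>2 + z))))))"
  shows "z \<le> 1512 * (s / sqrt n)\<^sup>2 + 288 * g * (s / sqrt n)"
proof -
  define N where "N = sqrt n"
  have N: "N > 0" "n = N * N" using n by (auto simp: N_def)
  have e3: "exp (1::real) \<le> 3" by (rule exp_le)
  have s2: "sqrt 2 \<le> (3 / 2 :: real)" by (rule real_le_lsqrt) (auto simp: power2_eq_square)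
  have 1: "sqrt (2 * (p + n)) \<le> 3 / 2 * (sqrt p + N)"
  proof -
    have "sqrt (p + n) \<le> sqrt p + N" unfolding N_def using p n by (intro sqrt_add_le_add_sqrt) auto
    then have "sqrt 2 * sqrt (p + n) \<le> 3 / 2 * (sqrt p + N)" using s2 p n by (intro mult_mono) auto
    then show ?thesis by (simp only: real_sqrt_mult)
  qed
  have 2: "sqrt (2 * (n * (g\<^sup>2 + z))) \<le> 3 / 2 * (N * (g + sqrt z))"
  proof -
    have "sqrt (g\<^sup>2 + z) \<le> sqrt (g\<^sup>2) + sqrt z" using z by (intro sqrt_add_le_add_sqrt) auto
    then have "sqrt 2 * (N * sqrt (g\<^sup>2 + z)) \<le> 3 / 2 * (N * (g + sqrt z))" using s2 g z N by (intro mult_mono mult_left_mono) auto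
    then show ?thesis by (simp only: real_sqrt_mult N_def)
  qed
  define x where "x = s / N"
  have x: "x \<ge> 0" "s = x * N" using N s by (auto simp: x_def)
  have "2 * g * (sqrt (2 * (p + n)) * (exp 1 * s)) \<le> 2 * g * (3 / 2 * (sqrt p + N) * (3 * s))"
    using g s p N 1 e3 by (intro mult_left_mono mult_mono) auto
  also have "\<dots> = 9 * s * (sqrt p * g) + 9 * g * s * N" by (simp add: algebra_simps)
  also have "\<dots> \<le> 9 * s * s + 9 * g * s * N" using s pg by (intro add_right_mono mult_left_mono) auto
  finally have A: "2 * g * (sqrt (2 * (p + n)) * (exp 1 * s)) \<le> 9 * s * s + 9 * g * s * N" .
  have B: "2 * s * sqrt (2 * (n * (g\<^sup>2 + z))) \<le> 2 * s * (3 / 2 * (N * (g + sqrt z)))"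
    using s 2 by (intro mult_left_mono) auto
  have "z \<le> 2 / n * (exp 1 * (2 * (9 * s * s + 9 * g * s * N + 2 * s * (3 / 2 * (N * (g + sqrt z))))))"
    using n by (intro order_trans[OF le] mult_left_mono[OF mult_left_mono[OF mult_left_mono[OF add_mono[OF A B]]]]) auto
  also have "\<dots> \<le> 2 / n * (3 * (2 * (9 * s * s + 9 * g * s * N + 2 * s * (3 / 2 * (N * (g + sqrt z))))))"
    using n s g z N e3 by (intro mult_left_mono mult_right_mono) auto
  also have "\<dots> = 108 * x\<^sup>2 + 144 * g * x + 36 * (x * sqrt z)"
    using N by (simp add: x(2) N(2) field_simps power2_eq_square)
  also have "36 * (x * sqrt z) \<le> 648 * x\<^sup>2 + z / 2"
  proof -
    have "0 \<le> (36 * x - sqrt z)\<^sup>2" by simp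
    then show ?thesis using z by (simp add: power2_diff power_mult_distrib)
  qed
  finally have "z \<le> 1512 * x\<^sup>2 + 288 * g * x" by simp
  then show ?thesis by (simp add: x_def N_def)
qed

context gaussian_sample
begin

definition scov :: "'w \<Rightarrow> 'a opr" where "scov w = sample_cov n (\<lambda>j. Y j w)"

lemma continuous_on_sample_cov:
  assumes "\<And>j. continuous_on UNIV (\<lambda>z. f z j)"
  shows "continuous_on UNIV (\<lambda>z. sample_cov n (f z))"
  unfolding sample_cov_eq_tsum using assms by (intro continuous_on_scaleR continuous_on_const continuous_on_tsum)

lemma Lpb_norm_Yj:
  assumes "j \<in> {1..n}" "p > 0"
  shows "Lpb M p (\<lambda>w. norm (Y j w)) (exp 1 * (xi + sqrt (2 * p) * sg))"
proof -
  define a where "a = (\<lambda>i. if i = j then 1 else 0 :: real)"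
  have "(\<Sum>i=1..n. a i *\<^sub>R Y i w) = (\<Sum>i=1..n. if i = j then Y i w else 0)" for w by (intro sum.cong) (auto simp: a_def)
  then have 1: "(\<Sum>i=1..n. a i *\<^sub>R Y i w) = Y j w" for w using assms by simp
  have "(\<Sum>i=1..n. (a i)\<^sup>2) = (\<Sum>i=1..n. if i = j then 1 else 0)" by (intro sum.cong) (auto simp: a_def)
  then have 2: "(\<Sum>i=1..n. (a i)\<^sup>2) = 1" using assms by simp
  show ?thesis using Lpb_lin[OF assms(2), of a] unfolding 1 2 by simp
qed

text \<open>Only finiteness matters here: it is what permits moving z / 2 to the left in the
  self-bounding inequality.\<close>

lemma Lpb_norm_scov:
  assumes p: "p \<ge> 1"
  shows "\<exists>B. Lpb M p (\<lambda>w. norm (scov w)) B"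
proof -
  have "\<exists>B. Lpb M p (\<lambda>w. (norm (Y j w))\<^sup>2) B" if j: "j \<in> {1..n}" for j
    using Lpb_powr[OF Lpb_norm_Yj[OF j, of "2 * p"], of 2] p by (auto simp: powr_numeral)
  then obtain B where B: "Lpb M p (\<lambda>w. \<Sum>j=1..n. (norm (Y j w))\<^sup>2) B"
    using Lpb_sum[of "{1..n}" M p "\<lambda>j w. (norm (Y j w))\<^sup>2"] p prob_space_axioms by auto
  have "Lpb M p (\<lambda>w. norm (scov w)) ((1 / real n) * B)"
  proof (rule Lpb_mono[OF Lpb_cmult[OF B]])
    show "(\<lambda>w. norm (scov w)) \<in> borel_measurable M" unfolding scov_def
      by (rule measurable_sample) (intro continuous_on_norm continuous_on_sample_cov continuous_on_product_coordinates)
    fix w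
    have "norm (tsum n (\<lambda>j. Y j w) (\<lambda>j. Y j w)) \<le> (\<Sum>j=1..n. norm (tens (Y j w) (Y j w)))" unfolding tsum_def by (rule norm_sum)
    also have "\<dots> \<le> (\<Sum>j=1..n. (norm (Y j w))\<^sup>2)" unfolding power2_eq_square by (intro sum_mono norm_tens_le)
    finally show "norm (scov w) \<le> (1 / real n) * (\<Sum>j=1..n. (norm (Y j w))\<^sup>2)"
      using n by (simp add: scov_def sample_cov_eq_tsum divide_right_mono)
  qed (use p in auto)
  then show ?thesis by blast
qed

section \<open>Symmetrisation of the deviation\<close>

definition dev :: "'w \<Rightarrow> real" where "dev w = norm (scov w - S)"

lemma dev_measurable: "dev \<in> borel_measurable M" unfolding dev_def scov_def
  by (rule measurable_sample) (intro continuous_on_norm continuous_on_diff continuous_on_const continuous_on_sample_cov continuous_on_product_coordinates)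

lemma Lpb_dev_ex:
  assumes p: "p \<ge> 1"
  shows "\<exists>B. Lpb M p dev B"
proof -
  obtain B where B: "Lpb M p (\<lambda>w. norm (scov w)) B" using Lpb_norm_scov[OF p] by auto
  have "Lpb M p dev (2 * (B + norm S))"
    by (rule Lpb_mono[OF Lpb_add[OF B Lpb_const[OF prob_space_axioms norm_ge_zero[of S]] p]])
      (use p in \<open>auto simp: dev_measurable dev_def norm_triangle_ineq4\<close>)
  then show ?thesis by blast
qed

lemma scov_pair_mean: "(\<integral>w. blinfun_apply u (scov w v) \<partial>M) = blinfun_apply u (blinfun_apply S v)" "integrable M (\<lambda>w. blinfun_apply u (scov w v))"
  for u v :: "'a dual"
proof -
  have e: "blinfun_apply u (scov w v) = (1 / real n) * (\<Sum>j=1..n. blinfun_apply v (Y j w) * blinfun_apply u (Y j w))" for w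
    by (simp add: scov_def sample_cov.rep_eq blinfun.scaleR_right blinfun.sum_right)
  have i: "integrable M (\<lambda>w. blinfun_apply v (Y j w) * blinfun_apply u (Y j w))" for j by (rule gaussian_space_integrable_mult[OF G Y_mem Y_mem])
  show "integrable M (\<lambda>w. blinfun_apply u (scov w v))" unfolding e using i by simp
  have "(\<integral>w. blinfun_apply u (scov w v) \<partial>M) = (1 / real n) * (\<Sum>j=1..n. \<integral>w. blinfun_apply v (Y j w) * blinfun_apply u (Y j w) \<partial>M)"
    unfolding e using i by simp
  also have "(\<Sum>j=1..n. \<integral>w. blinfun_apply v (Y j w) * blinfun_apply u (Y j w) \<partial>M) = (\<Sum>j=1..n. blinfun_apply u (blinfun_apply S v))"
    by (intro sum.cong refl) (simp add: Y_cov)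
  finally show "(\<integral>w. blinfun_apply u (scov w v) \<partial>M) = blinfun_apply u (blinfun_apply S v)" using n by simp
qed

lemma integrable_norm_scov_diff: "integrable M (\<lambda>w'. norm (scov w - scov w'))"
proof (rule Bochner_Integration.integrable_bound)
  obtain B where B: "Lpb M 1 (\<lambda>w. norm (scov w)) B" using Lpb_norm_scov[of 1] by auto
  show "integrable M (\<lambda>w'. norm (scov w) + norm (scov w'))" using Lpb_integral(1)[OF prob_space_axioms B] by simp
  show "(\<lambda>w'. norm (scov w - scov w')) \<in> borel_measurable M" unfolding scov_def
    by (rule measurable_sample) (intro continuous_on_norm continuous_on_diff continuous_on_const continuous_on_sample_cov continuous_on_product_coordinates)
  show "AE w' in M. norm (norm (scov w - scov w')) \<le> norm (norm (scov w) + norm (scov w'))"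
    by (intro AE_I2) (auto simp: norm_triangle_ineq4)
qed

text \<open>\<open>S\<close> is the mean of an independent copy when tested on functionals, and
  norming functionals suffice for the norm: Jensen's inequality carried out scalarwise.\<close>

lemma dev_le_integral: "dev w \<le> (\<integral>w'. norm (scov w - scov w') \<partial>M)"
  unfolding dev_def
proof (rule norm_blinfun_bound)
  show "0 \<le> (\<integral>w'. norm (scov w - scov w') \<partial>M)" by simp
  fix v :: "'a dual"
  show "norm ((scov w - S) v) \<le> (\<integral>w'. norm (scov w - scov w') \<partial>M) * norm v"
  proof (rule norm_le_norming)
    fix l
    have "norming l ((scov w - S) v) = (\<integral>w'. norming l (scov w v) - norming l (scov w' v) \<partial>M)"
      using scov_pair_mean[of "norming l" v] by (simp add: minus_blinfun.rep_eq blinfun.diff_right prob_space)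
    also have "\<dots> \<le> (\<integral>w'. norm (scov w - scov w') * norm v \<partial>M)"
    proof (rule integral_mono)
      show "integrable M (\<lambda>w'. norming l (scov w v) - norming l (scov w' v))" using scov_pair_mean(2) by simp
      show "integrable M (\<lambda>w'. norm (scov w - scov w') * norm v)" using integrable_norm_scov_diff by simp
      fix w'
      have "norming l (scov w v) - norming l (scov w' v) = norming l ((scov w - scov w') v)" by (simp add: minus_blinfun.rep_eq blinfun.diff_right)
      also have "\<dots> \<le> norm ((scov w - scov w') v)" by (rule norming_le)
      also have "\<dots> \<le> norm (scov w - scov w') * norm v" by (rule norm_blinfun)
      finally show "norming l (scov w v) - norming l (scov w' v) \<le> norm (scov w - scov w') * norm v" .
    qed
    finally show "norming l ((scov w - S) v) \<le> (\<integral>w'. norm (scov w - scov w') \<partial>M) * norm v" by simp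
  qed
qed

text \<open>The mean is replaced by an independent copy and the pair is rotated; the two resulting
  tensor sums are transposes with equal norms, whence the factor 2.\<close>

lemma dev_symmetrization:
  assumes p: "p \<ge> 1"
  shows "(\<integral>\<^sup>+w. ennreal (dev w powr p) \<partial>M)
    \<le> (\<integral>\<^sup>+x. ennreal ((2 / real n * norm (tsum n (\<lambda>j. Y j (fst x)) (\<lambda>j. Y j (snd x)))) powr p) \<partial>(M \<Otimes>\<^sub>M M))"
proof -
  define T where "T = (\<lambda>w w'. tsum n (\<lambda>j. Y j w) (\<lambda>j. Y j w'))"
  define \<psi> :: "'a opr \<Rightarrow> real" where "\<psi> = (\<lambda>A. (1 / real n * norm A) powr p)"
  have c\<psi>: "continuous_on UNIV \<psi>" unfolding \<psi>_def
    using p by (intro continuous_on_powr' continuous_on_mult continuous_on_const continuous_on_norm continuous_on_id) auto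
  have \<Delta>: "norm (scov w - scov w') powr p = \<psi> (T w w - T w' w')" for w w'
    by (simp add: scov_def sample_cov_eq_tsum \<psi>_def T_def scaleR_right_diff_distrib[symmetric])
  have m: "(\<lambda>x. ennreal (\<psi> (T (fst x) (fst x) - T (snd x) (snd x)))) \<in> borel_measurable (M \<Otimes>\<^sub>M M)"
    unfolding T_def
    by (intro measurable_compose[OF _ measurable_ennreal] measurable_sample_pair[where F = "\<lambda>a b. \<psi> (tsum n a a - tsum n b b)"]
      continuous_on_compose2[OF c\<psi>] continuous_on_diff continuous_on_tsum continuous_on_coordinate) auto
  have "(\<integral>\<^sup>+w. ennreal (dev w powr p) \<partial>M) \<le> (\<integral>\<^sup>+w. (\<integral>\<^sup>+w'. ennreal (norm (scov w - scov w') powr p) \<partial>M) \<partial>M)"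
  proof (rule nn_integral_mono)
    fix w
    have "ennreal (dev w powr p) \<le> ennreal ((\<integral>w'. norm (scov w - scov w') \<partial>M) powr p)"
      using p dev_le_integral[of w] by (intro ennreal_leI powr_mono2) (auto simp: dev_def)
    also have "\<dots> \<le> (\<integral>\<^sup>+w'. ennreal (norm (scov w - scov w') powr p) \<partial>M)"
      using integrable_norm_scov_diff p by (intro integral_powr_le prob_space_axioms) auto
    finally show "ennreal (dev w powr p) \<le> (\<integral>\<^sup>+w'. ennreal (norm (scov w - scov w') powr p) \<partial>M)" .
  qed
  also have "\<dots> = (\<integral>\<^sup>+x. ennreal (\<psi> (T (fst x) (fst x) - T (snd x) (snd x))) \<partial>(M \<Otimes>\<^sub>M M))"
    unfolding \<Delta> using nn_integral_fst[OF m] by simp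
  also have "\<dots> = (\<integral>\<^sup>+x. ennreal (\<psi> (T (fst x) (snd x) + T (snd x) (fst x))) \<partial>(M \<Otimes>\<^sub>M M))"
    unfolding T_def by (rule rotation_decoupling[OF c\<psi>])
  also have "\<dots> \<le> (\<integral>\<^sup>+x. ennreal ((2 / real n * norm (T (fst x) (snd x))) powr p) \<partial>(M \<Otimes>\<^sub>M M))"
  proof (rule nn_integral_mono)
    fix x
    have "norm (T (fst x) (snd x) + T (snd x) (fst x)) \<le> norm (T (fst x) (snd x)) + norm (T (snd x) (fst x))" by (rule norm_triangle_ineq)
    also have "norm (T (snd x) (fst x)) = norm (T (fst x) (snd x))" unfolding T_def by (rule norm_tsum_commute)
    finally have "1 / real n * norm (T (fst x) (snd x) + T (snd x) (fst x)) \<le> 1 / real n * (2 * norm (T (fst x) (snd x)))"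
      by (intro mult_left_mono) auto
    then show "ennreal (\<psi> (T (fst x) (snd x) + T (snd x) (fst x))) \<le> ennreal ((2 / real n * norm (T (fst x) (snd x))) powr p)"
      unfolding \<psi>_def using p by (intro ennreal_leI powr_mono2) auto
  qed
  finally show ?thesis unfolding T_def .
qed

text \<open>The strong second moment, that is, the norm of \<open>S\<close> times the effective
  rank.\<close>

definition Rr :: real where "Rr = (\<integral>w. (norm (Y 1 w))\<^sup>2 \<partial>M)"

lemma Rr_nonneg: "0 \<le> Rr" by (simp add: Rr_def)

lemma integrable_norm_Y_square: "integrable M (\<lambda>w. (norm (Y 1 w))\<^sup>2)"
proof -
  have "Lpb M 1 (\<lambda>w. (norm (Y 1 w))\<^sup>2) ((exp 1 * (xi + sqrt (2 * 2) * sg)) powr 2)"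
    using Lpb_powr[OF Lpb_norm_Y[of 2], of 2] by (simp add: powr_numeral)
  from Lpb_integral(1)[OF prob_space_axioms this] show ?thesis by simp
qed

lemma xi_le: "xi \<le> sqrt Rr"
proof -
  have "integrable M (\<lambda>w. norm (Y 1 w))" using Lpb_integral(1)[OF prob_space_axioms Lpb_norm_Y[of 1]] by simp
  then have "xi\<^sup>2 \<le> Rr" unfolding xi_def Rr_def by (intro integral_square_ge prob_space_axioms integrable_norm_Y_square)
  then show ?thesis by (rule real_le_rsqrt)
qed

text \<open>Equivalently, the effective rank of a nonzero \<open>S\<close> is at least 1, so it may
  serve as the order of a moment.\<close>

lemma sg_le_Rr: "sg\<^sup>2 \<le> Rr"
proof -
  have "norm S \<le> Rr"
  proof (rule norm_blinfun_bound[OF Rr_nonneg])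
    fix v :: "'a dual"
    show "norm (S v) \<le> Rr * norm v"
    proof (rule norm_le_norming)
      fix l
      have "norming l (S v) = (\<integral>w. blinfun_apply v (Y 1 w) * norming l (Y 1 w) \<partial>M)" using n by (simp add: Y_cov)
      also have "\<dots> \<le> (\<integral>w. (norm (Y 1 w))\<^sup>2 * norm v \<partial>M)"
      proof (rule integral_mono)
        show "integrable M (\<lambda>w. blinfun_apply v (Y 1 w) * norming l (Y 1 w))" by (rule gaussian_space_integrable_mult[OF G Y_mem Y_mem])
        show "integrable M (\<lambda>w. (norm (Y 1 w))\<^sup>2 * norm v)" using integrable_norm_Y_square by simp
        fix w
        have "\<bar>blinfun_apply (norming l) (Y 1 w)\<bar> \<le> norm (norming l :: 'a dual) * norm (Y 1 w)" using norm_blinfun[of "norming l" "Y 1 w"] by simp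
        also have "\<dots> \<le> 1 * norm (Y 1 w)" by (intro mult_right_mono norm_norming) auto
        finally have 1: "\<bar>blinfun_apply (norming l) (Y 1 w)\<bar> \<le> norm (Y 1 w)" by simp
        have "blinfun_apply v (Y 1 w) * norming l (Y 1 w) \<le> \<bar>blinfun_apply v (Y 1 w)\<bar> * \<bar>norming l (Y 1 w)\<bar>" unfolding abs_mult[symmetric] by simp
        also have "\<dots> \<le> (norm v * norm (Y 1 w)) * norm (Y 1 w)" using norm_blinfun[of v "Y 1 w"] 1 by (intro mult_mono) auto
        finally show "blinfun_apply v (Y 1 w) * norming l (Y 1 w) \<le> (norm (Y 1 w))\<^sup>2 * norm v" by (simp add: power2_eq_square ac_simps)
      qed
      finally show "norming l (S v) \<le> Rr * norm v" by (simp add: Rr_def)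
    qed
  qed
  then show ?thesis by (simp add: sg_square)
qed

end

context gaussian_sample_frame
begin

text \<open>Jensen's inequality takes the mean over the weights out of the power, Fubini exchanges
  weights and sample, and for fixed weights the sum has the law of their Euclidean length times Y
  1.\<close>

lemma Lpb_Vmean:
  assumes p: "p \<ge> 1"
  shows "Lpb M p (\<lambda>w. Vmean (\<lambda>j. Y j w)) (sqrt (2 * (p + real n)) * (exp 1 * (xi + sqrt (2 * p) * sg)))"
proof -
  interpret P: pair_prob_space M M ..
  have [measurable]: "\<gamma> j \<in> borel_measurable M" for j by (rule gaussian_spaceD(4)[OF G \<gamma>_mem])
  have [measurable]: "Y j \<in> borel_measurable M" for j by (rule Y_measurable)
  define f where "f = (\<lambda>w w'. norm (\<Sum>j=1..n. \<gamma> j w' *\<^sub>R Y j w))"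
  have fm[measurable]: "(\<lambda>(w, w'). f w w') \<in> borel_measurable (M \<Otimes>\<^sub>M M)" unfolding f_def by measurable
  define K where "K = exp 1 * (xi + sqrt (2 * p) * sg)"
  have K: "0 \<le> K" using xi_nonneg sg_nonneg p by (simp add: K_def)
  have V: "Vmean (\<lambda>j. Y j w) = (\<integral>w'. f w w' \<partial>M)" for w by (simp add: Vmean_def f_def)
  have Vm: "(\<lambda>w. Vmean (\<lambda>j. Y j w)) \<in> borel_measurable M" unfolding V by (rule borel_measurable_lebesgue_integral[OF fm])
  have "(\<integral>\<^sup>+w. ennreal (Vmean (\<lambda>j. Y j w) powr p) \<partial>M) \<le> (\<integral>\<^sup>+w. (\<integral>\<^sup>+w'. ennreal (f w w' powr p) \<partial>M) \<partial>M)"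
    unfolding V using p integrable_\<gamma>_norm by (intro nn_integral_mono integral_powr_le prob_space_axioms) (auto simp: f_def)
  also have "\<dots> = (\<integral>\<^sup>+w'. (\<integral>\<^sup>+w. ennreal (f w w' powr p) \<partial>M) \<partial>M)"
    by (rule P.Fubini'[symmetric]) measurable
  also have "\<dots> \<le> (\<integral>\<^sup>+w'. ennreal ((K * sqrt (\<Sum>j=1..n. (\<gamma> j w')\<^sup>2)) powr p) \<partial>M)"
  proof (rule nn_integral_mono)
    fix w'
    show "(\<integral>\<^sup>+w. ennreal (f w w' powr p) \<partial>M) \<le> ennreal ((K * sqrt (\<Sum>j=1..n. (\<gamma> j w')\<^sup>2)) powr p)"
      using LpbD(4)[OF Lpb_lin[of p "\<lambda>j. \<gamma> j w'"]] p by (simp add: f_def K_def mult.commute)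
  qed
  also have "\<dots> \<le> ennreal ((K * sqrt (2 * (p + real n))) powr p)"
    using LpbD(4)[OF Lpb_cmult[OF Lpb_\<gamma> K, of p]] p by simp
  finally show ?thesis using Vm K p by (simp add: Lpb_def K_def mult.commute Vmean_def)
qed

text \<open>Here the deviation re-enters its own bound: the squared weak norm of the sample is n
  times the norm of the sample covariance, at most n (norm S + dev). Because of the square root only
  the moment of order p / 2 is used, and this is bounded by the one of order p.\<close>

lemma Lpb_bnorm:
  assumes p: "p \<ge> 1" and dev: "Lpb M p dev z"
  shows "Lpb M p (\<lambda>w. bnorm (\<lambda>j. Y j w)) (sqrt (2 * (real n * (sg\<^sup>2 + z))))"
proof -
  have z: "0 \<le> z" using LpbD[OF dev] by simp
  have 1: "Lpb M p (\<lambda>w. real n * (sg\<^sup>2 + dev w)) (real n * (2 * (sg\<^sup>2 + z)))"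
    by (intro Lpb_cmult Lpb_add Lpb_const prob_space_axioms dev p) auto
  have "Lpb M (p / 2) (\<lambda>w. real n * (sg\<^sup>2 + dev w)) (real n * (2 * (sg\<^sup>2 + z)))"
    by (rule Lpb_lower[OF prob_space_axioms 1]) (use p in auto)
  from Lpb_powr[OF this, of "1 / 2"]
  have "Lpb M p (\<lambda>w. (real n * (sg\<^sup>2 + dev w)) powr (1 / 2)) ((real n * (2 * (sg\<^sup>2 + z))) powr (1 / 2))" by simp
  then show ?thesis
  proof (rule Lpb_mono)
    show "(\<lambda>w. bnorm (\<lambda>j. Y j w)) \<in> borel_measurable M" unfolding bnorm_def
      by (rule measurable_sample) (intro continuous_on_real_sqrt continuous_on_norm continuous_on_tsum continuous_on_product_coordinates)
    fix w
    have "scov w = S + (scov w - S)" by simp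
    then have "norm (scov w) \<le> norm S + norm (scov w - S)" by (metis norm_triangle_ineq)
    then have "norm (tsum n (\<lambda>j. Y j w) (\<lambda>j. Y j w)) \<le> real n * (sg\<^sup>2 + dev w)"
      using n by (simp add: scov_def sample_cov_eq_tsum sg_square dev_def field_simps)
    then show "bnorm (\<lambda>j. Y j w) \<le> (real n * (sg\<^sup>2 + dev w)) powr (1 / 2)"
      by (simp add: bnorm_def powr_half_sqrt dev_def)
    show "(real n * (2 * (sg\<^sup>2 + z))) powr (1 / 2) \<le> sqrt (2 * (real n * (sg\<^sup>2 + z)))" using z by (simp add: powr_half_sqrt mult.left_commute)
  qed (use p in \<open>auto simp: bnorm_def\<close>)
qed

text \<open>Chevet's bound conditionally on the first copy, followed by the moments of its two
  random ingredients, the mean norm with Gaussian weights and the weak norm.\<close>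

lemma tsum_moment:
  assumes p: "p \<ge> 1" and dev: "Lpb M p dev z"
  defines "s \<equiv> xi + sqrt (2 * p) * sg"
  shows "(\<integral>\<^sup>+x. ennreal (norm (tsum n (\<lambda>j. Y j (fst x)) (\<lambda>j. Y j (snd x))) powr p) \<partial>(M \<Otimes>\<^sub>M M))
    \<le> ennreal ((exp 1 * (2 * (2 * sg * (sqrt (2 * (p + real n)) * (exp 1 * s)) + 2 * s * sqrt (2 * (real n * (sg\<^sup>2 + z)))))) powr p)"
proof -
  have s: "0 \<le> s" "2 * xi + sqrt (2 * p) * sg \<le> 2 * s" using xi_nonneg sg_nonneg p by (auto simp: s_def)
  have m: "(\<lambda>x. ennreal (norm (tsum n (\<lambda>j. Y j (fst x)) (\<lambda>j. Y j (snd x))) powr p)) \<in> borel_measurable (M \<Otimes>\<^sub>M M)"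
    using p by (intro measurable_compose[OF _ measurable_ennreal] measurable_sample_pair[where F = "\<lambda>a b. norm (tsum n a b) powr p"]
      continuous_on_powr' continuous_on_norm continuous_on_tsum continuous_on_coordinate continuous_on_const) auto
  define D where "D = (\<lambda>w. 2 * sg * Vmean (\<lambda>j. Y j w) + 2 * s * bnorm (\<lambda>j. Y j w))"
  have "(\<integral>\<^sup>+x. ennreal (norm (tsum n (\<lambda>j. Y j (fst x)) (\<lambda>j. Y j (snd x))) powr p) \<partial>(M \<Otimes>\<^sub>M M))
    = (\<integral>\<^sup>+w. (\<integral>\<^sup>+w'. ennreal (norm (tsum n (\<lambda>j. Y j w) (\<lambda>j. Y j w')) powr p) \<partial>M) \<partial>M)"
    using nn_integral_fst[OF m, symmetric] by simp
  also have "\<dots> \<le> (\<integral>\<^sup>+w. ennreal ((exp 1 * D w) powr p) \<partial>M)"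
  proof (rule nn_integral_mono)
    fix w
    let ?y = "\<lambda>j. Y j w"
    have b0: "0 \<le> bnorm ?y" "0 \<le> Vmean ?y" by (simp_all add: bnorm_def Vmean_def)
    have "(2 * xi + sqrt (2 * p) * sg) * bnorm ?y \<le> 2 * s * bnorm ?y" using b0 s by (intro mult_right_mono) auto
    then have le: "2 * (sg * Vmean ?y + bnorm ?y * xi) + sqrt (2 * p) * sg * bnorm ?y \<le> D w"
      by (simp add: D_def algebra_simps)
    have "(\<integral>\<^sup>+w'. ennreal (norm (tsum n ?y (\<lambda>j. Y j w')) powr p) \<partial>M)
      \<le> ennreal ((exp 1 * (2 * (sg * Vmean ?y + bnorm ?y * xi) + sqrt (2 * p) * sg * bnorm ?y)) powr p)"
      using chevet(2)[of p ?y] p by (intro LpbD(4)) auto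
    also have "\<dots> \<le> ennreal ((exp 1 * D w) powr p)"
      using le b0 sg_nonneg xi_nonneg p by (intro ennreal_leI powr_mono2 mult_left_mono) auto
    finally show "(\<integral>\<^sup>+w'. ennreal (norm (tsum n ?y (\<lambda>j. Y j w')) powr p) \<partial>M) \<le> ennreal ((exp 1 * D w) powr p)" .
  qed
  also have "\<dots> \<le> ennreal ((exp 1 * (2 * (2 * sg * (sqrt (2 * (p + real n)) * (exp 1 * s)) + 2 * s * sqrt (2 * (real n * (sg\<^sup>2 + z)))))) powr p)"
    unfolding D_def s_def
    by (intro LpbD(4) Lpb_cmult Lpb_add Lpb_Vmean Lpb_bnorm p dev) (use sg_nonneg s s_def in auto)
  finally show ?thesis .
qed

theorem Lpb_dev:
  assumes p: "p \<ge> 1"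
  shows "Lpb M p dev (7000 * (sg * sqrt (Rr / n) + Rr / n + sg\<^sup>2 * (sqrt (p / n) + p / n)))"
proof -
  obtain B where "Lpb M p dev B" using Lpb_dev_ex[OF p] by auto
  \<comment> \<open>\<open>z\<close> is the exact moment, so every bound for the deviation,
    including one that contains \<open>z\<close> itself, is an inequality for
    \<open>z\<close>.\<close>
  then obtain z where z: "Lpb M p dev z" "\<And>B. Lpb M p dev B \<Longrightarrow> z \<le> B" using Lpb_least p by (metis less_le_trans zero_less_one)
  have z0: "0 \<le> z" using LpbD[OF z(1)] by simp
  define s where "s = xi + sqrt (2 * p) * sg"
  have s: "0 \<le> s" using xi_nonneg sg_nonneg p by (simp add: s_def)
  define K where "K = exp 1 * (2 * (2 * sg * (sqrt (2 * (p + real n)) * (exp 1 * s)) + 2 * s * sqrt (2 * (real n * (sg\<^sup>2 + z)))))"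
  have K: "0 \<le> K" using s sg_nonneg z0 p by (simp add: K_def)
  have "(\<integral>\<^sup>+w. ennreal (dev w powr p) \<partial>M)
    \<le> (\<integral>\<^sup>+x. ennreal ((2 / real n * norm (tsum n (\<lambda>j. Y j (fst x)) (\<lambda>j. Y j (snd x)))) powr p) \<partial>(M \<Otimes>\<^sub>M M))"
    by (rule dev_symmetrization[OF p])
  also have "\<dots> = ennreal ((2 / real n) powr p) * (\<integral>\<^sup>+x. ennreal (norm (tsum n (\<lambda>j. Y j (fst x)) (\<lambda>j. Y j (snd x))) powr p) \<partial>(M \<Otimes>\<^sub>M M))"
  proof -
    have m: "(\<lambda>x. ennreal (norm (tsum n (\<lambda>j. Y j (fst x)) (\<lambda>j. Y j (snd x))) powr p)) \<in> borel_measurable (M \<Otimes>\<^sub>M M)"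
      using p by (intro measurable_compose[OF _ measurable_ennreal] measurable_sample_pair[where F = "\<lambda>a b. norm (tsum n a b) powr p"]
        continuous_on_powr' continuous_on_norm continuous_on_tsum continuous_on_coordinate continuous_on_const) auto
    have "(\<integral>\<^sup>+x. ennreal ((2 / real n * norm (tsum n (\<lambda>j. Y j (fst x)) (\<lambda>j. Y j (snd x)))) powr p) \<partial>(M \<Otimes>\<^sub>M M))
      = (\<integral>\<^sup>+x. ennreal ((2 / real n) powr p) * ennreal (norm (tsum n (\<lambda>j. Y j (fst x)) (\<lambda>j. Y j (snd x))) powr p) \<partial>(M \<Otimes>\<^sub>M M))"
      by (intro nn_integral_cong, subst powr_mult) (auto intro: ennreal_mult)
    then show ?thesis using nn_integral_cmult[OF m] by simp
  qed
  also have "\<dots> \<le> ennreal ((2 / real n) powr p) * ennreal (K powr p)"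
    unfolding K_def s_def by (intro mult_left_mono tsum_moment p z(1)) auto
  also have "\<dots> = ennreal ((2 / real n * K) powr p)" using K by (subst powr_mult) (auto simp: ennreal_mult)
  finally have "Lpb M p dev (2 / real n * K)" using K by (simp add: Lpb_def dev_measurable dev_def)
  then have zK: "z \<le> 2 / real n * K" by (rule z(2))
  have "sqrt p * sg \<le> sqrt (2 * p) * sg" using p sg_nonneg by (intro mult_right_mono real_sqrt_le_mono) auto
  then have pg: "sqrt p * sg \<le> s" using xi_nonneg by (simp add: s_def)
  define x where "x = s / sqrt n"
  have zx: "z \<le> 1512 * x\<^sup>2 + 288 * sg * x"
    unfolding x_def using zK sg_nonneg s pg p n z0 by (intro sqrt_fixpoint_bound) (auto simp: K_def)
  define a b where "a = sqrt (Rr / n)" and "b = sqrt (p / n) * sg"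
  have ab: "0 \<le> a" "0 \<le> b" "a\<^sup>2 = Rr / n" "b\<^sup>2 = p / n * sg\<^sup>2" using Rr_nonneg sg_nonneg p by (auto simp: a_def b_def power_mult_distrib)
  have x0: "0 \<le> x" using s by (simp add: x_def)
  have xab: "x \<le> a + 3 / 2 * b"
  proof -
    have s2: "sqrt 2 \<le> (3 / 2 :: real)" by (rule real_le_lsqrt) (auto simp: power2_eq_square)
    have "sqrt 2 * (sqrt p * sg) \<le> 3 / 2 * (sqrt p * sg)" using p sg_nonneg by (intro mult_right_mono[OF s2]) auto
    then have "sqrt (2 * p) * sg \<le> 3 / 2 * sqrt p * sg" by (simp only: real_sqrt_mult mult.assoc)
    then have "s \<le> sqrt Rr + 3 / 2 * sqrt p * sg" using xi_le by (simp add: s_def)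
    then have "x \<le> (sqrt Rr + 3 / 2 * sqrt p * sg) / sqrt n" unfolding x_def by (intro divide_right_mono) auto
    also have "\<dots> = a + 3 / 2 * b" by (simp add: a_def b_def real_sqrt_divide add_divide_distrib)
    finally show ?thesis .
  qed
  have "x\<^sup>2 \<le> (a + 3 / 2 * b)\<^sup>2" using x0 xab by (intro power_mono) auto
  also have "\<dots> \<le> 2 * a\<^sup>2 + 9 / 2 * b\<^sup>2"
  proof -
    have "0 \<le> (a - 3 / 2 * b)\<^sup>2" by simp
    then show ?thesis by (simp add: power2_eq_square algebra_simps)
  qed
  finally have x2: "x\<^sup>2 \<le> 2 * a\<^sup>2 + 9 / 2 * b\<^sup>2" .
  have sx: "sg * x \<le> sg * a + 3 / 2 * (sg * b)" using mult_left_mono[OF xab sg_nonneg] by (simp add: algebra_simps)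
  have nn: "0 \<le> sg * a" "0 \<le> sg * b" using sg_nonneg ab by auto
  \<comment> \<open>The largest coefficient is 1512 * 9 / 2 = 6804, at b^2.\<close>
  have "z \<le> 7000 * (sg * a + a\<^sup>2 + (sg * b + b\<^sup>2))"
  proof -
    have "z \<le> 1512 * x\<^sup>2 + 288 * (sg * x)" using zx by (simp only: mult.assoc)
    then show ?thesis using x2 sx nn zero_le_power2[of a] zero_le_power2[of b] by (simp only: distrib_left)
  qed
  also have "sg * a + a\<^sup>2 + (sg * b + b\<^sup>2) = sg * sqrt (Rr / n) + Rr / n + sg\<^sup>2 * (sqrt (p / n) + p / n)"
    unfolding ab(3,4) by (simp add: a_def b_def power2_eq_square algebra_simps)
  finally show ?thesis using p by (intro Lpb_mono[OF z(1)]) (auto simp: dev_measurable dev_def)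
qed

end

section \<open>Linear functionals of the deviation\<close>

context gaussian_sample
begin

section \<open>Means of functionals of tensor squares\<close>

lemma norm_tens_diff: "norm (tens x x - tens y y) \<le> norm (x - y) * (norm x + norm y)" for x y :: 'a
proof -
  interpret tens: bounded_bilinear "tens :: 'a \<Rightarrow> 'a \<Rightarrow> 'a opr" by (rule bounded_bilinear_tens)
  have "tens x x - tens y y = tens x (x - y) + tens (x - y) y" by (simp add: tens.diff_left tens.diff_right)
  then have "norm (tens x x - tens y y) \<le> norm (tens x (x - y)) + norm (tens (x - y) y)" by (simp add: norm_triangle_ineq)
  also have "\<dots> \<le> norm x * norm (x - y) + norm (x - y) * norm y" by (intro add_mono norm_tens_le)
  finally show ?thesis by (simp add: algebra_simps)
qed

lemma tens_borel: "\<phi> \<in> borel_measurable borel \<Longrightarrow> (\<lambda>w. \<phi> (tens (Y j w) (Y j w))) \<in> borel_measurable M"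
  for \<phi> :: "'a opr \<Rightarrow> real"
proof -
  assume \<phi>: "\<phi> \<in> borel_measurable borel"
  interpret tens: bounded_bilinear "tens :: 'a \<Rightarrow> 'a \<Rightarrow> 'a opr" by (rule bounded_bilinear_tens)
  have "(\<lambda>w. tens (Y j w) (Y j w)) \<in> borel_measurable M"
    by (rule measurable_sample[where F = "\<lambda>y. tens (y j) (y j)"]) (intro tens.continuous_on continuous_on_product_coordinates)
  from measurable_compose[OF this \<phi>] show ?thesis .
qed

text \<open>
  The space of operators is not separable, so the Bochner integral of the library does not apply to
  \<open>Y \<otimes> Y\<close>; instead \<open>Y\<close> itself is approximated by simple functions.
\<close>

lemma functional_cov:
  fixes l :: "'a opr \<Rightarrow>\<^sub>L real"
  assumes j: "j \<in> {1..n}"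
  shows "(\<integral>w. l (tens (Y j w) (Y j w)) \<partial>M) = l S" "integrable M (\<lambda>w. l (tens (Y j w) (Y j w)))"
proof -
  interpret tens: bounded_bilinear "tens :: 'a \<Rightarrow> 'a \<Rightarrow> 'a opr" by (rule bounded_bilinear_tens)
  define X where "X = Y j"
  have [measurable]: "X \<in> borel_measurable M" unfolding X_def by (rule Y_measurable)
  have i2: "integrable M (\<lambda>w. (norm (X w))\<^sup>2)"
  proof -
    have "Lpb M 1 (\<lambda>w. (norm (Y j w))\<^sup>2) ((exp 1 * (xi + sqrt (2 * 2) * sg)) powr 2)"
      using Lpb_powr[OF Lpb_norm_Yj[OF j, of 2], of 2] by (simp add: powr_numeral)
    from Lpb_integral(1)[OF prob_space_axioms this] show ?thesis by (simp add: X_def)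
  qed
  have lm: "(\<lambda>A. blinfun_apply l A) \<in> borel_measurable borel" by (intro borel_measurable_continuous_onI linear_continuous_on blinfun.bounded_linear_right)
  have l_le: "\<bar>l (tens x x)\<bar> \<le> norm l * (norm x)\<^sup>2" for x
  proof -
    have "\<bar>l (tens x x)\<bar> \<le> norm l * norm (tens x x)" using norm_blinfun[of l "tens x x"] by simp
    also have "\<dots> \<le> norm l * (norm x * norm x)" by (intro mult_left_mono norm_tens_le) auto
    finally show ?thesis by (simp add: power2_eq_square)
  qed
  have iX: "integrable M (\<lambda>w. l (tens (X w) (X w)))"
  proof (rule Bochner_Integration.integrable_bound)
    show "integrable M (\<lambda>w. norm l * (norm (X w))\<^sup>2)" using i2 by simp
    show "(\<lambda>w. l (tens (X w) (X w))) \<in> borel_measurable M" unfolding X_def by (rule tens_borel[OF lm])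
    show "AE w in M. norm (l (tens (X w) (X w))) \<le> norm (norm l * (norm (X w))\<^sup>2)" using l_le by (intro AE_I2) simp
  qed
  then show "integrable M (\<lambda>w. l (tens (Y j w) (Y j w)))" by (simp add: X_def)
  obtain F where F': "\<forall>i. simple_function M (F i)" "\<forall>w\<in>space M. (\<lambda>i. F i w) \<longlonglongrightarrow> X w"
    "\<forall>i. \<forall>w\<in>space M. dist (F i w) 0 \<le> 2 * dist (X w) 0"
    using borel_measurable_implies_sequence_metric[OF \<open>X \<in> borel_measurable M\<close>, of 0] by (elim exE conjE) (rule that)
  then have F: "\<And>i. simple_function M (F i)" "\<And>w. w \<in> space M \<Longrightarrow> (\<lambda>i. F i w) \<longlonglongrightarrow> X w"
    "\<And>i w. w \<in> space M \<Longrightarrow> norm (F i w) \<le> 2 * norm (X w)" by auto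
  have [measurable]: "F i \<in> borel_measurable M" for i using F(1) by (rule borel_measurable_simple_function)
  \<comment> \<open>A bound for the difference of the tensor squares of X and F i, dominated by 9
    |X|^2 because |F i| <= 2 |X|.\<close>
  define d where "d = (\<lambda>i w. norm (X w - F i w) * (norm (X w) + norm (F i w)))"
  have d_le: "d i w \<le> 9 * (norm (X w))\<^sup>2" "0 \<le> d i w" if "w \<in> space M" for i w
  proof -
    have "norm (X w - F i w) \<le> 3 * norm (X w)" using norm_triangle_ineq4[of "X w" "F i w"] F(3)[OF that, of i] by simp
    moreover have "norm (X w) + norm (F i w) \<le> 3 * norm (X w)" using F(3)[OF that, of i] by simp
    ultimately have "d i w \<le> (3 * norm (X w)) * (3 * norm (X w))" unfolding d_def by (intro mult_mono) auto
    then show "d i w \<le> 9 * (norm (X w))\<^sup>2" by (simp add: power2_eq_square)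
    show "0 \<le> d i w" by (simp add: d_def)
  qed
  have id: "integrable M (d i)" for i
  proof (rule Bochner_Integration.integrable_bound)
    show "integrable M (\<lambda>w. 9 * (norm (X w))\<^sup>2)" using i2 by simp
    show "d i \<in> borel_measurable M" unfolding d_def by measurable
    show "AE w in M. norm (d i w) \<le> norm (9 * (norm (X w))\<^sup>2)" using d_le by (intro AE_I2) auto
  qed
  define e where "e = (\<lambda>i. \<integral>w. d i w \<partial>M)"
  have "(\<lambda>i. \<integral>w. d i w \<partial>M) \<longlonglongrightarrow> (\<integral>w. 0 \<partial>M)"
  proof (rule integral_dominated_convergence)
    show "integrable M (\<lambda>w. 9 * (norm (X w))\<^sup>2)" using i2 by simp
    show "AE w in M. (\<lambda>i. d i w) \<longlonglongrightarrow> 0"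
    proof (rule AE_I2)
      fix w assume w: "w \<in> space M"
      have "(\<lambda>i. d i w) \<longlonglongrightarrow> norm (X w - X w) * (norm (X w) + norm (X w))"
        unfolding d_def by (intro tendsto_intros F(2)[OF w])
      then show "(\<lambda>i. d i w) \<longlonglongrightarrow> 0" by simp
    qed
    show "AE w in M. norm (d i w) \<le> 9 * (norm (X w))\<^sup>2" for i using d_le by (intro AE_I2) auto
  qed (use id in auto)
  then have e0: "e \<longlonglongrightarrow> 0" by (simp add: e_def)
  have sb: "Bochner_Integration.simple_bochner_integrable M (\<lambda>w. tens (F i w) (F i w))" for i
  proof (rule simple_bochner_integrable.intros)
    show "simple_function M (\<lambda>w. tens (F i w) (F i w))" using F(1) by (rule simple_function_compose1)
  qed (simp add: emeasure_eq_measure)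
  \<comment> \<open>The integral of a simple function is a finite sum of operators, hence again an
    operator.\<close>
  define Si where "Si = (\<lambda>i. Bochner_Integration.simple_bochner_integral M (\<lambda>w. tens (F i w) (F i w)))"
  have lin: "(\<integral>w. h (tens (F i w) (F i w)) \<partial>M) = h (Si i)" "integrable M (\<lambda>w. h (tens (F i w) (F i w)))"
    if h: "bounded_linear h" for h :: "'a opr \<Rightarrow> real" and i
  proof -
    have lh: "linear h" using h by (simp add: bounded_linear.linear)
    have sh: "Bochner_Integration.simple_bochner_integrable M (\<lambda>w. h (tens (F i w) (F i w)))"
    proof (rule simple_bochner_integrable.intros)
      show "simple_function M (\<lambda>w. h (tens (F i w) (F i w)))" using F(1) by (rule simple_function_compose1)
    qed (simp add: emeasure_eq_measure)
    show "(\<integral>w. h (tens (F i w) (F i w)) \<partial>M) = h (Si i)"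
      unfolding Si_def simple_bochner_integral_linear[OF lh sb, symmetric] by (rule simple_bochner_integrable_eq_integral[OF sh, symmetric])
    show "integrable M (\<lambda>w. h (tens (F i w) (F i w)))" using has_bochner_integral_simple_bochner_integrable[OF sh] by (auto simp: integrable.simps)
  qed
  have diff: "\<bar>(\<integral>w. h (tens (X w) (X w)) \<partial>M) - h (Si i)\<bar> \<le> C * e i"
    if h: "bounded_linear h" and C: "\<And>A. \<bar>h A\<bar> \<le> C * norm A" "0 \<le> C" and ih: "integrable M (\<lambda>w. h (tens (X w) (X w)))" for h :: "'a opr \<Rightarrow> real" and C i
  proof -
    interpret h: bounded_linear h by fact
    have "(\<integral>w. h (tens (X w) (X w)) \<partial>M) - h (Si i) = (\<integral>w. h (tens (X w) (X w)) - h (tens (F i w) (F i w)) \<partial>M)"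
      using lin[OF h] ih by simp
    also have "\<bar>\<dots>\<bar> \<le> (\<integral>w. \<bar>h (tens (X w) (X w)) - h (tens (F i w) (F i w))\<bar> \<partial>M)" by (rule integral_abs_bound)
    also have "\<dots> \<le> (\<integral>w. C * d i w \<partial>M)"
    proof (rule integral_mono)
      fix w
      have "\<bar>h (tens (X w) (X w)) - h (tens (F i w) (F i w))\<bar> \<le> C * norm (tens (X w) (X w) - tens (F i w) (F i w))"
        using C(1) by (simp add: h.diff[symmetric])
      also have "\<dots> \<le> C * d i w" unfolding d_def using C by (intro mult_left_mono norm_tens_diff)
      finally show "\<bar>h (tens (X w) (X w)) - h (tens (F i w) (F i w))\<bar> \<le> C * d i w" .
    qed (use id ih lin[OF h] in auto)
    finally show ?thesis by (simp add: e_def)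
  qed
  \<comment> \<open>The operators \<open>Si i\<close> converge to \<open>S\<close> in norm, which
    norming functionals alone can detect. Norm convergence is what lets an arbitrary
    \<open>l\<close> pass to the limit, beyond functionals built from an evaluation.\<close>
  have SSi: "norm (S - Si i) \<le> e i" for i
  proof (rule norm_blinfun_bound)
    show "0 \<le> e i" unfolding e_def by (simp add: d_def)
    fix v :: "'a dual"
    show "norm ((S - Si i) v) \<le> e i * norm v"
    proof (rule norm_le_norming)
      fix k
      define h :: "'a opr \<Rightarrow> real" where "h = (\<lambda>A. norming k (A v))"
      have h: "bounded_linear h" unfolding h_def by (intro bounded_linear_compose[OF blinfun.bounded_linear_right] blinfun.bounded_linear_left)
      have hC: "\<bar>h A\<bar> \<le> norm v * norm A" for A
      proof -
        have "\<bar>h A\<bar> \<le> norm (norming k :: 'a dual) * norm (A v)" unfolding h_def using norm_blinfun[of "norming k" "A v"] by simp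
        also have "\<dots> \<le> 1 * (norm A * norm v)" by (intro mult_mono norm_norming norm_blinfun) auto
        finally show ?thesis by (simp add: mult.commute)
      qed
      have ht: "h (tens x x) = blinfun_apply v x * norming k x" for x by (simp add: h_def tens.rep_eq blinfun.scaleR_right)
      have ih: "integrable M (\<lambda>w. h (tens (X w) (X w)))" unfolding ht X_def by (rule gaussian_space_integrable_mult[OF G Y_mem Y_mem])
      have "(\<integral>w. h (tens (X w) (X w)) \<partial>M) = norming k (S v)" unfolding ht X_def using j by (simp add: Y_cov)
      then have "norming k (S v) - h (Si i) \<le> norm v * e i" using diff[OF h hC _ ih, of i] by simp
      then show "norming k ((S - Si i) v) \<le> e i * norm v" by (simp add: h_def minus_blinfun.rep_eq blinfun.diff_right mult.commute)
    qed
  qed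
  have "\<bar>(\<integral>w. l (tens (X w) (X w)) \<partial>M) - l S\<bar> \<le> 2 * norm l * e i" for i
  proof -
    have lC: "\<bar>l A\<bar> \<le> norm l * norm A" for A using norm_blinfun[of l A] by simp
    have 1: "\<bar>(\<integral>w. l (tens (X w) (X w)) \<partial>M) - l (Si i)\<bar> \<le> norm l * e i" by (rule diff[OF blinfun.bounded_linear_right lC _ iX]) simp
    have "\<bar>l (S - Si i)\<bar> \<le> norm l * norm (S - Si i)" by (rule lC)
    also have "\<dots> \<le> norm l * e i" by (intro mult_left_mono SSi) auto
    finally show ?thesis using 1 by (simp add: blinfun.diff_right)
  qed
  moreover have "(\<lambda>i. 2 * norm l * e i) \<longlonglongrightarrow> 2 * norm l * 0" by (intro tendsto_intros e0)
  ultimately have "\<bar>(\<integral>w. l (tens (X w) (X w)) \<partial>M) - l S\<bar> \<le> 2 * norm l * 0" by (intro LIMSEQ_le_const) auto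
  then show "(\<integral>w. l (tens (Y j w) (Y j w)) \<partial>M) = l S" by (simp add: X_def)
qed

end

context gaussian_sample_frame
begin

text \<open>The variance of this Gaussian variable T is itself \<open>l\<close> applied to a sum of
  tensors, whose norm is tested by covariances of T with variables V of variance at most (sg b)^2.
  The inequality 2 T V <= c T^2 + V^2 / c with c = 1 / norm l returns half of the variance, which is
  absorbed.\<close>

lemma functional_tsum_gaussian:
  fixes l :: "'a opr \<Rightarrow>\<^sub>L real" and y :: "nat \<Rightarrow> 'a"
  shows "(\<lambda>w. l (tsum n y (\<lambda>j. Y j w))) \<in> G" "(\<integral>w. (l (tsum n y (\<lambda>j. Y j w)))\<^sup>2 \<partial>M) \<le> (norm l * (sg * bnorm y))\<^sup>2"
proof -
  interpret tens: bounded_bilinear "tens :: 'a \<Rightarrow> 'a \<Rightarrow> 'a opr" by (rule bounded_bilinear_tens)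
  define u :: "nat \<Rightarrow> 'a dual" where "u = (\<lambda>j. Blinfun (\<lambda>x. l (tens (y j) x)))"
  have u: "u j x = l (tens (y j) x)" for j x
  proof -
    have "bounded_linear (\<lambda>x. l (tens (y j) x))"
      by (intro bounded_linear_compose[OF blinfun.bounded_linear_right] tens.bounded_linear_right)
    then show ?thesis by (simp add: u_def bounded_linear_Blinfun_apply)
  qed
  define T where "T = (\<lambda>w. \<Sum>j=1..n. u j (Y j w))"
  have T: "l (tsum n y (\<lambda>j. Y j w)) = T w" for w by (simp add: T_def u tsum_def blinfun.sum_right)
  have TG: "T \<in> G" unfolding T_def by (rule lin_mem)
  show "(\<lambda>w. l (tsum n y (\<lambda>j. Y j w))) \<in> G" unfolding T by (rule TG)
  define t2 where "t2 = (\<integral>w. (T w)\<^sup>2 \<partial>M)"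
  have t0: "0 \<le> t2" by (simp add: t2_def)
  define b where "b = bnorm y"
  have b2: "b\<^sup>2 = norm (tsum n y y)" by (simp_all add: b_def bnorm_def)
  have t2l: "t2 = l (tsum n y (\<lambda>j. S (u j)))" unfolding t2_def T_def lin_var by (simp add: u tsum_def blinfun.sum_right)
  have le: "t2 \<le> (norm l * (sg * b))\<^sup>2"
  proof (cases "norm l = 0")
    case True
    then show ?thesis using t2l by simp
  next
    case False
    then have nl: "norm l > 0" by simp
    define c where "c = 1 / norm l"
    have c: "c > 0" using nl by (simp add: c_def)
    have "norm (tsum n y (\<lambda>j. S (u j))) \<le> (c * t2 + (sg * b)\<^sup>2 / c) / 2"
    proof (rule norm_tsum_le)
      fix i k
      define V where "V = (\<lambda>w. \<Sum>j=1..n. (norming i (y j) *\<^sub>R norming k) (Y j w))"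
      have VG: "V \<in> G" unfolding V_def by (rule lin_mem)
      have TV: "(\<Sum>j=1..n. norming i (y j) * norming k (S (u j))) = (\<integral>w. T w * V w \<partial>M)"
        unfolding T_def V_def lin_cov by (simp add: scaleR_blinfun.rep_eq)
      have VV: "(\<integral>w. (V w)\<^sup>2 \<partial>M) \<le> (sg * b)\<^sup>2"
      proof -
        have "(\<integral>w. (V w)\<^sup>2 \<partial>M) = (\<Sum>j=1..n. (norming i (y j))\<^sup>2) * norming k (S (norming k))"
          unfolding V_def lin_var by (simp add: scaleR_blinfun.rep_eq blinfun.scaleR_right sum_distrib_left power2_eq_square ac_simps)
        also have "\<dots> \<le> b\<^sup>2 * sg\<^sup>2"
        proof (rule mult_mono)
          show "(\<Sum>j=1..n. (norming i (y j))\<^sup>2) \<le> b\<^sup>2" unfolding b2 power2_eq_square[of "blinfun_apply _ _"] by (rule norming_pair_le)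
          have "norming k (S (norming k)) \<le> norm (norming k :: 'a dual) * norm (norming k :: 'a dual) * sg\<^sup>2" by (rule cov_le)
          also have "\<dots> \<le> 1 * 1 * sg\<^sup>2" by (intro mult_mono norm_norming) auto
          finally show "norming k (S (norming k)) \<le> sg\<^sup>2" by simp
        qed (auto simp: var_nonneg)
        finally show ?thesis by (simp add: power_mult_distrib mult.commute)
      qed
      have "0 \<le> (\<integral>w. (c * T w + (-1) * V w)\<^sup>2 \<partial>M)" by simp
      then have "0 \<le> c\<^sup>2 * t2 - 2 * c * (\<integral>w. T w * V w \<partial>M) + (\<integral>w. (V w)\<^sup>2 \<partial>M)"
        unfolding gaussian_space_second_moment[OF G TG VG] by (simp add: t2_def)
      then have "2 * c * (\<integral>w. T w * V w \<partial>M) \<le> c\<^sup>2 * t2 + (sg * b)\<^sup>2" using VV by linarith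
      then have "(\<integral>w. T w * V w \<partial>M) \<le> (c * t2 + (sg * b)\<^sup>2 / c) / 2" using c by (simp add: field_simps power2_eq_square)
      then show "(\<Sum>j=1..n. norming i (y j) * norming k (S (u j))) \<le> (c * t2 + (sg * b)\<^sup>2 / c) / 2" unfolding TV .
    next
      show "0 \<le> (c * t2 + (sg * b)\<^sup>2 / c) / 2" using c t0 by simp
    qed
    then have "norm l * norm (tsum n y (\<lambda>j. S (u j))) \<le> norm l * ((c * t2 + (sg * b)\<^sup>2 / c) / 2)" by (intro mult_left_mono) auto
    moreover have "t2 \<le> norm l * norm (tsum n y (\<lambda>j. S (u j)))"
      unfolding t2l using norm_blinfun[of l "tsum n y (\<lambda>j. S (u j))"] by simp
    ultimately have "t2 \<le> norm l * ((c * t2 + (sg * b)\<^sup>2 / c) / 2)" by linarith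
    also have "\<dots> = t2 / 2 + (norm l * (sg * b))\<^sup>2 / 2" using nl by (simp add: c_def field_simps power2_eq_square)
    finally show ?thesis by simp
  qed
  then show "(\<integral>w. (l (tsum n y (\<lambda>j. Y j w)))\<^sup>2 \<partial>M) \<le> (norm l * (sg * bnorm y))\<^sup>2" unfolding T by (simp add: t2_def b_def)
qed

lemma Lpb_functional_tsum:
  fixes l :: "'a opr \<Rightarrow>\<^sub>L real" and y :: "nat \<Rightarrow> 'a"
  assumes p: "p \<ge> 1"
  shows "Lpb M p (\<lambda>w. \<bar>l (tsum n y (\<lambda>j. Y j w))\<bar>) (8 * sqrt p * norm l * (sg * bnorm y))"
proof -
  define T where "T = (\<lambda>w. l (tsum n y (\<lambda>j. Y j w)))"
  define t where "t = norm l * (sg * bnorm y)"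
  have t0: "0 \<le> t" using sg_nonneg by (simp add: t_def bnorm_def)
  have TG: "T \<in> G" and Tv: "(\<integral>w. (T w)\<^sup>2 \<partial>M) \<le> t\<^sup>2" using functional_tsum_gaussian[of l y] by (auto simp: T_def t_def)
  \<comment> \<open>The absolute value as the supremum of a sequence: T at index 0 and - T at all
    later ones.\<close>
  define g where "g = (\<lambda>i::nat. if i = 0 then T else (\<lambda>w. - T w))"
  have g: "g i \<in> G" for i using TG gaussian_spaceD(9)[OF G TG] by (simp add: g_def)
  have gv: "(\<integral>w. (g i w)\<^sup>2 \<partial>M) \<le> t\<^sup>2" for i using Tv by (simp add: g_def)
  have gle: "g i w \<le> \<bar>T w\<bar>" for i w using abs_ge_self[of "T w"] abs_ge_minus_self[of "T w"] by (simp add: g_def)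
  have bdd: "bdd_above (range (\<lambda>i. g i w))" for w using gle by (intro bdd_aboveI[where M = "\<bar>T w\<bar>"]) auto
  have SUP: "\<bar>T w\<bar> = (SUP i. g i w)" for w
  proof (rule antisym)
    show "(SUP i. g i w) \<le> \<bar>T w\<bar>" by (intro cSUP_least gle) auto
    have "g 0 w \<le> (SUP i. g i w)" "g 1 w \<le> (SUP i. g i w)" by (intro cSUP_upper bdd UNIV_I)+
    then show "\<bar>T w\<bar> \<le> (SUP i. g i w)" by (simp add: g_def)
  qed
  have rv: "gaussian_rv M T" by (rule gaussian_spaceD(2)[OF G TG])
  have "(\<integral>w. \<bar>T w\<bar> \<partial>M)\<^sup>2 \<le> (\<integral>w. \<bar>T w\<bar>\<^sup>2 \<partial>M)"
    using gaussian_rv_abs_power[OF rv, of 2] gaussian_rv_integrable[OF rv] by (intro integral_square_ge prob_space_axioms) auto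
  also have "\<dots> \<le> t\<^sup>2" using Tv by simp
  finally have mean: "(\<integral>w. \<bar>T w\<bar> \<partial>M) \<le> t" using t0 by (rule power2_le_imp_le)
  have sp: "1 \<le> sqrt p" using p by simp
  have s2: "sqrt 2 \<le> (3 / 2 :: real)" by (rule real_le_lsqrt) (auto simp: power2_eq_square)
  have e3: "exp (1::real) \<le> 3" by (rule exp_le)
  \<comment> \<open>A mean of at most t and sqrt (2 p) t <= 3/2 sqrt p t give 5/2; with e <= 3 this
    becomes 15/2 <= 8.\<close>
  have D: "(\<integral>w. \<bar>T w\<bar> \<partial>M) + sqrt (2 * p * t\<^sup>2) \<le> 5 / 2 * sqrt p * t"
  proof -
    have "sqrt (2 * p * t\<^sup>2) = sqrt 2 * (sqrt p * t)" using t0 by (simp add: real_sqrt_mult)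
    also have "\<dots> \<le> 3 / 2 * (sqrt p * t)" using t0 p by (intro mult_right_mono s2) auto
    finally have "sqrt (2 * p * t\<^sup>2) \<le> 3 / 2 * (sqrt p * t)" .
    moreover have "1 * t \<le> sqrt p * t" using t0 by (intro mult_right_mono sp) auto
    ultimately show ?thesis using mean by (simp add: mult.assoc)
  qed
  have L: "Lpb M p (\<lambda>w. \<bar>T w\<bar>) (exp 1 * (5 / 2 * sqrt p * t))"
    by (rule Lpb_SUP[where g = g, OF G g gv bdd SUP _ _ D]) (use p in auto)
  have "exp 1 * (5 / 2 * sqrt p * t) \<le> 8 * sqrt p * t"
  proof -
    have "exp 1 * (5 / 2 * sqrt p * t) \<le> 3 * (5 / 2 * sqrt p * t)" using t0 p by (intro mult_right_mono e3) auto
    also have "\<dots> \<le> 8 * (sqrt p * t)" using t0 p by simp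
    finally show ?thesis by (simp only: mult.assoc)
  qed
  moreover have "(\<lambda>w. \<bar>T w\<bar>) \<in> borel_measurable M" using gaussian_spaceD(4)[OF G TG] by simp
  ultimately have "Lpb M p (\<lambda>w. \<bar>T w\<bar>) (8 * sqrt p * t)" using p by (intro Lpb_mono[OF L]) auto
  then show ?thesis by (simp add: T_def t_def mult.assoc)
qed

text \<open>A functional may treat the two transposed tensor sums differently, so both are kept;
  they have equal integrals by Fubini. Hence 2 * 2^p <= 4^p and the factor 4.\<close>

lemma functional_symmetrization:
  fixes l :: "'a opr \<Rightarrow>\<^sub>L real"
  assumes p: "p \<ge> 1"
  defines "T \<equiv> \<lambda>w w'. tsum n (\<lambda>j. Y j w) (\<lambda>j. Y j w')"
  shows "(\<integral>\<^sup>+w. ennreal (\<bar>l (scov w - S)\<bar> powr p) \<partial>M)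
    \<le> ennreal ((4 / real n) powr p) * (\<integral>\<^sup>+w. (\<integral>\<^sup>+w'. ennreal (\<bar>l (T w w')\<bar> powr p) \<partial>M) \<partial>M)"
proof -
  interpret P: pair_prob_space M M ..
  have lc: "continuous_on UNIV (blinfun_apply l)" by (intro linear_continuous_on blinfun.bounded_linear_right)
  have lscov: "l (scov w) = (1 / real n) * (\<Sum>j=1..n. l (tens (Y j w) (Y j w)))" for w
    by (simp add: scov_def sample_cov_eq_tsum tsum_def blinfun.scaleR_right blinfun.sum_right)
  have isc: "integrable M (\<lambda>w. l (scov w))" unfolding lscov by (intro integrable_mult_right Bochner_Integration.integrable_sum functional_cov(2))
  have msc: "(\<integral>w. l (scov w) \<partial>M) = l S"
  proof -
    have "(\<integral>w. l (scov w) \<partial>M) = (1 / real n) * (\<Sum>j=1..n. \<integral>w. l (tens (Y j w) (Y j w)) \<partial>M)"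
      unfolding lscov integral_mult_right_zero by (subst Bochner_Integration.integral_sum) (auto intro: functional_cov(2))
    also have "(\<Sum>j=1..n. \<integral>w. l (tens (Y j w) (Y j w)) \<partial>M) = (\<Sum>j=1..n. l S)" by (intro sum.cong refl functional_cov(1))
    finally show ?thesis using n by simp
  qed
  define \<psi> :: "'a opr \<Rightarrow> real" where "\<psi> = (\<lambda>A. (1 / real n * \<bar>l A\<bar>) powr p)"
  have c\<psi>: "continuous_on UNIV \<psi>" unfolding \<psi>_def
    using p by (intro continuous_on_powr' continuous_on_mult continuous_on_const continuous_on_rabs lc) auto
  have \<Delta>: "\<bar>l (scov w - scov w')\<bar> powr p = \<psi> (T w w - T w' w')" for w w'
    by (simp add: scov_def sample_cov_eq_tsum \<psi>_def T_def scaleR_right_diff_distrib[symmetric] blinfun.scaleR_right abs_mult)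
  have m: "(\<lambda>x. ennreal (\<psi> (T (fst x) (fst x) - T (snd x) (snd x)))) \<in> borel_measurable (M \<Otimes>\<^sub>M M)"
    unfolding T_def
    by (intro measurable_compose[OF _ measurable_ennreal] measurable_sample_pair[where F = "\<lambda>a b. \<psi> (tsum n a a - tsum n b b)"]
      continuous_on_compose2[OF c\<psi>] continuous_on_diff continuous_on_tsum continuous_on_coordinate) auto
  define f where "f = (\<lambda>w w'. ennreal (\<bar>l (T w w')\<bar> powr p))"
  have fm: "(\<lambda>x. f (fst x) (snd x)) \<in> borel_measurable (M \<Otimes>\<^sub>M M)" unfolding f_def T_def
    using p by (intro measurable_compose[OF _ measurable_ennreal] measurable_sample_pair[where F = "\<lambda>a b. \<bar>l (tsum n a b)\<bar> powr p"]
      continuous_on_powr' continuous_on_rabs continuous_on_compose2[OF lc] continuous_on_tsum continuous_on_coordinate continuous_on_const) auto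
  have fm': "(\<lambda>x. f (snd x) (fst x)) \<in> borel_measurable (M \<Otimes>\<^sub>M M)" unfolding f_def T_def
    using p by (intro measurable_compose[OF _ measurable_ennreal] measurable_sample_pair[where F = "\<lambda>a b. \<bar>l (tsum n b a)\<bar> powr p"]
      continuous_on_powr' continuous_on_rabs continuous_on_compose2[OF lc] continuous_on_tsum continuous_on_coordinate continuous_on_const) auto
  define J where "J = (\<integral>\<^sup>+w. (\<integral>\<^sup>+w'. f w w' \<partial>M) \<partial>M)"
  have J1: "(\<integral>\<^sup>+x. f (fst x) (snd x) \<partial>(M \<Otimes>\<^sub>M M)) = J" unfolding J_def using nn_integral_fst[OF fm] by simp
  have J2: "(\<integral>\<^sup>+x. f (snd x) (fst x) \<partial>(M \<Otimes>\<^sub>M M)) = J"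
  proof -
    have "(\<integral>\<^sup>+x. f (snd x) (fst x) \<partial>(M \<Otimes>\<^sub>M M)) = (\<integral>\<^sup>+w. (\<integral>\<^sup>+w'. f w' w \<partial>M) \<partial>M)" using nn_integral_fst[OF fm'] by simp
    also have "\<dots> = J" unfolding J_def using P.Fubini'[of "\<lambda>w w'. f w w'"] fm by (simp add: case_prod_beta')
    finally show ?thesis .
  qed
  have "(\<integral>\<^sup>+w. ennreal (\<bar>l (scov w - S)\<bar> powr p) \<partial>M) \<le> (\<integral>\<^sup>+w. (\<integral>\<^sup>+w'. ennreal (\<bar>l (scov w - scov w')\<bar> powr p) \<partial>M) \<partial>M)"
  proof (rule nn_integral_mono)
    fix w
    have i: "integrable M (\<lambda>w'. l (scov w - scov w'))" using isc by (simp add: blinfun.diff_right)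
    have "l (scov w - S) = (\<integral>w'. l (scov w - scov w') \<partial>M)" using isc msc by (simp add: blinfun.diff_right prob_space)
    then have "\<bar>l (scov w - S)\<bar> \<le> (\<integral>w'. \<bar>l (scov w - scov w')\<bar> \<partial>M)" using integral_abs_bound[of M "\<lambda>w'. l (scov w - scov w')"] by simp
    then have "ennreal (\<bar>l (scov w - S)\<bar> powr p) \<le> ennreal ((\<integral>w'. \<bar>l (scov w - scov w')\<bar> \<partial>M) powr p)"
      using p by (intro ennreal_leI powr_mono2) auto
    also have "\<dots> \<le> (\<integral>\<^sup>+w'. ennreal (\<bar>l (scov w - scov w')\<bar> powr p) \<partial>M)"
      using i p by (intro integral_powr_le prob_space_axioms) auto
    finally show "ennreal (\<bar>l (scov w - S)\<bar> powr p) \<le> (\<integral>\<^sup>+w'. ennreal (\<bar>l (scov w - scov w')\<bar> powr p) \<partial>M)" .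
  qed
  also have "\<dots> = (\<integral>\<^sup>+x. ennreal (\<psi> (T (fst x) (fst x) - T (snd x) (snd x))) \<partial>(M \<Otimes>\<^sub>M M))"
    unfolding \<Delta> using nn_integral_fst[OF m] by simp
  also have "\<dots> = (\<integral>\<^sup>+x. ennreal (\<psi> (T (fst x) (snd x) + T (snd x) (fst x))) \<partial>(M \<Otimes>\<^sub>M M))"
    unfolding T_def by (rule rotation_decoupling[OF c\<psi>])
  also have "\<dots> \<le> (\<integral>\<^sup>+x. ennreal ((2 / real n) powr p) * (f (fst x) (snd x) + f (snd x) (fst x)) \<partial>(M \<Otimes>\<^sub>M M))"
  proof (rule nn_integral_mono)
    fix x
    define a b where "a = \<bar>l (T (fst x) (snd x))\<bar>" and "b = \<bar>l (T (snd x) (fst x))\<bar>"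
    have "1 / real n * \<bar>l (T (fst x) (snd x) + T (snd x) (fst x))\<bar> \<le> 1 / real n * (a + b)"
      by (intro mult_left_mono) (auto simp: a_def b_def blinfun.add_right)
    then have "\<psi> (T (fst x) (snd x) + T (snd x) (fst x)) \<le> (1 / real n * (a + b)) powr p"
      unfolding \<psi>_def using p by (intro powr_mono2) auto
    also have "\<dots> = (1 / real n) powr p * (a + b) powr p" by (rule powr_mult)
    also have "\<dots> \<le> (1 / real n) powr p * (2 powr p * (a powr p + b powr p))"
      using p by (intro mult_left_mono powr_add_le) (auto simp: a_def b_def)
    also have "\<dots> = (2 / real n) powr p * (a powr p + b powr p)" by (simp add: powr_divide)
    finally have "ennreal (\<psi> (T (fst x) (snd x) + T (snd x) (fst x))) \<le> ennreal ((2 / real n) powr p * (a powr p + b powr p))" by (rule ennreal_leI)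
    also have "\<dots> = ennreal ((2 / real n) powr p) * (f (fst x) (snd x) + f (snd x) (fst x))" by (simp add: ennreal_mult ennreal_plus f_def a_def b_def)
    finally show "ennreal (\<psi> (T (fst x) (snd x) + T (snd x) (fst x))) \<le> ennreal ((2 / real n) powr p) * (f (fst x) (snd x) + f (snd x) (fst x))" .
  qed
  also have "\<dots> = ennreal ((2 / real n) powr p) * (J + J)"
    using fm fm' J1 J2 by (simp add: nn_integral_cmult nn_integral_add)
  also have "\<dots> = ennreal ((2 / real n) powr p * 2) * J"
    by (simp add: ennreal_mult mult_2[symmetric] mult.assoc)
  also have "\<dots> \<le> ennreal ((4 / real n) powr p) * J"
  proof (intro mult_right_mono ennreal_leI)
    have "2 powr 1 \<le> (2::real) powr p" using p by (intro powr_mono) auto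
    then have "(2 / real n) powr p * 2 \<le> (2 / real n) powr p * 2 powr p" by (intro mult_left_mono) auto
    also have "\<dots> = (2 / real n * 2) powr p" by (rule powr_mult[symmetric])
    finally show "(2 / real n) powr p * 2 \<le> (4 / real n) powr p" by simp
  qed auto
  finally show ?thesis by (simp only: J_def f_def)
qed

theorem Lpb_functional_dev:
  fixes l :: "'a opr \<Rightarrow>\<^sub>L real"
  assumes p: "p \<ge> 1" and dev: "Lpb M p dev z"
  shows "Lpb M p (\<lambda>w. \<bar>l (scov w - S)\<bar>) (4 / real n * (8 * sqrt p * norm l * sg * sqrt (2 * (real n * (sg\<^sup>2 + z)))))"
proof -
  have lc: "continuous_on UNIV (blinfun_apply l)" by (intro linear_continuous_on blinfun.bounded_linear_right)
  define K where "K = 8 * sqrt p * norm l * sg"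
  have K: "0 \<le> K" using sg_nonneg p by (simp add: K_def)
  define B where "B = sqrt (2 * (real n * (sg\<^sup>2 + z)))"
  have B: "0 \<le> B" using LpbD(3)[OF dev] by (simp add: B_def)
  have bn: "Lpb M p (\<lambda>w. K * bnorm (\<lambda>j. Y j w)) (K * B)" unfolding B_def by (intro Lpb_cmult Lpb_bnorm p dev K)
  have "(\<integral>\<^sup>+w. ennreal (\<bar>l (scov w - S)\<bar> powr p) \<partial>M)
    \<le> ennreal ((4 / real n) powr p) * (\<integral>\<^sup>+w. (\<integral>\<^sup>+w'. ennreal (\<bar>l (tsum n (\<lambda>j. Y j w) (\<lambda>j. Y j w'))\<bar> powr p) \<partial>M) \<partial>M)"
    by (rule functional_symmetrization[OF p])
  also have "\<dots> \<le> ennreal ((4 / real n) powr p) * (\<integral>\<^sup>+w. ennreal ((K * bnorm (\<lambda>j. Y j w)) powr p) \<partial>M)"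
  proof (intro mult_left_mono nn_integral_mono)
    fix w
    show "(\<integral>\<^sup>+w'. ennreal (\<bar>l (tsum n (\<lambda>j. Y j w) (\<lambda>j. Y j w'))\<bar> powr p) \<partial>M) \<le> ennreal ((K * bnorm (\<lambda>j. Y j w)) powr p)"
      using LpbD(4)[OF Lpb_functional_tsum[OF p, of l "\<lambda>j. Y j w"]] by (simp add: K_def mult.assoc)
  qed auto
  also have "\<dots> \<le> ennreal ((4 / real n) powr p) * ennreal ((K * B) powr p)" by (intro mult_left_mono LpbD(4)[OF bn]) auto
  also have "\<dots> = ennreal ((4 / real n * (K * B)) powr p)" using K B by (subst powr_mult) (auto simp: ennreal_mult)
  finally have "(\<integral>\<^sup>+w. ennreal (\<bar>l (scov w - S)\<bar> powr p) \<partial>M) \<le> ennreal ((4 / real n * (K * B)) powr p)" .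
  moreover have "(\<lambda>w. \<bar>l (scov w - S)\<bar>) \<in> borel_measurable M" unfolding scov_def
    by (rule measurable_sample) (intro continuous_on_rabs continuous_on_compose2[OF lc] continuous_on_diff continuous_on_const continuous_on_sample_cov continuous_on_product_coordinates, auto)
  moreover have "0 \<le> 4 / real n * (K * B)" using K B by simp
  ultimately have "Lpb M p (\<lambda>w. \<bar>l (scov w - S)\<bar>) (4 / real n * (K * B))" by (simp add: Lpb_def)
  then show ?thesis by (simp only: K_def B_def)
qed

text \<open>This is sqrt (r / n) with r the effective rank; max rho rho^2 is the typical size of the
  deviation relative to the norm of \<open>S\<close>.\<close>

definition rho :: real where "rho = sqrt (Rr / norm S / real n)"

lemma rho_nonneg: "0 \<le> rho" using Rr_nonneg by (simp add: rho_def)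

lemma Rr_eq:
  assumes "S \<noteq> 0"
  shows "sg * sqrt (Rr / n) = sg\<^sup>2 * rho" "Rr / n = sg\<^sup>2 * rho\<^sup>2"
proof -
  have s: "norm S > 0" using assms by simp
  show 1: "Rr / n = sg\<^sup>2 * rho\<^sup>2" unfolding sg_square using s Rr_nonneg by (simp add: rho_def)
  show "sg * sqrt (Rr / n) = sg\<^sup>2 * rho" unfolding 1 using sg_nonneg rho_nonneg by (simp add: real_sqrt_mult power2_eq_square)
qed

lemma Lpb_dev_rho:
  assumes p: "p \<ge> 1" and S: "S \<noteq> 0"
  shows "Lpb M p dev (7000 * sg\<^sup>2 * (rho + rho\<^sup>2 + sqrt (p / n) + p / n))"
  using Lpb_dev[OF p] unfolding Rr_eq(1)[OF S] unfolding Rr_eq(2)[OF S] by (simp add: algebra_simps)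

lemma Lpb_functional_dev_rho:
  fixes l :: "'a opr \<Rightarrow>\<^sub>L real"
  assumes p: "p \<ge> 1" and S: "S \<noteq> 0"
  shows "Lpb M p (\<lambda>w. \<bar>l (scov w - S)\<bar>) (7200 * norm l * (sg\<^sup>2 * (sqrt (p / n) * max rho 1 + p / n)))"
proof -
  define t where "t = sqrt (p / n)"
  have t: "0 \<le> t" "t\<^sup>2 = p / n" using p by (auto simp: t_def)
  define m where "m = max rho 1"
  have m: "1 \<le> m" "rho \<le> m" by (auto simp: m_def)
  define z where "z = 7000 * sg\<^sup>2 * (rho + rho\<^sup>2 + t + t\<^sup>2)"
  have dev: "Lpb M p dev z" using Lpb_dev_rho[OF p S] by (simp add: z_def t(2) t_def[symmetric])
  have N: "0 < real n" using n by simp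
  \<comment> \<open>Since m bounds 1 and rho, the coefficients 14001, 7000 and 7000 of m^2, m t and
    t^2 stay below 22500, 45000 and 22500, those of (150 (m + t))^2. Then 7200 = 32 * 3/2 *
    150.\<close>
  have zle: "sqrt (sg\<^sup>2 + z) \<le> 150 * sg * (m + t)"
  proof -
    have "rho\<^sup>2 \<le> m\<^sup>2" using rho_nonneg m by (intro power_mono) auto
    moreover have "m \<le> m\<^sup>2" "1 \<le> m\<^sup>2" using m by (auto simp: power2_eq_square mult_le_cancel_left1 one_le_power intro: order_trans[OF _ mult_mono[of 1 m 1 m]])
    moreover have "t \<le> m * t" using mult_right_mono[OF m(1) t(1)] by simp
    ultimately have "1 + 7000 * (rho + rho\<^sup>2 + t + t\<^sup>2) \<le> 22500 * (m\<^sup>2 + 2 * (m * t) + t\<^sup>2)"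
      using m(2) t zero_le_power2[of t] by (simp only: distrib_left)
    also have "\<dots> = (150 * (m + t))\<^sup>2" by (simp add: power2_eq_square algebra_simps)
    finally have "sg\<^sup>2 * (1 + 7000 * (rho + rho\<^sup>2 + t + t\<^sup>2)) \<le> sg\<^sup>2 * (150 * (m + t))\<^sup>2" by (intro mult_left_mono) auto
    moreover have "(150 * sg * (m + t))\<^sup>2 = sg\<^sup>2 * (150 * (m + t))\<^sup>2" by (simp only: power2_eq_square ac_simps)
    moreover have "sg\<^sup>2 + z = sg\<^sup>2 * (1 + 7000 * (rho + rho\<^sup>2 + t + t\<^sup>2))" by (simp add: z_def algebra_simps)
    ultimately have "sg\<^sup>2 + z \<le> (150 * sg * (m + t))\<^sup>2" by (simp only:)
    then show ?thesis using sg_nonneg m t by (intro real_le_lsqrt) auto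
  qed
  have s2: "sqrt 2 \<le> (3 / 2 :: real)" by (rule real_le_lsqrt) (auto simp: power2_eq_square)
  have "4 / real n * (8 * sqrt p * norm l * sg * sqrt (2 * (real n * (sg\<^sup>2 + z)))) = 32 * (t * norm l * sg) * (sqrt 2 * sqrt (sg\<^sup>2 + z))"
  proof -
    have "sqrt (2 * (real n * (sg\<^sup>2 + z))) = sqrt 2 * (sqrt n * sqrt (sg\<^sup>2 + z))" by (simp only: real_sqrt_mult)
    then have "4 / real n * (8 * sqrt p * norm l * sg * sqrt (2 * (real n * (sg\<^sup>2 + z)))) = 32 * (sqrt p * sqrt n / n * norm l * sg) * (sqrt 2 * sqrt (sg\<^sup>2 + z))"
      by (simp only:) simp
    moreover have "sqrt p * sqrt n / n = t" using N by (simp add: t_def real_sqrt_divide real_div_sqrt field_simps)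
    ultimately show ?thesis by (simp only:)
  qed
  also have "\<dots> \<le> 32 * (t * norm l * sg) * (3 / 2 * (150 * sg * (m + t)))"
    using t(1) sg_nonneg s2 zle LpbD(3)[OF dev] by (intro mult_left_mono mult_mono) auto
  also have "\<dots> = 7200 * norm l * (sg\<^sup>2 * (t * m + t\<^sup>2))" by (simp add: power2_eq_square algebra_simps)
  finally have le: "4 / real n * (8 * sqrt p * norm l * sg * sqrt (2 * (real n * (sg\<^sup>2 + z)))) \<le> 7200 * norm l * (sg\<^sup>2 * (t * m + t\<^sup>2))" .
  note F = Lpb_functional_dev[OF p dev, of l]
  have "Lpb M p (\<lambda>w. \<bar>l (scov w - S)\<bar>) (7200 * norm l * (sg\<^sup>2 * (t * m + t\<^sup>2)))"
    by (rule Lpb_mono[OF F _ _ _ _ le]) (use p LpbD(1)[OF F] in auto)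
  then show ?thesis by (simp add: t_def m_def t(2)[unfolded t_def])
qed

text \<open>
  The part of the deviation exceeding a multiple of its typical size is controlled by the
  deviation term alone: for \<open>p\<close> below the effective rank use the moment of order equal to the
  effective rank.
\<close>

lemma Lpb_dev_excess:
  assumes p: "p \<ge> 1" and S: "S \<noteq> 0"
  defines "a \<equiv> 7000 * sg\<^sup>2 * (rho + rho\<^sup>2)"
  shows "Lpb M p (\<lambda>w. if dev w > 2 * exp 1 * a then dev w else 0) (14000 * (sg\<^sup>2 * (sqrt (p / n) + p / n)))"
proof -
  define t where "t = sqrt (p / n)"
  have t: "0 \<le> t" "t\<^sup>2 = p / n" using p by (auto simp: t_def)
  define F where "F = (\<lambda>w. if dev w > 2 * exp 1 * a then dev w else 0)"
  have [measurable]: "dev \<in> borel_measurable M" by (rule dev_measurable)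
  have Fm: "F \<in> borel_measurable M" unfolding F_def by measurable
  have F0: "0 \<le> F w" "F w \<le> dev w" for w by (auto simp: F_def dev_def)
  define B where "B = 14000 * (sg\<^sup>2 * (t + t\<^sup>2))"
  have B0: "0 \<le> B" unfolding B_def using t(1) by (intro mult_nonneg_nonneg add_nonneg_nonneg) auto
  have N: "0 < real n" using n by simp
  have nS: "norm S > 0" using S by simp
  define q where "q = Rr / norm S"
  have q1: "1 \<le> q" using sg_le_Rr nS by (simp add: q_def sg_square)
  have rq: "rho = sqrt (q / n)" by (simp add: rho_def q_def)
  have r2: "rho\<^sup>2 = q / n" using q1 by (simp add: rq)
  have a0: "0 < a" using nS q1 N by (auto simp: a_def rq sg_square intro!: mult_pos_pos add_pos_pos)
  have "Lpb M p F B"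
  proof (cases "q \<le> p")
    case True
    then have "rho \<le> t" "rho\<^sup>2 \<le> t\<^sup>2" unfolding r2 t(2) unfolding rq t_def using N by (auto simp: divide_right_mono)
    then have "sg\<^sup>2 * (rho + rho\<^sup>2 + t + t\<^sup>2) \<le> sg\<^sup>2 * (2 * (t + t\<^sup>2))" by (intro mult_left_mono) auto
    then have "7000 * sg\<^sup>2 * (rho + rho\<^sup>2 + t + p / n) \<le> B" by (simp add: B_def t(2) algebra_simps)
    then show ?thesis using Lpb_mono[OF Lpb_dev_rho[OF p S] _ Fm F0] p by (simp add: t_def)
  next
    case False
    define m where "m = q / p"
    have m: "1 \<le> m" "q = m * p" using False p by (auto simp: m_def)
    \<comment> \<open>At the order q the terms in q / n coincide with those in rho, so the deviation
      bound is 2 a.\<close>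
    have dq: "Lpb M q dev (2 * a)"
      using Lpb_dev_rho[OF q1 S] by (simp add: a_def r2 rq[symmetric] algebra_simps)
    \<comment> \<open>On the event of excess the exponent p - q is negative, so this power of the
      deviation is at most its value at the threshold.\<close>
    have pt: "F w powr p \<le> (2 * exp 1 * a) powr (p - q) * dev w powr q" for w
    proof (cases "dev w > 2 * exp 1 * a")
      case True
      have d0: "0 < 2 * exp 1 * a" using a0 by simp
      have "F w powr p = dev w powr (p - q) * dev w powr q" using True by (simp add: F_def powr_add[symmetric])
      also have "\<dots> \<le> (2 * exp 1 * a) powr (p - q) * dev w powr q"
        using True d0 False by (intro mult_right_mono powr_mono2') auto
      finally show ?thesis .
    next
      case nT: False
      then show ?thesis by (simp add: F_def)
    qed
    have "(\<integral>\<^sup>+w. ennreal (F w powr p) \<partial>M) \<le> (\<integral>\<^sup>+w. ennreal ((2 * exp 1 * a) powr (p - q)) * ennreal (dev w powr q) \<partial>M)"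
      using pt by (intro nn_integral_mono) (auto simp: ennreal_mult[symmetric] intro!: ennreal_leI)
    also have "\<dots> = ennreal ((2 * exp 1 * a) powr (p - q)) * (\<integral>\<^sup>+w. ennreal (dev w powr q) \<partial>M)" by (rule nn_integral_cmult) simp
    also have "\<dots> \<le> ennreal ((2 * exp 1 * a) powr (p - q)) * ennreal ((2 * a) powr q)" by (intro mult_left_mono LpbD(4)[OF dq]) auto
    also have "\<dots> = ennreal ((2 * exp 1 * a) powr (p - q) * (2 * a) powr q)" by (simp add: ennreal_mult)
    also have "\<dots> \<le> ennreal (B powr p)"
    proof (rule ennreal_leI)
      have "(2 * exp 1 * a) powr (p - q) = exp (p - q) * (2 * a) powr (p - q)"
        using powr_mult[of "exp 1" "2 * a" "p - q"] by (simp add: powr_def ac_simps)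
      then have "(2 * exp 1 * a) powr (p - q) * (2 * a) powr q = exp (p - q) * (2 * a) powr p"
        using a0 by (simp add: mult.assoc powr_add[symmetric])
      also have "\<dots> \<le> (1 / m) powr p * (2 * a) powr p"
      proof (rule mult_right_mono)
        \<comment> \<open>The constant e in the threshold produces exp (p - q) = exp (1 - m)^p,
          which is at most (1 / m)^p; this factor compensates 2 a <= m B.\<close>
        have "m \<le> exp (m - 1)" using exp_ge_add_one_self[of "m - 1"] by simp
        then have "1 / exp (m - 1) \<le> 1 / m" using m by (intro divide_left_mono) auto
        then have "exp (1 - m) \<le> 1 / m" using exp_minus[of "m - 1"] by (simp add: inverse_eq_divide)
        then have "exp (1 - m) powr p \<le> (1 / m) powr p" using p by (intro powr_mono2) auto
        then show "exp (p - q) \<le> (1 / m) powr p" by (simp add: powr_def m(2) algebra_simps)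
      qed simp
      also have "\<dots> = (1 / m * (2 * a)) powr p" by (rule powr_mult[symmetric])
      also have "\<dots> \<le> B powr p"
      proof (rule powr_mono2)
        have r2m: "rho\<^sup>2 = m * t\<^sup>2" unfolding r2 t(2) by (simp add: m(2))
        have "rho\<^sup>2 \<le> (m * t)\<^sup>2"
        proof -
          have "m * t\<^sup>2 \<le> m\<^sup>2 * t\<^sup>2" using m by (intro mult_right_mono) (auto simp: power2_eq_square)
          then show ?thesis by (simp add: r2m power_mult_distrib)
        qed
        then have "rho \<le> m * t" by (rule power2_le_imp_le) (use m t(1) in auto)
        then have "rho + rho\<^sup>2 \<le> m * (t + t\<^sup>2)" by (simp add: r2m algebra_simps)
        then have "7000 * sg\<^sup>2 * (rho + rho\<^sup>2) \<le> 7000 * sg\<^sup>2 * (m * (t + t\<^sup>2))" by (intro mult_left_mono) auto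
        then have "2 * a \<le> m * B" by (simp add: a_def B_def algebra_simps)
        then show "1 / m * (2 * a) \<le> B" using m by (simp add: field_simps)
      qed (use p m a0 in auto)
      finally show "(2 * exp 1 * a) powr (p - q) * (2 * a) powr q \<le> B powr p" .
    qed
    finally show ?thesis using Fm F0 B0 by (simp add: Lpb_def)
  qed
  then show ?thesis by (simp add: F_def B_def t(2)) (simp add: t_def)
qed

end

section \<open>Samples of a Gaussian law\<close>

lemma gaussian_rv_char:
  assumes "prob_space M" "gaussian_rv M g"
  shows "char (distr M borel g) t = complex_of_real (exp (- t\<^sup>2 * (\<integral>w. (g w)\<^sup>2 \<partial>M) / 2))"
proof (rule gaussian_rv_std[OF assms(2)])
  fix r assume r: "r\<^sup>2 = (\<integral>w. (g w)\<^sup>2 \<partial>M)"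
    and *: "\<And>f::real\<Rightarrow>real. f \<in> borel_measurable borel \<Longrightarrow> (\<integral>w. f (g w) \<partial>M) = (\<integral>x. f (r * x) \<partial>std_normal_distribution)"
  interpret prob_space M by fact
  have g: "g \<in> borel_measurable M" using assms(2) by (rule gaussian_rv_measurable)
  have c: "(\<integral>x. cos (t * x + s) \<partial>distr M borel g) = cos s * exp (- t\<^sup>2 * (\<integral>w. (g w)\<^sup>2 \<partial>M) / 2)" for s
    using *[of "\<lambda>x. cos (t * x + s)"] std_normal_cos[of "t * r" s] g r by (simp add: integral_distr power_mult_distrib mult.assoc)
  show ?thesis using c[of 0] c[of "- (pi / 2)"] g by (simp add: cos_sin_char complex_eq_iff)
qed

lemma gaussian_rv_of_char:
  assumes "prob_space M" and g: "g \<in> borel_measurable M" and v: "v \<ge> 0"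
    and char: "\<And>t. char (distr M borel g) t = complex_of_real (exp (- t\<^sup>2 * v / 2))"
  shows "gaussian_rv M g"
proof -
  interpret prob_space M by fact
  interpret std: real_distribution std_normal_distribution by (rule real_dist_normal_dist)
  let ?D = "distr std_normal_distribution borel (\<lambda>x. sqrt v * x)"
  have c: "(\<integral>x. cos (t * x + s) \<partial>?D) = cos s * exp (- t\<^sup>2 * v / 2)" for t s
    using std_normal_cos[of "t * sqrt v" s] v by (simp add: integral_distr power_mult_distrib mult.assoc)
  have rD: "real_distribution ?D" by (rule std.real_distribution_distr) simp
  have "char ?D t = complex_of_real (exp (- t\<^sup>2 * v / 2))" for t
    using c[of t 0] c[of t "- (pi / 2)"] rD by (simp add: cos_sin_char complex_eq_iff)
  then have "distr M borel g = ?D" using char g rD by (intro Levy_uniqueness ext) auto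
  then show ?thesis unfolding gaussian_rv_def centered_normal_iff using v g by (auto intro!: exI[of _ "sqrt v"])
qed

text \<open>Independence makes characteristic functions of sums factorise, so all combinations are
  Gaussian and their span is a Gaussian space. Setting \<open>Y\<close> to 0 outside {1..n} leaves
  the sample covariance as it is.\<close>

lemma gaussian_sample_of_law:
  fixes X :: "nat \<Rightarrow> 'w \<Rightarrow> 'a::{banach, second_countable_topology}"
  assumes M: "prob_space M" and law: "gaussian_law \<mu> S" and n: "1 \<le> n"
    and ind: "prob_space.indep_vars M (\<lambda>_. borel) X {1..n}" and d: "\<And>j. j \<in> {1..n} \<Longrightarrow> distr M borel (X j) = \<mu>"
  defines "Y \<equiv> \<lambda>j. if j \<in> {1..n} then X j else (\<lambda>_. 0)"
  shows "gaussian_sample M {\<lambda>w. \<Sum>j=1..n. blinfun_apply (u j) (Y j w) |u. True} S Y n"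
proof -
  interpret prob_space M by fact
  define G :: "('w \<Rightarrow> real) set" where "G = {\<lambda>w. \<Sum>j=1..n. blinfun_apply (u j) (Y j w) |u. True}"
  have Xm: "X j \<in> borel_measurable M" if "j \<in> {1..n}" for j using ind that by (auto simp: indep_vars_def)
  have Ym: "Y j \<in> borel_measurable M" for j using Xm by (simp add: Y_def)
  have bm: "blinfun_apply u \<in> borel_measurable borel" for u :: "'a dual"
    using borel_measurable_blinfun_apply[of "\<lambda>x. x" borel u] by simp
  have YX: "blinfun_apply u (Y j w) = blinfun_apply u (X j w)" if "j \<in> {1..n}" for u :: "'a dual" and j w using that by (simp add: Y_def)
  have rv: "gaussian_rv M (\<lambda>w. blinfun_apply u (X j w))" if j: "j \<in> {1..n}" for u :: "'a dual" and j
  proof -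
    have "distr M borel (\<lambda>w. blinfun_apply u (X j w)) = distr \<mu> borel (blinfun_apply u)"
      unfolding d[OF j, symmetric] using Xm[OF j] bm by (subst distr_distr) (auto simp: comp_def)
    then show ?thesis using law borel_measurable_blinfun_apply[OF Xm[OF j]] by (simp add: gaussian_rv_def gaussian_law_def)
  qed
  have mom: "(\<integral>w. blinfun_apply u (X j w) * blinfun_apply v (X j w) \<partial>M) = blinfun_apply v (blinfun_apply S u)" if j: "j \<in> {1..n}" for u v :: "'a dual" and j
  proof -
    have "(\<integral>w. blinfun_apply u (X j w) * blinfun_apply v (X j w) \<partial>M) = (\<integral>x. blinfun_apply u x * blinfun_apply v x \<partial>\<mu>)"
      unfolding d[OF j, symmetric] using Xm[OF j] bm by (subst integral_distr) auto
    also have "\<dots> = (\<integral>x. blinfun_apply v (blinfun_apply u x *\<^sub>R x) \<partial>\<mu>)" by (simp add: blinfun.scaleR_right)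
    also have "\<dots> = blinfun_apply v (blinfun_apply S u)"
      using has_bochner_integral_bounded_linear[OF blinfun.bounded_linear_right[of v], of \<mu> "\<lambda>x. blinfun_apply u x *\<^sub>R x" "blinfun_apply S u"] law
      by (simp add: gaussian_law_def has_bochner_integral_integral_eq)
    finally show ?thesis .
  qed
  have indu: "indep_vars (\<lambda>_. borel) (\<lambda>j w. blinfun_apply (u j) (X j w)) {1..n}" for u :: "nat \<Rightarrow> 'a dual"
    by (rule indep_vars_compose2[OF ind]) (rule bm)
  have Grv: "gaussian_rv M (\<lambda>w. \<Sum>j=1..n. blinfun_apply (u j) (Y j w))" for u :: "nat \<Rightarrow> 'a dual"
  proof (rule gaussian_rv_of_char[OF M])
    define v where "v = (\<lambda>j. \<integral>w. (blinfun_apply (u j) (X j w))\<^sup>2 \<partial>M)"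
    show "(\<lambda>w. \<Sum>j=1..n. blinfun_apply (u j) (Y j w)) \<in> borel_measurable M" by (intro borel_measurable_sum borel_measurable_blinfun_apply Ym)
    show "0 \<le> (\<Sum>j=1..n. v j)" by (intro sum_nonneg) (simp add: v_def)
    fix t
    have "char (distr M borel (\<lambda>w. \<Sum>j=1..n. blinfun_apply (u j) (Y j w))) t = char (distr M borel (\<lambda>w. \<Sum>j=1..n. blinfun_apply (u j) (X j w))) t"
      by (simp add: YX)
    also have "\<dots> = (\<Prod>j=1..n. char (distr M borel (\<lambda>w. blinfun_apply (u j) (X j w))) t)" by (rule char_distr_sum[OF indu])
    also have "\<dots> = (\<Prod>j=1..n. complex_of_real (exp (- t\<^sup>2 * v j / 2)))"
      by (intro prod.cong refl) (simp add: gaussian_rv_char[OF M rv] v_def)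
    also have "\<dots> = complex_of_real (exp (\<Sum>j=1..n. - t\<^sup>2 * v j / 2))" by (simp only: of_real_prod[symmetric] exp_sum[symmetric] finite_atLeastAtMost)
    also have "(\<Sum>j=1..n. - t\<^sup>2 * v j / 2) = - t\<^sup>2 * (\<Sum>j=1..n. v j) / 2" by (simp only: sum_divide_distrib sum_distrib_left)
    finally show "char (distr M borel (\<lambda>w. \<Sum>j=1..n. blinfun_apply (u j) (Y j w))) t = complex_of_real (exp (- t\<^sup>2 * (\<Sum>j=1..n. v j) / 2))" .
  qed
  have GI: "(\<lambda>w. \<Sum>j=1..n. blinfun_apply (u j) (Y j w)) \<in> G" for u by (auto simp: G_def)
  have comb: "(\<lambda>w. a * g w + b * h w) \<in> G" if gh: "g \<in> G" "h \<in> G" for g h a b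
  proof -
    obtain u v where uv: "g = (\<lambda>w. \<Sum>j=1..n. blinfun_apply (u j) (Y j w))" "h = (\<lambda>w. \<Sum>j=1..n. blinfun_apply (v j) (Y j w))" using gh by (auto simp: G_def)
    have "(\<lambda>w. a * g w + b * h w) = (\<lambda>w. \<Sum>j=1..n. blinfun_apply (a *\<^sub>R u j + b *\<^sub>R v j) (Y j w))"
      by (simp add: uv plus_blinfun.rep_eq scaleR_blinfun.rep_eq sum.distrib sum_distrib_left)
    then show ?thesis using GI[of "\<lambda>j. a *\<^sub>R u j + b *\<^sub>R v j"] by simp
  qed
  have ne: "G \<noteq> {}" by (auto simp: G_def)
  have GG: "gaussian_space M G" unfolding gaussian_space_def using M ne comb Grv by (auto simp: G_def)
  have mem: "(\<lambda>w. blinfun_apply u (Y j w)) \<in> G" for j and u :: "'a dual"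
  proof -
    have "(\<lambda>w. blinfun_apply u (Y j w)) = (\<lambda>w. \<Sum>i=1..n. blinfun_apply (if i = j then u else 0) (Y i w))"
    proof
      fix w
      have "(\<Sum>i=1..n. blinfun_apply (if i = j then u else 0) (Y i w)) = (\<Sum>i=1..n. if i = j then blinfun_apply u (Y i w) else 0)"
        by (intro sum.cong) auto
      then show "blinfun_apply u (Y j w) = (\<Sum>i=1..n. blinfun_apply (if i = j then u else 0) (Y i w))"
        by (auto simp: Y_def)
    qed
    then show ?thesis using GI[of "\<lambda>i. if i = j then u else 0"] by simp
  qed
  have cov: "(\<integral>w. blinfun_apply u (Y i w) * blinfun_apply v (Y j w) \<partial>M) = (if i = j \<and> i \<in> {1..n} then blinfun_apply v (blinfun_apply S u) else 0)" for i j and u v :: "'a dual"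
  proof (cases "i \<in> {1..n} \<and> j \<in> {1..n} \<and> i \<noteq> j")
    case True
    define f where "f = (\<lambda>k w. blinfun_apply (if k = i then u else v) (X k w))"
    have "indep_vars (\<lambda>_. borel) f {i, j}" unfolding f_def by (rule indep_vars_subset[OF indu]) (use True in auto)
    then have "(\<integral>w. (\<Prod>k\<in>{i, j}. f k w) \<partial>M) = (\<Prod>k\<in>{i, j}. \<integral>w. f k w \<partial>M)"
      by (rule indep_vars_lebesgue_integral[rotated]) (use True gaussian_rv_integrable[OF rv] in \<open>auto simp: f_def\<close>)
    then show ?thesis using True gaussian_rv_mean[OF rv[of i u]] by (auto simp: f_def YX)
  next
    case False
    then show ?thesis using mom by (auto simp: Y_def)
  qed
  show ?thesis unfolding G_def[symmetric] using GG Ym mem cov n by unfold_locales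
qed

context gaussian_sample
begin

text \<open>All norming coordinates have variance 0; being countably many, they vanish
  simultaneously almost surely.\<close>

lemma scov_degenerate:
  assumes "S = 0"
  shows "AE w in M. scov w = S"
proof -
  have "AE w in M. blinfun_apply (norming k) (Y j w) = 0" if j: "j \<in> {1..n}" for k j
  proof -
    have "(\<integral>w. blinfun_apply (norming k) (Y j w) * blinfun_apply (norming k) (Y j w) \<partial>M) = 0" using assms by (simp add: Y_cov)
    then have "AE w in M. blinfun_apply (norming k) (Y j w) * blinfun_apply (norming k) (Y j w) = 0"
      by (subst (asm) integral_nonneg_eq_0_iff_AE[OF gaussian_space_integrable_mult[OF G Y_mem Y_mem]]) auto
    then show ?thesis by simp
  qed
  then have "AE w in M. \<forall>k. \<forall>j\<in>{1..n}. blinfun_apply (norming k) (Y j w) = 0" by (simp add: AE_all_countable AE_ball_countable)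
  then show ?thesis
  proof eventually_elim
    case (elim w)
    have "norm (Y j w) \<le> 0" if "j \<in> {1..n}" for j by (rule norm_le_norming) (use elim that in auto)
    then have "tsum n (\<lambda>j. Y j w) (\<lambda>j. Y j w) = 0" unfolding tsum_def
      by (intro sum.neutral ballI blinfun_eqI) (auto simp: tens.rep_eq)
    then show ?case using assms by (simp add: scov_def sample_cov_eq_tsum)
  qed
qed

text \<open>Polarisation: if the quadratic form vanishes, then so does the symmetric bilinear form,
  and with it \<open>S\<close>.\<close>

lemma nondegenerate_functional:
  assumes "S \<noteq> 0"
  obtains u :: "'a dual" where "0 < blinfun_apply u (blinfun_apply S u)"
proof (rule ccontr)
  assume "\<not> thesis"
  then have 0: "blinfun_apply u (blinfun_apply S u) = 0" for u :: "'a dual" using that var_nonneg[of u] by (metis less_le)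
  have "blinfun_apply v (blinfun_apply S u) = 0" for u v :: "'a dual"
  proof -
    have "blinfun_apply v (blinfun_apply S u) = blinfun_apply u (blinfun_apply S v)"
      using Y_cov[of u 1 v 1] Y_cov[of v 1 u 1] n by (simp add: mult.commute)
    moreover have "blinfun_apply u (blinfun_apply S v) + blinfun_apply v (blinfun_apply S u) = 0"
      using 0[of "u + v"] 0[of u] 0[of v] by (simp add: plus_blinfun.rep_eq blinfun.add_right)
    ultimately show ?thesis by simp
  qed
  then have "norm (blinfun_apply S u) \<le> 0" for u by (intro norm_le_norming) simp
  then have "S = 0" by (intro blinfun_eqI) simp
  then show False using assms by simp
qed

end

section \<open>Smooth functionals\<close>

lemma powr_subadditive:
  fixes x y s :: real
  assumes "0 \<le> x" "0 \<le> y" "0 < s" "s \<le> 1"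
  shows "(x + y) powr s \<le> x powr s + y powr s"
proof -
  have "(x powr s) powr (1 / s) + (y powr s) powr (1 / s) \<le> (x powr s + y powr s) powr (1 / s)"
    using assms by (intro powr_superadditive) auto
  then have "x + y \<le> (x powr s + y powr s) powr (1 / s)" using assms by (simp add: powr_powr)
  then have "(x + y) powr s \<le> ((x powr s + y powr s) powr (1 / s)) powr s" using assms by (intro powr_mono2) auto
  then show ?thesis using assms by (simp add: powr_powr)
qed

lemma Lip_seminormD:
  fixes g :: "'b::real_normed_vector \<Rightarrow> 'c::real_normed_vector"
  assumes "Lip_seminorm s g < \<infinity>"
  obtains L where "0 \<le> L" "Lip_seminorm s g = ennreal L" "\<And>x y. norm (g x - g y) \<le> L * norm (x - y) powr s"
proof -
  obtain L where L: "Lip_seminorm s g = ennreal L" "0 \<le> L" using assms by (cases "Lip_seminorm s g") auto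
  have "norm (g x - g y) \<le> L * norm (x - y) powr s" for x y
  proof (cases "x = y")
    case False
    have "ennreal (norm (g x - g y) / norm (x - y) powr s) \<le> Lip_seminorm s g"
      unfolding Lip_seminorm_def using False by (intro SUP_upper2[of "(x, y)"]) auto
    then have "norm (g x - g y) / norm (x - y) powr s \<le> L" using L by simp
    then show ?thesis using False by (simp add: divide_le_eq)
  qed simp
  with L that show ?thesis by blast
qed

lemma holder_continuous:
  fixes g :: "'b::real_normed_vector \<Rightarrow> 'c::real_normed_vector"
  assumes "\<And>x y. norm (g x - g y) \<le> L * norm (x - y) powr s" "0 < s"
  shows "continuous_on UNIV g"
  unfolding continuous_on_def
proof
  fix x :: 'b
  have "((\<lambda>y. L * norm (y - x) powr s) \<longlongrightarrow> L * norm (x - x) powr s) (at x)"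
    using assms(2) by (intro tendsto_intros tendsto_powr') auto
  then have "((\<lambda>y. L * norm (y - x) powr s) \<longlongrightarrow> 0) (at x)" by simp
  then have "((\<lambda>y. g y - g x) \<longlongrightarrow> 0) (at x)"
    by (rule Lim_null_comparison[rotated]) (use assms(1) in auto)
  then show "(g \<longlongrightarrow> g x) (at x within UNIV)" by (simp add: LIM_zero_iff)
qed

lemma Lp_norm_le:
  assumes "Lpb M p (\<lambda>w. \<bar>\<eta> w\<bar>) B" "p > 0" "\<eta> \<in> borel_measurable M"
  shows "Lp_norm M p \<eta> \<le> ennreal B"
proof -
  note L = LpbD[OF assms(1)]
  have le: "(\<integral>\<^sup>+w. ennreal (\<bar>\<eta> w\<bar> powr p) \<partial>M) \<le> ennreal (B powr p)" using L by simp
  then have "(\<integral>\<^sup>+w. ennreal (\<bar>\<eta> w\<bar> powr p) \<partial>M) < \<infinity>" by (auto intro: le_less_trans)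
  then have i: "integrable M (\<lambda>w. \<bar>\<eta> w\<bar> powr p)" using assms(3) by (intro integrableI_nonneg) auto
  have "ennreal (\<integral>w. \<bar>\<eta> w\<bar> powr p \<partial>M) \<le> ennreal (B powr p)" using le nn_integral_eq_integral[OF i] by simp
  then have "(\<integral>w. \<bar>\<eta> w\<bar> powr p \<partial>M) powr (1 / p) \<le> (B powr p) powr (1 / p)" using assms(2) by (intro powr_mono2) auto
  then show ?thesis using i assms(2) L(3) by (simp add: Lp_norm_def powr_powr ennreal_leI)
qed

lemma norm_derivative_le_Lipschitz:
  fixes f :: "'b::real_normed_vector \<Rightarrow> real" and l :: "'b \<Rightarrow>\<^sub>L real"
  assumes L: "0 \<le> L" "\<And>x y. norm (f x - f y) \<le> L * norm (x - y)" and d: "(f has_derivative blinfun_apply l) (at A)"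
  shows "norm l \<le> L"
proof (rule norm_blinfun_bound[OF L(1)])
  fix h :: 'b
  have "((\<lambda>t. A + t *\<^sub>R h) has_derivative (\<lambda>t. t *\<^sub>R h)) (at 0)" by (auto intro!: derivative_eq_intros)
  moreover have "(f has_derivative blinfun_apply l) (at (A + 0 *\<^sub>R h))" using d by simp
  ultimately have "((\<lambda>t. f (A + t *\<^sub>R h)) has_derivative (\<lambda>t. l (t *\<^sub>R h))) (at (0::real))"
    by (rule has_derivative_compose)
  then have "((\<lambda>t. f (A + t *\<^sub>R h)) has_field_derivative l h) (at 0)"
    by (rule has_derivative_imp_has_field_derivative) (simp add: blinfun.scaleR_right)
  then have "((\<lambda>t. (f (A + t *\<^sub>R h) - f A) / t) \<longlongrightarrow> l h) (at 0)" by (simp add: has_field_derivative_iff)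
  then have "((\<lambda>t. norm ((f (A + t *\<^sub>R h) - f A) / t)) \<longlongrightarrow> norm (l h)) (at 0)" by (rule tendsto_norm)
  then show "norm (l h) \<le> L * norm h"
  proof (rule tendsto_upperbound)
    show "\<forall>\<^sub>F t in at 0. norm ((f (A + t *\<^sub>R h) - f A) / t) \<le> L * norm h"
    proof (rule eventually_at_filter[THEN iffD2], rule always_eventually, intro allI impI)
      fix t :: real assume t: "t \<noteq> 0"
      have "norm (f (A + t *\<^sub>R h) - f A) \<le> L * (\<bar>t\<bar> * norm h)" using L(2)[of "A + t *\<^sub>R h" A] by simp
      then show "norm ((f (A + t *\<^sub>R h) - f A) / t) \<le> L * norm h" using t by (simp add: field_simps)
    qed
  qed simp
qed

text \<open>On the segment from A to B the derivative differs from that at A by at most L |B - A|^s;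
  the mean value inequality contributes the remaining factor |B - A|.\<close>

lemma taylor_remainder_holder:
  fixes f :: "'b::real_normed_vector \<Rightarrow> real" and f' :: "'b \<Rightarrow> 'b \<Rightarrow>\<^sub>L real"
  assumes d: "\<And>A. (f has_derivative blinfun_apply (f' A)) (at A)"
    and L: "0 \<le> L" "\<And>A B. norm (f' A - f' B) \<le> L * norm (A - B) powr s" and s: "0 < s"
  shows "\<bar>f B - f A - f' A (B - A)\<bar> \<le> L * norm (B - A) powr (1 + s)"
proof -
  have "norm (f B - f A - f' A (B - A)) \<le> norm (B - A) * (L * norm (B - A) powr s)"
  proof (rule differentiable_bound_linearization[where S = "(\<lambda>t. A + t *\<^sub>R (B - A)) ` {0..1}"])
    show "A + t *\<^sub>R (B - A) \<in> (\<lambda>t. A + t *\<^sub>R (B - A)) ` {0..1}" if "t \<in> {0..1}" for t using that by auto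
    show "A \<in> (\<lambda>t. A + t *\<^sub>R (B - A)) ` {0..1}" by (intro image_eqI[of _ _ 0]) auto
    show "(f has_derivative blinfun_apply (f' x)) (at x within (\<lambda>t. A + t *\<^sub>R (B - A)) ` {0..1})" for x
      using d by (rule has_derivative_at_withinI)
    fix x assume "x \<in> (\<lambda>t. A + t *\<^sub>R (B - A)) ` {0..1}"
    then obtain t where t: "0 \<le> t" "t \<le> 1" "x = A + t *\<^sub>R (B - A)" by auto
    have "norm (x - A) \<le> norm (B - A)" using t by (simp add: mult_left_le_one_le)
    then have "L * norm (x - A) powr s \<le> L * norm (B - A) powr s" using L s by (intro mult_left_mono powr_mono2) auto
    moreover have "onorm (blinfun_apply (f' x) - blinfun_apply (f' A)) = norm (f' x - f' A)"
      by (simp add: norm_blinfun.rep_eq minus_blinfun.rep_eq fun_diff_def)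
    ultimately show "onorm (blinfun_apply (f' x) - blinfun_apply (f' A)) \<le> L * norm (B - A) powr s" using L(2)[of x A] by simp
  qed
  also have "\<dots> = L * norm (B - A) powr (1 + s)" by (cases "B = A") (auto simp: powr_add)
  finally show ?thesis by simp
qed

context gaussian_sample
begin

lemma error_measurable:
  fixes f :: "'a opr \<Rightarrow> real"
  assumes "continuous_on UNIV f"
  shows "(\<lambda>w. f (scov w) - f S) \<in> borel_measurable M"
proof -
  have "(\<lambda>w. f (scov w)) \<in> borel_measurable M" unfolding scov_def
    by (rule measurable_sample) (intro continuous_on_compose2[OF assms] continuous_on_sample_cov continuous_on_product_coordinates, auto)
  then show ?thesis by simp
qed

lemma error_degenerate:
  assumes "S = 0" "continuous_on UNIV f" "p > 0"
  shows "Lpb M p (\<lambda>w. \<bar>f (scov w) - f S\<bar>) 0"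
proof -
  have "AE w in M. ennreal (\<bar>f (scov w) - f S\<bar> powr p) = 0"
    using scov_degenerate[OF assms(1)] by eventually_elim simp
  then have "(\<integral>\<^sup>+w. ennreal (\<bar>f (scov w) - f S\<bar> powr p) \<partial>M) = 0"
    using error_measurable[OF assms(2)] by (subst nn_integral_0_iff_AE) auto
  then show ?thesis using error_measurable[OF assms(2)] by (simp add: Lpb_def)
qed

end

context gaussian_sample_frame
begin

text \<open>The moment of order p s of the deviation suffices and is bounded by that of order p.
  Subadditivity of x^s distributes the power over the terms, and as s <= 1 the constants 7000^s and
  2^s are bounded uniformly in s.\<close>

lemma holder_estimate:
  fixes f :: "'a opr \<Rightarrow> real"
  assumes S: "S \<noteq> 0" and s: "0 < s" "s \<le> 1" and p: "p \<ge> 1"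
    and L: "0 \<le> L" "\<And>A B. norm (f A - f B) \<le> L * norm (A - B) powr s"
  shows "Lpb M p (\<lambda>w. \<bar>f (scov w) - f S\<bar>)
    (14000 * (L * (norm S powr s * (max rho (rho\<^sup>2) powr s + max rho 1 powr s * sqrt (p / n) powr s + (p / n) powr s))))"
proof -
  define t where "t = sqrt (p / n)"
  have t: "0 \<le> t" "t\<^sup>2 = p / n" using p by (auto simp: t_def)
  define B where "B = 7000 * sg\<^sup>2 * (rho + rho\<^sup>2 + t + t\<^sup>2)"
  have dev: "Lpb M p dev B" using Lpb_dev_rho[OF p S] by (simp add: B_def t(2)) (simp add: t_def)
  have "p * s \<le> p * 1" using p s by (intro mult_left_mono) auto
  then have "Lpb M (p * s) dev B" by (intro Lpb_lower[OF prob_space_axioms dev]) (use p s in auto)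
  from Lpb_powr[OF this s(1)] have "Lpb M p (\<lambda>w. dev w powr s) (B powr s)" using s by simp
  from Lpb_cmult[OF this L(1)] have LL: "Lpb M p (\<lambda>w. L * dev w powr s) (L * B powr s)" .
  have B: "B powr s \<le> 14000 * (norm S powr s * (max rho (rho\<^sup>2) powr s + max rho 1 powr s * t powr s + (t\<^sup>2) powr s))"
  proof -
    define m where "m = max rho (rho\<^sup>2)"
    have m: "0 \<le> m" using rho_nonneg by (simp add: m_def)
    have "rho + rho\<^sup>2 \<le> 2 * m" by (simp add: m_def)
    then have "B \<le> 7000 * sg\<^sup>2 * (2 * m + (t + t\<^sup>2))" unfolding B_def by (intro mult_left_mono) auto
    then have "B powr s \<le> (7000 * sg\<^sup>2 * (2 * m + (t + t\<^sup>2))) powr s" using s LpbD(3)[OF dev] by (intro powr_mono2) auto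
    also have "\<dots> = 7000 powr s * norm S powr s * (2 * m + (t + t\<^sup>2)) powr s" by (simp only: powr_mult sg_square)
    also have "\<dots> \<le> 7000 powr s * norm S powr s * (2 * (m powr s) + (t powr s + (t\<^sup>2) powr s))"
    proof (rule mult_left_mono)
      have "2 powr s \<le> (2::real) powr 1" using s by (intro powr_mono) auto
      then have "(2 * m) powr s \<le> 2 * (m powr s)" by (simp add: powr_mult mult_right_mono)
      moreover have "(t + t\<^sup>2) powr s \<le> t powr s + (t\<^sup>2) powr s" using t(1) s by (intro powr_subadditive) auto
      moreover have "(2 * m + (t + t\<^sup>2)) powr s \<le> (2 * m) powr s + (t + t\<^sup>2) powr s" using t(1) m s by (intro powr_subadditive) auto
      ultimately show "(2 * m + (t + t\<^sup>2)) powr s \<le> 2 * (m powr s) + (t powr s + (t\<^sup>2) powr s)" by linarith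
    qed simp
    also have "\<dots> \<le> 7000 * norm S powr s * (2 * (m powr s + max rho 1 powr s * t powr s + (t\<^sup>2) powr s))"
    proof (intro mult_mono)
      show "7000 powr s \<le> (7000::real)" using powr_mono[of s 1 7000] s by simp
      have "1 powr s \<le> max rho 1 powr s" using s by (intro powr_mono2) auto
      then have "1 * t powr s \<le> max rho 1 powr s * t powr s" by (intro mult_right_mono) auto
      moreover have "0 \<le> m powr s" "0 \<le> t powr s" "0 \<le> (t\<^sup>2) powr s" by auto
      ultimately show "2 * (m powr s) + (t powr s + (t\<^sup>2) powr s) \<le> 2 * (m powr s + max rho 1 powr s * t powr s + (t\<^sup>2) powr s)"
        by (smt (verit) mult_1)
    qed auto
    finally show ?thesis unfolding m_def by argo
  qed
  have le: "L * B powr s \<le> 14000 * (L * (norm S powr s * (max rho (rho\<^sup>2) powr s + max rho 1 powr s * sqrt (p / n) powr s + (p / n) powr s)))"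
    using mult_left_mono[OF B L(1)] by (simp add: t(2) mult.left_commute) (simp add: t_def)
  show ?thesis
  proof (rule Lpb_mono[OF LL _ _ _ _ le])
    show "(\<lambda>w. \<bar>f (scov w) - f S\<bar>) \<in> borel_measurable M"
      using error_measurable[OF holder_continuous[OF L(2) s(1)]] by simp
    show "\<bar>f (scov w) - f S\<bar> \<le> L * dev w powr s" for w using L(2)[of "scov w" S] by (simp add: dev_def)
  qed (use p in auto)
qed

text \<open>
  The linearisation at \<open>S\<close> contributes the linear term; the remainder is bounded by the Hoelder
  estimate when the deviation has its typical size and by the Lipschitz estimate otherwise.
\<close>

lemma smooth_estimate:
  fixes f :: "'a opr \<Rightarrow> real" and l :: "'a opr \<Rightarrow>\<^sub>L real"
  assumes S: "S \<noteq> 0" and s: "0 < s" "s \<le> 1" and p: "p \<ge> 1"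
    and L: "0 \<le> L" "\<And>A B. norm (f A - f B) \<le> L * norm (A - B)" and l: "norm l \<le> L"
    and L': "0 \<le> L'" "\<And>A. \<bar>f A - f S - l (A - S)\<bar> \<le> L' * norm (A - S) powr (1 + s)"
  shows "Lpb M p (\<lambda>w. \<bar>f (scov w) - f S\<bar>)
    (10 ^ 11 * (L * (norm S * (sqrt (p / n) * max rho 1 + p / n)) + L' * (norm S powr (1 + s) * max rho (rho\<^sup>2) powr (1 + s))))"
proof -
  define E where "E = norm S * (sqrt (p / n) * max rho 1 + p / n)"
  define m where "m = max rho (rho\<^sup>2)"
  have m: "0 \<le> m" using rho_nonneg by (simp add: m_def)
  define a where "a = 7000 * sg\<^sup>2 * (rho + rho\<^sup>2)"
  have a0: "0 \<le> a" using rho_nonneg by (simp add: a_def)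
  \<comment> \<open>The threshold of \<open>Lpb_dev_excess\<close>: below it the remainder is at
    most the constant L' K^(1+s), above it a multiple of the excess, whose moments are free of the
    effective rank.\<close>
  define K where "K = 2 * exp 1 * a"
  have K0: "0 \<le> K" using a0 by (simp add: K_def)
  define exc where "exc = (\<lambda>w. if dev w > K then dev w else 0)"
  have "sqrt (p / n) * 1 \<le> sqrt (p / n) * max rho 1" using p by (intro mult_left_mono) auto
  then have "sg\<^sup>2 * (sqrt (p / n) + p / n) \<le> E" unfolding E_def sg_square by (intro mult_left_mono) auto
  moreover have exc0: "Lpb M p exc (14000 * (sg\<^sup>2 * (sqrt (p / n) + p / n)))"
    using Lpb_dev_excess[OF p S] by (simp add: exc_def K_def a_def)
  ultimately have exc: "Lpb M p exc (14000 * E)"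
    by (intro Lpb_mono[OF exc0]) (use p LpbD[OF exc0] in auto)
  have lin: "Lpb M p (\<lambda>w. \<bar>l (scov w - S)\<bar>) (7200 * L * E)"
  proof (rule Lpb_mono[OF Lpb_functional_dev_rho[OF p S, of l]])
    have E0: "0 \<le> E" using p by (auto simp: E_def intro!: mult_nonneg_nonneg add_nonneg_nonneg)
    show "7200 * norm l * (sg\<^sup>2 * (sqrt (p / n) * max rho 1 + p / n)) \<le> 7200 * L * E"
      unfolding E_def[symmetric] sg_square using l E0 by (intro mult_right_mono mult_left_mono) auto
    show "(\<lambda>w. \<bar>l (scov w - S)\<bar>) \<in> borel_measurable M" using LpbD(1)[OF Lpb_functional_dev_rho[OF p S, of l]] .
  qed (use p in auto)
  have c: "Lpb M p (\<lambda>_. L' * K powr (1 + s)) (L' * K powr (1 + s))" using L' by (intro Lpb_const prob_space_axioms) auto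
  have sum: "Lpb M p (\<lambda>w. (\<bar>l (scov w - S)\<bar> + 2 * L * exc w) + L' * K powr (1 + s))
      (2 * (2 * (7200 * L * E + 2 * L * (14000 * E)) + L' * K powr (1 + s)))"
    using L by (intro Lpb_add Lpb_cmult lin exc c p) auto
  \<comment> \<open>84000 = 2 * 3 * 7000 * 2, from e <= 3 and rho + rho^2 <= 2 m; the exponent 1 + s
    is at most 2.\<close>
  have K: "K powr (1 + s) \<le> 84000\<^sup>2 * (norm S powr (1 + s) * m powr (1 + s))"
  proof -
    have "exp (1::real) \<le> 3" by (rule exp_le)
    then have "K \<le> 2 * 3 * a" unfolding K_def using a0 by (intro mult_right_mono mult_left_mono) auto
    also have "a \<le> 7000 * sg\<^sup>2 * (2 * m)" unfolding a_def by (intro mult_left_mono) (auto simp: m_def)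
    finally have "K \<le> 84000 * (norm S * m)" by (simp add: sg_square)
    then have "K powr (1 + s) \<le> (84000 * (norm S * m)) powr (1 + s)" using s K0 by (intro powr_mono2) auto
    also have "\<dots> = 84000 powr (1 + s) * (norm S powr (1 + s) * m powr (1 + s))" by (simp only: powr_mult)
    also have "84000 powr (1 + s) \<le> (84000::real) powr 2" using s by (intro powr_mono) auto
    finally show ?thesis by (simp add: powr_numeral mult_right_mono)
  qed
  \<comment> \<open>The dominant constant is 2 * 84000^2, about 1.4 * 10^10; the terms with
    \<open>L\<close> contribute 4 * (7200 + 28000).\<close>
  have le: "2 * (2 * (7200 * L * E + 2 * L * (14000 * E)) + L' * K powr (1 + s))
      \<le> 10 ^ 11 * (L * E + L' * (norm S powr (1 + s) * m powr (1 + s)))"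
  proof -
    have "0 \<le> L * E" using L p by (auto simp: E_def intro!: mult_nonneg_nonneg add_nonneg_nonneg)
    moreover have "L' * K powr (1 + s) \<le> L' * (84000\<^sup>2 * (norm S powr (1 + s) * m powr (1 + s)))" by (intro mult_left_mono K L')
    moreover have "0 \<le> L' * (norm S powr (1 + s) * m powr (1 + s))" using L' by simp
    ultimately show ?thesis by (simp add: algebra_simps)
  qed
  have "Lpb M p (\<lambda>w. \<bar>f (scov w) - f S\<bar>) (10 ^ 11 * (L * E + L' * (norm S powr (1 + s) * m powr (1 + s))))"
  proof (rule Lpb_mono[OF sum _ _ _ _ le])
    have "continuous_on UNIV f" by (rule holder_continuous[of f L 1]) (use L(2) in auto)
    then show "(\<lambda>w. \<bar>f (scov w) - f S\<bar>) \<in> borel_measurable M" using error_measurable by simp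
    fix w
    \<comment> \<open>The linearisation error has two bounds: 2 L dev, from the Lipschitz condition
      and norm l <= L, and L' dev^(1+s), from the Hoelder condition on the derivative.\<close>
    define r where "r = f (scov w) - f S - l (scov w - S)"
    have r1: "\<bar>r\<bar> \<le> L' * dev w powr (1 + s)" using L'(2)[of "scov w"] by (simp add: r_def dev_def)
    have "\<bar>l (scov w - S)\<bar> \<le> norm l * dev w" using norm_blinfun[of l "scov w - S"] by (simp add: dev_def)
    also have "\<dots> \<le> L * dev w" using l by (intro mult_right_mono) (auto simp: dev_def)
    finally have "\<bar>r\<bar> \<le> 2 * L * dev w" using L(2)[of "scov w" S] unfolding r_def dev_def by simp
    then have "\<bar>r\<bar> \<le> 2 * L * exc w + L' * K powr (1 + s)"
    proof (cases "dev w > K")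
      case True
      moreover have "0 \<le> L' * K powr (1 + s)" using L' by simp
      ultimately show ?thesis using \<open>\<bar>r\<bar> \<le> 2 * L * dev w\<close> by (simp add: exc_def)
    next
      case False
      then have "L' * dev w powr (1 + s) \<le> L' * K powr (1 + s)" using s L' by (intro mult_left_mono powr_mono2) (auto simp: dev_def)
      then show ?thesis using False r1 by (simp add: exc_def)
    qed
    moreover have "\<bar>f (scov w) - f S\<bar> \<le> \<bar>l (scov w - S)\<bar> + \<bar>r\<bar>" by (simp add: r_def)
    ultimately show "\<bar>f (scov w) - f S\<bar> \<le> (\<bar>l (scov w - S)\<bar> + 2 * L * exc w) + L' * K powr (1 + s)" by linarith
  qed (use p in auto)
  then show ?thesis by (simp add: E_def m_def)
qed

end

text \<open>One functional of positive variance, normalised and applied to each sample vector,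
  yields independent standard Gaussian variables on the given probability space.\<close>

lemma gaussian_sample_frame_of_law:
  fixes X :: "nat \<Rightarrow> 'w \<Rightarrow> 'a::{banach, second_countable_topology}"
  assumes M: "prob_space M" and law: "gaussian_law \<mu> S" and n: "1 \<le> n"
    and ind: "prob_space.indep_vars M (\<lambda>_. borel) X {1..n}" and d: "\<And>j. j \<in> {1..n} \<Longrightarrow> distr M borel (X j) = \<mu>"
    and S: "S \<noteq> 0"
  defines "Y \<equiv> \<lambda>j. if j \<in> {1..n} then X j else (\<lambda>_. 0)"
  shows "\<exists>\<gamma>. gaussian_sample_frame M {\<lambda>w. \<Sum>j=1..n. blinfun_apply (u j) (Y j w) |u. True} S Y n \<gamma>"
proof -
  define G :: "('w \<Rightarrow> real) set" where "G = {\<lambda>w. \<Sum>j=1..n. blinfun_apply (u j) (Y j w) |u. True}"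
  interpret gaussian_sample M G S Y n
    unfolding G_def Y_def by (rule gaussian_sample_of_law[OF M law n ind d])
  obtain u where u: "0 < blinfun_apply u (blinfun_apply S u)" using nondegenerate_functional[OF S] .
  define c where "c = 1 / sqrt (blinfun_apply u (blinfun_apply S u))"
  have c: "c * c * blinfun_apply u (blinfun_apply S u) = 1" using u by (simp add: c_def)
  define \<gamma> where "\<gamma> = (\<lambda>j w. c * blinfun_apply u (Y j w))"
  have cov: "(\<integral>w. \<gamma> i w * \<gamma> j w \<partial>M) = (if i = j \<and> i \<in> {1..n} then 1 else 0)" for i j
  proof -
    have "(\<integral>w. \<gamma> i w * \<gamma> j w \<partial>M) = (\<integral>w. c * c * (blinfun_apply u (Y i w) * blinfun_apply u (Y j w)) \<partial>M)" by (simp add: \<gamma>_def ac_simps)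
    then show ?thesis using c by (simp add: Y_cov)
  qed
  have "gaussian_sample_frame M G S Y n \<gamma>"
  proof
    show "\<gamma> j \<in> G" for j unfolding \<gamma>_def by (rule gaussian_spaceD(6)[OF G Y_mem])
    show "(\<integral>w. (\<gamma> j w)\<^sup>2 \<partial>M) = 1" if "j \<in> {1..n}" for j using cov[of j j] that by (simp add: power2_eq_square)
    show "(\<integral>w. \<gamma> i w * \<gamma> j w \<partial>M) = 0" if "i \<noteq> j" for i j using cov[of i j] that by simp
    have "indep_vars (\<lambda>_. borel) (\<lambda>j w. c * blinfun_apply u (X j w)) {1..n}"
      by (rule indep_vars_compose2[OF ind, where Y = "\<lambda>_ x. c * blinfun_apply u x"])
        (auto intro!: borel_measurable_times borel_measurable_blinfun_apply)
    then show "indep_vars (\<lambda>_. borel) \<gamma> {1..n}"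
      by (rule indep_vars_cong[THEN iffD1, rotated -1]) (auto simp: \<gamma>_def Y_def)
  qed
  then show ?thesis unfolding G_def by blast
qed

text \<open>For \<Sigma> = 0 the sample covariance equals \<Sigma> almost surely and the error
  vanishes; otherwise the standard Gaussian weights exist and the moment estimates apply. The
  constant 10^11 of the smooth estimate serves both parts.\<close>

theorem theorem2p1:
  shows "\<exists>C::real. 0 < C \<and> C \<le> numerical_bound \<and>
    (\<forall>(M :: 'w measure) (\<mu> :: 'a::{banach, second_countable_topology} measure) (\<Sigma> :: 'a opr)
      (n :: nat) (X :: nat \<Rightarrow> 'w \<Rightarrow> 'a) (f :: 'a opr \<Rightarrow> real) (\<rho> :: real).
      prob_space M \<longrightarrow>
      gaussian_law \<mu> \<Sigma> \<longrightarrow>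
      1 \<le> n \<longrightarrow>
      prob_space.indep_vars M (\<lambda>_. borel) X {1..n} \<longrightarrow>
      (\<forall>j\<in>{1..n}. distr M borel (X j) = \<mu>) \<longrightarrow>
      0 < \<rho> \<longrightarrow> \<rho> \<le> 1 \<longrightarrow>
      (let r = effective_rank \<mu> \<Sigma>;
           err = (\<lambda>\<omega>. f (sample_cov n (\<lambda>j. X j \<omega>)) - f \<Sigma>)
       in
        (Lip_seminorm \<rho> f < \<infinity> \<longrightarrow>
          (\<forall>p\<ge>1. Lp_norm M p err \<le>
             ennreal C * (Lip_seminorm \<rho> f * ennreal (norm \<Sigma> powr \<rho> *
               ((max (sqrt (r / n)) (r / n)) powr \<rho>
                + (max (sqrt (r / n)) 1) powr \<rho> * (sqrt (p / n)) powr \<rho>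
                + (p / n) powr \<rho>)))))
        \<and>
        (\<forall>f' :: 'a opr \<Rightarrow> ('a opr \<Rightarrow>\<^sub>L real).
          Lip_seminorm 1 f < \<infinity> \<longrightarrow>
          (\<forall>A. (f has_derivative blinfun_apply (f' A)) (at A)) \<longrightarrow>
          continuous_on UNIV f' \<longrightarrow>
          Lip_seminorm \<rho> f' < \<infinity> \<longrightarrow>
          (\<forall>p\<ge>1. Lp_norm M p err \<le>
             ennreal C *
              (Lip_seminorm 1 f * ennreal (norm \<Sigma> *
                 (sqrt (p / n) * max (sqrt (r / n)) 1 + p / n))
               + Lip_seminorm \<rho> f' * ennreal (norm \<Sigma> powr (1 + \<rho>) *
                 (max (sqrt (r / n)) (r / n)) powr (1 + \<rho>)))))))"
proof (rule exI[of _ "10 ^ 11"], intro conjI allI impI)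
  show "(0::real) < 10 ^ 11" by simp
  show "(10::real) ^ 11 \<le> numerical_bound" unfolding numerical_bound_def by (intro power_increasing) auto
next
  fix M :: "'w measure" and \<mu> :: "'a measure" and \<Sigma> :: "'a opr" and n :: nat and X :: "nat \<Rightarrow> 'w \<Rightarrow> 'a"
    and f :: "'a opr \<Rightarrow> real" and \<rho> :: real
  assume M: "prob_space M" and law: "gaussian_law \<mu> \<Sigma>" and n: "1 \<le> n"
    and ind: "prob_space.indep_vars M (\<lambda>_. borel) X {1..n}" and d: "\<forall>j\<in>{1..n}. distr M borel (X j) = \<mu>"
    and rho: "0 < \<rho>" "\<rho> \<le> 1"
  define Y where "Y = (\<lambda>j. if j \<in> {1..n} then X j else (\<lambda>_. 0))"
  define G :: "('w \<Rightarrow> real) set" where "G = {\<lambda>w. \<Sum>j=1..n. blinfun_apply (u j) (Y j w) |u. True}"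
  interpret gaussian_sample M G \<Sigma> Y n
    unfolding G_def Y_def by (rule gaussian_sample_of_law[OF M law n ind]) (use d in auto)
  define err where "err = (\<lambda>\<omega>. f (sample_cov n (\<lambda>j. X j \<omega>)) - f \<Sigma>)"
  have "sample_cov n (\<lambda>j. X j w) = scov w" for w
    unfolding scov_def sample_cov_eq_tsum tsum_def by (simp add: Y_def)
  then have err: "err = (\<lambda>w. f (scov w) - f \<Sigma>)" by (simp add: err_def)
  define r where "r = effective_rank \<mu> \<Sigma>"
  have X1: "X 1 \<in> borel_measurable M" using ind n by (auto simp: indep_vars_def)
  have "(\<integral>x. (norm x)\<^sup>2 \<partial>\<mu>) = (\<integral>w. (norm (X 1 w))\<^sup>2 \<partial>M)"
    using X1 n d[rule_format, of 1, symmetric] by (simp add: integral_distr)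
  then have r: "r = Rr / norm \<Sigma>" using n unfolding r_def effective_rank_def Rr_def by (simp add: Y_def)
  have r0: "0 \<le> r" using Rr_nonneg by (simp add: r)
  have frame: "\<exists>\<gamma>. gaussian_sample_frame M G \<Sigma> Y n \<gamma>" if "\<Sigma> \<noteq> 0"
    unfolding G_def Y_def by (rule gaussian_sample_frame_of_law[OF M law n ind _ that]) (use d in auto)
  have part1: "Lp_norm M p err \<le> ennreal (10 ^ 11) * (Lip_seminorm \<rho> f * ennreal (norm \<Sigma> powr \<rho> *
       ((max (sqrt (r / n)) (r / n)) powr \<rho> + (max (sqrt (r / n)) 1) powr \<rho> * (sqrt (p / n)) powr \<rho> + (p / n) powr \<rho>)))"
    if Lf: "Lip_seminorm \<rho> f < \<infinity>" and p: "1 \<le> p" for p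
  proof -
    obtain L where L: "0 \<le> L" "Lip_seminorm \<rho> f = ennreal L" "\<And>x y. norm (f x - f y) \<le> L * norm (x - y) powr \<rho>"
      using Lip_seminormD[OF Lf] by blast
    have cf: "continuous_on UNIV f" by (rule holder_continuous[OF L(3) rho(1)])
    define Q where "Q = norm \<Sigma> powr \<rho> * ((max (sqrt (r / n)) (r / n)) powr \<rho> + (max (sqrt (r / n)) 1) powr \<rho> * (sqrt (p / n)) powr \<rho> + (p / n) powr \<rho>)"
    have Q0: "0 \<le> Q" by (simp add: Q_def)
    have bound: "Lpb M p (\<lambda>w. \<bar>err w\<bar>) (10 ^ 11 * (L * Q))"
    proof (cases "\<Sigma> = 0")
      case True
      show ?thesis unfolding err
        by (rule Lpb_mono[OF error_degenerate[OF True cf]]) (use p L Q0 error_measurable[OF cf] in auto)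
    next
      case False
      then obtain \<gamma> where "gaussian_sample_frame M G \<Sigma> Y n \<gamma>" using frame by blast
      then interpret fr: gaussian_sample_frame M G \<Sigma> Y n \<gamma> .
      have rh: "fr.rho = sqrt (r / n)" "(fr.rho)\<^sup>2 = r / n" using r0 by (simp_all add: fr.rho_def r[symmetric])
      have "Lpb M p (\<lambda>w. \<bar>err w\<bar>) (14000 * (L * Q))"
        using fr.holder_estimate[OF False rho p L(1,3)] unfolding err Q_def rh(2) unfolding rh(1) .
      then show ?thesis
      proof (rule Lpb_mono)
        show "14000 * (L * Q) \<le> 10 ^ 11 * (L * Q)" using L Q0 by (intro mult_right_mono) auto
      qed (use p error_measurable[OF cf] in \<open>auto simp: err\<close>)
    qed
    have "Lp_norm M p err \<le> ennreal (10 ^ 11 * (L * Q))"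
      using bound p error_measurable[OF cf] by (intro Lp_norm_le) (auto simp: err)
    also have "\<dots> = ennreal (10 ^ 11) * (Lip_seminorm \<rho> f * ennreal Q)" using L Q0 by (simp add: ennreal_mult)
    finally show ?thesis unfolding Q_def .
  qed
  have part2: "Lp_norm M p err \<le> ennreal (10 ^ 11) * (Lip_seminorm 1 f * ennreal (norm \<Sigma> * (sqrt (p / n) * max (sqrt (r / n)) 1 + p / n))
       + Lip_seminorm \<rho> f' * ennreal (norm \<Sigma> powr (1 + \<rho>) * (max (sqrt (r / n)) (r / n)) powr (1 + \<rho>)))"
    if Lf: "Lip_seminorm 1 f < \<infinity>" and df: "\<And>A. (f has_derivative blinfun_apply (f' A)) (at A)"
      and Lf': "Lip_seminorm \<rho> f' < \<infinity>" and p: "1 \<le> p" for p and f' :: "'a opr \<Rightarrow> ('a opr \<Rightarrow>\<^sub>L real)"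
  proof -
    obtain L where L: "0 \<le> L" "Lip_seminorm 1 f = ennreal L" "\<And>x y. norm (f x - f y) \<le> L * norm (x - y) powr 1"
      using Lip_seminormD[OF Lf] by blast
    obtain L' where L': "0 \<le> L'" "Lip_seminorm \<rho> f' = ennreal L'" "\<And>x y. norm (f' x - f' y) \<le> L' * norm (x - y) powr \<rho>"
      using Lip_seminormD[OF Lf'] by blast
    have cf: "continuous_on UNIV f" by (rule holder_continuous[OF L(3)]) simp
    have L1: "norm (f x - f y) \<le> L * norm (x - y)" for x y using L(3)[of x y] by simp
    have l: "norm (f' \<Sigma>) \<le> L" by (rule norm_derivative_le_Lipschitz[OF L(1) L1 df])
    have rem: "\<bar>f A - f \<Sigma> - f' \<Sigma> (A - \<Sigma>)\<bar> \<le> L' * norm (A - \<Sigma>) powr (1 + \<rho>)" for A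
      by (rule taylor_remainder_holder[where f = f and f' = f', OF df L'(1,3) rho(1)])
    define Q where "Q = norm \<Sigma> * (sqrt (p / n) * max (sqrt (r / n)) 1 + p / n)"
    define Q' where "Q' = norm \<Sigma> powr (1 + \<rho>) * (max (sqrt (r / n)) (r / n)) powr (1 + \<rho>)"
    have Q0: "0 \<le> Q" "0 \<le> Q'" using p by (auto simp: Q_def Q'_def intro!: mult_nonneg_nonneg add_nonneg_nonneg)
    have bound: "Lpb M p (\<lambda>w. \<bar>err w\<bar>) (10 ^ 11 * (L * Q + L' * Q'))"
    proof (cases "\<Sigma> = 0")
      case True
      show ?thesis unfolding err
        by (rule Lpb_mono[OF error_degenerate[OF True cf]]) (use p L L' Q0 error_measurable[OF cf] in auto)
    next
      case False
      then obtain \<gamma> where "gaussian_sample_frame M G \<Sigma> Y n \<gamma>" using frame by blast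
      then interpret fr: gaussian_sample_frame M G \<Sigma> Y n \<gamma> .
      have rh: "fr.rho = sqrt (r / n)" "(fr.rho)\<^sup>2 = r / n" using r0 by (simp_all add: fr.rho_def r[symmetric])
      show ?thesis
        using fr.smooth_estimate[OF False rho p L(1) L1 l L'(1) rem] unfolding err Q_def Q'_def rh(2) unfolding rh(1) .
    qed
    have "Lp_norm M p err \<le> ennreal (10 ^ 11 * (L * Q + L' * Q'))"
      using bound p error_measurable[OF cf] by (intro Lp_norm_le) (auto simp: err)
    also have "\<dots> = ennreal (10 ^ 11) * (Lip_seminorm 1 f * ennreal Q + Lip_seminorm \<rho> f' * ennreal Q')"
      using L L' Q0 by (simp add: ennreal_mult ennreal_plus)
    finally show ?thesis unfolding Q_def Q'_def .
  qed
  show "let r = effective_rank \<mu> \<Sigma>;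
           err = (\<lambda>\<omega>. f (sample_cov n (\<lambda>j. X j \<omega>)) - f \<Sigma>)
       in
        (Lip_seminorm \<rho> f < \<infinity> \<longrightarrow>
          (\<forall>p\<ge>1. Lp_norm M p err \<le>
             ennreal (10 ^ 11) * (Lip_seminorm \<rho> f * ennreal (norm \<Sigma> powr \<rho> *
               ((max (sqrt (r / n)) (r / n)) powr \<rho>
                + (max (sqrt (r / n)) 1) powr \<rho> * (sqrt (p / n)) powr \<rho>
                + (p / n) powr \<rho>)))))
        \<and>
        (\<forall>f' :: 'a opr \<Rightarrow> ('a opr \<Rightarrow>\<^sub>L real).
          Lip_seminorm 1 f < \<infinity> \<longrightarrow>
          (\<forall>A. (f has_derivative blinfun_apply (f' A)) (at A)) \<longrightarrow>
          continuous_on UNIV f' \<longrightarrow>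
          Lip_seminorm \<rho> f' < \<infinity> \<longrightarrow>
          (\<forall>p\<ge>1. Lp_norm M p err \<le>
             ennreal (10 ^ 11) *
              (Lip_seminorm 1 f * ennreal (norm \<Sigma> *
                 (sqrt (p / n) * max (sqrt (r / n)) 1 + p / n))
               + Lip_seminorm \<rho> f' * ennreal (norm \<Sigma> powr (1 + \<rho>) *
                 (max (sqrt (r / n)) (r / n)) powr (1 + \<rho>)))))"
    unfolding Let_def r_def[symmetric] err_def[symmetric] using part1 part2 by blast
qed

end
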